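(* Let $n\ge1$ and $\nu>n$. The Fourier transform $(f,A)\mapsto(\widehat f,\widehat A)$, initially defined for $f\in L^1(\mathbb B^n,\iota)^K\cap L^2(\mathbb B^n,\iota)^K$ and $A\in\mathcal T^1(\mathcal A^2_\nu)^K$, extends to a unitary isomorphism $$L^2(\mathbb B^n,\iota)^K\oplus\mathcal T^2(\mathcal A^2_\nu)^K\;\simeq\;L^2(\mathbb R^+\times\mathbb Z_2,\mu_{\mathfrak a}).$$
   Context: Ball and Bergman space: $\mathbb B^n$ is the open unit ball of $\mathbb C^n$, $\langle z,w\rangle=\sum_j z_j\overline{w_j}$, $dz$ is Lebesgue measure normalized so that $\mathbb B^n$ has measure $1$, $d\iota(z)=(1-|z|^2)^{-(n+1)}dz$, $c_\nu=\frac{\Gamma(\nu)}{n!\,\Gamma(\nu-n)}$, $d\mu_\nu(z)=c_\nu(1-|z|^2)^{\nu-n-1}dz$. $\mathcal A^2_\nu$ is the Hilbert space of holomorphic functions in $L^2(\mathbb B^n,\mu_\nu)$. For $w\in\mathbb B^n$, $k_w(z)=(1-|w|^2)^{\nu/2}(1-\langle z,w\rangle)^{-\nu}$ (principal branch). Group: $G=\mathrm{SU}(n,1)$ consists of the matrices $x=\begin{pmatrix}A & w^t \\ v & d\end{pmatrix}$ of determinant $1$ preserving $-|z_1|^2-\dots-|z_n|^2+|z_{n+1}|^2$, acting on $\mathbb B^n$ by $x\cdot z=(Az+w)/(v\cdot z+d)$; $K\cong\mathrm U(n)$ is the stabilizer of $0$. Haar measure on $G$ is normalized by $\int_G f(x\cdot0)\,dx=\int_{\mathbb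 B^n}f\,d\iota$. $\pi_\nu(x)f(z)=k_{x\cdot0}(z)f(x^{-1}\cdot z)$ is a projective unitary representation of $G$ on $\mathcal A^2_\nu$, and $L_x(A)=\pi_\nu(x)A\pi_\nu(x)^*$. Radial functions are those with $f(k\cdot z)=f(z)$, radial operators those with $L_k(A)=A$, for all $k\in K$; a superscript $K$ denotes the radial elements. $\mathcal T^1$, $\mathcal T^2$ are the trace class and Hilbert–Schmidt operators. For radial trace class $A,B$, $(A*B)(x\cdot0)=\mathrm{tr}(A\,L_x(B))$ is a radial integrable function on $\mathbb B^n$; for a function $f$ on $\mathbb B^n$, $f*A=\int_G f(x\cdot0)L_x(A)\,dx$ (weak integral). Spherical transform: for $\lambda\in\mathbb R\cup i[-n,n]$, $\phi_\lambda(z)=(1-|z|^2)^{\frac{n+i\lambda}{2}}\,{}_2F_1\!\big(\tfrac{n+i\lambda}2,\tfrac{n+i\lambda}2;n;|z|^2\big)$ (these are the positive definite spherical functions of $(G,K)$; $\phi_\lambda=\phi_{-\lambda}$), and $\widehat f(\lambda)=\int_{\mathbb B^n}f\,\phi_\lambda\,d\iota$. $\mu_{\mathfrak a}$ is the Plancherel measure on $\mathbb R^+=[0,\infty)\cong\mathbb R/\{\pm1\}$, i.e. the measure for which $f\mapsto\widehat f$ extends from $L^1\cap L^2$ to a unitary isomorphism $L^2(\mathbb B^n,\iota)^K\simeq L^2(\mathbb R^+,\mu_{\mathfrak a})$. It is extended to $\mathbb R^+\times\mathbb Z_2$ by $\mu_{\mathfrak a}(\Omega\times\{j\})=\mu_{\mathfrak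 a}(\Omega)$, $j=0,1$, and $L^2(\mathbb R^+\times\mathbb Z_2,\mu_{\mathfrak a})$ is identified with $L^2(\mathbb R^+,\mu_{\mathfrak a})\oplus L^2(\mathbb R^+,\mu_{\mathfrak a})$, a pair $(f_0,f_1)$ corresponding to the function $(\lambda,j)\mapsto f_j(\lambda)$. Operator Fourier transform: $P_0$ is the orthogonal projection onto constants in $\mathcal A^2_\nu$, $h_\nu(z)=(1-|z|^2)^\nu$; $\widehat{h_\nu}(\lambda)>0$ for $\lambda\in\mathbb R\cup i[-n,n]$. For $A\in\mathcal T^1(\mathcal A^2_\nu)^K$, $\widehat A(\lambda)=\mathrm{tr}(A\,T^{\lambda,\nu})=\widehat{(A*P_0)}(\lambda)/\sqrt{\widehat{h_\nu}(\lambda)}$, with $T^{\lambda,\nu}=\widehat{h_\nu}(\lambda)^{-1/2}(\phi_\lambda*P_0)$ and the positive square root. *)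

theory Defs
  imports "HOL-Analysis.Analysis"
begin

section \<open>Inner product spaces on carriers\<close>

text \<open>
  The Hilbert spaces below are function spaces that depend on real parameters, so they are given by
  carriers. As usual for $L^2$ spaces, vectors at distance zero are identified (\<open>ips_eq\<close>); the Hilbert
  space meant is the quotient by this relation. Inner products are linear in the first argument.
\<close>

record 'a ips =
  ips_carrier :: "'a set"
  ips_add :: "'a \<Rightarrow> 'a \<Rightarrow> 'a"
  ips_scale :: "complex \<Rightarrow> 'a \<Rightarrow> 'a"
  ips_inner :: "'a \<Rightarrow> 'a \<Rightarrow> complex"

definition ips_norm :: "('a, 'm) ips_scheme \<Rightarrow> 'a \<Rightarrow> real" where
  "ips_norm H x = sqrt (Re (ips_inner H x x))"

definition ips_eq :: "('a, 'm) ips_scheme \<Rightarrow> 'a \<Rightarrow> 'a \<Rightarrow> bool" where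
  "ips_eq H x y \<longleftrightarrow> ips_norm H (ips_add H x (ips_scale H (-1) y)) = 0"

definition ips_sum :: "'a ips \<Rightarrow> 'b ips \<Rightarrow> ('a \<times> 'b) ips" where
  "ips_sum V W =
     \<lparr> ips_carrier = ips_carrier V \<times> ips_carrier W,
       ips_add = (\<lambda>(x, y) (x', y'). (ips_add V x x', ips_add W y y')),
       ips_scale = (\<lambda>c (x, y). (ips_scale V c x, ips_scale W c y)),
       ips_inner = (\<lambda>(x, y) (x', y'). ips_inner V x x' + ips_inner W y y') \<rparr>"

definition linear_op :: "'a ips \<Rightarrow> 'b ips \<Rightarrow> ('a \<Rightarrow> 'b) \<Rightarrow> bool" where
  "linear_op V W T \<longleftrightarrow>
     (\<forall>x\<in>ips_carrier V. T x \<in> ips_carrier W) \<and>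
     (\<forall>x\<in>ips_carrier V. \<forall>y\<in>ips_carrier V. ips_eq W (T (ips_add V x y)) (ips_add W (T x) (T y))) \<and>
     (\<forall>c. \<forall>x\<in>ips_carrier V. ips_eq W (T (ips_scale V c x)) (ips_scale W c (T x)))"

definition unitary_iso :: "'a ips \<Rightarrow> 'b ips \<Rightarrow> ('a \<Rightarrow> 'b) \<Rightarrow> bool" where
  "unitary_iso V W U \<longleftrightarrow>
     linear_op V W U \<and>
     (\<forall>x\<in>ips_carrier V. \<forall>y\<in>ips_carrier V. ips_inner W (U x) (U y) = ips_inner V x y) \<and>
     (\<forall>w\<in>ips_carrier W. \<exists>x\<in>ips_carrier V. ips_eq W (U x) w)"

definition extends_to_unitary_iso :: "'a ips \<Rightarrow> 'b ips \<Rightarrow> 'a set \<Rightarrow> ('a \<Rightarrow> 'b) \<Rightarrow> bool" where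
  "extends_to_unitary_iso V W D F \<longleftrightarrow>
     D \<subseteq> ips_carrier V \<and> (\<forall>x\<in>D. F x \<in> ips_carrier W) \<and>
     (\<exists>U. unitary_iso V W U \<and> (\<forall>x\<in>D. ips_eq W (U x) (F x)))"

definition L2_space :: "'a measure \<Rightarrow> ('a \<Rightarrow> complex) ips" where
  "L2_space M =
     \<lparr> ips_carrier = {f \<in> borel_measurable M. integrable M (\<lambda>x. (cmod (f x))\<^sup>2)},
       ips_add = (\<lambda>f g x. f x + g x),
       ips_scale = (\<lambda>c f x. c * f x),
       ips_inner = (\<lambda>f g. LINT x|M. f x * cnj (g x)) \<rparr>"


section \<open>Operators on a Hilbert space\<close>

text \<open>
  Operators on \<open>H\<close> are functions whose values outside the carrier of \<open>H\<close> are irrelevant.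
\<close>

definition bounded_op :: "'a ips \<Rightarrow> ('a \<Rightarrow> 'a) \<Rightarrow> bool" where
  "bounded_op H T \<longleftrightarrow>
     linear_op H H T \<and> (\<exists>B. \<forall>x\<in>ips_carrier H. ips_norm H (T x) \<le> B * ips_norm H x)"

definition adjoint_op :: "'a ips \<Rightarrow> ('a \<Rightarrow> 'a) \<Rightarrow> 'a \<Rightarrow> 'a" where
  "adjoint_op H T y =
     (SOME u. u \<in> ips_carrier H \<and> (\<forall>x\<in>ips_carrier H. ips_inner H (T x) y = ips_inner H x u))"

definition is_onb :: "'a ips \<Rightarrow> 'a set \<Rightarrow> bool" where
  "is_onb H E \<longleftrightarrow>
     E \<subseteq> ips_carrier H \<and>
     (\<forall>e\<in>E. \<forall>e'\<in>E. ips_inner H e e' = (if e = e' then 1 else 0)) \<and>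
     (\<forall>x\<in>ips_carrier H. (\<forall>e\<in>E. ips_inner H x e = 0) \<longrightarrow> ips_norm H x = 0)"

text \<open>
  Traces and Hilbert--Schmidt norms are computed in one fixed orthonormal basis;
  they do not depend on its choice.
\<close>

definition some_onb :: "'a ips \<Rightarrow> 'a set" where
  "some_onb H = (SOME E. is_onb H E)"

definition hilbert_schmidt :: "'a ips \<Rightarrow> ('a \<Rightarrow> 'a) \<Rightarrow> bool" where
  "hilbert_schmidt H T \<longleftrightarrow>
     bounded_op H T \<and> (\<lambda>e. (ips_norm H (T e))\<^sup>2) summable_on some_onb H"

text \<open>
  The operator \<open>R\<close> is the absolute value of \<open>T\<close>: it is positive and its square is the product of the
  adjoint of \<open>T\<close> with \<open>T\<close>.
\<close>

definition trace_class :: "'a ips \<Rightarrow> ('a \<Rightarrow> 'a) \<Rightarrow> bool" where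
  "trace_class H T \<longleftrightarrow>
     bounded_op H T \<and>
     (\<exists>R. bounded_op H R \<and>
          (\<forall>x\<in>ips_carrier H. ips_inner H (R x) x \<in> nonneg_Reals) \<and>
          (\<forall>x\<in>ips_carrier H. \<forall>y\<in>ips_carrier H.
             ips_inner H (R x) (R y) = ips_inner H (T x) (T y)) \<and>
          (\<lambda>e. ips_inner H (R e) e) summable_on some_onb H)"

definition op_trace :: "'a ips \<Rightarrow> ('a \<Rightarrow> 'a) \<Rightarrow> complex" where
  "op_trace H T = (\<Sum>\<^sub>\<infinity>e\<in>some_onb H. ips_inner H (T e) e)"

definition op_scale :: "'a ips \<Rightarrow> complex \<Rightarrow> ('a \<Rightarrow> 'a) \<Rightarrow> 'a \<Rightarrow> 'a" where
  "op_scale H c T = (\<lambda>x. ips_scale H c (T x))"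

definition HS_space :: "'a ips \<Rightarrow> ('a \<Rightarrow> 'a) ips" where
  "HS_space H =
     \<lparr> ips_carrier = {T. hilbert_schmidt H T},
       ips_add = (\<lambda>S T x. ips_add H (S x) (T x)),
       ips_scale = op_scale H,
       ips_inner = (\<lambda>S T. \<Sum>\<^sub>\<infinity>e\<in>some_onb H. ips_inner H (S e) (T e)) \<rparr>"

definition weak_integral_op :: "'a ips \<Rightarrow> 'g measure \<Rightarrow> ('g \<Rightarrow> 'a \<Rightarrow> 'a) \<Rightarrow> 'a \<Rightarrow> 'a" where
  "weak_integral_op H m F x =
     (SOME u. u \<in> ips_carrier H \<and>
        (\<forall>y\<in>ips_carrier H.
           has_bochner_integral m (\<lambda>g. ips_inner H (F g x) y) (ips_inner H u y)))"


section \<open>The unit ball and the Bergman spaces\<close>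

definition hprod :: "complex^'n \<Rightarrow> complex^'n \<Rightarrow> complex" where
  "hprod z w = (\<Sum>j\<in>UNIV. z $ j * cnj (w $ j))"

text \<open>
  Measures on the ball are measures on the whole space for which the complement of the ball is a null set.
\<close>

definition ball_measure :: "(complex^'n) measure" where
  "ball_measure = uniform_measure lborel (ball 0 1)"

definition iota :: "(complex^'n) measure" where
  "iota = density ball_measure
     (\<lambda>z. ennreal ((1 - (norm z)\<^sup>2) powr (- (real CARD('n) + 1))))"

definition bergman_const :: "'n itself \<Rightarrow> real \<Rightarrow> real" where
  "bergman_const _ \<nu> = Gamma \<nu> / (fact CARD('n) * Gamma (\<nu> - real CARD('n)))"

definition bergman_measure :: "real \<Rightarrow> (complex^'n) measure" where
  "bergman_measure \<nu> = density ball_measure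
     (\<lambda>z. ennreal (bergman_const TYPE('n) \<nu> * (1 - (norm z)\<^sup>2) powr (\<nu> - real CARD('n) - 1)))"

definition holomorphic_Cn :: "(complex^'n \<Rightarrow> complex) \<Rightarrow> (complex^'n) set \<Rightarrow> bool" where
  "holomorphic_Cn f S \<longleftrightarrow>
     (\<forall>z\<in>S. \<exists>L. (f has_derivative L) (at z) \<and> (\<forall>c v. L (c *s v) = c * L v))"

text \<open>
  A function on the ball is represented by its extension by zero, so that elements of the Bergman space
  are equal iff they agree on the ball.
\<close>

definition bergman_space :: "real \<Rightarrow> (complex^'n \<Rightarrow> complex) ips" where
  "bergman_space \<nu> = (L2_space (bergman_measure \<nu>))
     \<lparr> ips_carrier :=
         {f \<in> ips_carrier (L2_space (bergman_measure \<nu>)).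
            holomorphic_Cn f (ball 0 1) \<and> (\<forall>z. z \<notin> ball 0 1 \<longrightarrow> f z = 0)} \<rparr>"

definition coherent :: "real \<Rightarrow> complex^'n \<Rightarrow> complex^'n \<Rightarrow> complex" where
  "coherent \<nu> w z =
     (if z \<in> ball 0 1
      then of_real ((1 - (norm w)\<^sup>2) powr (\<nu> / 2)) * (1 - hprod z w) powr (of_real (- \<nu>))
      else 0)"


section \<open>The group and its representation\<close>

text \<open>
  Square matrices of size $n+1$ are indexed by \<open>'n option\<close>, the index \<open>None\<close> playing the role of $n+1$.
\<close>

type_synonym 'n gmat = "complex^('n option)^('n option)"

definition lorentz_form :: "complex^('n::finite option) \<Rightarrow> real" where
  "lorentz_form z = - (\<Sum>j\<in>UNIV. (cmod (z $ Some j))\<^sup>2) + (cmod (z $ None))\<^sup>2"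

definition SU_n1 :: "('n::finite) gmat set" where
  "SU_n1 = {x. det x = 1 \<and> (\<forall>z. lorentz_form (x *v z) = lorentz_form z)}"

definition act :: "('n::finite) gmat \<Rightarrow> complex^'n \<Rightarrow> complex^'n" where
  "act x z = (\<chi> i. ((\<Sum>j\<in>UNIV. x $ Some i $ Some j * z $ j) + x $ Some i $ None) /
                   ((\<Sum>j\<in>UNIV. x $ None $ Some j * z $ j) + x $ None $ None))"

definition stab0 :: "('n::finite) gmat set" where
  "stab0 = {k \<in> SU_n1. act k 0 = 0}"

text \<open>
  The normalization forces the invariant measure to be finite on compact sets and nonzero.
\<close>

definition normalized_haar :: "('n::finite) gmat measure \<Rightarrow> bool" where
  "normalized_haar m \<longleftrightarrow>
     sets m = sets (restrict_space borel SU_n1) \<and>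
     (\<forall>x\<in>SU_n1. distr m m (\<lambda>y. x ** y) = m) \<and>
     (\<forall>f\<in>borel_measurable borel. (\<integral>\<^sup>+x. f (act x 0) \<partial>m) = (\<integral>\<^sup>+z. f z \<partial>iota))"

definition bergman_rep ::
    "real \<Rightarrow> ('n::finite) gmat \<Rightarrow> (complex^'n \<Rightarrow> complex) \<Rightarrow> complex^'n \<Rightarrow> complex" where
  "bergman_rep \<nu> x f z = coherent \<nu> (act x 0) z * f (act (matrix_inv x) z)"

type_synonym 'n bop = "(complex^'n \<Rightarrow> complex) \<Rightarrow> complex^'n \<Rightarrow> complex"

definition translate_op :: "real \<Rightarrow> ('n::finite) gmat \<Rightarrow> 'n bop \<Rightarrow> 'n bop" where
  "translate_op \<nu> x A = bergman_rep \<nu> x \<circ> A \<circ> adjoint_op (bergman_space \<nu>) (bergman_rep \<nu> x)"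

text \<open>Radial functions are understood modulo null sets.\<close>

definition radial_fun :: "(complex^('n::finite) \<Rightarrow> complex) \<Rightarrow> bool" where
  "radial_fun f \<longleftrightarrow> (\<forall>k\<in>stab0. AE z in iota. f (act k z) = f z)"

definition radial_op :: "real \<Rightarrow> ('n::finite) bop \<Rightarrow> bool" where
  "radial_op \<nu> A \<longleftrightarrow>
     (\<forall>k\<in>stab0. \<forall>f\<in>ips_carrier (bergman_space \<nu>). translate_op \<nu> k A f = A f)"

definition radial_L2 :: "(complex^('n::finite) \<Rightarrow> complex) ips" where
  "radial_L2 = (L2_space iota)
     \<lparr> ips_carrier := {f \<in> ips_carrier (L2_space iota). radial_fun f} \<rparr>"

definition radial_HS :: "real \<Rightarrow> ('n::finite) bop ips" where
  "radial_HS \<nu> = (HS_space (bergman_space \<nu>))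
     \<lparr> ips_carrier := {A \<in> ips_carrier (HS_space (bergman_space \<nu>)). radial_op \<nu> A} \<rparr>"

definition radial_L1_L2 :: "(complex^('n::finite) \<Rightarrow> complex) set" where
  "radial_L1_L2 = {f \<in> ips_carrier radial_L2. integrable iota f}"

definition radial_T1 :: "real \<Rightarrow> ('n::finite) bop set" where
  "radial_T1 \<nu> = {A. trace_class (bergman_space \<nu>) A \<and> radial_op \<nu> A}"


section \<open>Fourier transforms\<close>

definition hyp2F1 :: "complex \<Rightarrow> complex \<Rightarrow> complex \<Rightarrow> complex \<Rightarrow> complex" where
  "hyp2F1 a b c z = (\<Sum>k. pochhammer a k * pochhammer b k / (pochhammer c k * fact k) * z ^ k)"

definition spherical_fun :: "complex \<Rightarrow> complex^'n \<Rightarrow> complex" where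
  "spherical_fun l z =
     (let a = (of_nat CARD('n) + \<i> * l) / 2
      in of_real (1 - (norm z)\<^sup>2) powr a *
         hyp2F1 a a (of_nat CARD('n)) (of_real ((norm z)\<^sup>2)))"

definition spherical_transform :: "(complex^'n \<Rightarrow> complex) \<Rightarrow> complex \<Rightarrow> complex" where
  "spherical_transform f l = (LINT z|iota. f z * spherical_fun l z)"

definition plancherel_measure :: "'n::finite itself \<Rightarrow> real measure \<Rightarrow> bool" where
  "plancherel_measure _ \<mu> \<longleftrightarrow>
     sets \<mu> = sets (restrict_space borel {0..}) \<and>
     extends_to_unitary_iso (radial_L2 :: (complex^'n \<Rightarrow> complex) ips) (L2_space \<mu>)
       radial_L1_L2 (\<lambda>f l. spherical_transform f (of_real l))"

definition conv_fun_op ::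
    "('n::finite) gmat measure \<Rightarrow> real \<Rightarrow> (complex^'n \<Rightarrow> complex) \<Rightarrow> 'n bop \<Rightarrow> 'n bop" where
  "conv_fun_op m \<nu> f A =
     weak_integral_op (bergman_space \<nu>) m
       (\<lambda>x. op_scale (bergman_space \<nu>) (f (act x 0)) (translate_op \<nu> x A))"

definition const_proj :: "real \<Rightarrow> ('n::finite) bop" where
  "const_proj \<nu> f =
     (let H = bergman_space \<nu>; u = indicator (ball 0 1)
      in ips_scale H (ips_inner H f u / ips_inner H u u) u)"

definition h_fun :: "real \<Rightarrow> complex^'n \<Rightarrow> complex" where
  "h_fun \<nu> z = of_real ((1 - (norm z)\<^sup>2) powr \<nu>)"

text \<open>
  The spherical transform of \<open>h_fun \<nu>\<close> is positive at the relevant parameters, where \<open>csqrt\<close> is the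
  positive square root.
\<close>

definition T_op :: "('n::finite) gmat measure \<Rightarrow> real \<Rightarrow> complex \<Rightarrow> 'n bop" where
  "T_op m \<nu> l =
     op_scale (bergman_space \<nu>)
       (1 / csqrt (spherical_transform (h_fun \<nu> :: complex^'n \<Rightarrow> complex) l))
       (conv_fun_op m \<nu> (spherical_fun l) (const_proj \<nu>))"

definition op_transform :: "('n::finite) gmat measure \<Rightarrow> real \<Rightarrow> 'n bop \<Rightarrow> complex \<Rightarrow> complex" where
  "op_transform m \<nu> A l = op_trace (bergman_space \<nu>) (A \<circ> T_op m \<nu> l)"

text \<open>A pair of functions is identified with a function on the product with $\{0,1\}$.\<close>

definition fourier_pair ::
    "('n::finite) gmat measure \<Rightarrow> real \<Rightarrow> (complex^'n \<Rightarrow> complex) \<times> 'n bop \<Rightarrow> real \<times> nat \<Rightarrow> complex" where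
  "fourier_pair m \<nu> = (\<lambda>(f, A) (l, j).
     if j = 0 then spherical_transform f (of_real l) else op_transform m \<nu> A (of_real l))"

end

theory Submission
 imports Defs "HOL-Complex_Analysis.Complex_Analysis" "HOL-Real_Asymp.Real_Asymp"
begin

text \<open>
 Write $d_k$ for the dimension of the homogeneous polynomials of degree $k$ on the ball. By Schur's lemma a radial
 operator $A$ acts on them as a scalar $a_k$, and its squared Hilbert--Schmidt norm is the sum of $|a_k|^2 d_k$. The operator
 T with parameter $l$ is radial with eigenvalues $s_k(l)\sqrt{h(l)}$, where $h$ is the spherical transform of $(1-|z|^2)^\nu$
 and $d_k s_k(l) h(l)$ is up to a constant the transform of $|z|^{2k}(1-|z|^2)^\nu$; the symmetry of the radial Laplacian
 gives a three-term recurrence which identifies $s_k$ as a continuous dual Hahn polynomial. Hence the transform of $A$ is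
 the sum of $a_k d_k s_k\sqrt h$, and the operator half of the theorem says that the functions $\sqrt{d_k}s_k\sqrt h$ form an
 orthonormal basis of the $L^2$ space of the Plancherel measure. The Plancherel isometry for functions yields this:
 normalized, the functions $(1-|z|^2)^{\nu+m}$ are an approximate identity at 0, so that testing with them gives
 integrals against $h$, and compactly supported radial functions have absolutely convergent expansions in the $s_k$.
\<close>

section \<open>Continuous dual Hahn polynomials and spherical functions\<close>

text \<open>The Plancherel measure is given only through the unitarity of the transform of
  functions, so already the integrability of polynomials in L against \<open>h\<close> has to be
  extracted from the isometry, and so do the orthogonality relations. The key is that raising the
  exponent \<alpha> of (1 - |z|^2)^\<alpha> by 1 multiplies the normalized transform by 1 +
  L/(\<alpha>(\<alpha> - n)): these transforms are positive and increase to 1. Monotone convergence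
  yields the integrability of all powers of L, dominated convergence the integrals of the s_k
  against h, namely 1 for k = 0 and 0 otherwise, and the symmetry of multiplication by L then gives
  orthogonality. Completeness is drawn from the isometry as well: sqrt(h) times a function
  orthogonal to all \<open>ek\<close> is the image of some f0, and every truncation of f0 to a
  smaller ball turns out to be orthogonal to f0. For operators, point evaluations and reproducing
  kernels take the place of a basis of monomials, so that sums over the arbitrary orthonormal basis
  in the definition of the trace become integrals over the ball.\<close>

no_notation fps_nth (infixl "$" 75)

text \<open>
 Continuous dual Hahn polynomials in the Laplace eigenvalue \<open>L\<close>; the recurrence is that of the moments of
 a spherical function against \<open>t ^ k\<close> times a fixed power of \<open>1 - t\<close>, with \<open>t\<close> the squared norm.
\<close>

fun sq :: "real \<Rightarrow> real \<Rightarrow> real \<Rightarrow> nat \<Rightarrow> real" where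
 "sq n \<nu> L 0 = 1"
| "sq n \<nu> L (Suc 0) = 1 - L / (n * \<nu>)"
| "sq n \<nu> L (Suc (Suc k)) = sq n \<nu> L (Suc k) +
   (real (Suc k) * (real (Suc k) + \<nu> - 1) * (sq n \<nu> L (Suc k) - sq n \<nu> L k) - L * sq n \<nu> L (Suc k)) /
   ((real (Suc k) + n) * (real (Suc k) + \<nu>))"

lemma sq_rec:
 assumes "n > 0" "\<nu> > 0"
 shows "(real k + n) * (real k + \<nu>) * (sq n \<nu> L (Suc k) - sq n \<nu> L k) =
   real k * (real k + \<nu> - 1) * (sq n \<nu> L k - sq n \<nu> L (k - 1)) - L * sq n \<nu> L k"
proof (cases k)
 case 0
 then show ?thesis using assms by (simp add: field_simps)
next
 case (Suc j)
 have "(real (Suc j) + n) * (real (Suc j) + \<nu>) \<noteq> 0" using assms by simp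
 then show ?thesis unfolding Suc by simp
qed

text \<open>Energy estimate: \<open>E k\<close>, the sum of L s_k^2 and B_k (s_k - s_{k-1})^2, does
  not increase once k \<ge> L. The recurrence turns the cross term 2 L s_k x into 2 B_k x y - 2 A_k
  x^2, and 2xy \<le> x^2 + y^2 leaves a multiple of x^2 whose sign is settled by A_k \<ge> B_{k+1}
  (from n \<ge> 1) and A_k \<ge> B_k + L (from k \<ge> L).\<close>

lemma sq_bounded:
 assumes n: "n \<ge> 1" and nu: "\<nu> > 0" and L: "L > 0"
 obtains C where "C \<ge> 0" "\<And>k. \<bar>sq n \<nu> L k\<bar> \<le> C"
proof -
 define s where "s = sq n \<nu> L"
 define A where "A k = (real k + n) * (real k + \<nu>)" for k
 define B where "B k = real k * (real k + \<nu> - 1)" for k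
 define E where "E k = L * (s k)^2 + B k * (s k - s (k - 1))^2" for k
 obtain k0 :: nat where k0: "real k0 \<ge> L" "k0 \<ge> 1" by (meson le_trans linear max.bounded_iff real_arch_simple of_nat_mono order_trans)
 have step: "E (Suc k) \<le> E k" if "k \<ge> k0" for k
 proof -
  define x y where "x = s (Suc k) - s k" and "y = s k - s (k - 1)"
  have k1: "k \<ge> 1" using that k0 by simp
  have B0: "B k \<ge> 0" using k1 nu unfolding B_def by (intro mult_nonneg_nonneg) auto
  have eq: "A k * x = B k * y - L * s k"
   unfolding A_def B_def x_def y_def s_def by (rule sq_rec) (use n nu in auto)
  have AB1: "A k - B (Suc k) = (n - 1) * (real k + \<nu>)" unfolding A_def B_def by (simp add: algebra_simps)
  have AB2: "A k - B k = real k * n + n * \<nu> + real k" unfolding A_def B_def by (simp add: algebra_simps)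
  have h1: "A k \<ge> B (Suc k)" using AB1 n nu by (smt (verit) mult_nonneg_nonneg of_nat_0_le_iff)
  have "real k \<ge> L" using k0 that by linarith
  hence h2: "A k \<ge> B k + L" using AB2 n nu by (smt (verit) mult_nonneg_nonneg of_nat_0_le_iff)
  have "L * (s (Suc k))^2 = L * (s k)^2 + 2 * (L * s k) * x + L * x^2"
   by (simp add: x_def power2_eq_square algebra_simps)
  also have "L * s k = B k * y - A k * x" using eq by simp
  finally have e1: "L * (s (Suc k))^2 = L * (s k)^2 + B k * (2 * x * y) - 2 * A k * x^2 + L * x^2"
   by (simp add: power2_eq_square algebra_simps)
  have "2 * x * y \<le> x^2 + y^2" using sum_squares_bound by blast
  hence e2: "B k * (2 * x * y) \<le> B k * (x^2 + y^2)" using B0 by (rule mult_left_mono)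
  have "(B k + L + B (Suc k) - 2 * A k) * x^2 \<le> 0" using h1 h2 by (intro mult_nonpos_nonneg) auto
  with e1 e2 have "L * (s (Suc k))^2 + B (Suc k) * x^2 \<le> L * (s k)^2 + B k * y^2"
   by (simp add: algebra_simps)
  thus ?thesis unfolding E_def x_def y_def by simp
 qed
 have Ele: "E k \<le> E k0" if "k \<ge> k0" for k
  using that by (induction rule: dec_induct) (use step in \<open>auto intro: order_trans\<close>)
 have B0: "B k \<ge> 0" for k using nu unfolding B_def by (cases k) (auto intro!: mult_nonneg_nonneg)
 have sle: "\<bar>s k\<bar> \<le> sqrt (E k0 / L)" if "k \<ge> k0" for k
 proof -
  have "L * (s k)^2 \<le> E k0" using Ele[OF that] B0[of k] unfolding E_def by (smt (verit) mult_nonneg_nonneg zero_le_power2)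
  hence "(s k)^2 \<le> E k0 / L" using L by (simp add: field_simps)
  thus ?thesis by (metis real_sqrt_abs real_sqrt_le_iff)
 qed
 define C where "C = (\<Sum>k<k0. \<bar>s k\<bar>) + sqrt (E k0 / L)"
 have E0: "E k0 \<ge> 0" unfolding E_def using L B0 by simp
 have "\<bar>s k\<bar> \<le> C" for k
 proof (cases "k < k0")
  case True
  hence "\<bar>s k\<bar> \<le> (\<Sum>k<k0. \<bar>s k\<bar>)" by (intro member_le_sum) auto
  thus ?thesis unfolding C_def using E0 L by (smt (verit) divide_nonneg_pos real_sqrt_ge_zero)
 next
  case False
  hence "\<bar>s k\<bar> \<le> sqrt (E k0 / L)" using sle by simp
  thus ?thesis unfolding C_def by (smt (verit) sum_nonneg abs_ge_zero)
 qed
 moreover have "C \<ge> 0" using calculation[of 0] by simp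
 ultimately show ?thesis using that unfolding s_def by blast
qed

section \<open>The binomial series and the hypergeometric equation for formal power series\<close>

lemma pochhammer_binomial_sums_complex:
 fixes a x :: complex
 assumes "cmod x < 1"
 shows "(\<lambda>k. pochhammer a k / fact k * x ^ k) sums (1 - x) powr (- a)"
proof -
 have "(\<lambda>k. ((- a) gchoose k) * (- x) ^ k) sums (1 + (- x)) powr (- a)"
  by (rule gen_binomial_complex) (use assms in simp)
 moreover have "((- a) gchoose k) * (- x) ^ k = pochhammer a k / fact k * x ^ k" for k
  by (simp add: gbinomial_pochhammer power_minus[of x] field_simps flip: power_add mult.assoc)
 ultimately show ?thesis by simp
qed

lemma pochhammer_binomial_sums:
 fixes a t :: real
 assumes "\<bar>t\<bar> < 1"
 shows "(\<lambda>k. pochhammer a k / fact k * t ^ k) sums (1 - t) powr (- a)"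
proof -
 have "complex_of_real (1 - t) powr of_real (- a) = of_real ((1 - t) powr (- a))"
  by (rule powr_of_real) (use assms in auto)
 hence "(\<lambda>k. complex_of_real (pochhammer a k / fact k * t ^ k)) sums of_real ((1 - t) powr (- a))"
  using pochhammer_binomial_sums_complex[of "of_real t" "of_real a"] assms
  by (simp add: pochhammer_of_real)
 thus ?thesis by (simp only: sums_of_real_iff)
qed

text \<open>\<open>F\<close> is 2F1(a, a; n; x) and \<open>B\<close> is (1 - x)^(-(\<nu> - a)), both
  as formal power series. The hypergeometric equation for \<open>F\<close> and the first-order
  equation for \<open>B\<close> combine into a second-order equation for the product, and comparing
  coefficients gives the recurrence.\<close>

lemma hyp_fps_recurrence:
 fixes a b n \<nu> :: complex
 assumes b: "b = \<nu> - a" and nz: "\<And>k. n + of_nat k \<noteq> 0"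
 defines "F \<equiv> Abs_fps (\<lambda>k. (pochhammer a k)^2 / (pochhammer n k * fact k))"
 defines "B \<equiv> Abs_fps (\<lambda>k. pochhammer b k / fact k)"
 shows "(of_nat k + 1) * (of_nat k + n) * (fps_nth (B * F) ((Suc k))) =
   (2 * of_nat k * (of_nat k - 1) + (2 * \<nu> + n + 1) * of_nat k + n * \<nu> - a * (n - a)) * (fps_nth (B * F) (k))
   - (of_nat k - 1 + \<nu>)^2 * (if k = 0 then 0 else (fps_nth (B * F) ((k - 1))))"
proof -
 let ?X = "fps_X :: complex fps" and ?c = "fps_const :: complex \<Rightarrow> complex fps"
 define F1 F2 B1 B2 where "F1 = fps_deriv F" and "F2 = fps_deriv F1" and "B1 = fps_deriv B" and "B2 = fps_deriv B1"
 have recF: "of_nat (Suc k) * (n + of_nat k) * fps_nth F (Suc k) = (a + of_nat k)^2 * fps_nth F (k)" for k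
 proof -
  have "1 + complex_of_nat k \<noteq> 0" by (metis of_nat_Suc of_nat_neq_0)
  thus ?thesis unfolding F_def using nz[of k]
   by (simp add: pochhammer_Suc power_mult_distrib divide_simps)
 qed
 have recB: "of_nat (Suc k) * fps_nth B (Suc k) = (b + of_nat k) * fps_nth B (k)" for k
 proof -
  have "1 + complex_of_nat k \<noteq> 0" by (metis of_nat_Suc of_nat_neq_0)
  thus ?thesis unfolding B_def by (simp add: pochhammer_Suc divide_simps)
 qed
 have hB: "(1 - ?X) * B1 = ?c b * B"
 proof (rule fps_ext)
  fix k show "(fps_nth ((1 - ?X) * B1) (k)) = (fps_nth (?c b * B) (k))"
   using recB[of k] by (cases k) (simp_all add: B1_def left_diff_distrib algebra_simps)
 qed
 have hF: "?X * (1 - ?X) * F2 = ?c (a^2) * F - (?c n - ?c (2 * a + 1) * ?X) * F1"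
 proof (rule fps_ext)
  fix k
  have "?X * (1 - ?X) * F2 = ?X * F2 - ?X * (?X * F2)" by (simp add: algebra_simps)
  moreover have "(?c n - ?c (2 * a + 1) * ?X) * F1 = ?c n * F1 - ?c (2 * a + 1) * (?X * F1)" by (simp add: algebra_simps)
  ultimately show "(fps_nth (?X * (1 - ?X) * F2) (k)) = fps_nth (?c (a^2) * F - (?c n - ?c (2 * a + 1) * ?X) * F1) k"
  proof (cases k)
   case 0
   thus ?thesis using recF[of 0] \<open>?X * (1 - ?X) * F2 = _\<close> \<open>(?c n - _) * F1 = _\<close>
    by (simp add: F1_def F2_def)
  next
   case (Suc j)
   have r: "(of_nat j + 2) * (n + of_nat j + 1) * (fps_nth F (Suc (Suc j))) = (a + of_nat j + 1)^2 * (fps_nth F ((Suc j)))"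
    using recF[of "Suc j"] by (simp add: algebra_simps)
   show ?thesis using r \<open>?X * (1 - ?X) * F2 = _\<close> \<open>(?c n - _) * F1 = _\<close> Suc
    by (cases j) (simp_all add: F1_def F2_def power2_eq_square algebra_simps)
  qed
 qed
 define Y where "Y = B * F"
 define Y1 Y2 where "Y1 = fps_deriv Y" and "Y2 = fps_deriv Y1"
 have Y1: "Y1 = B1 * F + B * F1" unfolding Y1_def Y_def B1_def F1_def by (simp add: algebra_simps)
 have Y2: "Y2 = B2 * F + 2 * B1 * F1 + B * F2" unfolding Y2_def Y1 by (simp add: B1_def F1_def F2_def B2_def algebra_simps)
 have hB2: "(1 - ?X) * B2 = (?c b + 1) * B1"
 proof -
  have "fps_deriv ((1 - ?X) * B1) = fps_deriv (?c b * B)" using hB by simp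
  hence "(1 - ?X) * B2 - B1 = ?c b * B1" by (simp add: B2_def B1_def algebra_simps)
  thus ?thesis by (simp add: algebra_simps)
 qed
 have hB3: "(1 - ?X)^2 * B2 = (?c b + 1) * ?c b * B"
 proof -
  have "(1 - ?X)^2 * B2 = (1 - ?X) * ((1 - ?X) * B2)" by (simp add: power2_eq_square algebra_simps)
  also have "\<dots> = (?c b + 1) * ((1 - ?X) * B1)" unfolding hB2 by (simp only: mult.left_commute)
  finally show ?thesis unfolding hB by (simp only: mult.assoc)
 qed
 have e1: "(1 - ?X) * Y1 = ?c b * (B * F) + (1 - ?X) * (B * F1)"
  using hB unfolding Y1 by (metis (no_types, lifting) distrib_left mult.assoc)
 have e2: "?X * (1 - ?X)^2 * Y2 = ?X * (?c b + 1) * ?c b * (B * F) + 2 * ?X * ?c b * ((1 - ?X) * (B * F1))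
   + (1 - ?X) * (?c (a^2) * (B * F)) - (?c n - ?c (2 * a + 1) * ?X) * ((1 - ?X) * (B * F1))"
 proof -
  have "?X * (1 - ?X)^2 * Y2 = ?X * ((1 - ?X)^2 * B2) * F + 2 * ?X * (1 - ?X) * ((1 - ?X) * B1) * F1
    + (1 - ?X) * B * (?X * (1 - ?X) * F2)" unfolding Y2 by (simp add: power2_eq_square algebra_simps)
  thus ?thesis unfolding hB3 hB hF by (simp add: algebra_simps del: fps_const_add fps_const_mult fps_const_sub)
 qed
 have cc: "?c b = ?c \<nu> - ?c a" "?c (a^2) = ?c a * ?c a" "?c (2 * a + 1) = 2 * ?c a + 1" "?c (2 * \<nu> + 1) = 2 * ?c \<nu> + 1"
   "?c (a * (n - a) - n * \<nu>) = ?c a * (?c n - ?c a) - ?c n * ?c \<nu>" "?c (\<nu>^2) = ?c \<nu> * ?c \<nu>"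
  by (simp_all add: b power2_eq_square numeral_fps_const flip: fps_const_add fps_const_sub fps_const_mult)
 \<comment> \<open>In the combined equation a survives only through a(n - a), which is the real
   number L for a = (n + i\<lambda>)/2. This is why the coefficients of the product are real and
   unchanged when \<lambda> is replaced by -\<lambda>.\<close>
 have ode: "?X * (1 - ?X)^2 * Y2 + (?c n - ?c (2 * \<nu> + 1) * ?X) * ((1 - ?X) * Y1) + (?c (a * (n - a) - n * \<nu>) + ?c (\<nu>^2) * ?X) * Y = 0"
  unfolding e1 e2 Y_def cc by (simp add: algebra_simps del: fps_const_add fps_const_mult fps_const_sub)
 have "?X * (?X * (1 - ?X)^2 * Y2 + (?c n - ?c (2 * \<nu> + 1) * ?X) * ((1 - ?X) * Y1) + (?c (a * (n - a) - n * \<nu>) + ?c (\<nu>^2) * ?X) * Y) = 0"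
  unfolding ode by simp
 \<comment> \<open>After multiplication by X the equation involves only X^2 Y'' and X Y', whose
   coefficients are k(k-1) y_k and k y_k; the remaining factors X are index shifts.\<close>
 define V where "V = ?X * (?X * Y2)"
 define W where "W = ?X * Y1"
 have Vn: "fps_nth V (k) = of_nat k * (of_nat k - 1) * fps_nth Y (k)" for k
  unfolding V_def Y2_def Y1_def by (cases k; cases "k - 1") (simp_all add: algebra_simps)
 have Wn: "fps_nth W (k) = of_nat k * fps_nth Y (k)" for k
  unfolding W_def Y1_def by (cases k) (simp_all add: algebra_simps)
 have "V - 2 * (?X * V) + ?X * (?X * V) + ?c n * W - ?c (2 * \<nu> + n + 1) * (?X * W) + ?c (2 * \<nu> + 1) * (?X * (?X * W))
   + ?c (a * (n - a) - n * \<nu>) * (?X * Y) + ?c (\<nu>^2) * (?X * (?X * Y)) =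
   ?X * (?X * (1 - ?X)^2 * Y2 + (?c n - ?c (2 * \<nu> + 1) * ?X) * ((1 - ?X) * Y1) + (?c (a * (n - a) - n * \<nu>) + ?c (\<nu>^2) * ?X) * Y)"
  (is "?LHS = _")
 proof -
  have "?c (2 * \<nu> + n + 1) = ?c (2 * \<nu> + 1) + ?c n" by simp
  thus ?thesis unfolding V_def W_def by (simp only: power2_eq_square) (simp add: algebra_simps del: fps_const_add fps_const_mult fps_const_sub)
 qed
 also have "\<dots> = 0" unfolding ode by simp
 finally have "fps_nth ?LHS (Suc k) = 0" by simp
 hence "(of_nat k + 1) * (of_nat k + n) * (fps_nth Y ((Suc k))) =
   (2 * of_nat k * (of_nat k - 1) + (2 * \<nu> + n + 1) * of_nat k + n * \<nu> - a * (n - a)) * fps_nth Y (k)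
   - (of_nat k - 1 + \<nu>)^2 * (if k = 0 then 0 else (fps_nth Y ((k - 1))))"
  by (cases k) (simp_all add: Vn Wn numeral_fps_const power2_eq_square algebra_simps)
 thus ?thesis unfolding Y_def .
qed

text \<open>For L = 0 all \<open>sq\<close> equal 1 and these are the coefficients of (1 -
  t)^(-\<nu>). For L = (n^2 + \<lambda>^2)/4 they turn out to be the power series coefficients, in t
  = |z|^2, of the spherical function divided by (1 - t)^\<nu>.\<close>

definition scoeff :: "real \<Rightarrow> real \<Rightarrow> real \<Rightarrow> nat \<Rightarrow> real" where
 "scoeff n \<nu> L k = pochhammer \<nu> k / fact k * sq n \<nu> L k"

definition sser :: "real \<Rightarrow> real \<Rightarrow> real \<Rightarrow> real \<Rightarrow> real" where
 "sser n \<nu> L t = (\<Sum>k. scoeff n \<nu> L k * t ^ k)"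

definition phi :: "real \<Rightarrow> real \<Rightarrow> real \<Rightarrow> real \<Rightarrow> real" where
 "phi n \<nu> L t = (1 - t) powr \<nu> * sser n \<nu> L t"

text \<open>The recurrence of \<open>sq\<close> rescaled by (\<nu>)_k / k!. It is the recurrence of
  \<open>hyp_fps_recurrence\<close> with a(n - a) replaced by L, so the two sequences agree by
  induction.\<close>

lemma scoeff_rec:
 assumes "n > 0" "\<nu> > 0"
 shows "(real k + 1) * (real k + n) * scoeff n \<nu> L (Suc k) =
  (2 * real k * (real k - 1) + (2 * \<nu> + n + 1) * real k + n * \<nu> - L) * scoeff n \<nu> L k
   - (real k - 1 + \<nu>)^2 * (if k = 0 then 0 else scoeff n \<nu> L (k - 1))"
proof -
 define q where "q = pochhammer \<nu> k / fact k"
 have q1: "scoeff n \<nu> L (Suc k) * (real k + 1) = (\<nu> + real k) * q * sq n \<nu> L (Suc k)"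
  unfolding scoeff_def q_def by (simp add: pochhammer_Suc divide_simps)
 have q0: "scoeff n \<nu> L k = q * sq n \<nu> L k" by (simp add: scoeff_def q_def)
 have qm: "(real k - 1 + \<nu>)^2 * (if k = 0 then 0 else scoeff n \<nu> L (k - 1)) = (real k - 1 + \<nu>) * real k * q * sq n \<nu> L (k - 1)"
 proof (cases k)
  case (Suc j)
  have "1 + real j \<noteq> 0" by simp
  thus ?thesis unfolding Suc scoeff_def q_def
   by (simp add: pochhammer_Suc divide_simps power2_eq_square add.commute)
 qed simp
 have "(real k + 1) * (real k + n) * scoeff n \<nu> L (Suc k) = q * ((real k + n) * (real k + \<nu>) * (sq n \<nu> L (Suc k) - sq n \<nu> L k))
   + q * (real k + n) * (real k + \<nu>) * sq n \<nu> L k"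
 proof -
  have "(real k + 1) * (real k + n) * scoeff n \<nu> L (Suc k) = (real k + n) * (scoeff n \<nu> L (Suc k) * (real k + 1))"
   by (simp only: mult_ac)
  thus ?thesis unfolding q1 by (simp add: algebra_simps)
 qed
 also have "\<dots> = q * (real k * (real k + \<nu> - 1) * (sq n \<nu> L k - sq n \<nu> L (k - 1)) - L * sq n \<nu> L k)
   + q * (real k + n) * (real k + \<nu>) * sq n \<nu> L k"
  by (subst sq_rec[OF assms]) simp
 finally show ?thesis unfolding qm q0 by (simp add: algebra_simps)
qed

lemma fps_coeff_eq_scoeff:
 fixes a :: complex
 assumes n: "n > 0" and nu: "\<nu> > 0" and L: "a * (of_real n - a) = of_real L"
 defines "F \<equiv> Abs_fps (\<lambda>k. (pochhammer a k)^2 / (pochhammer (of_real n) k * fact k))"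
 defines "B \<equiv> Abs_fps (\<lambda>k. pochhammer (of_real \<nu> - a) k / fact k)"
 shows "(fps_nth (B * F) (k)) = of_real (scoeff n \<nu> L k)"
proof (induction k rule: less_induct)
 case (less k)
 have nz: "complex_of_real n + of_nat k \<noteq> 0" for k
 proof -
  have "complex_of_real n + of_nat k = of_real (n + real k)" by simp
  moreover have "n + real k \<noteq> 0" using n by (simp add: add_nonneg_eq_0_iff)
  ultimately show ?thesis by (simp only: of_real_eq_0_iff not_False_eq_True)
 qed
 show ?case
 proof (cases k)
  case 0 thus ?thesis by (simp add: B_def F_def scoeff_def)
 next
  case (Suc j)
  have z: "(of_nat j + 1) * (of_nat j + complex_of_real n) \<noteq> 0"
  proof -
   have "complex_of_nat j + 1 \<noteq> 0" by (metis add.commute of_nat_Suc of_nat_neq_0)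
   thus ?thesis using nz[of j] by (simp add: add.commute)
  qed
  have "(of_nat j + 1) * (of_nat j + complex_of_real n) * (fps_nth (B * F) ((Suc j))) =
   (2 * of_nat j * (of_nat j - 1) + (2 * of_real \<nu> + of_real n + 1) * of_nat j + of_real n * of_real \<nu> - a * (of_real n - a)) * (fps_nth (B * F) (j))
   - (of_nat j - 1 + of_real \<nu>)^2 * (if j = 0 then 0 else (fps_nth (B * F) ((j - 1))))"
   unfolding B_def F_def by (rule hyp_fps_recurrence[OF refl nz])
  also have "\<dots> = of_real ((2 * real j * (real j - 1) + (2 * \<nu> + n + 1) * real j + n * \<nu> - L) * scoeff n \<nu> L j
   - (real j - 1 + \<nu>)^2 * (if j = 0 then 0 else scoeff n \<nu> L (j - 1)))"
   unfolding L using less.IH[of j] less.IH[of "j - 1"] Suc by (cases j) simp_all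
  also have "\<dots> = of_real ((real j + 1) * (real j + n) * scoeff n \<nu> L (Suc j))"
   by (subst scoeff_rec[OF n nu]) simp
  also have "\<dots> = (of_nat j + 1) * (of_nat j + complex_of_real n) * of_real (scoeff n \<nu> L (Suc j))" by simp
  finally show ?thesis unfolding Suc using z by (metis mult_left_cancel)
 qed
qed

lemma summable_hyp:
 fixes a :: complex and n t :: real
 assumes n: "n \<ge> 1" and t: "\<bar>t\<bar> < 1"
 shows "summable (\<lambda>k. norm ((pochhammer a k)^2 / (pochhammer (of_real n) k * fact k) * (of_real t) ^ k))"
proof -
 define f where "f k = (pochhammer a k)^2 / (pochhammer (of_real n) k * fact k) * (of_real t) ^ k" for k
 define c where "c = (1 + \<bar>t\<bar>) / 2"
 have c: "\<bar>t\<bar> < c" "c < 1" using t by (auto simp: c_def)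
 define r where "r k = (cmod a + real k)^2 / ((1 + real k) * (real k + 1)) * \<bar>t\<bar>" for k
 have "r \<longlonglongrightarrow> \<bar>t\<bar>" unfolding r_def by real_asymp
 hence "eventually (\<lambda>k. r k < c) sequentially" using c(1) by (rule order_tendstoD(2))
 then obtain N where N: "\<And>k. k \<ge> N \<Longrightarrow> r k < c" by (auto simp: eventually_sequentially)
 have "norm (f (Suc k)) \<le> c * norm (f k)" if "k \<ge> N" for k
 proof -
  have fs: "f (Suc k) = (a + of_nat k)^2 / (of_real (n + real k) * of_nat (Suc k)) * of_real t * f k"
   unfolding f_def by (simp add: pochhammer_Suc power_mult_distrib mult_ac)
  have "norm (f (Suc k)) = ((cmod (a + of_nat k))^2 / ((n + real k) * (real k + 1)) * \<bar>t\<bar>) * norm (f k)"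
  proof -
   have "cmod (complex_of_real (n + real k)) = n + real k" unfolding norm_of_real using n by simp
   moreover have "cmod (of_nat (Suc k)) = real k + 1" unfolding norm_of_nat by simp
   ultimately show ?thesis unfolding fs by (simp only: norm_mult norm_divide norm_power norm_of_real)
  qed
  also have "(cmod (a + of_nat k))^2 / ((n + real k) * (real k + 1)) * \<bar>t\<bar> \<le> r k"
  proof -
   have "cmod (a + of_nat k) \<le> cmod a + real k" by (metis norm_of_nat norm_triangle_ineq)
   thus ?thesis unfolding r_def using n
    by (intro mult_right_mono frac_le mult_mono power_mono) auto
  qed
  finally show ?thesis using N[OF that] by (smt (verit) mult_right_mono norm_ge_zero)
 qed
 hence "summable (\<lambda>k. norm (f k))" by (intro summable_ratio_test[OF c(2), of N]) simp
 thus ?thesis unfolding f_def .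
qed

lemma summable_pochhammer_binomial:
 fixes a x :: complex assumes "cmod x < 1"
 shows "summable (\<lambda>k. norm (pochhammer a k / fact k * x ^ k))"
proof -
 obtain r where r: "cmod x < r" "r < 1" using assms dense by blast
 have "summable (\<lambda>k. pochhammer a k / fact k * (of_real r) ^ k)"
 proof -
  have "0 \<le> r" using r norm_ge_zero[of x] by linarith
  hence "cmod (of_real r) < 1" using r by simp
  from pochhammer_binomial_sums_complex[OF this, of a] show ?thesis by (rule sums_summable)
 qed
 moreover have "norm x < norm (complex_of_real r)" using r norm_ge_zero[of x] by (simp add: abs_of_pos del: norm_ge_zero)
 ultimately show ?thesis by (rule powser_insidea)
qed

text \<open>Split (1 - t)^a into (1 - t)^\<nu> and (1 - t)^(a - \<nu>), and multiply the binomial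
  series of the second factor with the hypergeometric series. The left side does not depend on
  \<nu>, so the exponent is free: it is taken to be 1 for the boundedness of spherical functions,
  and it can stay fixed while the exponent of a tested weight varies.\<close>

theorem spherical_fun_eq_phi:
 fixes z :: "complex^'n::finite"
 assumes z: "norm z < 1" and nu: "\<nu> > 0"
 shows "spherical_fun (of_real l) z = of_real (phi (real CARD('n)) \<nu> (((real CARD('n))^2 + l^2) / 4) ((norm z)^2))"
proof -
 define n where "n = real CARD('n)"
 have n1: "n \<ge> 1" unfolding n_def by (simp add: Suc_leI)
 define a where "a = (of_real n + \<i> * of_real l) / (2::complex)"
 define L where "L = (n^2 + l^2) / 4"
 define t where "t = (norm z)^2"
 have t: "0 \<le> t" "t < 1" using z by (auto simp: t_def abs_square_less_1)
 have aL: "a * (of_real n - a) = of_real L"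
  by (simp add: complex_eq_iff a_def L_def power2_eq_square field_simps)
 define F where "F = Abs_fps (\<lambda>k. (pochhammer a k)^2 / (pochhammer (of_real n) k * fact k))"
 define B where "B = Abs_fps (\<lambda>k. pochhammer (of_real \<nu> - a) k / fact k)"
 let ?t = "complex_of_real t"
 have sB: "summable (\<lambda>k. norm (fps_nth B (k) * ?t ^ k))" unfolding B_def
  using summable_pochhammer_binomial[of ?t "of_real \<nu> - a"] t by (simp add: abs_less_iff)
 have sF: "summable (\<lambda>k. norm (fps_nth F (k) * ?t ^ k))" unfolding F_def
  using summable_hyp[OF n1, of t a] t by simp
 have "(\<lambda>k. \<Sum>i\<le>k. (fps_nth B (i) * ?t ^ i) * ((fps_nth F ((k - i))) * ?t ^ (k - i))) sums ((\<Sum>k. fps_nth B (k) * ?t ^ k) * (\<Sum>k. fps_nth F (k) * ?t ^ k))"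
  by (rule Cauchy_product_sums[OF sB sF])
 moreover have "(\<Sum>i\<le>k. (fps_nth B (i) * ?t ^ i) * ((fps_nth F ((k - i))) * ?t ^ (k - i))) = of_real (scoeff n \<nu> L k * t ^ k)" for k
 proof -
  have "(\<Sum>i\<le>k. (fps_nth B (i) * ?t ^ i) * ((fps_nth F ((k - i))) * ?t ^ (k - i))) = (\<Sum>i\<le>k. fps_nth B (i) * (fps_nth F ((k - i))) * ?t ^ k)"
  proof (rule sum.cong[OF refl])
   fix i assume "i \<in> {..k}"
   hence "?t ^ k = ?t ^ i * ?t ^ (k - i)" by (simp flip: power_add)
   thus "(fps_nth B (i) * ?t ^ i) * ((fps_nth F ((k - i))) * ?t ^ (k - i)) = fps_nth B (i) * (fps_nth F ((k - i))) * ?t ^ k" by simp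
  qed
  also have "\<dots> = (fps_nth (B * F) (k)) * ?t ^ k" by (simp add: fps_mult_nth sum_distrib_right atLeast0AtMost)
  finally show ?thesis unfolding B_def F_def fps_coeff_eq_scoeff[OF order_less_le_trans[OF zero_less_one n1] nu aL] by simp
 qed
 ultimately have sm: "(\<lambda>k. complex_of_real (scoeff n \<nu> L k * t ^ k)) sums ((\<Sum>k. fps_nth B (k) * ?t ^ k) * (\<Sum>k. fps_nth F (k) * ?t ^ k))"
  by simp
 have "(\<Sum>k. fps_nth B (k) * ?t ^ k) = (1 - ?t) powr (- (of_real \<nu> - a))"
  using pochhammer_binomial_sums_complex[of ?t "of_real \<nu> - a"] t by (simp add: B_def sums_iff)
 moreover have "(\<Sum>k. fps_nth F (k) * ?t ^ k) = hyp2F1 a a (of_real n) ?t"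
  unfolding hyp2F1_def F_def by (simp add: power2_eq_square)
 moreover have "of_real (sser n \<nu> L t) = (\<Sum>k. fps_nth B (k) * ?t ^ k) * (\<Sum>k. fps_nth F (k) * ?t ^ k)"
 proof -
  have "summable (\<lambda>k. complex_of_real (scoeff n \<nu> L k * t ^ k))" using sm by (rule sums_summable)
  hence "summable (\<lambda>k. scoeff n \<nu> L k * t ^ k)" by (simp only: summable_complex_of_real)
  hence "(\<lambda>k. complex_of_real (scoeff n \<nu> L k * t ^ k)) sums of_real (sser n \<nu> L t)"
   unfolding sser_def by (intro sums_of_real summable_sums)
  thus ?thesis using sm by (rule sums_unique2)
 qed
 ultimately have "of_real (sser n \<nu> L t) = (1 - ?t) powr (a - of_real \<nu>) * hyp2F1 a a (of_real n) ?t" by simp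
 moreover have "complex_of_real ((1 - t) powr \<nu>) = (1 - ?t) powr of_real \<nu>"
  using powr_of_real[of "1 - t" \<nu>] t by simp
 moreover have "(1 - ?t) powr of_real \<nu> * (1 - ?t) powr (a - of_real \<nu>) = (1 - ?t) powr a"
  using t by (simp add: powr_add[symmetric])
 ultimately have "of_real (phi n \<nu> L t) = (1 - ?t) powr a * hyp2F1 a a (of_real n) ?t"
  unfolding phi_def by (simp add: mult.assoc[symmetric])
 moreover have "spherical_fun (of_real l) z = (1 - ?t) powr a * hyp2F1 a a (of_real n) ?t"
  by (simp add: spherical_fun_def t_def a_def n_def Let_def)
 ultimately show ?thesis by (simp add: t_def n_def L_def)
qed

section \<open>Derivatives, differential equation and growth of the power series\<close>

definition sser1 :: "real \<Rightarrow> real \<Rightarrow> real \<Rightarrow> real \<Rightarrow> real" where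
 "sser1 n \<nu> L t = (\<Sum>k. diffs (scoeff n \<nu> L) k * t ^ k)"

definition sser2 :: "real \<Rightarrow> real \<Rightarrow> real \<Rightarrow> real \<Rightarrow> real" where
 "sser2 n \<nu> L t = (\<Sum>k. diffs (diffs (scoeff n \<nu> L)) k * t ^ k)"

locale spherical_series =
 fixes n \<nu> L :: real
 assumes n1: "n \<ge> 1" and nu0: "\<nu> > 0" and L0: "L > 0"
begin

abbreviation "c \<equiv> scoeff n \<nu> L"

lemma scoeff_bound:
 obtains C where "C \<ge> 0" "\<And>k. \<bar>sq n \<nu> L k\<bar> \<le> C" "\<And>k. \<bar>c k\<bar> \<le> C * (pochhammer \<nu> k / fact k)"
proof -
 obtain C where C: "C \<ge> 0" "\<And>k. \<bar>sq n \<nu> L k\<bar> \<le> C" using sq_bounded[OF n1 nu0 L0] by blast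
 have "\<bar>c k\<bar> \<le> C * (pochhammer \<nu> k / fact k)" for k
 proof -
  have "pochhammer \<nu> k > 0" using nu0 by (rule pochhammer_pos)
  thus ?thesis unfolding scoeff_def using C(2)[of k] by (simp add: abs_mult divide_simps mult.commute)
 qed
 thus ?thesis using that C by blast
qed

lemma summable_abs_scoeff:
 assumes "\<bar>t\<bar> < 1" shows "summable (\<lambda>k. \<bar>c k * t ^ k\<bar>)"
proof -
 obtain C where C0: "C \<ge> 0" "\<And>k. \<bar>sq n \<nu> L k\<bar> \<le> C" and C: "\<And>k. \<bar>c k\<bar> \<le> C * (pochhammer \<nu> k / fact k)"
  by (rule scoeff_bound; rule that)
 have "summable (\<lambda>k. C * (pochhammer \<nu> k / fact k * \<bar>t\<bar> ^ k))"
  by (intro summable_mult sums_summable[OF pochhammer_binomial_sums]) (use assms in simp)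
 thus ?thesis
 proof (rule summable_comparison_test')
  show "norm \<bar>c k * t ^ k\<bar> \<le> C * (pochhammer \<nu> k / fact k * \<bar>t\<bar> ^ k)" for k
   using mult_right_mono[OF C[of k], of "\<bar>t\<bar> ^ k"] by (simp add: abs_mult power_abs mult.assoc)
 qed
qed

lemma summable_scoeff: "\<bar>t\<bar> < 1 \<Longrightarrow> summable (\<lambda>k. c k * t ^ k)"
 using summable_abs_scoeff by (rule summable_rabs_cancel)

lemma summable_diffs: "\<bar>t\<bar> < 1 \<Longrightarrow> summable (\<lambda>k. diffs c k * t ^ k)"
 by (rule termdiff_converges[where K = 1]) (auto intro: summable_scoeff)

lemma summable_diffs2: "\<bar>t\<bar> < 1 \<Longrightarrow> summable (\<lambda>k. diffs (diffs c) k * t ^ k)"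
 by (rule termdiff_converges[where K = 1]) (auto intro: summable_diffs)

lemma sser_deriv: "\<bar>t\<bar> < 1 \<Longrightarrow> (sser n \<nu> L has_real_derivative sser1 n \<nu> L t) (at t)"
 unfolding sser_def[abs_def] sser1_def by (rule termdiffs_strong'[where K = 1]) (auto intro: summable_scoeff)

lemma sser1_deriv: "\<bar>t\<bar> < 1 \<Longrightarrow> (sser1 n \<nu> L has_real_derivative sser2 n \<nu> L t) (at t)"
 unfolding sser1_def[abs_def] sser2_def by (rule termdiffs_strong'[where K = 1]) (auto intro: summable_diffs)

lemma sums0: "\<bar>t\<bar> < 1 \<Longrightarrow> (\<lambda>k. c k * t ^ k) sums sser n \<nu> L t"
 unfolding sser_def by (intro summable_sums summable_scoeff)

lemma sums1: assumes "\<bar>t\<bar> < 1" shows "(\<lambda>k. real k * c k * t ^ k) sums (t * sser1 n \<nu> L t)"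
proof -
 have "(\<lambda>k. t * (real k * c k * t ^ (k - Suc 0))) sums (t * sser1 n \<nu> L t)"
  unfolding sser1_def by (intro sums_mult diffs_equiv summable_diffs assms)
 moreover have "t * (real k * c k * t ^ (k - Suc 0)) = real k * c k * t ^ k" for k by (cases k) auto
 ultimately show ?thesis by simp
qed

lemma sums2: assumes "\<bar>t\<bar> < 1" shows "(\<lambda>k. real k * (real k - 1) * c k * t ^ k) sums (t^2 * sser2 n \<nu> L t)"
proof -
 have "(\<lambda>k. t^2 * (real k * diffs c k * t ^ (k - Suc 0))) sums (t^2 * sser2 n \<nu> L t)"
  unfolding sser2_def by (intro sums_mult diffs_equiv summable_diffs2 assms)
 moreover have "t^2 * (real k * diffs c k * t ^ (k - Suc 0)) = real (Suc k) * (real (Suc k) - 1) * c (Suc k) * t ^ Suc k" for k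
  by (cases k) (auto simp: diffs_def power2_eq_square)
 ultimately have "(\<lambda>k. real (Suc k) * (real (Suc k) - 1) * c (Suc k) * t ^ Suc k) sums (t^2 * sser2 n \<nu> L t)" by simp
 thus ?thesis by (subst (asm) sums_Suc_iff) simp
qed

text \<open>Analytic counterpart of the formal equation, recovered from the coefficients: t S' and
  t^2 S'' have the coefficients k c_k and k(k-1) c_k, and \<open>scoeff_rec\<close> says that the
  resulting identity of power series holds term by term.\<close>

lemma sser_ode:
 assumes t: "0 < t" "t < 1"
 shows "t * (1 - t)^2 * sser2 n \<nu> L t + (n - (2 * \<nu> + 1) * t) * (1 - t) * sser1 n \<nu> L t + (L - n * \<nu> + \<nu>^2 * t) * sser n \<nu> L t = 0"
proof -
 define T0 T1 T2 where "T0 = sser n \<nu> L t" and "T1 = t * sser1 n \<nu> L t" and "T2 = t^2 * sser2 n \<nu> L t"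
 have ta: "\<bar>t\<bar> < 1" using t by simp
 note s0 = sums0[OF ta, folded T0_def] and s1 = sums1[OF ta, folded T1_def] and s2 = sums2[OF ta, folded T2_def]
 have "(\<lambda>k. real k * (real k - 1) * c k * t ^ k + n * (real k * c k * t ^ k)) sums (T2 + n * T1)"
  by (intro sums_add sums_mult s1 s2)
 hence "(\<lambda>k. real k * (real k - 1 + n) * c k * t ^ k) sums (T2 + n * T1)"
  by (rule sums_cong[THEN iffD1, rotated]) (simp add: algebra_simps)
 hence A: "(\<lambda>k. real (Suc k) * (real (Suc k) - 1 + n) * c (Suc k) * t ^ Suc k) sums (T2 + n * T1)"
  by (subst sums_Suc_iff) simp
 have "(\<lambda>k. t * (2 * (real k * (real k - 1) * c k * t ^ k) + (2 * \<nu> + n + 1) * (real k * c k * t ^ k) + (n * \<nu> - L) * (c k * t ^ k)))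
   sums (t * (2 * T2 + (2 * \<nu> + n + 1) * T1 + (n * \<nu> - L) * T0))"
  by (intro sums_add sums_mult s0 s1 s2)
 moreover have "(\<lambda>k. t^2 * ((real k * (real k - 1) * c k * t ^ k) + (2 * \<nu> + 1) * (real k * c k * t ^ k) + \<nu>^2 * (c k * t ^ k)))
   sums (t^2 * (T2 + (2 * \<nu> + 1) * T1 + \<nu>^2 * T0))"
  by (intro sums_add sums_mult s0 s1 s2)
 hence "(\<lambda>k. (real (Suc k) - 1 + \<nu>)^2 * c k * t ^ (Suc (Suc k))) sums (t^2 * (T2 + (2 * \<nu> + 1) * T1 + \<nu>^2 * T0))"
  by (rule sums_cong[THEN iffD1, rotated]) (simp add: algebra_simps power2_eq_square)
 hence "(\<lambda>k. (real k - 1 + \<nu>)^2 * (if k = 0 then 0 else c (k - 1)) * t ^ (Suc k)) sums (t^2 * (T2 + (2 * \<nu> + 1) * T1 + \<nu>^2 * T0))"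
  using sums_Suc_iff[of "\<lambda>k. (real k - 1 + \<nu>)^2 * (if k = 0 then 0 else c (k - 1)) * t ^ (Suc k)"] by simp
 ultimately have "(\<lambda>k. t * (2 * (real k * (real k - 1) * c k * t ^ k) + (2 * \<nu> + n + 1) * (real k * c k * t ^ k) + (n * \<nu> - L) * (c k * t ^ k))
   - (real k - 1 + \<nu>)^2 * (if k = 0 then 0 else c (k - 1)) * t ^ (Suc k))
   sums (t * (2 * T2 + (2 * \<nu> + n + 1) * T1 + (n * \<nu> - L) * T0) - t^2 * (T2 + (2 * \<nu> + 1) * T1 + \<nu>^2 * T0))"
  by (rule sums_diff)
 moreover have "t * (2 * (real k * (real k - 1) * c k * t ^ k) + (2 * \<nu> + n + 1) * (real k * c k * t ^ k) + (n * \<nu> - L) * (c k * t ^ k))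
   - (real k - 1 + \<nu>)^2 * (if k = 0 then 0 else c (k - 1)) * t ^ (Suc k) = real (Suc k) * (real (Suc k) - 1 + n) * c (Suc k) * t ^ Suc k" for k
 proof -
  have "real (Suc k) * (real (Suc k) - 1 + n) * c (Suc k) * t ^ Suc k = ((real k + 1) * (real k + n) * c (Suc k)) * t ^ Suc k" by (simp add: algebra_simps)
  also have "\<dots> = ((2 * real k * (real k - 1) + (2 * \<nu> + n + 1) * real k + n * \<nu> - L) * c k
   - (real k - 1 + \<nu>)^2 * (if k = 0 then 0 else c (k - 1))) * t ^ Suc k"
   by (subst scoeff_rec) (use n1 nu0 in auto)
  finally show ?thesis by (simp add: algebra_simps)
 qed
 ultimately have "T2 + n * T1 = t * (2 * T2 + (2 * \<nu> + n + 1) * T1 + (n * \<nu> - L) * T0) - t^2 * (T2 + (2 * \<nu> + 1) * T1 + \<nu>^2 * T0)"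
  using A by (simp add: sums_iff)
 hence "t * (t * (1 - t)^2 * sser2 n \<nu> L t + (n - (2 * \<nu> + 1) * t) * (1 - t) * sser1 n \<nu> L t + (L - n * \<nu> + \<nu>^2 * t) * sser n \<nu> L t) = 0"
  unfolding T0_def T1_def T2_def by (simp add: algebra_simps power2_eq_square)
 thus ?thesis using t by simp
qed

text \<open>All growth bounds come from |c_k| \<le> C (\<nu>)_k / k!, compared termwise with the
  binomial series of (1 - t)^(-\<nu>) and its derivative. In the last one the constant terms cancel
  because c_0 = 1, so the right side vanishes at t = 0.\<close>

lemma sser_bounds:
 obtains C where "C \<ge> 0" "\<And>k. \<bar>sq n \<nu> L k\<bar> \<le> C"
  "\<And>t. 0 \<le> t \<Longrightarrow> t < 1 \<Longrightarrow> \<bar>sser n \<nu> L t\<bar> \<le> C * (1 - t) powr (- \<nu>)"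
  "\<And>t. 0 \<le> t \<Longrightarrow> t < 1 \<Longrightarrow> \<bar>sser1 n \<nu> L t\<bar> \<le> C * \<nu> * (1 - t) powr (- \<nu> - 1)"
  "\<And>t. 0 \<le> t \<Longrightarrow> t < 1 \<Longrightarrow> \<bar>sser n \<nu> L t - (1 - t) powr (- \<nu>)\<bar> \<le> (C + 1) * ((1 - t) powr (- \<nu>) - 1)"
proof -
 obtain C where C0: "C \<ge> 0" and Csq: "\<And>k. \<bar>sq n \<nu> L k\<bar> \<le> C" and C: "\<And>k. \<bar>c k\<bar> \<le> C * (pochhammer \<nu> k / fact k)"
  by (rule scoeff_bound; rule that)
 show ?thesis
 proof (rule that[OF C0 Csq])
  fix t :: real assume t: "0 \<le> t" "t < 1"
  have ta: "\<bar>t\<bar> < 1" using t by simp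
  have b1: "(\<lambda>k. C * (pochhammer \<nu> k / fact k * t ^ k)) sums (C * (1 - t) powr (- \<nu>))"
   by (intro sums_mult pochhammer_binomial_sums ta)
  have "norm (\<Sum>k. c k * t ^ k) \<le> (\<Sum>k. C * (pochhammer \<nu> k / fact k * t ^ k))"
  proof (rule norm_suminf_le[OF _ sums_summable[OF b1]])
   fix k show "norm (c k * t ^ k) \<le> C * (pochhammer \<nu> k / fact k * t ^ k)"
    using mult_right_mono[OF C[of k], of "t ^ k"] t by (simp add: abs_mult mult.assoc)
  qed
  thus "\<bar>sser n \<nu> L t\<bar> \<le> C * (1 - t) powr (- \<nu>)" using b1 by (simp add: sser_def sums_iff)
  have b2: "(\<lambda>k. C * \<nu> * (pochhammer (\<nu> + 1) k / fact k * t ^ k)) sums (C * \<nu> * (1 - t) powr (- (\<nu> + 1)))"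
   by (intro sums_mult pochhammer_binomial_sums ta)
  have "norm (\<Sum>k. diffs c k * t ^ k) \<le> (\<Sum>k. C * \<nu> * (pochhammer (\<nu> + 1) k / fact k * t ^ k))"
  proof (rule norm_suminf_le[OF _ sums_summable[OF b2]])
   fix k
   have "\<bar>diffs c k\<bar> = real (Suc k) * \<bar>c (Suc k)\<bar>" by (simp add: diffs_def abs_mult)
   also have "\<dots> \<le> real (Suc k) * (C * (pochhammer \<nu> (Suc k) / fact (Suc k)))" by (intro mult_left_mono C) auto
   also have "\<dots> = C * \<nu> * (pochhammer (\<nu> + 1) k / fact k)"
    by (simp add: pochhammer_rec divide_simps add.commute)
   finally have "\<bar>diffs c k\<bar> * t ^ k \<le> C * \<nu> * (pochhammer (\<nu> + 1) k / fact k) * t ^ k"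
    using t by (intro mult_right_mono) auto
   thus "norm (diffs c k * t ^ k) \<le> C * \<nu> * (pochhammer (\<nu> + 1) k / fact k * t ^ k)"
    using t by (simp add: abs_mult mult.assoc)
  qed
  moreover have "- (\<nu> + 1) = - \<nu> - 1" by simp
  ultimately show "\<bar>sser1 n \<nu> L t\<bar> \<le> C * \<nu> * (1 - t) powr (- \<nu> - 1)" using b2 by (simp add: sser1_def sums_iff)
  have p0: "(\<lambda>k. pochhammer \<nu> k / fact k * t ^ k) sums ((1 - t) powr (- \<nu>))" by (intro pochhammer_binomial_sums ta)
  have "(\<lambda>k. c (Suc k) * t ^ (Suc k) - pochhammer \<nu> (Suc k) / fact (Suc k) * t ^ (Suc k)) sums ((sser n \<nu> L t - 1) - ((1 - t) powr (- \<nu>) - 1))"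
   using sums0[OF ta] p0 by (intro sums_diff; subst sums_Suc_iff) (auto simp: scoeff_def)
  moreover have b3: "(\<lambda>k. (C + 1) * (pochhammer \<nu> (Suc k) / fact (Suc k) * t ^ (Suc k))) sums ((C + 1) * ((1 - t) powr (- \<nu>) - 1))"
   using p0 by (intro sums_mult; subst sums_Suc_iff) auto
  have "norm (\<Sum>k. c (Suc k) * t ^ (Suc k) - pochhammer \<nu> (Suc k) / fact (Suc k) * t ^ (Suc k)) \<le> (\<Sum>k. (C + 1) * (pochhammer \<nu> (Suc k) / fact (Suc k) * t ^ (Suc k)))"
  proof (rule norm_suminf_le[OF _ sums_summable[OF b3]])
   fix k
   let ?p = "pochhammer \<nu> (Suc k) / fact (Suc k)"
   have "?p > 0" using pochhammer_pos[OF nu0] by simp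
   hence "\<bar>c (Suc k) - ?p\<bar> \<le> (C + 1) * ?p" using C[of "Suc k"] by (simp only: distrib_right)
   hence "\<bar>c (Suc k) - ?p\<bar> * t ^ Suc k \<le> (C + 1) * ?p * t ^ Suc k" using t by (intro mult_right_mono) auto
   moreover have "norm (c (Suc k) * t ^ (Suc k) - ?p * t ^ (Suc k)) = \<bar>c (Suc k) - ?p\<bar> * t ^ Suc k"
    unfolding left_diff_distrib[symmetric] real_norm_def abs_mult using t by simp
   ultimately show "norm (c (Suc k) * t ^ (Suc k) - ?p * t ^ (Suc k)) \<le> (C + 1) * (?p * t ^ (Suc k))" by (simp only: mult.assoc)
  qed
  ultimately show "\<bar>sser n \<nu> L t - (1 - t) powr (- \<nu>)\<bar> \<le> (C + 1) * ((1 - t) powr (- \<nu>) - 1)"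
   using b3 by (simp add: sums_iff)
 qed
qed

text \<open>The last estimate controls how the spherical function approaches its value 1 at the
  center; it drives the limit of the normalized transforms in
  \<open>h_ratio_tendsto\<close>.\<close>

lemma phi_bounds:
 obtains C where "C \<ge> 0" "\<And>k. \<bar>sq n \<nu> L k\<bar> \<le> C"
  "\<And>t. 0 \<le> t \<Longrightarrow> t < 1 \<Longrightarrow> \<bar>phi n \<nu> L t\<bar> \<le> C"
  "\<And>t. 0 \<le> t \<Longrightarrow> t < 1 \<Longrightarrow> \<bar>phi n \<nu> L t - 1\<bar> \<le> (C + 1) * (1 - (1 - t) powr \<nu>)"
proof -
 obtain C where C: "C \<ge> 0" "\<And>k. \<bar>sq n \<nu> L k\<bar> \<le> C"
  and b0: "\<And>t. 0 \<le> t \<Longrightarrow> t < 1 \<Longrightarrow> \<bar>sser n \<nu> L t\<bar> \<le> C * (1 - t) powr (- \<nu>)"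
  and "\<And>t. 0 \<le> t \<Longrightarrow> t < 1 \<Longrightarrow> \<bar>sser1 n \<nu> L t\<bar> \<le> C * \<nu> * (1 - t) powr (- \<nu> - 1)"
  and b1: "\<And>t. 0 \<le> t \<Longrightarrow> t < 1 \<Longrightarrow> \<bar>sser n \<nu> L t - (1 - t) powr (- \<nu>)\<bar> \<le> (C + 1) * ((1 - t) powr (- \<nu>) - 1)"
  by (rule sser_bounds; rule that)
 show ?thesis
 proof (rule that[OF C])
  fix t :: real assume t: "0 \<le> t" "t < 1"
  have pp: "(1 - t) powr \<nu> * (1 - t) powr (- \<nu>) = 1" using t by (simp flip: powr_add)
  have "\<bar>phi n \<nu> L t\<bar> = (1 - t) powr \<nu> * \<bar>sser n \<nu> L t\<bar>" by (simp add: phi_def abs_mult)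
  also have "\<dots> \<le> (1 - t) powr \<nu> * (C * (1 - t) powr (- \<nu>))" by (intro mult_left_mono b0 t) auto
  also have "\<dots> = C" using pp by (simp add: mult.left_commute)
  finally show "\<bar>phi n \<nu> L t\<bar> \<le> C" .
  have "phi n \<nu> L t - 1 = (1 - t) powr \<nu> * (sser n \<nu> L t - (1 - t) powr (- \<nu>))" using pp by (simp add: phi_def algebra_simps)
  hence "\<bar>phi n \<nu> L t - 1\<bar> = (1 - t) powr \<nu> * \<bar>sser n \<nu> L t - (1 - t) powr (- \<nu>)\<bar>" by (simp add: abs_mult)
  also have "\<dots> \<le> (1 - t) powr \<nu> * ((C + 1) * ((1 - t) powr (- \<nu>) - 1))" by (intro mult_left_mono b1 t) auto
  also have "\<dots> = (C + 1) * (1 - (1 - t) powr \<nu>)" using pp by (simp add: algebra_simps)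
  finally show "\<bar>phi n \<nu> L t - 1\<bar> \<le> (C + 1) * (1 - (1 - t) powr \<nu>)" .
 qed
qed

end

lemma beta_integral:
 fixes s :: real
 assumes "s > -1"
 shows "set_integrable lborel {0<..<1} (\<lambda>t. t ^ j * (1 - t) powr s)"
  and "(LINT t:{0<..<1}|lborel. t ^ j * (1 - t) powr s) = Beta (real j + 1) (s + 1)"
proof -
 have eq: "t powr (real j + 1 - 1) * (1 - t) powr (s + 1 - 1) = t ^ j * (1 - t) powr s" if "t \<in> {0<..<1}" for t :: real
  using that by (simp add: powr_realpow)
 have "set_integrable lborel {0..1} (\<lambda>t. t powr (real j + 1 - 1) * (1 - t) powr (s + 1 - 1))"
  by (rule integrable_Beta) (use assms in auto)
 hence "set_integrable lborel {0<..<1} (\<lambda>t. t powr (real j + 1 - 1) * (1 - t) powr (s + 1 - 1))"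
  by (rule set_integrable_subset) auto
 thus I: "set_integrable lborel {0<..<1} (\<lambda>t. t ^ j * (1 - t) powr s)"
  by (rule set_integrable_cong[THEN iffD1, rotated 3]) (use eq in auto)
 have "((\<lambda>t. t powr (real j + 1 - 1) * (1 - t) powr (s + 1 - 1)) has_integral Beta (real j + 1) (s + 1)) {0<..<1}"
  using has_integral_Beta_real[of "real j + 1" "s + 1"] assms by (simp add: has_integral_Icc_iff_Ioo)
 hence "((\<lambda>t. t ^ j * (1 - t) powr s) has_integral Beta (real j + 1) (s + 1)) {0<..<1}"
  by (rule has_integral_eq[rotated]) (use eq in auto)
 thus "(LINT t:{0<..<1}|lborel. t ^ j * (1 - t) powr s) = Beta (real j + 1) (s + 1)"
  using set_borel_integral_eq_integral(2)[OF I] by (simp add: integral_unique)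
qed

section \<open>Spherical transforms of powers\<close>

locale spherical_moments =
 fixes N :: nat and \<nu> L :: real
 assumes N1: "N \<ge> 1" and nuN: "\<nu> > real N" and L_pos: "L > 0"

sublocale spherical_moments \<subseteq> spherical_series "real N" \<nu> L
 using N1 nuN L_pos by unfold_locales auto

context spherical_moments
begin

abbreviation "S \<equiv> sser (real N) \<nu> L"
abbreviation "S1 \<equiv> sser1 (real N) \<nu> L"
abbreviation "S2 \<equiv> sser2 (real N) \<nu> L"

text \<open>One factor (1 - t)^\<nu> belongs to the tested function, one to the spherical function
  (1 - t)^\<nu> S(t); what remains, t^(N-1) (1 - t)^(-N-1), is the radial density of
  \<open>iota\<close> without its constant N.\<close>

definition moment :: "nat \<Rightarrow> real" where
 "moment k = (LINT t:{0<..<1}|lborel. t ^ (N - 1 + k) * (1 - t) powr (2 * \<nu> - real N - 1) * S t)"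

lemma isCont_S: "\<bar>t\<bar> < 1 \<Longrightarrow> isCont S t" using sser_deriv by (rule DERIV_isCont)
lemma isCont_S1: "\<bar>t\<bar> < 1 \<Longrightarrow> isCont S1 t" using sser1_deriv by (rule DERIV_isCont)

lemma moment_integrable:
 "set_integrable lborel {0<..<1} (\<lambda>t. t ^ j * (1 - t) powr (2 * \<nu> - real N - 1) * S t)"
proof -
 obtain C where C: "C \<ge> 0" "\<And>k. \<bar>sq (real N) \<nu> L k\<bar> \<le> C"
  and b0: "\<And>t. 0 \<le> t \<Longrightarrow> t < 1 \<Longrightarrow> \<bar>S t\<bar> \<le> C * (1 - t) powr (- \<nu>)"
  and "\<And>t. 0 \<le> t \<Longrightarrow> t < 1 \<Longrightarrow> \<bar>S1 t\<bar> \<le> C * \<nu> * (1 - t) powr (- \<nu> - 1)"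
  and "\<And>t. 0 \<le> t \<Longrightarrow> t < 1 \<Longrightarrow> \<bar>S t - (1 - t) powr (- \<nu>)\<bar> \<le> (C + 1) * ((1 - t) powr (- \<nu>) - 1)"
  by (rule sser_bounds; rule that)
 have "set_integrable lborel {0<..<1} (\<lambda>t. C * (t ^ j * (1 - t) powr (\<nu> - real N - 1)))"
  by (intro set_integrable_mult_right beta_integral) (use nuN in auto)
 moreover have "set_borel_measurable lborel {0<..<1} (\<lambda>t. t ^ j * (1 - t) powr (2 * \<nu> - real N - 1) * S t)"
 proof -
  have "(\<lambda>t. indicator {0<..<1} t *\<^sub>R (t ^ j * (1 - t) powr (2 * \<nu> - real N - 1) * S t)) \<in> borel_measurable borel"
   by (rule borel_measurable_continuous_on_indicator) (auto intro!: continuous_intros continuous_at_imp_continuous_on isCont_S)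
  thus ?thesis by (simp add: set_borel_measurable_def)
 qed
 ultimately show ?thesis
 proof (rule set_integrable_bound)
  show "AE t in lborel. t \<in> {0<..<1} \<longrightarrow> norm (t ^ j * (1 - t) powr (2 * \<nu> - real N - 1) * S t) \<le> norm (C * (t ^ j * (1 - t) powr (\<nu> - real N - 1)))"
  proof (intro AE_I2 impI)
   fix t :: real assume t: "t \<in> {0<..<1}"
   have "norm (t ^ j * (1 - t) powr (2 * \<nu> - real N - 1) * S t) = t ^ j * (1 - t) powr (2 * \<nu> - real N - 1) * \<bar>S t\<bar>"
    using t by (simp add: abs_mult)
   also have "\<dots> \<le> t ^ j * (1 - t) powr (2 * \<nu> - real N - 1) * (C * (1 - t) powr (- \<nu>))"
    using t by (intro mult_left_mono b0) auto
   also have "\<dots> = C * (t ^ j * ((1 - t) powr (2 * \<nu> - real N - 1) * (1 - t) powr (- \<nu>)))" by simp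
   also have "(1 - t) powr (2 * \<nu> - real N - 1) * (1 - t) powr (- \<nu>) = (1 - t) powr (\<nu> - real N - 1)"
    unfolding powr_add[symmetric] by (rule arg_cong[where f = "(powr) (1 - t)"]) simp
   also have "C * (t ^ j * (1 - t) powr (\<nu> - real N - 1)) = norm (C * (t ^ j * (1 - t) powr (\<nu> - real N - 1)))"
    using t C by (simp add: abs_mult)
   finally show "norm (t ^ j * (1 - t) powr (2 * \<nu> - real N - 1) * S t) \<le> norm (C * (t ^ j * (1 - t) powr (\<nu> - real N - 1)))" .
  qed
 qed
qed

text \<open>Symmetry of the radial Laplacian: the integrand is the derivative of the Wronskian of
 \<open>(1 - t)\<^sup>\<nu> t\<^sup>k\<close> and the spherical function, weighted so that the boundary terms vanish.\<close>

lemma moment_rec: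
 "real k * (real k + real N - 1) * (if k = 0 then 0 else moment (k - 1))
  + (L - (2 * real k * (real k - 1) + 2 * real k * \<nu> + real N * (real k + \<nu>) + real k)) * moment k
  + (real k + \<nu>)^2 * moment (Suc k) = 0"
proof -
 define e where "e = 2 * \<nu> + 1 - real N"
 define m where "m = N - 1 + k"
 define al where "al = real k * (real k + real N - 1)"
 define be where "be = L - (2 * real k * (real k - 1) + 2 * real k * \<nu> + real N * (real k + \<nu>) + real k)"
 define ga where "ga = (real k + \<nu>)^2"
 \<comment> \<open>The Wronskian of (1 - t)^\<nu> t^k and (1 - t)^\<nu> S is (1 - t)^(2\<nu>) (t^k
   S' - k t^(k-1) S). \<open>W\<close> is this expression with opposite sign, times the weight t^N
   (1 - t)^(1-N) of the radial Laplacian.\<close>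
 define W where "W t = (1 - t) powr e * t ^ m * (real k * S t - t * S1 t)" for t
 define w where "w t = (1 - t) powr (2 * \<nu> - real N - 1)" for t
 define f where "f t = al * (t ^ (m - 1) * w t * S t) + be * (t ^ m * w t * S t) + ga * (t ^ Suc m * w t * S t)" for t
 have mN: "real m = real N - 1 + real k" using N1 by (simp add: m_def of_nat_diff)
 have deriv: "(W has_real_derivative f t) (at t)" if t: "0 < t" "t < 1" for t
 proof -
  have ta: "\<bar>t\<bar> < 1" using t by simp
  have pw: "((\<lambda>t. (1 - t) powr e) has_real_derivative - e * (1 - t) powr (e - 1)) (at t)"
   using t by (auto intro!: derivative_eq_intros)
  have "(W has_real_derivative
    ((- e * (1 - t) powr (e - 1)) * t ^ m + (real m * t ^ (m - 1)) * (1 - t) powr e) * (real k * S t - t * S1 t)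
    + (real k * S1 t - (S1 t + t * S2 t)) * ((1 - t) powr e * t ^ m)) (at t)"
   unfolding W_def[abs_def]
   using t by (auto intro!: derivative_eq_intros pw sser_deriv sser1_deriv ta simp: algebra_simps)
  moreover have "((- e * (1 - t) powr (e - 1)) * t ^ m + (real m * t ^ (m - 1)) * (1 - t) powr e) * (real k * S t - t * S1 t)
    + (real k * S1 t - (S1 t + t * S2 t)) * ((1 - t) powr e * t ^ m) = f t"
  proof -
   have w1: "(1 - t) powr (e - 1) = (1 - t) * w t" and w2: "(1 - t) powr e = (1 - t)^2 * w t"
   proof -
    have "(1 - t) powr (e - 1) = (1 - t) powr (1 + (2 * \<nu> - real N - 1))"
     by (rule arg_cong[where f = "(powr) (1 - t)"]) (simp add: e_def)
    thus "(1 - t) powr (e - 1) = (1 - t) * w t" using t by (simp only: powr_add) (simp add: w_def)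
    have "(1 - t) powr e = (1 - t) powr (2 + (2 * \<nu> - real N - 1))"
     by (rule arg_cong[where f = "(powr) (1 - t)"]) (simp add: e_def)
    thus "(1 - t) powr e = (1 - t)^2 * w t" using t by (simp only: powr_add) (simp add: w_def)
   qed
   have tm: "real m * t ^ (m - 1) = real m * t ^ m / t" using t by (cases m) auto
   \<comment> \<open>For k = 0 the exponent m - 1 may be truncated at 0, but then \<open>al\<close>
     is 0.\<close>
   have am: "al * t ^ (m - 1) = al * t ^ m / t"
   proof (cases "k = 0")
    case False
    hence "m = Suc (m - 1)" by (simp add: m_def)
    hence "t ^ m = t * t ^ (m - 1)" by (metis power_Suc)
    thus ?thesis using t by simp
   qed (simp add: al_def)
   have ode: "t * (1 - t)^2 * S2 t = - ((real N - (2 * \<nu> + 1) * t) * (1 - t) * S1 t) - (L - real N * \<nu> + \<nu>^2 * t) * S t"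
    using sser_ode[OF t] by linarith
   define p where "p = t ^ m * w t / t"
   have "((- e * (1 - t) powr (e - 1)) * t ^ m + (real m * t ^ (m - 1)) * (1 - t) powr e) * (real k * S t - t * S1 t)
    + (real k * S1 t - (S1 t + t * S2 t)) * ((1 - t) powr e * t ^ m)
    = p * ((- e * (1 - t) * t + real m * (1 - t)^2) * (real k * S t - t * S1 t) + (real k * S1 t - S1 t) * ((1 - t)^2 * t) - t * (t * (1 - t)^2 * S2 t))"
    unfolding tm w1 w2 p_def using t by (simp add: field_simps)
   also have "\<dots> = p * ((al + be * t + ga * t^2) * S t)"
    unfolding ode mN al_def be_def ga_def e_def by (simp add: power2_eq_square algebra_simps)
   also have "\<dots> = f t"
   proof -
    have "f t = (al * t ^ (m - 1)) * w t * S t + be * (t ^ m * w t * S t) + ga * (t ^ Suc m * w t * S t)"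
     by (simp add: f_def)
    thus ?thesis unfolding am p_def using t by (simp add: field_simps power2_eq_square)
   qed
   finally show ?thesis .
  qed
  ultimately show ?thesis by simp
 qed
 have contf: "isCont f t" if t: "0 < t" "t < 1" for t
  unfolding f_def w_def using t by (intro continuous_intros isCont_S) auto
 have ints: "set_integrable lborel {0<..<1} (\<lambda>t. t ^ j * w t * S t)" for j
  unfolding w_def by (rule moment_integrable)
 have intf: "set_integrable lborel {0<..<1} f"
  unfolding f_def by (intro set_integral_add set_integrable_mult_right ints)
 have lim0: "(W \<longlongrightarrow> 0) (at_right 0)"
 proof -
  have "isCont W 0" unfolding W_def by (intro continuous_intros isCont_S isCont_S1) auto
  hence "(W \<longlongrightarrow> W 0) (at_right 0)" by (auto simp: isCont_def intro: tendsto_mono[OF at_le])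
  moreover have "W 0 = 0" unfolding W_def m_def by (cases "N - 1 + k = 0") auto
  ultimately show ?thesis by simp
 qed
 obtain C where C: "C \<ge> 0" "\<And>k. \<bar>sq (real N) \<nu> L k\<bar> \<le> C"
  and b0: "\<And>t. 0 \<le> t \<Longrightarrow> t < 1 \<Longrightarrow> \<bar>S t\<bar> \<le> C * (1 - t) powr (- \<nu>)"
  and b1: "\<And>t. 0 \<le> t \<Longrightarrow> t < 1 \<Longrightarrow> \<bar>S1 t\<bar> \<le> C * \<nu> * (1 - t) powr (- \<nu> - 1)"
  and "\<And>t. 0 \<le> t \<Longrightarrow> t < 1 \<Longrightarrow> \<bar>S t - (1 - t) powr (- \<nu>)\<bar> \<le> (C + 1) * ((1 - t) powr (- \<nu>) - 1)"
  by (rule sser_bounds; rule that)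
 \<comment> \<open>By the growth bounds |W| is at most a constant times (1 - t)^(\<nu> - N) near 1,
   so the boundary term vanishes because \<nu> > N.\<close>
 have lim1: "(W \<longlongrightarrow> 0) (at_left 1)"
 proof (rule Lim_null_comparison)
  define g where "g t = real k * C * (1 - t) powr (\<nu> + 1 - real N) + C * \<nu> * (1 - t) powr (\<nu> - real N)" for t
  show "(g \<longlongrightarrow> 0) (at_left 1)"
  proof -
   have "((\<lambda>t::real. (1 - t) powr a) \<longlongrightarrow> 0) (at_left 1)" if "a > 0" for a :: real
   proof -
    have "((\<lambda>t::real. (1 - t) powr a) \<longlongrightarrow> (1 - 1) powr a) (at_left 1)"
     using that by (intro tendsto_powr' tendsto_intros) (auto simp: eventually_at_filter)
    thus ?thesis using that by simp
   qed
   hence "(g \<longlongrightarrow> real k * C * 0 + C * \<nu> * 0) (at_left 1)"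
    unfolding g_def using nuN by (intro tendsto_intros) auto
   thus ?thesis by simp
  qed
  have "norm (W t) \<le> g t" if t: "0 < t" "t < 1" for t
  proof -
   have "norm (W t) = (1 - t) powr e * t ^ m * \<bar>real k * S t - t * S1 t\<bar>" unfolding W_def using t by (simp add: abs_mult)
   also have "\<dots> \<le> (1 - t) powr e * 1 * \<bar>real k * S t - t * S1 t\<bar>"
    using t by (intro mult_right_mono mult_left_mono power_le_one) auto
   also have "\<bar>real k * S t - t * S1 t\<bar> \<le> real k * \<bar>S t\<bar> + t * \<bar>S1 t\<bar>"
    using t abs_triangle_ineq4[of "real k * S t" "t * S1 t"] by (simp add: abs_mult)
   also have "\<dots> \<le> real k * (C * (1 - t) powr (- \<nu>)) + 1 * (C * \<nu> * (1 - t) powr (- \<nu> - 1))"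
    using t nu0 C by (intro add_mono mult_mono b0 b1) auto
   finally have "norm (W t) \<le> (1 - t) powr e * 1 * (real k * (C * (1 - t) powr (- \<nu>)) + 1 * (C * \<nu> * (1 - t) powr (- \<nu> - 1)))"
    using t by (simp add: mult_left_mono)
   also have "\<dots> = real k * C * ((1 - t) powr e * (1 - t) powr (- \<nu>)) + C * \<nu> * ((1 - t) powr e * (1 - t) powr (- \<nu> - 1))"
    by (simp add: algebra_simps)
   also have "(1 - t) powr e * (1 - t) powr (- \<nu>) = (1 - t) powr (\<nu> + 1 - real N)"
    unfolding powr_add[symmetric] e_def by (rule arg_cong[where f = "(powr) (1 - t)"]) simp
   also have "(1 - t) powr e * (1 - t) powr (- \<nu> - 1) = (1 - t) powr (\<nu> - real N)"
    unfolding powr_add[symmetric] e_def by (rule arg_cong[where f = "(powr) (1 - t)"]) simp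
   finally show ?thesis by (simp add: g_def)
  qed
  thus "eventually (\<lambda>t. norm (W t) \<le> g t) (at_left 1)"
   unfolding eventually_at_left_field by (intro exI[of _ 0]) auto
 qed
 have "(LBINT t=ereal 0..ereal 1. f t) = 0 - 0"
 proof (rule interval_integral_FTC_integrable)
  show "(W has_vector_derivative f t) (at t)" if "ereal 0 < ereal t" "ereal t < ereal 1" for t
   using deriv[of t] that by (simp add: has_real_derivative_iff_has_vector_derivative)
  show "((W \<circ> real_of_ereal) \<longlongrightarrow> 0) (at_right (ereal 0))" using lim0 by (simp only: ereal_tendsto_simps)
  show "((W \<circ> real_of_ereal) \<longlongrightarrow> 0) (at_left (ereal 1))" using lim1 by (simp only: ereal_tendsto_simps)
  show "set_integrable lborel (einterval (ereal 0) (ereal 1)) f" using intf by simp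
 qed (use contf in auto)
 hence "(LINT t:{0<..<1}|lborel. f t) = 0" by (simp add: interval_lebesgue_integral_def)
 hence h0: "al * (LINT t:{0<..<1}|lborel. t ^ (m - 1) * w t * S t) + be * (LINT t:{0<..<1}|lborel. t ^ m * w t * S t) + ga * (LINT t:{0<..<1}|lborel. t ^ Suc m * w t * S t) = 0"
  unfolding f_def by (subst (asm) set_integral_add, (intro set_integral_add set_integrable_mult_right ints)+, subst (asm) set_integral_add, (intro set_integrable_mult_right ints)+) simp
 have e1: "(LINT t:{0<..<1}|lborel. t ^ m * w t * S t) = moment k" unfolding moment_def m_def w_def by simp
 have e2: "(LINT t:{0<..<1}|lborel. t ^ Suc m * w t * S t) = moment (Suc k)" unfolding moment_def m_def w_def by simp
 have e3: "al * (LINT t:{0<..<1}|lborel. t ^ (m - 1) * w t * S t) = al * (if k = 0 then 0 else moment (k - 1))"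
  unfolding moment_def m_def w_def al_def by (cases k) auto
 show ?thesis using h0 unfolding e1 e2 e3 unfolding al_def be_def ga_def .
qed

text \<open>Scaled by (\<nu>)_k / (N)_k, the moments obey the recurrence of \<open>sq\<close>, and
  since \<open>sq\<close> starts with 1 only the factor \<open>moment 0\<close> stays free. Thus the
  polynomials that give the power series coefficients of the spherical function also give its
  moments.\<close>

lemma moment_eq:
 "pochhammer \<nu> k / pochhammer (real N) k * moment k = sq (real N) \<nu> L k * moment 0"
proof (induction k rule: less_induct)
 case (less k)
 show ?case
 proof (cases k)
  case (Suc j)
  define u where "u i = pochhammer \<nu> i / pochhammer (real N) i * moment i" for i
  have pos: "pochhammer \<nu> i > 0" "pochhammer (real N) i > 0" for i
   using nu0 N1 by (auto intro!: pochhammer_pos)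
  have mu: "moment i = pochhammer (real N) i / pochhammer \<nu> i * u i" for i
   using pos(1)[of i] pos(2)[of i] by (simp add: u_def)
  define q where "q = pochhammer (real N) j / pochhammer \<nu> j"
  have q0: "q > 0" unfolding q_def using pos by simp
  have nz: "real N + real j > 0" "\<nu> + real j > 0" using N1 nu0 by auto
  have m1: "(real j + \<nu>)^2 * moment (Suc j) = q * (real j + \<nu>) * (real j + real N) * u (Suc j)"
  proof -
   have "x^2 * (b * y / (a * x) * v) = b / a * x * y * v" if "x > 0" "a > 0" for x y a b v :: real
    using that by (simp add: power2_eq_square)
   from this[of "\<nu> + real j" "pochhammer \<nu> j" "pochhammer (real N) j" "real N + real j" "u (Suc j)"] nz pos(1)[of j]
   show ?thesis unfolding mu[of "Suc j"] q_def pochhammer_Suc by (simp only: add.commute)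
  qed
  have m0: "moment j = q * u j" unfolding mu[of j] q_def ..
  have mm: "real j * (real j + real N - 1) * (if j = 0 then 0 else moment (j - 1)) = q * (real j * (real j + \<nu> - 1)) * u (j - 1)"
  proof (cases j)
   case (Suc i)
   have nz: "real N + real i > 0" "\<nu> + real i > 0" using N1 nu0 by auto
   have gen: "r * y * (b / a * v) = b * y / (a * x) * (r * x) * v" if "x > 0" "a > 0" for r x y a b v :: real
    using that by simp
   have "real j + real N - 1 = real N + real i" "real j + \<nu> - 1 = \<nu> + real i" by (simp_all add: Suc)
   thus ?thesis unfolding q_def using gen[OF nz(2) pos(1)[of i], of "real j" "real N + real i" "pochhammer (real N) i" "u i"]
    unfolding \<open>real j + real N - 1 = _\<close> \<open>real j + \<nu> - 1 = _\<close>
    by (simp only: Suc pochhammer_Suc mu[of i] nat.distinct if_False diff_Suc_1)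
  qed simp
  have "q * ((real j * (real j + \<nu> - 1)) * u (j - 1)
   + (L - (2 * real j * (real j - 1) + 2 * real j * \<nu> + real N * (real j + \<nu>) + real j)) * u j
   + (real j + \<nu>) * (real j + real N) * u (Suc j)) = 0"
   using moment_rec[of j] unfolding mm m0 m1 by (simp add: algebra_simps)
  hence "(real j * (real j + \<nu> - 1)) * u (j - 1)
   + (L - (2 * real j * (real j - 1) + 2 * real j * \<nu> + real N * (real j + \<nu>) + real j)) * u j
   + (real j + \<nu>) * (real j + real N) * u (Suc j) = 0"
   using q0 by (metis mult_eq_0_iff less_irrefl)
  hence "(real j + \<nu>) * (real j + real N) * u (Suc j) =
    (2 * real j * (real j - 1) + 2 * real j * \<nu> + real N * (real j + \<nu>) + real j - L) * u j - (real j * (real j + \<nu> - 1)) * u (j - 1)"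
   by (simp add: algebra_simps)
  also have "u j = sq (real N) \<nu> L j * moment 0" using less.IH[of j] Suc by (simp add: u_def)
  also have "u (j - 1) = sq (real N) \<nu> L (j - 1) * moment 0" using less.IH[of "j - 1"] Suc by (simp add: u_def)
  finally have "(real j + \<nu>) * (real j + real N) * u (Suc j) = ((real j + real N) * (real j + \<nu>) * (sq (real N) \<nu> L j)
    + (real j * (real j + \<nu> - 1) * (sq (real N) \<nu> L j - sq (real N) \<nu> L (j - 1)) - L * sq (real N) \<nu> L j)) * moment 0"
   by (simp add: algebra_simps)
  also have "\<dots> = (real j + \<nu>) * (real j + real N) * (sq (real N) \<nu> L (Suc j) * moment 0)"
  proof -
   have "0 < real N" using N1 by simp
   show ?thesis unfolding sq_rec[OF \<open>0 < real N\<close> nu0, of j L, symmetric] by (simp add: algebra_simps)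
  qed
  finally have "u (Suc j) = sq (real N) \<nu> L (Suc j) * moment 0"
   using nz by (simp add: add.commute)
  thus ?thesis by (simp add: u_def Suc)
 qed simp
qed

end

section \<open>Integration of radial functions over the ball\<close>

definition radial_density :: "nat \<Rightarrow> real \<Rightarrow> real" where
 "radial_density N t = indicator {0<..<1} t * (real N * t ^ (N - 1))"

lemma nn_integral_radial_density:
 assumes x: "0 \<le> x" "x < 1" and N: "N \<ge> 1"
 shows "(\<integral>\<^sup>+t. ennreal (radial_density N t) * indicator {x<..} t \<partial>lborel) = ennreal (1 - x ^ N)"
proof -
 have "(\<integral>\<^sup>+t. ennreal (radial_density N t) * indicator {x<..} t \<partial>lborel)
   = (\<integral>\<^sup>+t. ennreal (real N * t ^ (N - 1)) * indicator {x..1} t \<partial>lborel)"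
 proof (rule nn_integral_cong_AE)
  have "AE t in lborel. t \<noteq> x" "AE t in lborel. t \<noteq> (1::real)" by (rule AE_lborel_singleton)+
  thus "AE t in lborel. ennreal (radial_density N t) * indicator {x<..} t = ennreal (real N * t ^ (N - 1)) * indicator {x..1} t"
   by eventually_elim (use x in \<open>auto simp: radial_density_def indicator_def\<close>)
 qed
 also have "\<dots> = ennreal (1 ^ N - x ^ N)"
  by (rule nn_integral_FTC_Icc) (use x in \<open>auto intro!: derivative_eq_intros\<close>)
 finally show ?thesis by simp
qed

lemma sets_ball_measure [simp, measurable_cong]: "sets (ball_measure :: (complex^'n) measure) = sets borel"
 by (simp add: ball_measure_def uniform_measure_def)

lemma space_ball_measure [simp]: "space (ball_measure :: (complex^'n) measure) = UNIV"
 by (simp add: ball_measure_def uniform_measure_def)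

lemma sets_iota [simp, measurable_cong]: "sets (iota :: (complex^'n) measure) = sets borel"
 by (simp add: iota_def)

lemma space_iota [simp]: "space (iota :: (complex^'n) measure) = UNIV"
 by (simp add: iota_def)

text \<open>In real dimension 2N the part of the ball with |z|^2 \<le> x has normalized volume x^N.
  So both sides give the half line {x<..} the mass 1 - x^N for 0 \<le> x < 1, and these tails
  determine the measure.\<close>

lemma ball_measure_pushforward:
 "distr (ball_measure :: (complex^'n::finite) measure) borel (\<lambda>z. (norm z)^2)
  = density lborel (\<lambda>t. ennreal (radial_density CARD('n) t))"
proof (rule measure_eqI_lessThan)
 let ?M = "distr (ball_measure :: (complex^'n) measure) borel (\<lambda>z. (norm z)^2)"
 let ?N = "density lborel (\<lambda>t. ennreal (radial_density CARD('n) t))"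
 let ?B = "ball (0::complex^'n) 1"
 define v where "v = unit_ball_vol (real DIM(complex^'n))"
 have v0: "v > 0" unfolding v_def by simp
 have N1: "CARD('n) \<ge> 1" by (simp add: Suc_leI)
 have m: "(\<lambda>z::complex^'n. (norm z)^2) \<in> borel_measurable borel" by measurable
 have ub: "emeasure lborel ?B = ennreal v" by (simp add: emeasure_ball v_def)
 have eM: "emeasure ?M {x<..} = emeasure lborel (?B \<inter> {z. x < (norm z)^2}) / ennreal v" for x
 proof -
  have "emeasure ?M {x<..} = emeasure (ball_measure :: (complex^'n) measure) ((\<lambda>z. (norm z)^2) -` {x<..})"
  proof (subst emeasure_distr)
   show "(\<lambda>z::complex^'n. (norm z)^2) \<in> ball_measure \<rightarrow>\<^sub>M borel" by measurable
  qed auto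
  also have "(\<lambda>z::complex^'n. (norm z)^2) -` {x<..} = {z. x < (norm z)^2}" by auto
  also have "emeasure ball_measure {z::complex^'n. x < (norm z)^2} = emeasure lborel (?B \<inter> {z. x < (norm z)^2}) / emeasure lborel ?B"
   unfolding ball_measure_def by (rule emeasure_uniform_measure) (auto intro!: borel_open open_Collect_less continuous_intros)
  finally show ?thesis by (simp only: ub)
 qed
 have eN: "emeasure ?N {x<..} = (\<integral>\<^sup>+t. ennreal (radial_density CARD('n) t) * indicator {x<..} t \<partial>lborel)" for x
  by (rule emeasure_density) (auto simp: radial_density_def)
 have key: "emeasure ?M {x<..} = (if x < 0 then 1 else if x < 1 then ennreal (1 - x ^ CARD('n)) else 0)" for x
 proof -
  consider "x < 0" | "0 \<le> x" "x < 1" | "x \<ge> 1" by linarith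
  thus ?thesis
  proof cases
   case 1
   hence "?B \<inter> {z. x < (norm z)^2} = ?B" by (auto intro: less_le_trans)
   thus ?thesis unfolding eM using 1 ub v0 by (simp add: ennreal_divide_self)
  next
   case 2
   have "?B \<inter> {z. x < (norm z)^2} = ?B - cball 0 (sqrt x)"
   proof -
    have "norm z \<le> sqrt x \<longleftrightarrow> (norm z)^2 \<le> x" for z :: "complex^'n"
     by (metis abs_norm_cancel real_sqrt_abs real_sqrt_le_iff)
    thus ?thesis by (auto simp: not_le)
   qed
   moreover have sx: "sqrt x < 1" using 2 by simp
   moreover have "emeasure lborel (?B - cball 0 (sqrt x)) = emeasure lborel ?B - emeasure lborel (cball (0::complex^'n) (sqrt x))"
    by (rule emeasure_Diff) (use 2 in \<open>auto simp: emeasure_cball intro: le_less_trans[OF _ sx]\<close>)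
   moreover have "emeasure lborel (cball (0::complex^'n) (sqrt x)) = ennreal (v * x ^ CARD('n))"
   proof -
    have "(sqrt x) ^ DIM(complex^'n) = x ^ CARD('n)" using 2 by (simp add: power_mult mult.commute[of _ 2])
    thus ?thesis using 2 by (simp add: emeasure_cball v_def)
   qed
   ultimately have "emeasure lborel (?B \<inter> {z. x < (norm z)^2}) = ennreal (v - v * x ^ CARD('n))"
    using ub v0 2 by (simp add: ennreal_minus)
   thus ?thesis unfolding eM using 2 v0
    by (simp add: divide_ennreal mult_left_le power_le_one diff_divide_distrib)
  next
   case 3
   hence "?B \<inter> {z. x < (norm z)^2} = {}"
   proof -
    have "(norm z)^2 \<le> 1" if "norm z < 1" for z :: "complex^'n" using that by (simp add: power_le_one)
    thus ?thesis using 3 by fastforce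
   qed
   thus ?thesis unfolding eM using 3 by simp
  qed
 qed
 show "emeasure ?M {x<..} < \<infinity>" for x unfolding key by auto
 have one: "(\<integral>\<^sup>+t. ennreal (radial_density CARD('n) t) * indicator {x<..} t \<partial>lborel) = 1" if "x < 0" for x
 proof -
  have "(\<integral>\<^sup>+t. ennreal (radial_density CARD('n) t) * indicator {x<..} t \<partial>lborel)
    = (\<integral>\<^sup>+t. ennreal (radial_density CARD('n) t) * indicator {0<..} t \<partial>lborel)"
   by (rule nn_integral_cong) (use that in \<open>auto simp: radial_density_def indicator_def\<close>)
  thus ?thesis using nn_integral_radial_density[of 0 "CARD('n)"] N1 by simp
 qed
 have zero: "(\<integral>\<^sup>+t. ennreal (radial_density CARD('n) t) * indicator {x<..} t \<partial>lborel) = 0" if "x \<ge> 1" for x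
 proof -
  have "(\<integral>\<^sup>+t. ennreal (radial_density CARD('n) t) * indicator {x<..} t \<partial>lborel) = (\<integral>\<^sup>+(t::real). 0 \<partial>lborel)"
   by (rule nn_integral_cong) (use that in \<open>auto simp: radial_density_def indicator_def\<close>)
  thus ?thesis by simp
 qed
 show "emeasure ?M {x<..} = emeasure ?N {x<..}" for x
  unfolding key eN using one[of x] zero[of x] nn_integral_radial_density[of x "CARD('n)"] N1 by auto
qed (auto simp: radial_density_def)

definition iota_density :: "nat \<Rightarrow> real \<Rightarrow> real" where
 "iota_density N t = real N * t ^ (N - 1) * (1 - t) powr (- (real N + 1))"

lemma iota_pushforward:
 "distr (iota :: (complex^'n::finite) measure) borel (\<lambda>z. (norm z)^2)
  = density lborel (\<lambda>t. ennreal (indicator {0<..<1} t * iota_density CARD('n) t))"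
proof -
 let ?g = "\<lambda>t::real. ennreal ((1 - t) powr (- (real CARD('n) + 1)))"
 have "distr (iota :: (complex^'n::finite) measure) borel (\<lambda>z. (norm z)^2) = density (distr (ball_measure :: (complex^'n) measure) borel (\<lambda>z. (norm z)^2)) ?g"
  unfolding iota_def by (rule density_distr[symmetric]) measurable
 also have "\<dots> = density lborel (\<lambda>t. ennreal (radial_density CARD('n) t) * ?g t)"
  unfolding ball_measure_pushforward by (rule density_density_eq) (auto simp: radial_density_def)
 also have "(\<lambda>t. ennreal (radial_density CARD('n) t) * ?g t) = (\<lambda>t. ennreal (indicator {0<..<1} t * iota_density CARD('n) t))"
  by (auto simp: radial_density_def iota_density_def fun_eq_iff indicator_def simp flip: ennreal_mult)
 finally show ?thesis .
qed

lemma
 fixes g :: "real \<Rightarrow> 'b::{banach, second_countable_topology}"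
 assumes [measurable]: "g \<in> borel_measurable borel"
 shows integrable_iota_radial: "integrable (iota :: (complex^'n::finite) measure) (\<lambda>z. g ((norm z)^2)) \<longleftrightarrow>
   set_integrable lborel {0<..<1} (\<lambda>t. iota_density CARD('n) t *\<^sub>R g t)" (is ?A)
  and integral_iota_radial: "(LINT z|(iota :: (complex^'n) measure). g ((norm z)^2)) =
   (LINT t:{0<..<1}|lborel. iota_density CARD('n) t *\<^sub>R g t)" (is ?B)
proof -
 have m: "(\<lambda>z::complex^'n. (norm z)^2) \<in> iota \<rightarrow>\<^sub>M borel" by measurable
 have m2: "(\<lambda>t. indicator {0<..<1} t * iota_density CARD('n) t) \<in> borel_measurable lborel"
  unfolding iota_density_def by measurable
 have nn: "0 \<le> indicator {0<..<1} t * iota_density CARD('n) t" for t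
  by (simp add: iota_density_def indicator_def)
 have e: "indicator {0<..<1} t *\<^sub>R (iota_density CARD('n) t *\<^sub>R g t) = (indicator {0<..<1} t * iota_density CARD('n) t) *\<^sub>R g t" for t by simp
 have "integrable (iota :: (complex^'n::finite) measure) (\<lambda>z. g ((norm z)^2)) \<longleftrightarrow> integrable (distr (iota :: (complex^'n::finite) measure) borel (\<lambda>z. (norm z)^2)) g"
  by (rule integrable_distr_eq[symmetric, OF m]) simp
 also have "\<dots> \<longleftrightarrow> set_integrable lborel {0<..<1} (\<lambda>t. iota_density CARD('n) t *\<^sub>R g t)"
  unfolding iota_pushforward set_integrable_def e by (rule integrable_density) (use m2 nn in auto)
 finally show ?A .
 have "(LINT z|(iota :: (complex^'n) measure). g ((norm z)^2)) = (LINT t|distr (iota :: (complex^'n::finite) measure) borel (\<lambda>z. (norm z)^2). g t)"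
  by (rule integral_distr[symmetric, OF m]) simp
 also have "\<dots> = (LINT t:{0<..<1}|lborel. iota_density CARD('n) t *\<^sub>R g t)"
  unfolding iota_pushforward set_lebesgue_integral_def e by (rule integral_density) (use m2 nn in auto)
 finally show ?B .
qed

lemma AE_iota_ball: "AE z in (iota :: (complex^'n::finite) measure). norm z < 1"
proof -
 have "AE z in (ball_measure :: (complex^'n) measure). z \<in> ball 0 1"
  unfolding ball_measure_def by (rule AE_uniform_measureI) auto
 hence "AE z in (ball_measure :: (complex^'n) measure). norm z < 1" by simp
 moreover have "(\<lambda>z::complex^'n. ennreal ((1 - (norm z)^2) powr (- (real CARD('n) + 1)))) \<in> borel_measurable ball_measure"
  by measurable
 ultimately show ?thesis unfolding iota_def by (subst AE_density) auto
qed

text \<open>For \<alpha> > N this is the integral of (1 - |z|^2)^\<alpha> against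
  \<open>iota\<close>, and hence the reciprocal of the normalizing constant of the Bergman measure
  with parameter \<alpha>.\<close>

definition weight_integral :: "nat \<Rightarrow> real \<Rightarrow> real" where
 "weight_integral N \<alpha> = real N * Beta (real N) (\<alpha> - real N)"

lemma
 assumes s: "s > real CARD('n)"
 shows integrable_iota_weight: "integrable (iota :: (complex^'n::finite) measure) (\<lambda>z. ((norm z)^2) ^ k * (1 - (norm z)^2) powr s)" (is ?A)
  and integral_iota_weight: "(LINT z|(iota :: (complex^'n) measure). ((norm z)^2) ^ k * (1 - (norm z)^2) powr s)
    = real CARD('n) * Beta (real CARD('n) + real k) (s - real CARD('n))" (is ?B)
proof -
 let ?N = "CARD('n)"
 have N1: "?N \<ge> 1" by (simp add: Suc_leI)
 have eq: "iota_density ?N t *\<^sub>R (t ^ k * (1 - t) powr s) = real ?N * (t ^ (?N - 1 + k) * (1 - t) powr (s - real ?N - 1))" if "t \<in> {0<..<1}" for t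
 proof -
  have "(1 - t) powr (s - real ?N - 1) = (1 - t) powr (- (real ?N + 1)) * (1 - t) powr s"
   unfolding powr_add[symmetric] by (rule arg_cong[where f = "(powr) (1 - t)"]) simp
  thus ?thesis unfolding iota_density_def power_add by simp
 qed
 have I: "set_integrable lborel {0<..<1} (\<lambda>t. real ?N * (t ^ (?N - 1 + k) * (1 - t) powr (s - real ?N - 1)))"
  by (intro set_integrable_mult_right beta_integral) (use s in auto)
 have m: "(\<lambda>t::real. t ^ k * (1 - t) powr s) \<in> borel_measurable borel" by measurable
 show ?A unfolding integrable_iota_radial[OF m]
  using I by (rule set_integrable_cong[THEN iffD1, rotated 3]) (use eq in auto)
 have "(LINT z|(iota :: (complex^'n) measure). ((norm z)^2) ^ k * (1 - (norm z)^2) powr s) = (LINT t:{0<..<1}|lborel. real ?N * (t ^ (?N - 1 + k) * (1 - t) powr (s - real ?N - 1)))"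
  unfolding integral_iota_radial[OF m] by (rule set_lebesgue_integral_cong) (use eq in auto)
 also have "\<dots> = real ?N * Beta (real (?N - 1 + k) + 1) (s - real ?N - 1 + 1)"
  unfolding set_integral_mult_right by (subst beta_integral(2)) (use s in auto)
 finally show ?B using N1 by (simp add: of_nat_diff)
qed

section \<open>Spherical transforms of the functions |z|^(2k) (1 - |z|^2)^\<nu>\<close>

definition lap :: "nat \<Rightarrow> real \<Rightarrow> real" where
 "lap N l = ((real N)^2 + l^2) / 4"

lemma lap_pos: "N \<ge> 1 \<Longrightarrow> lap N l > 0"
 unfolding lap_def by (simp add: add_pos_nonneg)

abbreviation sqc :: "nat \<Rightarrow> real \<Rightarrow> real \<Rightarrow> nat \<Rightarrow> real" where
 "sqc N \<nu> l k \<equiv> sq (real N) \<nu> (lap N l) k"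

text \<open>For \<nu> > N this real number is the spherical transform of \<open>h_fun \<nu>\<close>
  at a real parameter l. The factor N is the constant of the radial density that
  \<open>moment\<close> leaves out.\<close>

definition h_hat :: "nat \<Rightarrow> real \<Rightarrow> real \<Rightarrow> real" where
 "h_hat N \<nu> l = real N * spherical_moments.moment N \<nu> (lap N l) 0"

definition wfun :: "real \<Rightarrow> nat \<Rightarrow> complex^'n::finite \<Rightarrow> complex" where
 "wfun \<nu> k z = of_real (((norm z)^2) ^ k * (1 - (norm z)^2) powr \<nu>)"

lemma measurable_wfun [measurable]: "wfun \<nu> k \<in> borel_measurable borel"
 unfolding wfun_def by measurable

lemma h_fun_eq_wfun: "h_fun \<nu> = wfun \<nu> 0"
 by (simp add: h_fun_def wfun_def fun_eq_iff)

lemma integrable_wfun: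
 "\<nu> > real CARD('n) \<Longrightarrow> integrable (iota :: (complex^'n::finite) measure) (wfun \<nu> k)"
 unfolding wfun_def by (intro integrable_of_real integrable_iota_weight)

lemma sms: "N \<ge> 1 \<Longrightarrow> \<nu> > real N \<Longrightarrow> spherical_moments N \<nu> (lap N l)"
 by unfold_locales (auto simp: lap_pos)

lemma spherical_transform_wfun:
 assumes nu: "\<nu> > real CARD('n)"
 shows "spherical_transform (wfun \<nu> k :: complex^'n::finite \<Rightarrow> complex) (of_real l)
  = of_real (real CARD('n) * spherical_moments.moment CARD('n) \<nu> (lap CARD('n) l) k)"
proof -
 let ?N = "CARD('n)" and ?L = "lap CARD('n) l"
 have N1: "?N \<ge> 1" by (simp add: Suc_leI)
 interpret spherical_moments ?N \<nu> ?L using sms[OF N1 nu] .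
 \<comment> \<open>The series is controlled only on the open interval, so the radial profile is cut
   off there to be Borel on the whole line. The center and the complement of the ball are null
   sets.\<close>
 define g where "g t = indicator {0<..<1} t * (t ^ k * (1 - t) powr \<nu> * phi (real ?N) \<nu> ?L t)" for t
 have "(\<lambda>t. indicator {0<..<1} t *\<^sub>R (t ^ k * (1 - t) powr \<nu> * ((1 - t) powr \<nu> * S t))) \<in> borel_measurable borel"
  by (rule borel_measurable_continuous_on_indicator) (auto intro!: continuous_intros continuous_at_imp_continuous_on isCont_S)
 hence mg: "g \<in> borel_measurable borel" by (simp add: g_def[abs_def] phi_def)
 have "AE z in (iota :: (complex^'n) measure). norm z < 1 \<and> z \<noteq> 0"
 proof -
  have "AE z in (iota :: (complex^'n) measure). z \<noteq> 0"
  proof -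
   have "emeasure (ball_measure :: (complex^'n) measure) {0} = 0"
    unfolding ball_measure_def by (subst emeasure_uniform_measure) auto
   hence "AE z in (ball_measure :: (complex^'n) measure). z \<noteq> 0" by (intro AE_I[of _ _ "{0}"]) auto
   thus ?thesis unfolding iota_def by (subst AE_density) auto
  qed
  thus ?thesis using AE_iota_ball by eventually_elim auto
 qed
 hence "spherical_transform (wfun \<nu> k :: complex^'n \<Rightarrow> complex) (of_real l) = (LINT z|(iota :: (complex^'n) measure). complex_of_real (g ((norm z)^2)))"
  unfolding spherical_transform_def
 proof (intro integral_cong_AE)
  have "AE z in (iota :: (complex^'n) measure). wfun \<nu> k z * spherical_fun (of_real l) z = complex_of_real (g ((norm z)^2))"
   using \<open>AE z in iota. norm z < 1 \<and> z \<noteq> 0\<close>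
  proof eventually_elim
   case (elim z)
   hence "(norm z)^2 \<in> {0<..<1}" by (auto simp: abs_square_less_1)
   thus ?case using elim spherical_fun_eq_phi[of z \<nu> l] nu0 by (simp add: g_def wfun_def lap_def)
  qed
  thus *: "AE z in (iota :: (complex^'n) measure). wfun \<nu> k z * spherical_fun (of_real l) z = complex_of_real (g ((norm z)^2))" .
  show mg': "(\<lambda>z::complex^'n. complex_of_real (g ((norm z)^2))) \<in> borel_measurable iota"
   using mg by measurable
  show "(\<lambda>z::complex^'n. wfun \<nu> k z * spherical_fun (of_real l) z) \<in> borel_measurable iota"
   unfolding spherical_fun_def hyp2F1_def Let_def by measurable
 qed
 also have "\<dots> = of_real (LINT z|(iota :: (complex^'n) measure). g ((norm z)^2))" by (rule integral_complex_of_real)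
 also have "(LINT z|(iota :: (complex^'n) measure). g ((norm z)^2)) = (LINT t:{0<..<1}|lborel. iota_density ?N t *\<^sub>R g t)"
  by (rule integral_iota_radial[OF mg])
 also have "\<dots> = (LINT t:{0<..<1}|lborel. real ?N * (t ^ (?N - 1 + k) * (1 - t) powr (2 * \<nu> - real ?N - 1) * S t))"
 proof (rule set_lebesgue_integral_cong)
  show "\<forall>t. t \<in> {0<..<1} \<longrightarrow> iota_density ?N t *\<^sub>R g t = real ?N * (t ^ (?N - 1 + k) * (1 - t) powr (2 * \<nu> - real ?N - 1) * S t)"
  proof (intro allI impI)
   fix t :: real assume t: "t \<in> {0<..<1}"
   have "(1 - t) powr (2 * \<nu> - real ?N - 1) = (1 - t) powr (- (real ?N + 1)) * ((1 - t) powr \<nu> * (1 - t) powr \<nu>)"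
    unfolding powr_add[symmetric] by (rule arg_cong[where f = "(powr) (1 - t)"]) simp
   thus "iota_density ?N t *\<^sub>R g t = real ?N * (t ^ (?N - 1 + k) * (1 - t) powr (2 * \<nu> - real ?N - 1) * S t)"
    using t unfolding iota_density_def g_def phi_def power_add by simp
  qed
 qed auto
 also have "\<dots> = real ?N * moment k" unfolding moment_def by (rule set_integral_mult_right)
 finally show ?thesis .
qed

lemma measurable_spherical_fun [measurable]:
 "(\<lambda>z. spherical_fun l (z::complex^'n::finite)) \<in> borel_measurable borel"
 unfolding spherical_fun_def hyp2F1_def Let_def by measurable

lemma spherical_transform_wfun_eq:
 assumes nu: "\<nu> > real CARD('n)"
 shows "spherical_transform (wfun \<nu> k :: complex^'n::finite \<Rightarrow> complex) (of_real l)
  = of_real (pochhammer (real CARD('n)) k / pochhammer \<nu> k * (sqc CARD('n) \<nu> l k * h_hat CARD('n) \<nu> l))"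
proof -
 have N1: "CARD('n) \<ge> 1" by (simp add: Suc_leI)
 interpret spherical_moments "CARD('n)" \<nu> "lap CARD('n) l" using sms[OF N1 nu] .
 have "pochhammer \<nu> k > 0" "pochhammer (real CARD('n)) k > 0" using nu0 by (auto intro!: pochhammer_pos)
 hence "real CARD('n) * moment k = pochhammer (real CARD('n)) k / pochhammer \<nu> k * (sqc CARD('n) \<nu> l k * (real CARD('n) * moment 0))"
  using moment_eq[of k] by (simp add: field_simps)
 thus ?thesis unfolding spherical_transform_wfun[OF nu] h_hat_def by (simp only:)
qed

lemma spherical_transform_h_fun:
 "\<nu> > real CARD('n) \<Longrightarrow> spherical_transform (h_fun \<nu> :: complex^'n::finite \<Rightarrow> complex) (of_real l) = of_real (h_hat CARD('n) \<nu> l)"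
 using spherical_transform_wfun_eq[of \<nu> 0 l] by (simp add: h_fun_eq_wfun)

lemma spherical_fun_bounded:
 obtains C where "C \<ge> 0" "\<And>z::complex^'n::finite. norm z < 1 \<Longrightarrow> cmod (spherical_fun (of_real l) z) \<le> C"
proof -
 let ?N = "CARD('n)"
 have N1: "?N \<ge> 1" by (simp add: Suc_leI)
 interpret spherical_series "real ?N" 1 "lap ?N l" using N1 lap_pos[OF N1] by unfold_locales auto
 obtain C where C: "C \<ge> 0" and "\<And>k. \<bar>sq (real ?N) 1 (lap ?N l) k\<bar> \<le> C"
  and b: "\<And>t. 0 \<le> t \<Longrightarrow> t < 1 \<Longrightarrow> \<bar>phi (real ?N) 1 (lap ?N l) t\<bar> \<le> C"
  and "\<And>t. 0 \<le> t \<Longrightarrow> t < 1 \<Longrightarrow> \<bar>phi (real ?N) 1 (lap ?N l) t - 1\<bar> \<le> (C + 1) * (1 - (1 - t) powr 1)"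
  by (rule phi_bounds; rule that)
 show ?thesis
 proof (rule that[OF C])
  fix z :: "complex^'n" assume z: "norm z < 1"
  hence "0 \<le> (norm z)^2" "(norm z)^2 < 1" by (auto simp: abs_square_less_1)
  from b[OF this] show "cmod (spherical_fun (of_real l) z) \<le> C"
   using spherical_fun_eq_phi[OF z, of 1 l] by (simp add: lap_def)
 qed
qed

lemma integrable_mult_spherical_fun:
 fixes f :: "complex^'n::finite \<Rightarrow> complex"
 assumes "integrable iota f" shows "integrable iota (\<lambda>z. f z * spherical_fun (of_real l) z)"
proof -
 obtain C where C: "C \<ge> 0" "\<And>z::complex^'n. norm z < 1 \<Longrightarrow> cmod (spherical_fun (of_real l) z) \<le> C"
  by (rule spherical_fun_bounded; rule that)
 have "integrable iota (\<lambda>z. C * norm (f z))" using assms by simp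
 thus ?thesis
 proof (rule Bochner_Integration.integrable_bound)
  show "(\<lambda>z. f z * spherical_fun (of_real l) z) \<in> borel_measurable iota" using assms by measurable
  show "AE z in iota. norm (f z * spherical_fun (complex_of_real l) z) \<le> norm (C * norm (f z))"
   using AE_iota_ball
  proof eventually_elim
   case (elim z)
   thus ?case using mult_left_mono[OF C(2)[OF elim], of "norm (f z)"] C(1) by (simp add: norm_mult mult.commute)
  qed
 qed
qed

lemma weight_integral_pos: "\<alpha> > real N \<Longrightarrow> N \<ge> 1 \<Longrightarrow> weight_integral N \<alpha> > 0"
 unfolding weight_integral_def by (simp add: Beta_def Gamma_real_pos)

lemma weight_integral_Suc:
 assumes "\<alpha> > real N" "N \<ge> 1" shows "weight_integral N (\<alpha> + 1) = (\<alpha> - real N) / \<alpha> * weight_integral N \<alpha>"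
proof -
 have "(real N + (\<alpha> - real N)) * Beta (real N) (\<alpha> - real N + 1) = (\<alpha> - real N) * Beta (real N) (\<alpha> - real N)"
  by (rule Beta_plus1_right) (use assms in \<open>auto dest: nonpos_Ints_nonpos\<close>)
 hence "\<alpha> * Beta (real N) (\<alpha> + 1 - real N) = (\<alpha> - real N) * Beta (real N) (\<alpha> - real N)"
  by (simp add: algebra_simps)
 hence "Beta (real N) (\<alpha> + 1 - real N) = (\<alpha> - real N) * Beta (real N) (\<alpha> - real N) / \<alpha>"
  using assms by (simp add: eq_divide_eq mult.commute)
 thus ?thesis unfolding weight_integral_def by simp
qed

text \<open>The transform of (1 - |z|^2)^\<alpha> normalized to have integral 1. As \<alpha> grows
  its mass concentrates at 0, where spherical functions are 1.\<close>

definition h_ratio :: "nat \<Rightarrow> real \<Rightarrow> real \<Rightarrow> real" where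
 "h_ratio N \<alpha> l = h_hat N \<alpha> l / weight_integral N \<alpha>"

context
 fixes dummy :: "'n::finite itself"
begin

lemma card_ge_1: "CARD('n) \<ge> 1" by (simp add: Suc_leI)

text \<open>The weight with exponent \<nu> + 1 is the difference of \<open>wfun \<nu> 0\<close> and
  \<open>wfun \<nu> 1\<close>, and the transform of the latter is known from the explicit polynomial
  s_1 = 1 - L/(N\<nu>).\<close>

lemma h_hat_Suc:
 assumes nu: "\<nu> > real CARD('n)"
 shows "h_hat CARD('n) (\<nu> + 1) l = (\<nu>^2 - real CARD('n) * \<nu> + lap CARD('n) l) / \<nu>^2 * h_hat CARD('n) \<nu> l"
proof -
 let ?N = "CARD('n)" and ?w = "wfun :: real \<Rightarrow> nat \<Rightarrow> complex^'n \<Rightarrow> complex"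
 let ?T = "\<lambda>f::complex^'n \<Rightarrow> complex. spherical_transform f (of_real l)"
 have nu0: "\<nu> > 0" using nu by simp
 have "?T (?w (\<nu> + 1) 0) = ?T (?w \<nu> 0) - ?T (?w \<nu> 1)"
 proof -
  have "?T (?w \<nu> 0) - ?T (?w \<nu> 1) = (LINT z|iota. ?w \<nu> 0 z * spherical_fun (of_real l) z - ?w \<nu> 1 z * spherical_fun (of_real l) z)"
   unfolding spherical_transform_def
   by (rule Bochner_Integration.integral_diff[symmetric]; intro integrable_mult_spherical_fun integrable_wfun nu)
  also have "\<dots> = ?T (?w (\<nu> + 1) 0)" unfolding spherical_transform_def
  proof (rule integral_cong_AE)
   show "AE z in iota. ?w \<nu> 0 z * spherical_fun (of_real l) z - ?w \<nu> 1 z * spherical_fun (of_real l) z = ?w (\<nu> + 1) 0 z * spherical_fun (of_real l) z"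
    using AE_iota_ball
   proof eventually_elim
    case (elim z)
    hence "(norm z)^2 < 1" by (auto simp: abs_square_less_1)
    hence "?w (\<nu> + 1) 0 z = ?w \<nu> 0 z - ?w \<nu> 1 z" by (simp add: wfun_def powr_add left_diff_distrib right_diff_distrib algebra_simps)
    thus ?case by (simp add: left_diff_distrib)
   qed
  qed measurable
  finally show ?thesis by simp
 qed
 moreover have "?T (?w (\<nu> + 1) 0) = of_real (h_hat ?N (\<nu> + 1) l)" using spherical_transform_wfun_eq[of "\<nu> + 1" 0 l, where 'n='n] nu by simp
 moreover have "?T (?w \<nu> 0) = of_real (h_hat ?N \<nu> l)" using spherical_transform_wfun_eq[of "\<nu>" 0 l, where 'n='n] nu by simp
 moreover have "?T (?w \<nu> 1) = of_real (real ?N / \<nu> * ((1 - lap ?N l / (real ?N * \<nu>)) * h_hat ?N \<nu> l))"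
  using spherical_transform_wfun_eq[of "\<nu>" 1 l, where 'n='n] nu by simp
 ultimately have "complex_of_real (h_hat ?N (\<nu> + 1) l) = of_real (h_hat ?N \<nu> l - (real ?N / \<nu> * ((1 - lap ?N l / (real ?N * \<nu>)) * h_hat ?N \<nu> l)))"
  by (simp only: of_real_diff)
 hence E1: "h_hat ?N (\<nu> + 1) l = h_hat ?N \<nu> l - (real ?N / \<nu> * ((1 - lap ?N l / (real ?N * \<nu>)) * h_hat ?N \<nu> l))"
  by (simp only: of_real_eq_iff)
 have E2: "real ?N / \<nu> * ((1 - lap ?N l / (real ?N * \<nu>)) * h_hat ?N \<nu> l) = (real ?N / \<nu> - lap ?N l / \<nu>^2) * h_hat ?N \<nu> l"
  using nu0 by (simp add: right_diff_distrib left_diff_distrib power2_eq_square)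
 show ?thesis unfolding E1 E2 using nu0 by (simp add: field_simps power2_eq_square)
qed

text \<open>Dividing \<open>h_hat_Suc\<close> by \<open>weight_integral_Suc\<close>, where the
  integral shrinks by (\<nu> - N)/\<nu>, leaves a factor larger than 1. Positivity and monotonicity
  in the exponent both rest on it.\<close>

lemma h_ratio_Suc:
 assumes nu: "\<nu> > real CARD('n)"
 shows "h_ratio CARD('n) (\<nu> + 1) l = (1 + lap CARD('n) l / (\<nu> * (\<nu> - real CARD('n)))) * h_ratio CARD('n) \<nu> l"
proof -
 have nu0: "\<nu> > 0" "\<nu> - real CARD('n) > 0" using nu by auto
 have w: "weight_integral CARD('n) \<nu> > 0" by (rule weight_integral_pos[OF nu card_ge_1])
 define d where "d = \<nu> - real CARD('n)"
 have e: "\<nu>^2 - real CARD('n) * \<nu> = \<nu> * d" by (simp add: d_def power2_eq_square algebra_simps)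
 have gen: "(n * d + L) / n^2 * h / (d / n * w) = (1 + L / (n * d)) * (h / w)" if "n > 0" "d > 0" "w > 0" for n d w L h :: real
  using that by (simp add: divide_simps power2_eq_square)
 have "d > 0" using nu by (simp add: d_def)
 from gen[OF nu0(1) this w] show ?thesis
  unfolding h_ratio_def h_hat_Suc[OF nu] weight_integral_Suc[OF nu card_ge_1] e d_def[symmetric] .
qed

text \<open>The difference of the spherical function and 1 is at most a constant times t = |z|^2,
  and the mean of t under the normalized weight of exponent \<alpha> is N/\<alpha>. The series
  representation keeps the original \<nu>, so the constant does not depend on \<alpha>.\<close>

lemma h_ratio_tendsto:
 assumes nu: "\<nu> > real CARD('n)"
 shows "(\<lambda>m. h_ratio CARD('n) (\<nu> + real m) l) \<longlonglongrightarrow> 1"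
proof -
 let ?N = "CARD('n)" and ?w = "wfun :: real \<Rightarrow> nat \<Rightarrow> complex^'n \<Rightarrow> complex"
 interpret spherical_series "real ?N" \<nu> "lap ?N l" using card_ge_1 lap_pos[OF card_ge_1] nu by unfold_locales auto
 obtain C where C: "C \<ge> 0" and "\<And>k. \<bar>sq (real ?N) \<nu> (lap ?N l) k\<bar> \<le> C"
  and "\<And>t. 0 \<le> t \<Longrightarrow> t < 1 \<Longrightarrow> \<bar>phi (real ?N) \<nu> (lap ?N l) t\<bar> \<le> C"
  and b: "\<And>t. 0 \<le> t \<Longrightarrow> t < 1 \<Longrightarrow> \<bar>phi (real ?N) \<nu> (lap ?N l) t - 1\<bar> \<le> (C + 1) * (1 - (1 - t) powr \<nu>)"
  by (rule phi_bounds; rule that)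
 obtain p :: nat where p: "real p \<ge> \<nu>" using real_arch_simple by blast
 \<comment> \<open>An integer p \<ge> \<nu> makes Bernoulli's inequality available and turns 1 - (1
   - t)^\<nu> into a linear bound.\<close>
 have bern: "1 - (1 - t) powr \<nu> \<le> real p * t" if t: "0 \<le> t" "t < 1" for t
 proof -
  have "1 + real p * (- t) \<le> (1 + (- t)) ^ p" by (rule Bernoulli_inequality) (use t in auto)
  also have "\<dots> = (1 - t) powr real p" using t by (simp add: powr_realpow)
  also have "\<dots> \<le> (1 - t) powr \<nu>" by (rule powr_mono') (use p t in auto)
  finally show ?thesis by simp
 qed
 have key: "\<bar>h_ratio ?N \<alpha> l - 1\<bar> \<le> (C + 1) * real p * real ?N / \<alpha>" if al: "\<alpha> \<ge> \<nu>" for \<alpha>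
 proof -
  have al': "\<alpha> > real ?N" "\<alpha> > 0" using al nu by auto
  have w: "weight_integral ?N \<alpha> > 0" by (rule weight_integral_pos[OF al'(1) card_ge_1])
  have i0: "(LINT z|iota. ?w \<alpha> 0 z) = of_real (weight_integral ?N \<alpha>)"
   using integral_iota_weight[OF al'(1), of 0] unfolding wfun_def integral_complex_of_real weight_integral_def by simp
  have i1: "(LINT z|(iota::(complex^'n) measure). ((norm z)^2) ^ 1 * (1 - (norm z)^2) powr \<alpha>) = real ?N / \<alpha> * weight_integral ?N \<alpha>"
  proof -
   have "(real ?N + (\<alpha> - real ?N)) * Beta (real ?N + 1) (\<alpha> - real ?N) = real ?N * Beta (real ?N) (\<alpha> - real ?N)"
    by (rule Beta_plus1_left) (use card_ge_1 in \<open>auto dest: nonpos_Ints_nonpos\<close>)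
   thus ?thesis using integral_iota_weight[OF al'(1), of 1] al' by (simp add: weight_integral_def field_simps)
  qed
  have "complex_of_real (h_hat ?N \<alpha> l - weight_integral ?N \<alpha>) = spherical_transform (?w \<alpha> 0) (of_real l) - (LINT z|iota. ?w \<alpha> 0 z)"
   using spherical_transform_wfun_eq[of \<alpha> 0 l, where 'n='n] al' by (simp add: i0)
  also have "\<dots> = (LINT z|iota. ?w \<alpha> 0 z * spherical_fun (of_real l) z - ?w \<alpha> 0 z)"
   unfolding spherical_transform_def
   by (rule Bochner_Integration.integral_diff[symmetric]; intro integrable_mult_spherical_fun integrable_wfun al')
  finally have "\<bar>h_hat ?N \<alpha> l - weight_integral ?N \<alpha>\<bar> = cmod (LINT z|iota. ?w \<alpha> 0 z * spherical_fun (of_real l) z - ?w \<alpha> 0 z)"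
   by (metis norm_of_real)
  also have "\<dots> \<le> (LINT z|(iota::(complex^'n) measure). (C + 1) * real p * (((norm z)^2) ^ 1 * (1 - (norm z)^2) powr \<alpha>))"
  proof (rule order_trans[OF integral_norm_bound], rule integral_mono_AE)
   show "integrable iota (\<lambda>z. norm (?w \<alpha> 0 z * spherical_fun (of_real l) z - ?w \<alpha> 0 z))"
    by (intro integrable_norm Bochner_Integration.integrable_diff integrable_mult_spherical_fun integrable_wfun al')
   show "integrable (iota::(complex^'n) measure) (\<lambda>z. (C + 1) * real p * (((norm z)^2) ^ 1 * (1 - (norm z)^2) powr \<alpha>))"
    by (intro integrable_mult_right integrable_iota_weight al')
   show "AE z in iota. norm (?w \<alpha> 0 z * spherical_fun (of_real l) z - ?w \<alpha> 0 z) \<le> (C + 1) * real p * (((norm z)^2) ^ 1 * (1 - (norm z)^2) powr \<alpha>)"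
    using AE_iota_ball
   proof eventually_elim
    case (elim z)
    define t where "t = (norm z)^2"
    have t: "0 \<le> t" "t < 1" using elim by (auto simp: t_def abs_square_less_1)
    have "norm (?w \<alpha> 0 z * spherical_fun (of_real l) z - ?w \<alpha> 0 z) = (1 - t) powr \<alpha> * \<bar>phi (real ?N) \<nu> (lap ?N l) t - 1\<bar>"
    proof -
     have "?w \<alpha> 0 z * spherical_fun (of_real l) z - ?w \<alpha> 0 z = of_real ((1 - t) powr \<alpha> * (phi (real ?N) \<nu> (lap ?N l) t - 1))"
      using spherical_fun_eq_phi[OF elim nu0, of l] by (simp add: wfun_def t_def lap_def right_diff_distrib)
     thus ?thesis by (simp only: norm_of_real abs_mult) simp
    qed
    also have "\<dots> \<le> (1 - t) powr \<alpha> * ((C + 1) * (real p * t))"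
     using C by (intro mult_left_mono order_trans[OF b[OF t]] bern t) auto
    finally show ?case by (simp add: t_def mult_ac)
   qed
  qed
  also have "\<dots> = (C + 1) * real p * (real ?N / \<alpha> * weight_integral ?N \<alpha>)" unfolding integral_mult_right_zero i1 ..
  finally have "\<bar>h_hat ?N \<alpha> l - weight_integral ?N \<alpha>\<bar> / weight_integral ?N \<alpha> \<le> (C + 1) * real p * (real ?N / \<alpha>)"
   using w by (simp add: divide_le_eq mult.assoc)
  moreover have "h_ratio ?N \<alpha> l - 1 = (h_hat ?N \<alpha> l - weight_integral ?N \<alpha>) / weight_integral ?N \<alpha>"
   using w by (simp add: h_ratio_def field_simps)
  ultimately show ?thesis using w by (simp add: abs_mult)
 qed
 have "(\<lambda>m. h_ratio ?N (\<nu> + real m) l - 1) \<longlonglongrightarrow> 0"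
 proof (rule Lim_null_comparison)
  show "\<forall>\<^sub>F m in sequentially. norm (h_ratio ?N (\<nu> + real m) l - 1) \<le> (C + 1) * real p * real ?N / (\<nu> + real m)"
   using key by auto
  show "(\<lambda>m. (C + 1) * real p * real ?N / (\<nu> + real m)) \<longlonglongrightarrow> 0" by real_asymp
 qed
 thus ?thesis by (simp only: LIM_zero_iff)
qed

text \<open>The factor in \<open>h_ratio_Suc\<close> is positive, so a nonpositive value would stay
  nonpositive each time the exponent grows by 1, against the limit 1.\<close>

lemma h_ratio_pos:
 assumes nu: "\<nu> > real CARD('n)"
 shows "h_ratio CARD('n) \<nu> l > 0"
proof (rule ccontr)
 assume neg: "\<not> ?thesis"
 have "h_ratio CARD('n) (\<nu> + real m) l \<le> 0" for m
 proof (induction m)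
  case (Suc m)
  have nm: "\<nu> + real m > real CARD('n)" using nu by simp
  have "1 + lap CARD('n) l / ((\<nu> + real m) * (\<nu> + real m - real CARD('n))) \<ge> 0"
   using lap_pos[OF card_ge_1, of l] nm nu by (intro add_nonneg_nonneg divide_nonneg_nonneg mult_nonneg_nonneg) auto
  hence "h_ratio CARD('n) (\<nu> + real m + 1) l \<le> 0" unfolding h_ratio_Suc[OF nm] using Suc by (simp add: mult_nonneg_nonpos)
  thus ?case by (simp add: add_ac)
 qed (use neg in simp)
 hence "1 \<le> (0::real)" by (intro LIMSEQ_le_const2[OF h_ratio_tendsto[OF nu]] exI[of _ 0] allI impI)
 thus False by simp
qed

lemma h_ratio_mono:
 assumes nu: "\<nu> > real CARD('n)"
 shows "incseq (\<lambda>m. h_ratio CARD('n) (\<nu> + real m) l)"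
proof (rule incseq_SucI)
 fix m
 have nm: "\<nu> + real m > real CARD('n)" using nu by simp
 have "1 + lap CARD('n) l / ((\<nu> + real m) * (\<nu> + real m - real CARD('n))) \<ge> 1"
  using lap_pos[OF card_ge_1, of l] nm by simp
 hence "h_ratio CARD('n) (\<nu> + real m) l \<le> h_ratio CARD('n) (\<nu> + real m + 1) l"
  unfolding h_ratio_Suc[OF nm] using h_ratio_pos[OF nm, of l] by simp
 thus "h_ratio CARD('n) (\<nu> + real m) l \<le> h_ratio CARD('n) (\<nu> + real (Suc m)) l" by (simp add: add_ac)
qed

lemma h_ratio_le_1:
 assumes nu: "\<nu> > real CARD('n)" shows "h_ratio CARD('n) (\<nu> + real m) l \<le> 1"
 by (rule incseq_le[OF h_ratio_mono[OF nu] h_ratio_tendsto[OF nu]])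

lemma h_hat_pos:
 assumes nu: "\<nu> > real CARD('n)" shows "h_hat CARD('n) \<nu> l > 0"
 using h_ratio_pos[OF nu, of l] weight_integral_pos[OF nu card_ge_1] by (simp add: h_ratio_def zero_less_divide_iff)

lemma h_hat_le:
 assumes nu: "\<nu> > real CARD('n)" shows "h_hat CARD('n) \<nu> l \<le> weight_integral CARD('n) \<nu>"
 using h_ratio_le_1[OF nu, of 0 l] weight_integral_pos[OF nu card_ge_1] by (simp add: h_ratio_def divide_le_eq)

end

section \<open>The group and its action on the ball\<close>

lemma sum_option: "(\<Sum>i\<in>UNIV. f (i::'n::finite option)) = (\<Sum>j\<in>UNIV. f (Some j)) + (f None :: 'a::comm_monoid_add)"
proof -
 have "(\<Sum>i\<in>UNIV. f (i::'n option)) = f None + sum f (range Some)"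
  unfolding UNIV_option_conv by (subst sum.insert) auto
 also have "sum f (range Some) = (\<Sum>j\<in>UNIV. f (Some j))" by (subst sum.reindex) auto
 finally show ?thesis by (simp add: add.commute)
qed

lemma hprod_self: "hprod z z = of_real ((norm z)^2)"
proof -
 have "(norm z)^2 = (\<Sum>i\<in>UNIV. (norm (z $ i))^2)"
  unfolding norm_vec_def L2_set_def by (simp add: sum_nonneg)
 thus ?thesis unfolding hprod_def by (simp add: complex_norm_square flip: of_real_power)
qed

lemma hprod_add_left: "hprod (x + y) z = hprod x z + hprod y z"
 by (simp add: hprod_def sum.distrib algebra_simps)
lemma hprod_diff_left: "hprod (x - y) z = hprod x z - hprod y z"
 by (simp add: hprod_def sum_subtractf algebra_simps)
lemma hprod_scale_left: "hprod (c *s x) z = c * hprod x z"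
 by (simp add: hprod_def sum_distrib_left mult.assoc)
lemma cnj_hprod: "cnj (hprod x y) = hprod y x"
 by (simp add: hprod_def cnj_sum mult.commute)
lemma hprod_add_right: "hprod z (x + y) = hprod z x + hprod z y"
 by (simp add: hprod_def sum.distrib algebra_simps)
lemma hprod_diff_right: "hprod z (x - y) = hprod z x - hprod z y"
 by (simp add: hprod_def sum_subtractf algebra_simps)
lemma hprod_scale_right: "hprod z (c *s x) = cnj c * hprod z x"
 by (simp add: hprod_def sum_distrib_left mult.left_commute)
lemma hprod_0 [simp]: "hprod 0 z = 0" "hprod z 0 = 0" by (simp_all add: hprod_def)

lemma norm_hprod_le: "cmod (hprod z w) \<le> norm z * norm w"
proof -
 have "cmod (hprod z w) \<le> (\<Sum>j\<in>UNIV. \<bar>norm (z $ j)\<bar> * \<bar>norm (w $ j)\<bar>)"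
  unfolding hprod_def by (rule order_trans[OF norm_sum]) (simp add: norm_mult)
 also have "\<dots> \<le> norm z * norm w" unfolding norm_vec_def by (rule L2_set_mult_ineq)
 finally show ?thesis .
qed

section \<open>The indefinite Hermitian form and the fractional linear action on the ball\<close>

definition jform :: "complex^('n::finite option) \<Rightarrow> complex^('n option) \<Rightarrow> complex" where
 "jform Z U = - (\<Sum>j\<in>UNIV. Z $ Some j * cnj (U $ Some j)) + Z $ None * cnj (U $ None)"

lemma jform_self: "jform Z Z = of_real (lorentz_form Z)"
 unfolding jform_def lorentz_form_def by (simp add: complex_norm_square flip: of_real_power)

lemma lorentz_form_add:
 "lorentz_form (Z + c *s U) = lorentz_form Z + 2 * Re (cnj c * jform Z U) + (cmod c)^2 * lorentz_form U"
proof -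
 have *: "(cmod (a + c * b))^2 = (cmod a)^2 + 2 * Re (cnj c * (a * cnj b)) + (cmod c)^2 * (cmod b)^2" for a b
  by (simp only: cmod_power2) (simp add: algebra_simps power2_eq_square)
 show ?thesis
  unfolding lorentz_form_def jform_def
  by (simp add: * sum.distrib sum_distrib_left sum_negf distrib_left right_diff_distrib Re_sum)
qed

text \<open>The full group U(n,1), without the determinant condition: matrices are constructed here
  and then moved into SU(n,1) by a scalar factor, which does not change the action
  (\<open>SU_scaling\<close>).\<close>

definition form_preserving :: "('n::finite) gmat \<Rightarrow> bool" where
 "form_preserving x \<longleftrightarrow> (\<forall>z. lorentz_form (x *v z) = lorentz_form z)"

lemma form_preserving_jform:
 assumes "form_preserving x" shows "jform (x *v Z) (x *v U) = jform Z U"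
proof -
 have e: "Re (cnj c * jform (x *v Z) (x *v U)) = Re (cnj c * jform Z U)" for c
 proof -
  have "lorentz_form (x *v Z + c *s (x *v U)) = lorentz_form (Z + c *s U)"
   using assms unfolding form_preserving_def by (metis matrix_vector_right_distrib vector_scalar_commute)
  thus ?thesis using assms unfolding lorentz_form_add form_preserving_def by simp
 qed
 show ?thesis using e[of 1] e[of \<i>] by (simp add: complex_eq_iff)
qed

text \<open>Homogeneous coordinates. The points of the ball are the lines on which the form is
  positive, and a matrix acts on lifts linearly up to the automorphy factor
  \<open>den\<close>.\<close>

definition lift :: "complex^'n \<Rightarrow> complex^('n option)" where
 "lift z = (\<chi> i. case i of None \<Rightarrow> 1 | Some j \<Rightarrow> z $ j)"

definition den :: "('n::finite) gmat \<Rightarrow> complex^'n \<Rightarrow> complex" where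
 "den x z = (x *v lift z) $ None"

lemma lift_nth [simp]: "lift z $ None = 1" "lift z $ Some j = z $ j" by (simp_all add: lift_def)

lemma act_nth: "act x z $ i = (x *v lift z) $ Some i / den x z"
 unfolding act_def den_def by (simp add: matrix_vector_mult_def sum_option)

lemma jform_lift: "jform (lift z) (lift u) = 1 - hprod z u"
 by (simp add: jform_def hprod_def)

lemma lorentz_lift: "lorentz_form (lift z) = 1 - (norm z)^2"
proof -
 have "complex_of_real (lorentz_form (lift z)) = of_real (1 - (norm z)^2)"
  using jform_lift[of z z] by (simp add: jform_self hprod_self)
 thus ?thesis by (simp only: of_real_eq_iff)
qed

lemma
 assumes x: "form_preserving x" and z: "norm z < 1"
 shows den_nonzero: "den x z \<noteq> 0" and mult_lift: "x *v lift z = den x z *s lift (act x z)"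
proof -
 have "lorentz_form (x *v lift z) > 0"
  using x z unfolding form_preserving_def by (simp add: lorentz_lift abs_square_less_1)
 moreover have "lorentz_form (x *v lift z) \<le> (cmod (den x z))^2" by (simp add: lorentz_form_def den_def sum_nonneg)
 ultimately show d: "den x z \<noteq> 0" by auto
 show "x *v lift z = den x z *s lift (act x z)"
  by (rule vec_eq_iff[THEN iffD2], rule allI) (case_tac i; simp add: act_nth d den_def[symmetric])
qed

lemma jform_scale: "jform (a *s Z) (b *s U) = a * cnj b * jform Z U"
 by (simp add: jform_def sum_distrib_left algebra_simps)

text \<open>Invariance of the form, read on lifts. It yields that the ball is preserved, that the
  stabilizer of 0 preserves the Hermitian product, and how weight and kernel transform.\<close>

lemma act_identity:
 assumes x: "form_preserving x" and z: "norm z < 1" and u: "norm u < 1"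
 shows "den x z * cnj (den x u) * (1 - hprod (act x z) (act x u)) = 1 - hprod z u"
 using form_preserving_jform[OF x, of "lift z" "lift u"]
 unfolding mult_lift[OF x z] mult_lift[OF x u] jform_scale jform_lift .

lemma act_norm_identity:
 assumes x: "form_preserving x" and z: "norm z < 1"
 shows "(cmod (den x z))^2 * (1 - (norm (act x z))^2) = 1 - (norm z)^2"
proof -
 have "complex_of_real ((cmod (den x z))^2 * (1 - (norm (act x z))^2)) = of_real (1 - (norm z)^2)"
  using act_identity[OF x z z] by (simp only: of_real_mult of_real_diff of_real_1 complex_norm_square hprod_self)
 thus ?thesis by (simp only: of_real_eq_iff)
qed

lemma norm_act_less:
 assumes x: "form_preserving x" and z: "norm z < 1" shows "norm (act x z) < 1"
proof -
 have "1 - (norm z)^2 > 0" using z by (simp add: abs_square_less_1)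
 moreover have "(cmod (den x z))^2 > 0" using den_nonzero[OF x z] by simp
 ultimately have "1 - (norm (act x z))^2 > 0" using act_norm_identity[OF x z] by (metis zero_less_mult_pos)
 thus ?thesis by (simp add: abs_square_less_1)
qed

lemma lift_eq_scale: assumes "c *s lift a = d *s lift b" "c \<noteq> 0" shows "a = b"
proof -
 have "c = d" using assms(1) by (metis lift_nth(1) mult.right_neutral vector_smult_component)
 moreover have "c * a $ j = d * b $ j" for j using assms(1) by (metis lift_nth(2) vector_smult_component)
 ultimately show ?thesis using assms(2) by (simp add: vec_eq_iff)
qed

lemma act_mult:
 assumes x: "form_preserving x" and y: "form_preserving y" and z: "norm z < 1"
 shows "act (x ** y) z = act x (act y z)"
proof -
 have xy: "form_preserving (x ** y)" using x y unfolding form_preserving_def by (metis matrix_vector_mul_assoc)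
 have "den (x ** y) z *s lift (act (x ** y) z) = x *v (y *v lift z)"
  using mult_lift[OF xy z] by (simp add: matrix_vector_mul_assoc)
 also have "\<dots> = (den y z * den x (act y z)) *s lift (act x (act y z))"
  unfolding mult_lift[OF y z] vector_scalar_commute mult_lift[OF x norm_act_less[OF y z]] by (simp add: vector_smult_assoc)
 finally show ?thesis using lift_eq_scale den_nonzero[OF xy z] by blast
qed

lemma act_one: "act (mat 1) z = z"
 by (simp add: vec_eq_iff act_nth den_def)

lemma SU_form: "x \<in> SU_n1 \<Longrightarrow> form_preserving x"
 by (simp add: SU_n1_def form_preserving_def)

lemma SU_mult: "x \<in> SU_n1 \<Longrightarrow> y \<in> SU_n1 \<Longrightarrow> x ** y \<in> SU_n1"
 by (simp add: SU_n1_def det_mul flip: matrix_vector_mul_assoc)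

lemma SU_inverse:
 assumes "x \<in> SU_n1"
 shows "matrix_inv x \<in> SU_n1" "matrix_inv x ** x = mat 1" "x ** matrix_inv x = mat 1"
proof -
 have "invertible x" using assms by (simp add: SU_n1_def invertible_det_nz)
 hence "x ** matrix_inv x = mat 1 \<and> matrix_inv x ** x = mat 1"
  unfolding matrix_inv_def invertible_def by (rule someI_ex)
 thus 1: "matrix_inv x ** x = mat 1" "x ** matrix_inv x = mat 1" by simp_all
 have "det (matrix_inv x) * det x = 1" by (metis 1(1) det_I det_mul)
 hence "det (matrix_inv x) = 1" using assms by (simp add: SU_n1_def)
 moreover have "lorentz_form (matrix_inv x *v z) = lorentz_form z" for z
  using assms 1(2) unfolding SU_n1_def by (metis (mono_tags, lifting) matrix_vector_mul_assoc matrix_vector_mul_lid mem_Collect_eq)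
 ultimately show "matrix_inv x \<in> SU_n1" by (simp add: SU_n1_def)
qed

lemma act_inverse:
 assumes x: "x \<in> SU_n1" and z: "norm z < 1"
 shows "act x (act (matrix_inv x) z) = z" "act (matrix_inv x) (act x z) = z"
 using act_mult[OF SU_form[OF x] SU_form[OF SU_inverse(1)[OF x]] z] act_mult[OF SU_form[OF SU_inverse(1)[OF x]] SU_form[OF x] z]
 by (simp_all add: SU_inverse[OF x] act_one)

lemma det_cnj: "det (\<chi> i j. cnj (M $ i $ j)) = cnj (det (M :: complex^'m^'m::finite))"
 unfolding det_def by (simp add: cnj_sum cnj_prod)

lemma matrix_entry_jform:
 fixes M :: "('n::finite) gmat"
 shows "(((\<chi> i j. cnj (M $ j $ i)) ** (\<chi> i j. if i = j then (if i = None then 1 else -1) else 0)) ** M) $ i $ j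
  = jform (column j M) (column i M)"
proof -
 have "((\<chi> i j. cnj (M $ j $ i)) ** (\<chi> i j. if i = j then (if i = None then 1 else -1) else (0::complex))) $ i $ k
   = cnj (M $ k $ i) * (if k = None then 1 else -1)" for i k
  unfolding matrix_matrix_mult_def by (simp add: if_distrib cong: if_cong)
 thus ?thesis unfolding matrix_matrix_mult_def[of _ M] jform_def column_def
  by (simp add: sum_option sum_negf mult.commute)
qed

text \<open>The columns of M have the same \<open>jform\<close> products as the standard basis. As a
  matrix identity this says that the adjoint of M, times J, times M, equals J for the diagonal sign
  matrix J; determinants then give |det M|^2 = 1.\<close>

lemma form_preserving_det:
 assumes "form_preserving (M :: ('n::finite) gmat)" shows "cmod (det M) = 1"
proof -
 define J :: "'n gmat" where "J = (\<chi> i j. if i = j then (if i = None then 1 else -1) else 0)"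
 have gen: "jform (column j M) (column i M) = jform (axis j 1) (axis i 1)" for i j
 proof -
  have "M *v axis j 1 = column j M" for j
   by (simp add: vec_eq_iff matrix_vector_mult_def column_def axis_def if_distrib[of "\<lambda>x. _ * x"] cong: if_cong)
  thus ?thesis using form_preserving_jform[OF assms, of "axis j 1" "axis i 1"] by simp
 qed
 have "((\<chi> i j. cnj (M $ j $ i)) ** J) ** M = J"
 proof (rule vec_eq_iff[THEN iffD2], rule allI, rule vec_eq_iff[THEN iffD2], rule allI)
  fix i j
  have "(((\<chi> i j. cnj (M $ j $ i)) ** J) ** M) $ i $ j = jform (axis j 1) (axis i 1)"
   unfolding J_def matrix_entry_jform gen ..
  also have "\<dots> = J $ i $ j" unfolding jform_def J_def axis_def
   by (cases i; cases j) (auto simp: if_distrib[of cnj] if_distrib[of "\<lambda>x. x * _"] cong: if_cong)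
  finally show "(((\<chi> i j. cnj (M $ j $ i)) ** J) ** M) $ i $ j = J $ i $ j" .
 qed
 hence "det (\<chi> i j. cnj (M $ j $ i)) * det J * det M = det J" by (metis det_mul)
 moreover have "det (\<chi> i j. cnj (M $ j $ i)) = cnj (det M)"
 proof -
  have "(\<chi> i j. cnj (M $ j $ i)) = transpose (\<chi> i j. cnj (M $ i $ j))" by (simp add: transpose_def)
  thus ?thesis by (simp add: det_transpose det_cnj)
 qed
 moreover have "det J \<noteq> 0"
  unfolding J_def by (subst det_diagonal) auto
 ultimately have "cnj (det M) * det M = 1" by (simp add: mult.assoc mult.left_commute)
 hence "complex_of_real ((cmod (det M))^2) = 1" unfolding complex_norm_square by (simp only: mult.commute)
 hence "(cmod (det M))^2 = 1" by (simp only: of_real_eq_1_iff)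
 thus ?thesis by (simp add: abs_square_eq_1)
qed

lemma SU_scaling:
 assumes M: "form_preserving (M :: ('n::finite) gmat)"
 obtains x where "x \<in> SU_n1" "\<And>z. act x z = act M z"
proof -
 define m where "m = CARD('n option)"
 let ?m = m
 have m0: "m > 0" by (simp add: m_def)
 \<comment> \<open>An (n+1)-st root of the inverse of det M. It has modulus 1, so scaling by it
   normalizes the determinant and still preserves the form.\<close>
 define c where "c = cis (- Arg (det M) / real ?m)"
 have dM: "det M = cis (Arg (det M))"
 proof -
  have "cmod (det M) = 1" by (rule form_preserving_det[OF M])
  moreover from this have "det M \<noteq> 0" by auto
  ultimately show ?thesis using cis_Arg[of "det M"] by (simp add: sgn_eq)
 qed
 have c1: "cmod c = 1" by (simp add: c_def)
 have "c ^ ?m = cis (- Arg (det M))" unfolding c_def Complex.DeMoivre using m0 by (intro arg_cong[where f = cis]) simp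
 hence cm: "c ^ ?m * det M = 1" by (subst dM) (simp add: cis_mult)
 define x where "x = mat c ** M"
 have xm: "x *v z = c *s (M *v z)" for z
 proof -
  have "mat c *v U = c *s U" for U :: "complex^('n option)"
   by (simp add: vec_eq_iff matrix_vector_mult_def mat_def if_distrib[of "\<lambda>x. x * _"] cong: if_cong)
  thus ?thesis unfolding x_def matrix_vector_mul_assoc[symmetric] .
 qed
 have "det (mat c :: 'n gmat) = c ^ ?m" by (subst det_diagonal) (auto simp: mat_def m_def)
 hence "det x = 1" unfolding x_def det_mul using cm by simp
 moreover have "lorentz_form (x *v z) = lorentz_form z" for z
 proof -
  have "lorentz_form (c *s U) = lorentz_form U" for U :: "complex^('n option)"
   by (simp add: lorentz_form_def norm_mult c1)
  thus ?thesis using M by (simp add: xm form_preserving_def)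
 qed
 ultimately have "x \<in> SU_n1" by (simp add: SU_n1_def)
 moreover have "act x z = act M z" for z
  using c1 by (auto simp: vec_eq_iff act_nth den_def xm)
 ultimately show ?thesis using that by blast
qed

lemma SU_transitive:
 fixes w :: "complex^'n::finite"
 assumes w: "norm w < 1"
 obtains x where "x \<in> SU_n1" "act x 0 = w"
proof -
 define r where "r = (norm w)^2"
 have r: "0 \<le> r" "r < 1" using w by (auto simp: r_def abs_square_less_1)
 define d where "d = 1 / sqrt (1 - r)"
 have d0: "d > 0" using r by (simp add: d_def)
 have d2: "d^2 * (1 - r) = 1" using r by (simp add: d_def power_divide)
 \<comment> \<open>\<open>M\<close> below is the Hermitian boost with blocks I + \<kappa> w w', d w,
   d w' and d, where w' is the conjugate transpose of w. For w \<noteq> 0 the value \<kappa> equals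
   (d - 1)/|w|^2; the present form also covers w = 0.\<close>
 define \<kappa> where "\<kappa> = d^2 / (d + 1)"
 have k1: "\<kappa> * (d + 1) = d^2" using d0 by (simp add: \<kappa>_def)
 have k2: "\<kappa> * r = d - 1"
 proof -
  have "d^2 * r = d^2 - d^2 * (1 - r)" by (simp add: algebra_simps)
  also have "\<dots> = (d - 1) * (d + 1)" unfolding d2 by (simp add: algebra_simps power2_eq_square)
  finally have "d^2 * r = (d - 1) * (d + 1)" .
  moreover have "(\<kappa> * r) * (d + 1) = (\<kappa> * (d + 1)) * r" by (simp add: algebra_simps)
  ultimately have "(\<kappa> * r) * (d + 1) = (d - 1) * (d + 1)" unfolding k1 by (simp only:)
  thus ?thesis using d0 by simp
 qed
 define M :: "'n gmat" where "M = (\<chi> i j. case i of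
   Some i' \<Rightarrow> (case j of Some j' \<Rightarrow> (if i' = j' then 1 else 0) + of_real \<kappa> * w $ i' * cnj (w $ j') | None \<Rightarrow> of_real d * w $ i')
  | None \<Rightarrow> (case j of Some j' \<Rightarrow> of_real d * cnj (w $ j') | None \<Rightarrow> of_real d))"
 have "lorentz_form (M *v Z) = lorentz_form Z" for Z
 proof -
  define a :: "complex^'n" where "a = (\<chi> j. Z $ Some j)"
  define b where "b = Z $ None"
  define s where "s = hprod a w"
  define m where "m = of_real \<kappa> * s + of_real d * b"
  have MS: "(M *v Z) $ Some i = (a + m *s w) $ i" for i
   unfolding matrix_vector_mult_def M_def
   by (simp add: sum_option a_def b_def s_def m_def hprod_def sum.distrib distrib_right sum_distrib_left algebra_simps if_distrib[of "\<lambda>x. x * _"] if_distrib[of "\<lambda>x. _ * x"] cong: if_cong)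
  have MN: "(M *v Z) $ None = of_real d * (s + b)"
   unfolding matrix_vector_mult_def M_def by (simp add: sum_option a_def b_def s_def hprod_def sum_distrib_left algebra_simps)
  have L: "lorentz_form U = (cmod (U $ None))^2 - (norm (\<chi> j. U $ Some j))^2" for U :: "complex^('n option)"
   unfolding lorentz_form_def norm_vec_def L2_set_def by (simp add: sum_nonneg)
  have N: "(norm (a + m *s w))^2 = (norm a)^2 + 2 * Re (cnj m * s) + (cmod m)^2 * r"
  proof -
   have "complex_of_real ((norm (a + m *s w))^2) = hprod a a + cnj m * s + m * cnj s + m * cnj m * hprod w w"
    unfolding hprod_self[symmetric] by (simp add: hprod_add_left hprod_add_right hprod_scale_left hprod_scale_right cnj_hprod s_def algebra_simps)
   also have "m * cnj s = cnj (cnj m * s)" by simp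
   also have "hprod a a + cnj m * s + cnj (cnj m * s) + m * cnj m * hprod w w = hprod a a + (cnj m * s + cnj (cnj m * s)) + m * cnj m * hprod w w" by (simp only: add.assoc)
   also have "\<dots> = of_real ((norm a)^2 + 2 * Re (cnj m * s) + (cmod m)^2 * r)"
    unfolding complex_add_cnj hprod_self by (simp only: of_real_add of_real_mult complex_norm_square r_def of_real_numeral)
   finally show ?thesis by (simp only: of_real_eq_iff)
  qed
  have ka: "d^2 - 2 * \<kappa> - \<kappa> * (\<kappa> * r) = 0" unfolding k2 k1[symmetric] by (simp add: algebra_simps)
  have "d^2 * (cmod (s + b))^2 - 2 * Re (cnj m * s) - (cmod m)^2 * r = (cmod b)^2"
  proof -
   have "d^2 * (cmod (s + b))^2 - 2 * Re (cnj m * s) - (cmod m)^2 * r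
    = (d^2 - 2 * \<kappa> - \<kappa> * (\<kappa> * r)) * (cmod s)^2 + (2 * d^2 - 2 * d - 2 * d * (\<kappa> * r)) * (Re s * Re b + Im s * Im b) + (d^2 * (1 - r)) * (cmod b)^2"
    unfolding m_def cmod_power2 by (simp add: power2_eq_square algebra_simps)
   thus ?thesis unfolding ka unfolding k2 d2 by (simp add: power2_eq_square algebra_simps)
  qed
  moreover have "(\<chi> j. (M *v Z) $ Some j) = a + m *s w" by (simp add: vec_eq_iff MS)
  ultimately show ?thesis unfolding L[of "M *v Z"] L[of Z] using N
   by (simp add: MN norm_mult power_mult_distrib a_def[symmetric] b_def[symmetric])
 qed
 hence fp: "form_preserving M" by (simp add: form_preserving_def)
 obtain x where x: "x \<in> SU_n1" "\<And>z. act x z = act M z" by (rule SU_scaling[OF fp]; rule that)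
 have "act M 0 = w"
  using d0 by (simp add: vec_eq_iff act_def M_def)
 thus ?thesis using that x by metis
qed

lemma stab0_of_unitary:
 fixes U :: "complex^'n^'n::finite"
 assumes U: "\<And>a. norm (U *v a) = norm a"
 obtains k where "k \<in> stab0" "\<And>z. act k z = U *v z"
proof -
 define M :: "'n gmat" where "M = (\<chi> i j. case i of
   Some i' \<Rightarrow> (case j of Some j' \<Rightarrow> U $ i' $ j' | None \<Rightarrow> 0) | None \<Rightarrow> (case j of Some j' \<Rightarrow> 0 | None \<Rightarrow> 1))"
 have "lorentz_form (M *v Z) = lorentz_form Z" for Z
 proof -
  have L: "lorentz_form U = (cmod (U $ None))^2 - (norm (\<chi> j. U $ Some j))^2" for U :: "complex^('n option)"
   unfolding lorentz_form_def norm_vec_def L2_set_def by (simp add: sum_nonneg)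
  have "(\<chi> j. (M *v Z) $ Some j) = U *v (\<chi> j. Z $ Some j)" "(M *v Z) $ None = Z $ None"
   by (simp_all add: vec_eq_iff matrix_vector_mult_def sum_option M_def)
  thus ?thesis unfolding L by (simp add: U)
 qed
 hence fp: "form_preserving M" by (simp add: form_preserving_def)
 obtain k where k: "k \<in> SU_n1" "\<And>z. act k z = act M z" by (rule SU_scaling[OF fp]; rule that)
 have "act M z = U *v z" for z
  by (simp add: vec_eq_iff act_def M_def matrix_vector_mult_def)
 thus ?thesis using that[of k] k by (simp add: stab0_def)
qed

lemma stab0_scalar:
 assumes "cmod c = 1" obtains k :: "('n::finite) gmat" where "k \<in> stab0" "\<And>z. act k z = c *s z"
proof -
 have e: "(\<chi> i j. if i = j then c else 0) *v z = c *s z" for z :: "complex^'n"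
  by (simp add: vec_eq_iff matrix_vector_mult_def if_distrib[of "\<lambda>x. x * _"] cong: if_cong)
 have "norm (c *s z) = norm z" for z :: "complex^'n"
  unfolding norm_vec_def by (simp add: norm_mult assms)
 hence *: "\<And>a :: complex^'n. norm ((\<chi> i j. if i = j then c else 0) *v a) = norm a" unfolding e .
 obtain k :: "'n gmat" where "k \<in> stab0" "\<And>z. act k z = (\<chi> i j. if i = j then c else 0) *v z"
  by (rule stab0_of_unitary[OF *]; rule that)
 thus ?thesis using that unfolding e by blast
qed

text \<open>The complex reflection that multiplies v by c and fixes its orthogonal complement. Such
  elements give transitivity on spheres and rotate one direction while fixing a vector orthogonal to
  it.\<close>

lemma stab0_reflection:
 fixes v :: "complex^'n::finite"
 assumes c: "cmod c = 1" and v: "norm v = 1"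
 obtains k :: "'n gmat" where "k \<in> stab0" "\<And>z. act k z = z + ((c - 1) * hprod z v) *s v"
proof -
 let ?U = "\<chi> i j. (if i = j then 1 else 0) + (c - 1) * v $ i * cnj (v $ j)"
 have e: "?U *v z = z + ((c - 1) * hprod z v) *s v" for z :: "complex^'n"
 proof (rule vec_eq_iff[THEN iffD2], rule allI)
  fix i
  have "(?U *v z) $ i = (\<Sum>j\<in>UNIV. (if i = j then 1 else 0) * z $ j) + (\<Sum>j\<in>UNIV. (c - 1) * v $ i * cnj (v $ j) * z $ j)"
   by (simp only: matrix_vector_mult_def vec_lambda_beta distrib_right sum.distrib)
  also have "(\<Sum>j\<in>UNIV. (if i = j then 1 else 0) * z $ j) = z $ i"
   by (simp add: if_distrib[of "\<lambda>x. x * _"] cong: if_cong)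
  also have "(\<Sum>j\<in>UNIV. (c - 1) * v $ i * cnj (v $ j) * z $ j) = (c - 1) * hprod z v * v $ i"
   by (simp add: hprod_def sum_distrib_left sum_distrib_right mult_ac)
  finally show "(?U *v z) $ i = (z + ((c - 1) * hprod z v) *s v) $ i" by simp
 qed
 have *: "norm (?U *v z) = norm z" for z
 proof -
  define s where "s = hprod z v"
  have cc: "c * cnj c = 1" using c by (simp add: complex_norm_square[symmetric])
  have "complex_of_real ((norm (?U *v z))^2) = hprod z z + cnj (c - 1) * cnj s * s + (c - 1) * s * cnj s + (c - 1) * cnj (c - 1) * s * cnj s"
  proof -
   have "hprod (z + p *s v) (z + p *s v) = hprod z z + cnj p * hprod z v + p * hprod v z + p * cnj p" for p
    using v by (simp add: hprod_add_left hprod_add_right hprod_scale_left hprod_scale_right hprod_self[of v] algebra_simps)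
   thus ?thesis unfolding e hprod_self[symmetric] s_def by (simp add: cnj_hprod mult_ac)
  qed
  also have "\<dots> = hprod z z + (c * cnj c - 1) * (s * cnj s)" by (simp add: algebra_simps)
  also have "\<dots> = of_real ((norm z)^2)" unfolding cc by (simp add: hprod_self)
  finally have "(norm (?U *v z))^2 = (norm z)^2" by (simp only: of_real_eq_iff)
  thus ?thesis by (simp add: power2_eq_iff_nonneg)
 qed
 obtain k :: "'n gmat" where "k \<in> stab0" "\<And>z. act k z = ?U *v z"
  by (rule stab0_of_unitary[OF *]; rule that)
 thus ?thesis using that unfolding e by blast
qed

lemma stab0_SU: "k \<in> stab0 \<Longrightarrow> k \<in> SU_n1" by (simp add: stab0_def)

text \<open>With k 0 = 0, \<open>act_identity\<close> at the point 0 says that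
  \<open>den k z\<close> times the conjugate of \<open>den k 0\<close> is 1. So \<open>den k\<close>
  is constant of modulus 1 and drops out of the identity for z and u.\<close>

lemma stab0_hprod:
 assumes k: "k \<in> stab0" and z: "norm z < 1" and u: "norm u < 1"
 shows "hprod (act k z) (act k u) = hprod z u"
proof -
 have fp: "form_preserving k" and k0: "act k 0 = 0" using k by (auto simp: stab0_def SU_form)
 have a: "den k z * cnj (den k 0) = 1" if "norm z < 1" for z
  using act_identity[OF fp that, of 0] by (simp add: k0)
 have "den k z = den k 0" using a[OF z] a[of 0] by (metis mult_cancel_right mult_zero_right norm_zero zero_less_one zero_neq_one)
 moreover have "den k u = den k 0" using a[OF u] a[of 0] by (metis mult_cancel_right mult_zero_right norm_zero zero_less_one zero_neq_one)
 ultimately show ?thesis using act_identity[OF fp z u] a[of 0] by simp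
qed

lemma stab0_norm:
 assumes k: "k \<in> stab0" and z: "norm z < 1" shows "norm (act k z) = norm z"
proof -
 have "complex_of_real ((norm (act k z))^2) = of_real ((norm z)^2)" using stab0_hprod[OF k z z] by (simp add: hprod_self)
 hence "(norm (act k z))^2 = (norm z)^2" by (simp only: of_real_eq_iff)
 thus ?thesis by (simp add: power2_eq_iff_nonneg)
qed

lemma stab0_inverse: "k \<in> stab0 \<Longrightarrow> matrix_inv k \<in> stab0"
 unfolding stab0_def using SU_inverse(1) act_inverse(2)[of k 0] by fastforce

section \<open>Measurability of the action and the invariant measure on the ball\<close>

lemma borel_measurable_vec:
 assumes "\<And>i. (\<lambda>x. f x $ i) \<in> borel_measurable M"
 shows "(f :: _ \<Rightarrow> complex^'n::finite) \<in> borel_measurable M"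
proof (subst borel_measurable_euclidean_space, rule ballI)
 fix b :: "complex^'n" assume "b \<in> Basis"
 then obtain i c where "b = axis i c" by (auto simp: Basis_vec_def)
 thus "(\<lambda>x. f x \<bullet> b) \<in> borel_measurable M" using assms[of i] by (simp add: inner_axis)
qed

lemma measurable_act [measurable]: "act x \<in> borel_measurable borel"
proof -
 have [measurable]: "(\<lambda>z. z $ j) \<in> borel_measurable (borel :: (complex^'a::finite) measure)" for j
  by (intro borel_measurable_continuous_onI continuous_intros)
 show ?thesis unfolding act_def by (rule borel_measurable_vec) simp
qed

lemma measurable_act_group:
 assumes "sets m = sets (restrict_space borel SU_n1)"
 shows "(\<lambda>x. act x z) \<in> borel_measurable m"
proof -
 have "(\<lambda>x. act x z) \<in> borel_measurable borel"
  unfolding act_def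
 proof (rule borel_measurable_vec)
  fix i :: 'a
  have [measurable]: "(\<lambda>x::('a::finite) gmat. x $ a $ b) \<in> borel_measurable borel" for a b
   by (intro borel_measurable_continuous_onI continuous_intros)
  show "(\<lambda>x::'a gmat. (\<chi> i. ((\<Sum>j\<in>UNIV. x $ Some i $ Some j * z $ j) + x $ Some i $ None) /
          ((\<Sum>j\<in>UNIV. x $ None $ Some j * z $ j) + x $ None $ None)) $ i) \<in> borel_measurable borel"
   by simp
 qed
 hence "(\<lambda>x. act x z) \<in> borel_measurable (restrict_space borel SU_n1)" by (rule measurable_restrict_space1)
 thus ?thesis using assms by (simp cong: measurable_cong_sets)
qed

context
 fixes haar :: "('n::finite) gmat measure"
 assumes haar: "normalized_haar haar"
begin

lemma sets_haar: "sets haar = sets (restrict_space borel SU_n1)" using haar by (simp add: normalized_haar_def)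

lemma space_haar: "space haar = SU_n1"
 using sets_eq_imp_space_eq[OF sets_haar] by (simp add: space_restrict_space)

lemma haar_pushforward: "distr haar borel (\<lambda>x. act x 0) = iota"
proof (rule measure_eqI)
 fix A assume "A \<in> sets (distr haar borel (\<lambda>x. act x 0))"
 hence A: "A \<in> sets borel" by simp
 note m = measurable_act_group[OF sets_haar, of 0]
 have "emeasure (distr haar borel (\<lambda>x. act x 0)) A = (\<integral>\<^sup>+z. indicator A z \<partial>distr haar borel (\<lambda>x. act x 0))"
  using A by simp
 also have "\<dots> = (\<integral>\<^sup>+x. indicator A (act x 0) \<partial>haar)" by (rule nn_integral_distr[OF m]) (use A in auto)
 also have "\<dots> = (\<integral>\<^sup>+z. indicator A z \<partial>iota)" using haar A by (simp add: normalized_haar_def)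
 also have "\<dots> = emeasure iota A" using A by simp
 finally show "emeasure (distr haar borel (\<lambda>x. act x 0)) A = emeasure iota A" .
qed simp

text \<open>The map from x to x 0 carries Haar measure to \<open>iota\<close> and intertwines left
  translation with the action, so invariance is inherited from Haar measure.\<close>

lemma iota_invariant:
 assumes y: "y \<in> SU_n1" shows "distr (iota :: (complex^'n) measure) borel (act y) = iota"
proof (rule measure_eqI)
 fix A assume "A \<in> sets (distr (iota :: (complex^'n) measure) borel (act y))"
 hence A: "A \<in> sets borel" by simp
 have inv: "distr haar haar (\<lambda>x. y ** x) = haar" using haar y by (simp add: normalized_haar_def)
 have my: "(\<lambda>x. y ** x) \<in> measurable haar haar"
 proof -
  have "(\<lambda>x. y ** x) \<in> borel_measurable borel"
   unfolding matrix_matrix_mult_def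
   by (intro borel_measurable_continuous_onI continuous_on_vec_lambda continuous_intros)
  hence "(\<lambda>x. y ** x) \<in> measurable (restrict_space borel SU_n1) (restrict_space borel SU_n1)"
   by (intro measurable_restrict_space2 measurable_restrict_space1) (auto simp: space_restrict_space SU_mult[OF y])
  thus ?thesis using sets_haar by (simp cong: measurable_cong_sets)
 qed
 note m = measurable_act_group[OF sets_haar, of 0]
 have "emeasure (distr (iota :: (complex^'n) measure) borel (act y)) A = (\<integral>\<^sup>+z. indicator A (act y z) \<partial>iota)"
  using A by (subst nn_integral_indicator[symmetric], simp, subst nn_integral_distr) auto
 also have "\<dots> = (\<integral>\<^sup>+x. indicator A (act y (act x 0)) \<partial>haar)"
  unfolding haar_pushforward[symmetric] using A by (intro nn_integral_distr m) auto
 also have "\<dots> = (\<integral>\<^sup>+x. indicator A (act (y ** x) 0) \<partial>haar)"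
  by (rule nn_integral_cong) (simp add: space_haar act_mult SU_form y)
 also have "\<dots> = (\<integral>\<^sup>+x. indicator A (act x 0) \<partial>distr haar haar (\<lambda>x. y ** x))"
  by (rule nn_integral_distr[OF my, symmetric]) (simp add: measurable_compose[OF m borel_measurable_indicator[OF A]])
 also have "\<dots> = emeasure iota A"
  unfolding inv using haar A by (simp add: normalized_haar_def)
 finally show "emeasure (distr (iota :: (complex^'n) measure) borel (act y)) A = emeasure iota A" .
qed simp

end

section \<open>The Plancherel side\<close>

lemma borel_measurable_cnj [measurable (raw)]:
 "f \<in> borel_measurable M \<Longrightarrow> (\<lambda>x. cnj (f x)) \<in> borel_measurable M"
 by (rule measurable_compose[where g = cnj and N = borel]) (auto intro!: borel_measurable_continuous_onI continuous_intros)

section \<open>Square integrable functions: inner product, norm and basic inequalities\<close>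

abbreviation L2 :: "'a measure \<Rightarrow> ('a \<Rightarrow> complex) set" where
 "L2 M \<equiv> ips_carrier (L2_space M)"

definition ip :: "'a measure \<Rightarrow> ('a \<Rightarrow> complex) \<Rightarrow> ('a \<Rightarrow> complex) \<Rightarrow> complex" where
 "ip M f g = (LINT x|M. f x * cnj (g x))"

definition nrm :: "'a measure \<Rightarrow> ('a \<Rightarrow> complex) \<Rightarrow> real" where
 "nrm M f = sqrt (LINT x|M. (cmod (f x))^2)"

lemma L2_iff: "f \<in> L2 M \<longleftrightarrow> f \<in> borel_measurable M \<and> integrable M (\<lambda>x. (cmod (f x))^2)"
 by (simp add: L2_space_def)

lemma L2_measurable: "f \<in> L2 M \<Longrightarrow> f \<in> borel_measurable M" by (simp add: L2_iff)
lemma L2_integrable: "f \<in> L2 M \<Longrightarrow> integrable M (\<lambda>x. (cmod (f x))^2)" by (simp add: L2_iff)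

lemma ips_inner_L2: "ips_inner (L2_space M) f g = ip M f g" by (simp add: L2_space_def ip_def)

lemma L2_norm_mult_integrable:
 assumes "f \<in> L2 M" "g \<in> L2 M" shows "integrable M (\<lambda>x. cmod (f x) * cmod (g x))"
proof (rule Bochner_Integration.integrable_bound)
 show "integrable M (\<lambda>x. (cmod (f x))^2 + (cmod (g x))^2)" using assms by (auto simp: L2_iff)
 show "(\<lambda>x. cmod (f x) * cmod (g x)) \<in> borel_measurable M" using assms by (auto simp: L2_iff)
 show "AE x in M. norm (cmod (f x) * cmod (g x)) \<le> norm ((cmod (f x))^2 + (cmod (g x))^2)"
 proof (rule AE_I2)
  fix x
  have "2 * (cmod (f x) * cmod (g x)) \<le> (cmod (f x))^2 + (cmod (g x))^2"
   using sum_squares_bound[of "cmod (f x)" "cmod (g x)"] by (simp add: mult.assoc)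
  moreover have "0 \<le> cmod (f x) * cmod (g x)" by simp
  ultimately have "cmod (f x) * cmod (g x) \<le> (cmod (f x))^2 + (cmod (g x))^2" by linarith
  thus "norm (cmod (f x) * cmod (g x)) \<le> norm ((cmod (f x))^2 + (cmod (g x))^2)" by simp
 qed
qed

lemma L2_mult_integrable:
 assumes "f \<in> L2 M" "g \<in> L2 M" shows "integrable M (\<lambda>x. f x * cnj (g x))"
 by (rule Bochner_Integration.integrable_bound[OF L2_norm_mult_integrable[OF assms]])
   (use assms in \<open>auto simp: L2_iff norm_mult\<close>)

lemma L2_scale: "f \<in> L2 M \<Longrightarrow> (\<lambda>x. c * f x) \<in> L2 M"
 by (auto simp: L2_iff norm_mult power_mult_distrib)

lemma L2_add:
 assumes "f \<in> L2 M" "g \<in> L2 M" shows "(\<lambda>x. f x + g x) \<in> L2 M"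
proof -
 have "integrable M (\<lambda>x. (cmod (f x + g x))^2)"
 proof (rule Bochner_Integration.integrable_bound)
  show "integrable M (\<lambda>x. 2 * (cmod (f x))^2 + 2 * (cmod (g x))^2)" using assms by (auto simp: L2_iff)
  show "(\<lambda>x. (cmod (f x + g x))^2) \<in> borel_measurable M" using assms by (auto simp: L2_iff)
  show "AE x in M. norm ((cmod (f x + g x))^2) \<le> norm (2 * (cmod (f x))^2 + 2 * (cmod (g x))^2)"
  proof (rule AE_I2)
   fix x
   have "(cmod (f x + g x))^2 \<le> (cmod (f x) + cmod (g x))^2" by (intro power_mono norm_triangle_ineq) auto
   also have "\<dots> \<le> 2 * (cmod (f x))^2 + 2 * (cmod (g x))^2"
    using sum_squares_bound[of "cmod (f x)" "cmod (g x)"] by (simp add: power2_sum)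
   finally show "norm ((cmod (f x + g x))^2) \<le> norm (2 * (cmod (f x))^2 + 2 * (cmod (g x))^2)" by simp
  qed
 qed
 thus ?thesis using assms by (auto simp: L2_iff)
qed

lemma L2_diff: assumes "f \<in> L2 M" "g \<in> L2 M" shows "(\<lambda>x. f x - g x) \<in> L2 M"
 using L2_add[OF assms(1) L2_scale[OF assms(2), of "-1"]] by simp

lemma L2_zero: "(\<lambda>x. 0) \<in> L2 M" by (simp add: L2_iff)

lemma L2_sum: "(\<And>i. i \<in> I \<Longrightarrow> f i \<in> L2 M) \<Longrightarrow> (\<lambda>x. \<Sum>i\<in>I. f i x) \<in> L2 M"
 by (induction I rule: infinite_finite_induct) (auto intro: L2_add L2_zero)

lemma ip_add_left: "f \<in> L2 M \<Longrightarrow> g \<in> L2 M \<Longrightarrow> h \<in> L2 M \<Longrightarrow> ip M (\<lambda>x. f x + g x) h = ip M f h + ip M g h"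
 unfolding ip_def by (simp add: distrib_right L2_mult_integrable)
lemma ip_diff_left: "f \<in> L2 M \<Longrightarrow> g \<in> L2 M \<Longrightarrow> h \<in> L2 M \<Longrightarrow> ip M (\<lambda>x. f x - g x) h = ip M f h - ip M g h"
 unfolding ip_def by (simp add: left_diff_distrib L2_mult_integrable)
lemma ip_scale_left: "ip M (\<lambda>x. c * f x) h = c * ip M f h"
 unfolding ip_def by (simp add: mult.assoc)
lemma cnj_ip: "cnj (ip M f g) = ip M g f"
 unfolding ip_def using Bochner_Integration.integral_cnj[of M "\<lambda>x. f x * cnj (g x)"] by (simp add: mult.commute)
lemma ip_add_right: "f \<in> L2 M \<Longrightarrow> g \<in> L2 M \<Longrightarrow> h \<in> L2 M \<Longrightarrow> ip M h (\<lambda>x. f x + g x) = ip M h f + ip M h g"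
 unfolding ip_def by (simp add: distrib_left L2_mult_integrable)
lemma ip_diff_right: "f \<in> L2 M \<Longrightarrow> g \<in> L2 M \<Longrightarrow> h \<in> L2 M \<Longrightarrow> ip M h (\<lambda>x. f x - g x) = ip M h f - ip M h g"
 unfolding ip_def by (simp add: right_diff_distrib L2_mult_integrable)
lemma ip_scale_right: "ip M h (\<lambda>x. c * f x) = cnj c * ip M h f"
 unfolding ip_def by (simp add: mult.left_commute)
lemma ip_sum_left: "(\<And>i. i \<in> I \<Longrightarrow> f i \<in> L2 M) \<Longrightarrow> h \<in> L2 M \<Longrightarrow> ip M (\<lambda>x. \<Sum>i\<in>I. f i x) h = (\<Sum>i\<in>I. ip M (f i) h)"
 unfolding ip_def by (simp add: sum_distrib_right L2_mult_integrable)
lemma ip_sum_right: "(\<And>i. i \<in> I \<Longrightarrow> f i \<in> L2 M) \<Longrightarrow> h \<in> L2 M \<Longrightarrow> ip M h (\<lambda>x. \<Sum>i\<in>I. f i x) = (\<Sum>i\<in>I. ip M h (f i))"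
 unfolding ip_def by (simp add: sum_distrib_left cnj_sum L2_mult_integrable)

lemma ip_cong_AE:
 assumes "f \<in> L2 M" "g \<in> L2 M" "f' \<in> L2 M" "g' \<in> L2 M" "AE x in M. f x = f' x" "AE x in M. g x = g' x"
 shows "ip M f g = ip M f' g'"
 unfolding ip_def by (rule integral_cong_AE) (use assms in \<open>auto simp: L2_iff\<close>)

lemma nrm_nonneg [simp]: "nrm M f \<ge> 0" by (simp add: nrm_def integral_nonneg)

lemma nrm_sq: "(nrm M f)^2 = (LINT x|M. (cmod (f x))^2)" by (simp add: nrm_def integral_nonneg)

lemma ip_self: "ip M f f = of_real ((nrm M f)^2)"
 unfolding nrm_sq ip_def integral_complex_of_real[symmetric] complex_norm_square ..

lemma ips_norm_L2: "ips_norm (L2_space M) f = nrm M f"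
 by (simp add: ips_norm_def ips_inner_L2 ip_self)

lemma nrm_scale: "nrm M (\<lambda>x. c * f x) = cmod c * nrm M f"
 unfolding nrm_def by (simp add: norm_mult power_mult_distrib real_sqrt_mult)

lemma L2_norm_CS:
 assumes "f \<in> L2 M" "g \<in> L2 M"
 shows "(LINT x|M. cmod (f x) * cmod (g x)) \<le> nrm M f * nrm M g"
proof -
 let ?I = "LINT x|M. cmod (f x) * cmod (g x)"
 have [measurable]: "f \<in> borel_measurable M" "g \<in> borel_measurable M" using assms by (auto simp: L2_iff)
 have "(\<integral>\<^sup>+x. ennreal (cmod (f x)) * ennreal (cmod (g x)) \<partial>M)^2 \<le>
   (\<integral>\<^sup>+x. (ennreal (cmod (f x)))^2 \<partial>M) * (\<integral>\<^sup>+x. (ennreal (cmod (g x)))^2 \<partial>M)"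
  by (rule Cauchy_Schwarz_nn_integral) measurable
 moreover have "(\<integral>\<^sup>+x. ennreal (cmod (f x)) * ennreal (cmod (g x)) \<partial>M) = ennreal ?I"
  using nn_integral_eq_integral[OF L2_norm_mult_integrable[OF assms]] by (simp add: ennreal_mult)
 moreover have "(\<integral>\<^sup>+x. (ennreal (cmod (f x)))^2 \<partial>M) = ennreal ((nrm M f)^2)"
  using nn_integral_eq_integral[OF L2_integrable[OF assms(1)]] by (simp add: ennreal_power nrm_sq)
 moreover have "(\<integral>\<^sup>+x. (ennreal (cmod (g x)))^2 \<partial>M) = ennreal ((nrm M g)^2)"
  using nn_integral_eq_integral[OF L2_integrable[OF assms(2)]] by (simp add: ennreal_power nrm_sq)
 ultimately have "ennreal (?I^2) \<le> ennreal ((nrm M f * nrm M g)^2)"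
  by (simp add: ennreal_power integral_nonneg power_mult_distrib flip: ennreal_mult)
 hence "?I^2 \<le> (nrm M f * nrm M g)^2" by (subst (asm) ennreal_le_iff) auto
 thus ?thesis by (rule power2_le_imp_le) simp
qed

lemma L2_CS:
 assumes "f \<in> L2 M" "g \<in> L2 M" shows "cmod (ip M f g) \<le> nrm M f * nrm M g"
proof -
 have "cmod (ip M f g) \<le> (LINT x|M. cmod (f x * cnj (g x)))" unfolding ip_def by (rule integral_norm_bound)
 thus ?thesis using L2_norm_CS[OF assms] by (simp add: norm_mult)
qed

lemma nrm_eq_0_iff:
 assumes "f \<in> L2 M" shows "nrm M f = 0 \<longleftrightarrow> (AE x in M. f x = 0)"
 unfolding nrm_def using integral_nonneg_eq_0_iff_AE[OF L2_integrable[OF assms]] by simp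

lemma nrm_add_sq:
 assumes "f \<in> L2 M" "g \<in> L2 M"
 shows "(nrm M (\<lambda>x. f x + g x))^2 = (nrm M f)^2 + 2 * Re (ip M f g) + (nrm M g)^2"
proof -
 have "complex_of_real ((nrm M (\<lambda>x. f x + g x))^2) = ip M f f + (ip M f g + cnj (ip M f g)) + ip M g g"
  unfolding ip_self[symmetric] using assms by (simp add: ip_add_left ip_add_right L2_add cnj_ip)
 also have "\<dots> = of_real ((nrm M f)^2 + 2 * Re (ip M f g) + (nrm M g)^2)"
  unfolding complex_add_cnj ip_self by simp
 finally show ?thesis by (simp only: of_real_eq_iff)
qed

lemma nrm_triangle:
 assumes "f \<in> L2 M" "g \<in> L2 M" shows "nrm M (\<lambda>x. f x + g x) \<le> nrm M f + nrm M g"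
proof (rule power2_le_imp_le)
 have "Re (ip M f g) \<le> nrm M f * nrm M g" using L2_CS[OF assms] complex_Re_le_cmod order_trans by blast
 thus "(nrm M (\<lambda>x. f x + g x))^2 \<le> (nrm M f + nrm M g)^2"
  unfolding nrm_add_sq[OF assms] by (simp add: power2_sum)
qed simp

lemma nrm_diff_comm: "nrm M (\<lambda>x. f x - g x) = nrm M (\<lambda>x. g x - f x)"
 by (simp add: nrm_def norm_minus_commute)

lemma ips_eq_L2:
 assumes "f \<in> L2 M" "g \<in> L2 M" shows "ips_eq (L2_space M) f g \<longleftrightarrow> (AE x in M. f x = g x)"
proof -
 have "ips_eq (L2_space M) f g \<longleftrightarrow> nrm M (\<lambda>x. f x - g x) = 0"
  by (simp add: ips_eq_def ips_norm_L2) (simp add: L2_space_def)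
 thus ?thesis using nrm_eq_0_iff[OF L2_diff[OF assms]] by simp
qed

lemma nrm_sum_sq:
 assumes "\<And>i. i < (N::nat) \<Longrightarrow> f i \<in> L2 M" "\<And>i j. i < N \<Longrightarrow> j < N \<Longrightarrow> i \<noteq> j \<Longrightarrow> ip M (f i) (f j) = 0"
 shows "(nrm M (\<lambda>x. \<Sum>i<N. f i x))^2 = (\<Sum>i<N. (nrm M (f i))^2)"
proof -
 have "complex_of_real ((nrm M (\<lambda>x. \<Sum>i<N. f i x))^2) = (\<Sum>i<N. \<Sum>j<N. ip M (f i) (f j))"
 proof -
  have m: "\<And>i. i \<in> {..<N} \<Longrightarrow> f i \<in> L2 M" using assms(1) by simp
  show ?thesis unfolding ip_self[symmetric]
   by (subst ip_sum_left[OF m L2_sum[OF m]]) (auto intro!: sum.cong ip_sum_right m)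
 qed
 also have "\<dots> = (\<Sum>i<N. \<Sum>j<N. if j = i then ip M (f i) (f i) else 0)"
  by (intro sum.cong refl) (use assms(2) in auto)
 also have "\<dots> = (\<Sum>i<N. ip M (f i) (f i))" by simp
 also have "\<dots> = of_real (\<Sum>i<N. (nrm M (f i))^2)" by (simp add: ip_self)
 finally show ?thesis by (simp only: of_real_eq_iff)
qed

lemma wfun_L2: "\<nu> > real CARD('n) \<Longrightarrow> wfun \<nu> k \<in> L2 (iota :: (complex^'n::finite) measure)"
proof -
 assume nu: "\<nu> > real CARD('n)"
 have "integrable (iota :: (complex^'n) measure) (\<lambda>z. ((norm z)^2) ^ (2 * k) * (1 - (norm z)^2) powr (2 * \<nu>))"
  by (rule integrable_iota_weight) (use nu in simp)
 moreover have "((norm z)^2) ^ (2 * k) * (1 - (norm z)^2) powr (2 * \<nu>) = (cmod (wfun \<nu> k z))^2" for z :: "complex^'n"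
 proof -
  have "((1 - (norm z)^2) powr \<nu>)^2 = (1 - (norm z)^2) powr (2 * \<nu>)"
   by (simp add: power2_eq_square flip: powr_add)
  thus ?thesis unfolding wfun_def norm_of_real power2_abs power_mult_distrib by (simp add: power_mult mult.commute)
 qed
 ultimately show ?thesis unfolding L2_iff by simp
qed

lemma wfun_radial_L1_L2:
 assumes nu: "\<nu> > real CARD('n)" shows "wfun \<nu> k \<in> (radial_L1_L2 :: (complex^'n::finite \<Rightarrow> complex) set)"
proof -
 have "radial_fun (wfun \<nu> k :: complex^'n \<Rightarrow> complex)"
  unfolding radial_fun_def
 proof
  fix g :: "'n gmat" assume g: "g \<in> stab0"
  show "AE z in iota. (wfun \<nu> k (act g z) :: complex) = wfun \<nu> k z"
   using AE_iota_ball by eventually_elim (simp add: wfun_def stab0_norm[OF g])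
 qed
 thus ?thesis using wfun_L2[OF nu] integrable_wfun[OF nu]
  by (simp add: radial_L1_L2_def radial_L2_def)
qed

lemma ip_wfun:
 assumes "\<nu> > real CARD('n)" "\<alpha> > real CARD('n)"
 shows "ip (iota :: (complex^'n::finite) measure) (wfun \<nu> k) (wfun \<alpha> 0) = of_real (real CARD('n) * Beta (real CARD('n) + real k) (\<nu> + \<alpha> - real CARD('n)))"
proof -
 have "wfun \<nu> k z * cnj (wfun \<alpha> 0 z) = of_real (((norm z)^2) ^ k * (1 - (norm z)^2) powr (\<nu> + \<alpha>))" for z :: "complex^'n"
  by (simp add: wfun_def powr_add mult.assoc)
 hence "ip (iota :: (complex^'n) measure) (wfun \<nu> k) (wfun \<alpha> 0) = of_real (LINT z|(iota :: (complex^'n) measure). ((norm z)^2) ^ k * (1 - (norm z)^2) powr (\<nu> + \<alpha>))"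
  unfolding ip_def by (simp only: integral_complex_of_real)
 also have "\<dots> = of_real (real CARD('n) * Beta (real CARD('n) + real k) (\<nu> + \<alpha> - real CARD('n)))"
  by (subst integral_iota_weight) (use assms in auto)
 finally show ?thesis .
qed

text \<open>The binomial coefficient (N+k-1 choose k), written so that it meets the Pochhammer
  symbols of the moments.\<close>

definition hdim :: "nat \<Rightarrow> nat \<Rightarrow> real" where "hdim N k = pochhammer (real N) k / fact k"

lemma hdim_ge_1: "N \<ge> 1 \<Longrightarrow> hdim N k \<ge> 1"
proof (induction k)
 case (Suc k)
 have "hdim N (Suc k) = hdim N k * ((real N + real k) / (real k + 1))"
  by (simp add: hdim_def pochhammer_Suc field_simps)
 also have "\<dots> \<ge> 1 * 1" using Suc by (intro mult_mono) auto
 finally show ?case by simp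
qed (simp add: hdim_def)

lemma hdim_pos: "N \<ge> 1 \<Longrightarrow> hdim N k > 0" using hdim_ge_1[of N k] by linarith

text \<open>Polynomial dependence on L reduces measurability and integrability of products of the
  s_k to powers of L, which are treated once in \<open>integrable_lap_power\<close>.\<close>

lemma sqc_poly:
 assumes "N \<ge> 1" "\<nu> > 0"
 shows "\<exists>p. \<forall>L. sq (real N) \<nu> L k = poly p L"
proof (induction k rule: less_induct)
 case (less k)
 show ?case
 proof (cases k)
  case 0 thus ?thesis by (intro exI[of _ 1]) simp
 next
  case (Suc j)
  obtain p where p: "\<And>L. sq (real N) \<nu> L j = poly p L" using less[of j] Suc by blast
  have "j - 1 < k" using Suc by simp
  then obtain q where q: "\<And>L. sq (real N) \<nu> L (j - 1) = poly q L" using less by blast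
  define a b where "a = (real j + real N) * (real j + \<nu>)" and "b = real j * (real j + \<nu> - 1)"
  have a: "a > 0" unfolding a_def using assms by (intro mult_pos_pos) auto
  have "sq (real N) \<nu> L k = poly (p + smult (1 / a) (smult b (p - q) - [:0, 1:] * p)) L" for L
  proof -
   have "a * (sq (real N) \<nu> L k - poly p L) = b * (poly p L - poly q L) - L * poly p L"
    using sq_rec[of "real N" \<nu> j L] assms unfolding p q a_def b_def Suc by simp
   thus ?thesis using a by (simp add: field_simps)
  qed
  thus ?thesis by blast
 qed
qed

locale plancherel_setting =
 fixes N :: nat and \<nu> :: real and \<mu> :: "real measure" and dummy :: "'n::finite itself"
 assumes NC: "N = CARD('n)" and nu: "\<nu> > real N" and pl: "plancherel_measure TYPE('n) \<mu>"
begin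

lemmas wfunD = wfun_radial_L1_L2[where 'n = 'n, folded NC]
lemmas st_wfun = spherical_transform_wfun_eq[where 'n = 'n, folded NC]
lemmas ipw = ip_wfun[where 'n = 'n, folded NC]

abbreviation "hh \<equiv> h_hat N \<nu>"
abbreviation "sk k l \<equiv> sqc N \<nu> l k"
abbreviation "rr m \<equiv> h_ratio N (\<nu> + real m)"
abbreviation "ft f l \<equiv> spherical_transform (f :: complex^'n \<Rightarrow> complex) (of_real l)"

lemma Npos: "N \<ge> 1" by (simp add: NC Suc_leI)
lemma nupos: "\<nu> > 0" using nu by simp

lemma sets_mu: "sets \<mu> = sets (restrict_space borel {0..})" using pl by (simp add: plancherel_measure_def)

lemma measurable_mu: "f \<in> borel_measurable borel \<Longrightarrow> f \<in> borel_measurable \<mu>"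
 unfolding measurable_cong_sets[OF sets_mu refl] by (rule measurable_restrict_space1)

lemma plancherel_ex: "\<exists>U. unitary_iso (radial_L2 :: (complex^'n \<Rightarrow> complex) ips) (L2_space \<mu>) U \<and>
  (\<forall>f\<in>radial_L1_L2. ips_eq (L2_space \<mu>) (U f) (ft f))"
 using pl by (simp add: plancherel_measure_def extends_to_unitary_iso_def)

text \<open>The unitary extension is only known to exist, so one is fixed. On
  \<open>radial_L1_L2\<close> it agrees with the integral transform almost everywhere.\<close>

definition U1 :: "(complex^'n \<Rightarrow> complex) \<Rightarrow> real \<Rightarrow> complex" where
 "U1 = (SOME U. unitary_iso (radial_L2 :: (complex^'n \<Rightarrow> complex) ips) (L2_space \<mu>) U \<and>
  (\<forall>f\<in>radial_L1_L2. ips_eq (L2_space \<mu>) (U f) (ft f)))"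

lemma U1: "unitary_iso radial_L2 (L2_space \<mu>) U1" "f \<in> radial_L1_L2 \<Longrightarrow> ips_eq (L2_space \<mu>) (U1 f) (ft f)"
 using someI_ex[OF plancherel_ex] unfolding U1_def by blast+

lemma radial_L2_carrier: "f \<in> ips_carrier radial_L2 \<longleftrightarrow> f \<in> L2 iota \<and> radial_fun f"
 by (simp add: radial_L2_def)

lemma radial_L1_L2_D: "f \<in> radial_L1_L2 \<Longrightarrow> f \<in> ips_carrier radial_L2" "f \<in> radial_L1_L2 \<Longrightarrow> integrable iota f"
 by (simp_all add: radial_L1_L2_def)

lemma ft_L2: "f \<in> radial_L1_L2 \<Longrightarrow> ft f \<in> L2 \<mu>"
 using pl by (simp add: plancherel_measure_def extends_to_unitary_iso_def)

lemma U1_L2: "f \<in> ips_carrier radial_L2 \<Longrightarrow> U1 f \<in> L2 \<mu>"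
 using U1(1) by (simp add: unitary_iso_def linear_op_def)

lemma U1_ip: "f \<in> ips_carrier radial_L2 \<Longrightarrow> g \<in> ips_carrier radial_L2 \<Longrightarrow> ip \<mu> (U1 f) (U1 g) = ip iota f g"
 using U1(1) unfolding unitary_iso_def ips_inner_L2 by (simp add: radial_L2_def ips_inner_L2)

lemma U1_AE: "f \<in> radial_L1_L2 \<Longrightarrow> AE l in \<mu>. U1 f l = ft f l"
 using U1(2) ips_eq_L2[OF U1_L2 ft_L2] radial_L1_L2_D by blast

lemma ft_ip:
 assumes "f \<in> radial_L1_L2" "g \<in> radial_L1_L2" shows "ip \<mu> (ft f) (ft g) = ip iota f g"
proof -
 have "ip \<mu> (ft f) (ft g) = ip \<mu> (U1 f) (U1 g)"
 proof (rule ip_cong_AE)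
  show "AE l in \<mu>. ft f l = U1 f l" using U1_AE[OF assms(1)] by eventually_elim simp
  show "AE l in \<mu>. ft g l = U1 g l" using U1_AE[OF assms(2)] by eventually_elim simp
 qed (use assms in \<open>auto intro: ft_L2 U1_L2 radial_L1_L2_D\<close>)
 thus ?thesis using U1_ip[OF radial_L1_L2_D(1)[OF assms(1)] radial_L1_L2_D(1)[OF assms(2)]] by simp
qed

lemma measurable_h_hat:
 assumes "\<alpha> > real N" shows "h_hat N \<alpha> \<in> borel_measurable \<mu>"
proof -
 have "ft (wfun \<alpha> 0) \<in> borel_measurable \<mu>" by (intro L2_measurable ft_L2 wfunD assms)
 hence "(\<lambda>l. Re (ft (wfun \<alpha> 0) l)) \<in> borel_measurable \<mu>" by measurable
 thus ?thesis using st_wfun[OF assms, of 0] by simp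
qed

lemma measurable_lap: "lap N \<in> borel_measurable \<mu>"
 by (rule measurable_mu) (simp add: lap_def[abs_def])

lemma measurable_poly_lap: "(\<lambda>l. poly p (lap N l)) \<in> borel_measurable \<mu>"
proof -
 have "(\<lambda>x. poly p x) \<in> borel_measurable borel" by (intro borel_measurable_continuous_onI continuous_intros)
 thus ?thesis using measurable_lap by (rule measurable_compose[rotated])
qed

definition wcoef :: "nat \<Rightarrow> real" where "wcoef k = pochhammer (real N) k / pochhammer \<nu> k"

lemma wcoef_pos: "wcoef k > 0"
 unfolding wcoef_def using nupos Npos by (intro divide_pos_pos pochhammer_pos) auto

definition bb :: "nat \<Rightarrow> nat \<Rightarrow> real" where
 "bb k m = real N * Beta (real N + real k) (2 * \<nu> + real m - real N) / (wcoef k * weight_integral N (\<nu> + real m))"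

text \<open>Up to constants the integrand is the product of the transforms of
  \<open>wfun \<nu> k\<close> and \<open>wfun (\<nu> + real m) 0\<close>, both square integrable.
  The isometry turns its integral into an inner product over the ball, which is a Beta
  integral.\<close>

lemma sk_h_ratio_integral:
 "integrable \<mu> (\<lambda>l. sk k l * hh l * rr m l)" "(LINT l|\<mu>. sk k l * hh l * rr m l) = bb k m"
proof -
 have nm: "\<nu> + real m > real N" using nu by simp
 note D = wfunD[OF nu, of k] wfunD[OF nm, of 0]
 have w: "weight_integral N (\<nu> + real m) > 0" by (rule weight_integral_pos[OF nm Npos])
 have e: "ft (wfun \<nu> k) l * cnj (ft (wfun (\<nu> + real m) 0) l) = of_real (wcoef k * weight_integral N (\<nu> + real m) * (sk k l * hh l * rr m l))" for l
  using w unfolding st_wfun[OF nu] st_wfun[OF nm] h_ratio_def wcoef_def by simp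
 have "integrable \<mu> (\<lambda>l. ft (wfun \<nu> k) l * cnj (ft (wfun (\<nu> + real m) 0) l))"
  by (intro L2_mult_integrable ft_L2 D)
 hence "integrable \<mu> (\<lambda>l. wcoef k * weight_integral N (\<nu> + real m) * (sk k l * hh l * rr m l))"
  unfolding e by (simp only: complex_of_real_integrable_eq)
 thus I: "integrable \<mu> (\<lambda>l. sk k l * hh l * rr m l)" using w wcoef_pos[of k] by simp
 have "complex_of_real (wcoef k * weight_integral N (\<nu> + real m) * (LINT l|\<mu>. sk k l * hh l * rr m l)) = ip \<mu> (ft (wfun \<nu> k)) (ft (wfun (\<nu> + real m) 0))"
  unfolding ip_def e integral_complex_of_real by simp
 also have "\<dots> = of_real (real N * Beta (real N + real k) (\<nu> + (\<nu> + real m) - real N))"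
  unfolding ft_ip[OF D] by (rule ipw[OF nu nm])
 finally have "wcoef k * weight_integral N (\<nu> + real m) * (LINT l|\<mu>. sk k l * hh l * rr m l) = real N * Beta (real N + real k) (\<nu> + (\<nu> + real m) - real N)"
  by (simp only: of_real_eq_iff)
 moreover have "\<nu> + (\<nu> + real m) - real N = 2 * \<nu> + real m - real N" by simp
 ultimately show "(LINT l|\<mu>. sk k l * hh l * rr m l) = bb k m"
  unfolding bb_def using w wcoef_pos[of k] by (simp add: field_simps)
qed

lemma weight_integral_shift: "(\<lambda>m. weight_integral N (\<nu> + real m + real p) / weight_integral N (\<nu> + real m)) \<longlonglongrightarrow> 1"
proof (induction p)
 case 0
 have "weight_integral N (\<nu> + real m) > 0" for m by (rule weight_integral_pos) (use nu Npos in auto)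
 hence "weight_integral N (\<nu> + real m + real 0) / weight_integral N (\<nu> + real m) = 1" for m
  by (simp add: less_imp_neq[symmetric])
 thus ?case by simp
next
 case (Suc p)
 have e: "weight_integral N (\<nu> + real m + real (Suc p)) = (\<nu> + real m + real p - real N) / (\<nu> + real m + real p) * weight_integral N (\<nu> + real m + real p)" for m
  using weight_integral_Suc[of N "\<nu> + real m + real p"] nu Npos by (simp add: add_ac)
 have "(\<lambda>m. (\<nu> + real m + real p - real N) / (\<nu> + real m + real p)) \<longlonglongrightarrow> 1" by real_asymp
 from tendsto_mult[OF this Suc] show ?case unfolding e by simp
qed

text \<open>\<open>bb k m\<close> is the mean of |z|^(2k) (1 - |z|^2)^\<nu> under the normalized
  weight of exponent \<nu> + m, divided by \<open>wcoef k\<close>. The weight concentrates at the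
  center, so the limit is the value at 0.\<close>

lemma bb_tendsto: "bb k \<longlonglongrightarrow> (if k = 0 then 1 else 0)"
proof (cases "k = 0")
 case True
 \<comment> \<open>Beta decreases in its second argument, so a shift of the exponent by an integer p
   \<ge> \<nu> bounds the shift by \<nu> from below; integer shifts are handled by
   \<open>weight_integral_shift\<close>.\<close>
 obtain p :: nat where p: "real p \<ge> \<nu>" using real_arch_simple by blast
 have W: "weight_integral N (\<nu> + real m) > 0" for m by (rule weight_integral_pos) (use nu Npos in auto)
 have b: "bb k m = weight_integral N (2 * \<nu> + real m) / weight_integral N (\<nu> + real m)" for m
  unfolding bb_def weight_integral_def using True by (simp add: wcoef_def)
 have "weight_integral N (\<nu> + real m + real p) / weight_integral N (\<nu> + real m) \<le> bb k m" for m
  unfolding b using W[of m] p nu Npos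
  by (intro divide_right_mono) (auto simp: weight_integral_def intro!: mult_left_mono Beta_real_mono)
 moreover have "bb k m \<le> 1" for m
 proof -
  have "weight_integral N (2 * \<nu> + real m) \<le> weight_integral N (\<nu> + real m)"
   using nu Npos by (auto simp: weight_integral_def intro!: mult_left_mono Beta_real_mono)
  thus ?thesis unfolding b using W[of m] by (simp add: divide_le_eq)
 qed
 ultimately have "bb k \<longlonglongrightarrow> 1"
  by (intro tendsto_sandwich[OF _ _ weight_integral_shift[of p] tendsto_const]) auto
 thus ?thesis using True by simp
next
 case False
 have "(\<lambda>m. real N / (\<nu> + real m)) \<longlonglongrightarrow> 0" by real_asymp
 hence lim: "(\<lambda>m. real N / (\<nu> + real m) / wcoef k) \<longlonglongrightarrow> 0" by (rule tendsto_divide_zero)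
 have "bb k m \<le> real N / (\<nu> + real m) / wcoef k" for m
 proof -
  have Bp: "Beta (real N) (\<nu> + real m - real N) > 0" using nu Npos by (simp add: Beta_def Gamma_real_pos)
  have "Beta (real N + real k) (2 * \<nu> + real m - real N) \<le> Beta (real N + 1) (\<nu> + real m - real N)"
   using False nu Npos by (intro Beta_real_mono) auto
  also have "\<dots> = real N / (\<nu> + real m) * Beta (real N) (\<nu> + real m - real N)"
  proof -
   have "(real N + (\<nu> + real m - real N)) * Beta (real N + 1) (\<nu> + real m - real N) = real N * Beta (real N) (\<nu> + real m - real N)"
    by (rule Beta_plus1_left) (use Npos in \<open>auto dest: nonpos_Ints_nonpos\<close>)
   thus ?thesis using nupos by (simp add: field_simps)
  qed
  finally have "Beta (real N + real k) (2 * \<nu> + real m - real N) / Beta (real N) (\<nu> + real m - real N) \<le> real N / (\<nu> + real m)"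
   using Bp by (simp add: divide_le_eq)
  hence "Beta (real N + real k) (2 * \<nu> + real m - real N) / Beta (real N) (\<nu> + real m - real N) / wcoef k \<le> real N / (\<nu> + real m) / wcoef k"
   using wcoef_pos[of k] by (intro divide_right_mono) auto
  moreover have "bb k m = Beta (real N + real k) (2 * \<nu> + real m - real N) / Beta (real N) (\<nu> + real m - real N) / wcoef k"
   unfolding bb_def weight_integral_def using Npos by simp
  ultimately show ?thesis by simp
 qed
 moreover have "bb k m \<ge> 0" for m
  unfolding bb_def weight_integral_def using wcoef_pos[of k] nu Npos
  by (intro divide_nonneg_nonneg mult_nonneg_nonneg) (auto simp: Beta_def intro!: divide_nonneg_nonneg mult_nonneg_nonneg Gamma_real_nonneg)
 ultimately have "bb k \<longlonglongrightarrow> 0"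
  by (intro tendsto_sandwich[OF _ _ tendsto_const lim]) auto
 thus ?thesis using False by simp
qed

lemmas rr_mono = h_ratio_mono[where 'n = 'n, folded NC, OF nu]
lemmas rr_lim = h_ratio_tendsto[where 'n = 'n, folded NC, OF nu]
lemmas hh_pos = h_hat_pos[where 'n = 'n, folded NC, OF nu]
lemmas hh_le = h_hat_le[where 'n = 'n, folded NC, OF nu]
lemmas rr_le_1 = h_ratio_le_1[where 'n = 'n, folded NC, OF nu]

lemma rr_nonneg: "rr m l \<ge> 0"
proof -
 have "\<nu> + real m > real N" using nu by simp
 from h_ratio_pos[where 'n = 'n, folded NC, OF this, of l] show ?thesis by simp
qed

lemma measurable_hh: "hh \<in> borel_measurable \<mu>" by (rule measurable_h_hat[OF nu])

lemma measurable_rr: "rr m \<in> borel_measurable \<mu>"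
 unfolding h_ratio_def[abs_def]
 by (intro borel_measurable_divide measurable_h_hat borel_measurable_const) (use nu in simp)

lemma measurable_sk: "(\<lambda>l. sk k l) \<in> borel_measurable \<mu>"
proof -
 obtain p where "\<And>L. sq (real N) \<nu> L k = poly p L" using sqc_poly[OF Npos nupos] by blast
 thus ?thesis using measurable_poly_lap[of p] by simp
qed

definition Ak :: "nat \<Rightarrow> real" where "Ak k = (real k + real N) * (real k + \<nu>)"
definition Bk :: "nat \<Rightarrow> real" where "Bk k = real k * (real k + \<nu> - 1)"

lemma lap_sk: "lap N l * sk k l = (Ak k + Bk k) * sk k l - Ak k * sk (Suc k) l - Bk k * sk (k - 1) l"
 using sq_rec[of "real N" \<nu> k "lap N l"] Npos nupos unfolding Ak_def Bk_def by (simp add: algebra_simps)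

text \<open>This span contains the constants and, by the three-term recurrence, is closed under
  multiplication by L. So it contains every power of L, and the integrals of
  \<open>sk_h_ratio_integral\<close> are known on all of it.\<close>

definition sk_span :: "(real \<Rightarrow> real) \<Rightarrow> bool" where
 "sk_span q \<longleftrightarrow> (\<exists>d \<tau>. \<forall>l. q l = (\<Sum>i<(d::nat). \<tau> i * sk i l))"

lemma sk_span_sk: "sk_span (\<lambda>l. c * sk k l)"
 unfolding sk_span_def
 by (intro exI[of _ "Suc k"] exI[of _ "\<lambda>i. if i = k then c else 0"]) (simp add: if_distrib[of "\<lambda>x. x * _"] cong: if_cong)

lemma sk_span_add: assumes "sk_span p" "sk_span q" shows "sk_span (\<lambda>l. p l + q l)"
proof -
 obtain d \<tau> d' \<tau>' where p: "\<And>l. p l = (\<Sum>i<(d::nat). \<tau> i * sk i l)" and q: "\<And>l. q l = (\<Sum>i<(d'::nat). \<tau>' i * sk i l)"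
  using assms unfolding sk_span_def by metis
 have ext: "(\<Sum>i<d. \<tau> i * sk i l) = (\<Sum>i<e. (if i < d then \<tau> i else 0) * sk i l)" if "d \<le> e" for d e \<tau> l
  using that by (intro sum.mono_neutral_cong_left) auto
 have "p l + q l = (\<Sum>i<max d d'. ((if i < d then \<tau> i else 0) + (if i < d' then \<tau>' i else 0)) * sk i l)" for l
  unfolding p q ext[of d "max d d'", OF max.cobounded1] ext[of d' "max d d'", OF max.cobounded2]
  by (simp only: sum.distrib distrib_right)
 thus ?thesis unfolding sk_span_def
  by (intro exI[of _ "max d d'"] exI[of _ "\<lambda>i. (if i < d then \<tau> i else 0) + (if i < d' then \<tau>' i else 0)"]) simp
qed

lemma sk_span_sum: "(\<And>i. i < (d::nat) \<Longrightarrow> sk_span (f i)) \<Longrightarrow> sk_span (\<lambda>l. \<Sum>i<d. f i l)"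
proof (induction d)
 case 0
 show ?case using sk_span_sk[of 0 0] by simp
next
 case (Suc d)
 thus ?case by (simp add: sk_span_add)
qed

lemma sk_span_lap: assumes "sk_span q" shows "sk_span (\<lambda>l. lap N l * q l)"
proof -
 obtain d \<tau> where q: "\<And>l. q l = (\<Sum>i<(d::nat). \<tau> i * sk i l)" using assms unfolding sk_span_def by metis
 have "lap N l * q l = (\<Sum>i<d. (\<tau> i * (Ak i + Bk i)) * sk i l + ((- \<tau> i * Ak i) * sk (Suc i) l + (- \<tau> i * Bk i) * sk (i - 1) l))" for l
 proof -
  have "lap N l * q l = (\<Sum>i<d. \<tau> i * (lap N l * sk i l))" unfolding q by (simp add: sum_distrib_left mult.left_commute)
  thus ?thesis unfolding lap_sk by (simp add: algebra_simps)
 qed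
 thus ?thesis by (simp only:) (intro sk_span_sum sk_span_add sk_span_sk)
qed

lemma sk_span_lap_power: "sk_span (\<lambda>l. lap N l ^ j)"
proof (induction j)
 case 0
 show ?case using sk_span_sk[of 1 0] by simp
qed (simp add: sk_span_lap)

lemma span_h_ratio:
 assumes "sk_span q"
 obtains v where "\<And>m. integrable \<mu> (\<lambda>l. q l * hh l * rr m l)" "(\<lambda>m. LINT l|\<mu>. q l * hh l * rr m l) \<longlonglongrightarrow> v"
proof -
 obtain d \<tau> where q: "\<And>l. q l = (\<Sum>i<(d::nat). \<tau> i * sk i l)" using assms unfolding sk_span_def by metis
 have e: "q l * hh l * rr m l = (\<Sum>i<d. \<tau> i * (sk i l * hh l * rr m l))" for l m
  unfolding q by (simp add: sum_distrib_right mult.assoc)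
 have I: "integrable \<mu> (\<lambda>l. q l * hh l * rr m l)" for m
  unfolding e by (intro Bochner_Integration.integrable_sum integrable_mult_right sk_h_ratio_integral)
 have v: "(LINT l|\<mu>. q l * hh l * rr m l) = (\<Sum>i<d. \<tau> i * bb i m)" for m
  unfolding e by (subst Bochner_Integration.integral_sum) (auto simp: sk_h_ratio_integral)
 have "(\<lambda>m. \<Sum>i<d. \<tau> i * bb i m) \<longlonglongrightarrow> (\<Sum>i<d. \<tau> i * (if i = 0 then 1 else 0))"
  by (intro tendsto_sum tendsto_mult tendsto_const bb_tendsto)
 thus ?thesis using that[OF I] unfolding v by blast
qed

lemma lap_nonneg: "lap N l \<ge> 0" using lap_pos[OF Npos, of l] by simp

text \<open>The functions L^j h \<open>rr m\<close> are nonnegative, increase to L^j h, and have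
  convergent integrals, so monotone convergence applies. Powers of L are used here because the s_k
  themselves have no fixed sign.\<close>

lemma integrable_lap_power: "integrable \<mu> (\<lambda>l. lap N l ^ j * hh l)"
proof -
 obtain v where v: "\<And>m. integrable \<mu> (\<lambda>l. lap N l ^ j * hh l * rr m l)" "(\<lambda>m. LINT l|\<mu>. lap N l ^ j * hh l * rr m l) \<longlonglongrightarrow> v"
  using span_h_ratio[OF sk_span_lap_power[of j]] by blast
 have nn: "lap N l ^ j * hh l \<ge> 0" for l using lap_nonneg[of l] hh_pos[of l] by simp
 show ?thesis
 proof (rule integrable_monotone_convergence[OF v(1) _ _ v(2)])
  show "AE l in \<mu>. mono (\<lambda>m. lap N l ^ j * hh l * rr m l)"
   using rr_mono nn by (auto simp: mono_def intro!: mult_left_mono)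
  show "AE l in \<mu>. (\<lambda>m. lap N l ^ j * hh l * rr m l) \<longlonglongrightarrow> lap N l ^ j * hh l"
   using tendsto_mult[OF tendsto_const rr_lim] by simp
  show "(\<lambda>l. lap N l ^ j * hh l) \<in> borel_measurable \<mu>"
   using measurable_hh measurable_lap by measurable
 qed
qed

lemma integrable_poly_hh: "integrable \<mu> (\<lambda>l. poly p (lap N l) * hh l)"
 unfolding poly_altdef sum_distrib_right mult.assoc
 by (intro Bochner_Integration.integrable_sum integrable_mult_right integrable_lap_power)

lemma integrable_sk_hh: "integrable \<mu> (\<lambda>l. sk k l * hh l)"
proof -
 obtain p where "\<And>L. sq (real N) \<nu> L k = poly p L" using sqc_poly[OF Npos nupos] by blast
 thus ?thesis using integrable_poly_hh[of p] by simp
qed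

lemma integrable_sk_sk_hh: "integrable \<mu> (\<lambda>l. sk j l * sk k l * hh l)"
proof -
 obtain p where "\<And>L. sq (real N) \<nu> L j = poly p L" using sqc_poly[OF Npos nupos] by blast
 moreover obtain q where "\<And>L. sq (real N) \<nu> L k = poly q L" using sqc_poly[OF Npos nupos] by blast
 ultimately show ?thesis using integrable_poly_hh[of "p * q"] by simp
qed

text \<open>Once s_k h is integrable, 0 \<le> \<open>rr m\<close> \<le> 1 permits dominated
  convergence, and the limit of the integrals is that of \<open>bb k\<close>.\<close>

lemma integral_sk_hh: "(LINT l|\<mu>. sk k l * hh l) = (if k = 0 then 1 else 0)"
proof -
 have "(\<lambda>m. LINT l|\<mu>. sk k l * hh l * rr m l) \<longlonglongrightarrow> (LINT l|\<mu>. sk k l * hh l)"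
 proof (rule integral_dominated_convergence[where w = "\<lambda>l. \<bar>sk k l * hh l\<bar>"])
  show "integrable \<mu> (\<lambda>l. \<bar>sk k l * hh l\<bar>)" by (intro integrable_abs integrable_sk_hh)
  show "(\<lambda>l. sk k l * hh l) \<in> borel_measurable \<mu>" using measurable_hh measurable_sk by measurable
  show "(\<lambda>l. sk k l * hh l * rr m l) \<in> borel_measurable \<mu>" for m using measurable_hh measurable_sk measurable_rr by measurable
  show "AE l in \<mu>. (\<lambda>m. sk k l * hh l * rr m l) \<longlonglongrightarrow> sk k l * hh l"
   using tendsto_mult[OF tendsto_const rr_lim] by simp
  show "AE l in \<mu>. norm (sk k l * hh l * rr m l) \<le> \<bar>sk k l * hh l\<bar>" for m
   using rr_le_1 rr_nonneg by (auto simp: abs_mult intro!: mult_left_le)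
 qed
 thus ?thesis using bb_tendsto[of k] unfolding sk_h_ratio_integral(2) by (rule LIMSEQ_unique)
qed

abbreviation "dk \<equiv> hdim N"

lemma dk_pos: "dk k > 0" by (rule hdim_pos[OF Npos])

text \<open>Detailed balance: the weights d_k symmetrize the recurrence, so that multiplication by L
  has a symmetric matrix in the functions sqrt(d_k) s_k.\<close>

lemma AB_dk: "Ak k * dk k = Bk (Suc k) * dk (Suc k)"
proof -
 have "real (Suc k) * dk (Suc k) = (real N + real k) * dk k"
 proof -
  have "dk (Suc k) = dk k * ((real N + real k) / (real k + 1))"
   by (simp add: hdim_def pochhammer_Suc field_simps)
  thus ?thesis by (simp add: add.commute)
 qed
 moreover have "Bk (Suc k) * dk (Suc k) = (real k + \<nu>) * (real (Suc k) * dk (Suc k))"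
  by (simp add: Bk_def mult_ac add.commute)
 ultimately show ?thesis by (simp add: Ak_def mult_ac add.commute)
qed

text \<open>Induction on j. The factor L may be attached to s_j or to s_k, so the recurrence
  expresses row j+1 of the Gram matrix through rows j and j-1. Row 0 is
  \<open>integral_sk_hh\<close>, and \<open>AB_dk\<close> produces the diagonal 1/d_k.\<close>

lemma sk_orthogonal: "(LINT l|\<mu>. sk j l * sk k l * hh l) = (if j = k then 1 / dk k else 0)"
proof -
 define M where "M j k = (LINT l|\<mu>. sk j l * sk k l * hh l)" for j k
 have sym: "M j k = M k j" for j k unfolding M_def by (simp add: mult.commute)
 have e: "(LINT l|\<mu>. (lap N l * sk j l) * sk k l * hh l) = (Ak j + Bk j) * M j k - Ak j * M (Suc j) k - Bk j * M (j - 1) k" for j k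
 proof -
  have "(lap N l * sk j l) * sk k l * hh l = (Ak j + Bk j) * (sk j l * sk k l * hh l) - Ak j * (sk (Suc j) l * sk k l * hh l) - Bk j * (sk (j - 1) l * sk k l * hh l)" for l
   unfolding lap_sk by (simp add: algebra_simps)
  thus ?thesis unfolding M_def by (simp add: integrable_sk_sk_hh del: of_nat_Suc)
 qed
 have rec: "Ak j * M (Suc j) k = (Ak j + Bk j) * M j k - Bk j * M (j - 1) k - ((Ak k + Bk k) * M j k - Ak k * M j (Suc k) - Bk k * M j (k - 1))" for j k
 proof -
  have "(LINT l|\<mu>. (lap N l * sk j l) * sk k l * hh l) = (LINT l|\<mu>. (lap N l * sk k l) * sk j l * hh l)"
   by (simp add: mult_ac)
  thus ?thesis unfolding e using sym[of k j] sym[of "Suc k" j] sym[of "k - 1" j] by simp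
 qed
 have "\<forall>k. M j k = (if j = k then 1 / dk k else 0)"
 proof (induction j rule: less_induct)
  case (less j)
  show ?case
  proof (cases j)
   case 0
   have "M 0 k = (if k = 0 then 1 else 0)" for k unfolding M_def using integral_sk_hh[of k] by simp
   thus ?thesis using 0 by (auto simp: hdim_def)
  next
   case (Suc i)
   have IH1: "M i k = (if i = k then 1 / dk k else 0)" for k using less[of i] Suc by simp
   \<comment> \<open>The factor \<open>Bk i\<close> vanishes for i = 0, where the truncated index i
     - 1 would be 0 again.\<close>
   have IH0: "Bk i * M (i - 1) k = (if i > 0 \<and> i - 1 = k then Bk i / dk k else 0)" for k
    using less[of "i - 1"] Suc by (cases i) (auto simp: Bk_def)
   have Ai: "Ak i > 0" unfolding Ak_def using Npos nupos by simp
   show ?thesis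
   proof
    fix k
    have R: "Ak i * M (Suc i) k = (Ak i + Bk i) * M i k - Bk i * M (i - 1) k - ((Ak k + Bk k) * M i k - Ak k * M i (Suc k) - Bk k * M i (k - 1))"
     by (rule rec)
    have "Ak i * M (Suc i) k = Ak i * (if Suc i = k then 1 / dk k else 0)"
    proof -
     consider "k = Suc i" | "k = i" | "Suc k = i" | "k \<noteq> Suc i" "k \<noteq> i" "Suc k \<noteq> i" by blast
     thus ?thesis
     proof cases
      case 1
      have "Ak i * M (Suc i) k = Bk (Suc i) * (1 / dk i)"
      proof -
       have z: "(if 0 < i \<and> i - 1 = Suc i then Bk i / dk (Suc i) else 0) = 0" by (rule if_not_P) arith
       show ?thesis using R unfolding IH0 IH1 1 z by simp
      qed
      also have "\<dots> = Ak i * (1 / dk (Suc i))" using AB_dk[of i] dk_pos[of i] dk_pos[of "Suc i"] by (simp add: field_simps)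
      finally show ?thesis using 1 by simp
     next
      case 2
      have "Bk i * M i (i - 1) = 0" unfolding IH1 by (cases i) (auto simp: Bk_def)
      thus ?thesis using R unfolding IH0 2 by (simp add: IH1)
     next
      case 3
      have "Ak i * M (Suc i) k = Ak k * (1 / dk i) - Bk i / dk k" using R 3 unfolding IH0 IH1 by auto
      also have "\<dots> = 0" using AB_dk[of k] dk_pos[of i] dk_pos[of k] 3 by (simp add: field_simps)
      finally show ?thesis using 3 by simp
     next
      case 4
      have "Bk k * M i (k - 1) = 0" unfolding IH1 using 4 by (cases k) (auto simp: Bk_def)
      thus ?thesis using R 4 unfolding IH0 by (auto simp: IH1)
     qed
    qed
    thus "M j k = (if j = k then 1 / dk k else 0)" using Ai Suc by simp
   qed
  qed
 qed
 thus ?thesis unfolding M_def by blast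
qed

text \<open>The transform of the projection onto homogeneous polynomials of degree \<open>k\<close>, divided by its Hilbert--Schmidt norm.\<close>

definition ek :: "nat \<Rightarrow> real \<Rightarrow> complex" where
 "ek k l = of_real (sqrt (dk k) * sk k l * sqrt (hh l))"

lemma measurable_ek: "ek k \<in> borel_measurable \<mu>"
 unfolding ek_def[abs_def] using measurable_hh measurable_sk by measurable

lemma ek_mult: "ek j l * cnj (ek k l) = of_real (sqrt (dk j) * sqrt (dk k) * (sk j l * sk k l * hh l))"
 using hh_pos[of l] by (simp add: ek_def flip: of_real_mult)

lemma ek_L2: "ek k \<in> L2 \<mu>"
proof -
 have "(cmod (ek k l))^2 = dk k * (sk k l * sk k l * hh l)" for l
  using dk_pos[of k] hh_pos[of l] unfolding ek_def norm_of_real power2_abs by (simp add: power_mult_distrib) (simp add: power2_eq_square)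
 thus ?thesis unfolding L2_iff using measurable_ek integrable_sk_sk_hh by simp
qed

lemma ek_orthonormal: "ip \<mu> (ek j) (ek k) = (if j = k then 1 else 0)"
proof -
 have "ip \<mu> (ek j) (ek k) = of_real (sqrt (dk j) * sqrt (dk k) * (LINT l|\<mu>. sk j l * sk k l * hh l))"
  unfolding ip_def ek_mult integral_complex_of_real by simp
 thus ?thesis unfolding sk_orthogonal using dk_pos[of k] by (cases "j = k") (simp_all flip: of_real_mult)
qed

lemma nrm_ek: "nrm \<mu> (ek k) = 1"
proof -
 have "complex_of_real ((nrm \<mu> (ek k))^2) = 1" using ek_orthonormal[of k k] by (simp add: ip_self)
 hence "(nrm \<mu> (ek k))^2 = 1" by (simp only: of_real_eq_1_iff)
 thus ?thesis using nrm_nonneg[of \<mu> "ek k"] by (simp add: power2_eq_1_iff)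
qed

text \<open>Insert the power series of the spherical function into the transform. On |z|^2 \<le> s <
  1 it is dominated by the convergent series at t = s, so sum and integral may be exchanged; the
  same support condition makes the coefficients decay like s^k.\<close>

lemma ft_expansion:
 assumes f: "integrable iota f" and s: "0 < s" "s < 1" and supp: "\<And>z. (norm z)^2 > s \<Longrightarrow> f z = 0"
 shows "(\<lambda>k. of_real (pochhammer \<nu> k / fact k * sk k l) * (LINT z|iota. f z * wfun \<nu> k z)) sums ft f l"
  and "cmod (LINT z|iota. f z * wfun \<nu> k z) \<le> s ^ k * (LINT z|iota. cmod (f z))"
proof -
 have wb: "cmod (f z * wfun \<nu> k z) \<le> s ^ k * cmod (f z)" if "norm z < 1" for z k
 proof (cases "(norm z)^2 > s")
  case False
  have z: "(norm z)^2 < 1" using that by (simp add: abs_square_less_1)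
  have "cmod (wfun \<nu> k z) = ((norm z)^2) ^ k * (1 - (norm z)^2) powr \<nu>"
   unfolding wfun_def norm_of_real using z by simp
  also have "\<dots> \<le> s ^ k * 1"
  proof (intro mult_mono power_mono)
   have "(1 - (norm z)^2) powr \<nu> \<le> 1 powr \<nu>" using z nupos by (intro powr_mono2) auto
   thus "(1 - (norm z)^2) powr \<nu> \<le> 1" by simp
  qed (use False s in auto)
  finally show ?thesis using mult_left_mono[of "cmod (wfun \<nu> k z)" "s ^ k" "cmod (f z)"] by (simp add: norm_mult mult.commute)
 qed (simp add: supp)
 have mf: "f \<in> borel_measurable iota" using f by simp
 have If: "integrable iota (\<lambda>z. cmod (f z))" using f by simp
 have I1: "integrable iota (\<lambda>z. f z * wfun \<nu> k z)" for k
 proof (rule Bochner_Integration.integrable_bound[where f = "\<lambda>z. s ^ k * cmod (f z)"])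
  show "AE z in iota. norm (f z * wfun \<nu> k z) \<le> norm (s ^ k * cmod (f z))"
   using AE_iota_ball by eventually_elim (use wb s in \<open>auto simp: abs_mult\<close>)
 qed (use If mf in auto)
 have B1: "(LINT z|iota. cmod (f z * wfun \<nu> k z)) \<le> s ^ k * (LINT z|iota. cmod (f z))" for k
 proof -
  have "(LINT z|iota. cmod (f z * wfun \<nu> k z)) \<le> (LINT z|iota. s ^ k * cmod (f z))"
  proof (rule integral_mono_AE)
   show "AE z in iota. cmod (f z * wfun \<nu> k z) \<le> s ^ k * cmod (f z)"
    using AE_iota_ball by eventually_elim (rule wb)
  qed (use I1 If in auto)
  thus ?thesis by simp
 qed
 show "cmod (LINT z|iota. f z * wfun \<nu> k z) \<le> s ^ k * (LINT z|iota. cmod (f z))"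
  by (rule order_trans[OF integral_norm_bound B1])
 interpret spherical_series "real N" \<nu> "lap N l" using Npos lap_pos[OF Npos] nupos by unfold_locales auto
 define F where "F k z = of_real (c k) * (f z * wfun \<nu> k z)" for k z
 have IF: "integrable iota (F k)" for k unfolding F_def[abs_def] by (intro integrable_mult_right I1)
 have sc: "summable (\<lambda>k. \<bar>c k * s ^ k\<bar>)" using summable_abs_scoeff[of s] s by simp
 have Fb: "cmod (F k z) \<le> \<bar>c k * s ^ k\<bar> * cmod (f z)" if "norm z < 1" for k z
  using mult_left_mono[OF wb[OF that, of k], of "\<bar>c k\<bar>"] s by (simp add: F_def norm_mult abs_mult mult.assoc)
 have "(\<lambda>k. integral\<^sup>L iota (F k)) sums (LINT z|iota. (\<Sum>k. F k z))"
 proof (rule sums_integral[OF IF])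
  show "AE z in iota. summable (\<lambda>k. norm (F k z))"
   using AE_iota_ball
  proof eventually_elim
   case (elim z)
   show ?case by (rule summable_comparison_test'[OF summable_mult2[OF sc, of "cmod (f z)"]]) (use Fb[OF elim] in simp)
  qed
  have "(LINT z|iota. norm (F k z)) \<le> \<bar>c k * s ^ k\<bar> * (LINT z|iota. cmod (f z))" for k
  proof -
   have "(LINT z|iota. norm (F k z)) \<le> (LINT z|iota. \<bar>c k * s ^ k\<bar> * cmod (f z))"
   proof (rule integral_mono_AE)
    show "AE z in iota. norm (F k z) \<le> \<bar>c k * s ^ k\<bar> * cmod (f z)"
     using AE_iota_ball by eventually_elim (rule Fb)
   qed (use IF If in auto)
   thus ?thesis by simp
  qed
  thus "summable (\<lambda>k. LINT z|iota. norm (F k z))"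
   by (intro summable_comparison_test'[OF summable_mult2[OF sc, of "LINT z|iota. cmod (f z)"]]) (simp add: integral_nonneg)
 qed
 moreover have "integral\<^sup>L iota (F k) = of_real (pochhammer \<nu> k / fact k * sk k l) * (LINT z|iota. f z * wfun \<nu> k z)" for k
  unfolding F_def[abs_def] by (simp add: scoeff_def)
 moreover have "(LINT z|iota. (\<Sum>k. F k z)) = ft f l"
  unfolding spherical_transform_def
 proof (rule integral_cong_AE)
  show "AE z in iota. (\<Sum>k. F k z) = f z * spherical_fun (of_real l) z"
   using AE_iota_ball
  proof eventually_elim
   case (elim z)
   define t where "t = (norm z)^2"
   have t: "\<bar>t\<bar> < 1" using elim by (simp add: t_def abs_square_less_1)
   have "(\<lambda>k. complex_of_real (c k * t ^ k)) sums of_real (sser (real N) \<nu> (lap N l) t)"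
    by (intro sums_of_real sums0 t)
   hence "(\<lambda>k. (f z * of_real ((1 - t) powr \<nu>)) * complex_of_real (c k * t ^ k)) sums ((f z * of_real ((1 - t) powr \<nu>)) * of_real (sser (real N) \<nu> (lap N l) t))"
    by (rule sums_mult)
   moreover have "(f z * of_real ((1 - t) powr \<nu>)) * complex_of_real (c k * t ^ k) = F k z" for k
    by (simp add: F_def wfun_def t_def)
   moreover have "(f z * of_real ((1 - t) powr \<nu>)) * of_real (sser (real N) \<nu> (lap N l) t) = f z * spherical_fun (of_real l) z"
    using spherical_fun_eq_phi[OF elim nupos, of l] by (simp add: phi_def t_def NC lap_def)
   ultimately show ?case by (simp add: sums_iff)
  qed
  have "F k \<in> borel_measurable iota" for k by (rule borel_measurable_integrable[OF IF])
  thus "(\<lambda>z. \<Sum>k. F k z) \<in> borel_measurable iota" by measurable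
  show "(\<lambda>z. f z * spherical_fun (of_real l) z) \<in> borel_measurable iota" using mf by measurable
 qed
 ultimately show "(\<lambda>k. of_real (pochhammer \<nu> k / fact k * sk k l) * (LINT z|iota. f z * wfun \<nu> k z)) sums ft f l"
  by simp
qed

end

section \<open>Limits in L2 and the Riesz-Fischer theorem\<close>

lemma L2_Fatou:
 fixes s :: "nat \<Rightarrow> 'a \<Rightarrow> complex"
 assumes s: "\<And>n. s n \<in> L2 M" and lim: "AE x in M. (\<lambda>n. s n x) \<longlonglongrightarrow> u x"
  and u: "u \<in> borel_measurable M" and g: "g \<in> L2 M" and b: "\<And>n. n \<ge> n0 \<Longrightarrow> nrm M (\<lambda>x. s n x - g x) \<le> e"
 shows "u \<in> L2 M" "nrm M (\<lambda>x. u x - g x) \<le> e"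
proof -
 have e0: "e \<ge> 0" using b[of n0] nrm_nonneg order_trans by blast
 have m: "s n \<in> borel_measurable M" "g \<in> borel_measurable M" for n using s g by (auto simp: L2_iff)
 have "(\<integral>\<^sup>+x. ennreal ((cmod (u x - g x))^2) \<partial>M) = (\<integral>\<^sup>+x. liminf (\<lambda>n. ennreal ((cmod (s n x - g x))^2)) \<partial>M)"
 proof (rule nn_integral_cong_AE)
  show "AE x in M. ennreal ((cmod (u x - g x))^2) = liminf (\<lambda>n. ennreal ((cmod (s n x - g x))^2))"
   using lim
  proof eventually_elim
   case (elim x)
   hence "(\<lambda>n. ennreal ((cmod (s n x - g x))^2)) \<longlonglongrightarrow> ennreal ((cmod (u x - g x))^2)"
    by (intro tendsto_ennrealI tendsto_intros)
   thus ?case by (intro lim_imp_Liminf[symmetric]) auto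
  qed
 qed
 also have "\<dots> \<le> liminf (\<lambda>n. \<integral>\<^sup>+x. ennreal ((cmod (s n x - g x))^2) \<partial>M)"
  by (rule nn_integral_liminf) (use m in measurable)
 also have "\<dots> \<le> ennreal (e^2)"
 proof (rule Liminf_le)
  have "(\<integral>\<^sup>+x. ennreal ((cmod (s n x - g x))^2) \<partial>M) \<le> ennreal (e^2)" if "n \<ge> n0" for n
  proof -
   have "(\<integral>\<^sup>+x. ennreal ((cmod (s n x - g x))^2) \<partial>M) = ennreal ((nrm M (\<lambda>x. s n x - g x))^2)"
    using nn_integral_eq_integral[OF L2_integrable[OF L2_diff[OF s[of n] g]]] by (simp add: nrm_sq)
   thus ?thesis using power_mono[OF b[OF that], of 2] by (simp add: ennreal_leI)
  qed
  thus "\<forall>\<^sub>F n in sequentially. (\<integral>\<^sup>+x. ennreal ((cmod (s n x - g x))^2) \<partial>M) \<le> ennreal (e^2)"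
   by (auto simp: eventually_sequentially)
 qed auto
 finally have fin: "(\<integral>\<^sup>+x. ennreal ((cmod (u x - g x))^2) \<partial>M) \<le> ennreal (e^2)" .
 have d: "(\<lambda>x. u x - g x) \<in> L2 M"
  unfolding L2_iff
 proof
  show mm: "(\<lambda>x. u x - g x) \<in> borel_measurable M" using u m by measurable
  show "integrable M (\<lambda>x. (cmod (u x - g x))^2)"
  proof (rule integrableI_bounded)
   have "(\<integral>\<^sup>+x. ennreal (norm ((cmod (u x - g x))^2)) \<partial>M) \<le> ennreal (e^2)" using fin by simp
   also have "\<dots> < \<infinity>" by simp
   finally show "(\<integral>\<^sup>+x. ennreal (norm ((cmod (u x - g x))^2)) \<partial>M) < \<infinity>" .
  qed (use mm in measurable)
 qed
 thus "u \<in> L2 M" using L2_add[OF d g] by simp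
 have "ennreal ((nrm M (\<lambda>x. u x - g x))^2) \<le> ennreal (e^2)"
  using fin nn_integral_eq_integral[OF L2_integrable[OF d]] by (simp add: nrm_sq)
 hence "(nrm M (\<lambda>x. u x - g x))^2 \<le> e^2" by (subst (asm) ennreal_le_iff) auto
 thus "nrm M (\<lambda>x. u x - g x) \<le> e" using e0 by (rule power2_le_imp_le)
qed

lemma L2_AE_convergent_subseq:
 fixes F :: "nat \<Rightarrow> 'a \<Rightarrow> complex"
 assumes F: "\<And>j. F j \<in> L2 M" and d: "\<And>j. nrm M (\<lambda>x. F (Suc j) x - F j x) \<le> (1/2) ^ j"
 shows "AE x in M. convergent (\<lambda>j. F j x)"
proof -
 define D where "D j x = F (Suc j) x - F j x" for j x
 have DL: "D j \<in> L2 M" for j unfolding D_def[abs_def] by (intro L2_diff F)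
 have [measurable]: "D j \<in> borel_measurable M" for j using DL by (auto simp: L2_iff)
 \<comment> \<open>The squared norms decay like 4^(-j), so the weight 2^j still leaves a summable
   series. Its finiteness at almost every x then forces geometric decay of \<open>D j x\<close> with
   ratio 1/sqrt 2.\<close>
 have e: "(\<integral>\<^sup>+x. ennreal (2 ^ j * (cmod (D j x))^2) \<partial>M) \<le> ennreal ((1/2) ^ j)" for j
 proof -
  have "(\<integral>\<^sup>+x. ennreal (2 ^ j * (cmod (D j x))^2) \<partial>M) = ennreal (2 ^ j * (nrm M (D j))^2)"
   using nn_integral_eq_integral[of M "\<lambda>x. 2 ^ j * (cmod (D j x))^2"] L2_integrable[OF DL[of j]] by (simp add: nrm_sq)
  also have "\<dots> \<le> ennreal (2 ^ j * ((1/2) ^ j)^2)"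
   using d[of j] unfolding D_def[symmetric] by (intro ennreal_leI mult_left_mono power_mono) auto
  also have "(2::real) ^ j * ((1/2) ^ j)^2 = (1/2) ^ j" by (simp add: power2_eq_square power_divide)
  finally show ?thesis .
 qed
 have "(\<integral>\<^sup>+x. (\<Sum>j. ennreal (2 ^ j * (cmod (D j x))^2)) \<partial>M) = (\<Sum>j. \<integral>\<^sup>+x. ennreal (2 ^ j * (cmod (D j x))^2) \<partial>M)"
  by (rule nn_integral_suminf) measurable
 also have "\<dots> \<le> (\<Sum>j. ennreal ((1/2) ^ j))" by (intro suminf_le e) auto
 also have "\<dots> = ennreal (\<Sum>j. (1/2) ^ j)" by (intro suminf_ennreal2 summable_geometric) auto
 also have "\<dots> < \<infinity>" by simp
 finally have "(\<integral>\<^sup>+x. (\<Sum>j. ennreal (2 ^ j * (cmod (D j x))^2)) \<partial>M) \<noteq> \<infinity>" by simp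
 hence "AE x in M. (\<Sum>j. ennreal (2 ^ j * (cmod (D j x))^2)) \<noteq> \<infinity>"
  by (intro nn_integral_PInf_AE) measurable
 thus ?thesis
 proof eventually_elim
  case (elim x)
  hence "summable (\<lambda>j. 2 ^ j * (cmod (D j x))^2)" by (intro summable_suminf_not_top) auto
  hence "bounded (range (\<lambda>j. 2 ^ j * (cmod (D j x))^2))"
   by (intro Bseq_eq_bounded[THEN iffD1] convergent_imp_Bseq) (meson convergentI summable_LIMSEQ_zero)
  then obtain K where K: "\<And>j. norm (2 ^ j * (cmod (D j x))^2) \<le> K" unfolding bounded_iff by auto
  define q :: real where "q = 1 / sqrt 2"
  have q: "0 < q" "q < 1" "q^2 = 1/2" by (auto simp: q_def power_divide)
  have K0: "K \<ge> 0" using K[of 0] by (meson norm_ge_zero order_trans)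
  have Db: "cmod (D j x) \<le> sqrt K * q ^ j" for j
  proof (rule power2_le_imp_le)
   have "(q ^ j)^2 = (1/2) ^ j" by (simp add: power_mult[symmetric] mult.commute[of j]) (simp add: power_mult q)
   hence "(sqrt K * q ^ j)^2 = K * (1/2) ^ j" using K0 by (simp add: power_mult_distrib)
   moreover have "2 ^ j * (cmod (D j x))^2 \<le> K" using K[of j] by simp
   moreover have "2 ^ j * (K * (1/2) ^ j) = K" by (simp add: power_divide)
   ultimately have "2 ^ j * (cmod (D j x))^2 \<le> 2 ^ j * (sqrt K * q ^ j)^2" by (simp only:)
   thus "(cmod (D j x))^2 \<le> (sqrt K * q ^ j)^2" by (rule mult_left_le_imp_le) simp
  qed (use q K0 in simp)
  have "summable (\<lambda>j. sqrt K * q ^ j)" using q by (intro summable_mult summable_geometric) simp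
  hence "summable (\<lambda>j. D j x)" by (rule summable_comparison_test') (rule Db)
  hence "convergent (\<lambda>n. \<Sum>j<n. D j x)" by (simp add: summable_iff_convergent)
  moreover have "(\<Sum>j<n. D j x) = F n x - F 0 x" for n unfolding D_def by (rule sum_lessThan_telescope)
  ultimately have "convergent (\<lambda>n. F n x - F 0 x)" by simp
  hence "convergent (\<lambda>n. (F n x - F 0 x) + F 0 x)" by (intro convergent_add convergent_const)
  thus ?case by simp
 qed
qed

lemma orthonormal_tail:
 assumes e: "\<And>k. e k \<in> L2 M" and on: "\<And>j k. ip M (e j) (e k) = (if j = k then 1 else 0)" and mn: "(m::nat) \<le> n"
 shows "(nrm M (\<lambda>x. (\<Sum>k<n. b k * e k x) - (\<Sum>k<m. b k * e k x)))^2 = (\<Sum>k=m..<n. (cmod (b k))^2)"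
proof -
 have L: "(\<lambda>x. \<Sum>k=m..<n. b k * e k x) \<in> L2 M" by (intro L2_sum L2_scale e)
 have "(\<Sum>k<n. b k * e k x) - (\<Sum>k<m. b k * e k x) = (\<Sum>k=m..<n. b k * e k x)" for x
  using sum_diff_nat_ivl[of 0 m n "\<lambda>k. b k * e k x"] mn by (simp add: lessThan_atLeast0)
 hence "complex_of_real ((nrm M (\<lambda>x. (\<Sum>k<n. b k * e k x) - (\<Sum>k<m. b k * e k x)))^2) = ip M (\<lambda>x. \<Sum>k=m..<n. b k * e k x) (\<lambda>x. \<Sum>k=m..<n. b k * e k x)"
  by (simp add: ip_self)
 also have "\<dots> = (\<Sum>j=m..<n. \<Sum>k=m..<n. b j * cnj (b k) * ip M (e j) (e k))"
 proof -
  have "ip M (e j) (\<lambda>x. \<Sum>k=m..<n. b k * e k x) = (\<Sum>k=m..<n. cnj (b k) * ip M (e j) (e k))" for j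
   by (subst ip_sum_right[OF L2_scale[OF e] e]) (simp add: ip_scale_right)
  thus ?thesis by (subst ip_sum_left[OF L2_scale[OF e] L]) (simp add: ip_scale_left mult.assoc sum_distrib_left)
 qed
 also have "\<dots> = (\<Sum>j=m..<n. \<Sum>k=m..<n. if k = j then b j * cnj (b j) else 0)"
  unfolding on by (intro sum.cong refl) auto
 also have "\<dots> = (\<Sum>j=m..<n. b j * cnj (b j))" by simp
 also have "\<dots> = of_real (\<Sum>k=m..<n. (cmod (b k))^2)" by (simp add: complex_norm_square flip: of_real_power)
 finally show ?thesis by (simp only: of_real_eq_iff)
qed

text \<open>Besides the limit in L2 it records a subsequence of the partial sums that converges
  almost everywhere. This later identifies the limit with a series known to converge at every
  point.\<close>

theorem Riesz_Fischer:
 assumes e: "\<And>k. e k \<in> L2 M" and on: "\<And>j k. ip M (e j) (e k) = (if j = k then 1 else 0)"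
  and b: "summable (\<lambda>k. (cmod (b k))^2)"
 obtains w r where "w \<in> L2 M" "\<And>k. ip M w (e k) = b k" "(nrm M w)^2 = (\<Sum>k. (cmod (b k))^2)"
  "strict_mono (r :: nat \<Rightarrow> nat)" "AE x in M. (\<lambda>j. \<Sum>k<r j. b k * e k x) \<longlonglongrightarrow> w x"
proof -
 define S where "S n x = (\<Sum>k<n. b k * e k x)" for n x
 have SL: "S n \<in> L2 M" for n unfolding S_def[abs_def] by (intro L2_sum L2_scale e)
 have tail: "\<exists>n0. \<forall>m\<ge>n0. \<forall>n\<ge>m. nrm M (\<lambda>x. S n x - S m x) \<le> \<epsilon>" if "\<epsilon> > 0" for \<epsilon>
 proof -
  have "\<exists>N. \<forall>m\<ge>N. \<forall>n. norm (\<Sum>k=m..<n. (cmod (b k))^2) < \<epsilon>^2"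
   using b \<open>\<epsilon> > 0\<close> unfolding summable_Cauchy by simp
  then obtain n0 where n0: "\<And>m n. m \<ge> n0 \<Longrightarrow> (\<Sum>k=m..<n. (cmod (b k))^2) < \<epsilon>^2" by (auto simp: abs_less_iff)
  have "nrm M (\<lambda>x. S n x - S m x) \<le> \<epsilon>" if "m \<ge> n0" "n \<ge> m" for m n
  proof (rule power2_le_imp_le)
   show "(nrm M (\<lambda>x. S n x - S m x))^2 \<le> \<epsilon>^2"
    unfolding S_def orthonormal_tail[OF e on that(2)] using n0[OF that(1), of n] by simp
  qed (use \<open>\<epsilon> > 0\<close> in simp)
  thus ?thesis by blast
 qed
 define n0 where "n0 j = (SOME n0. \<forall>m\<ge>n0. \<forall>n\<ge>m. nrm M (\<lambda>x. S n x - S m x) \<le> (1/2) ^ j)" for j :: nat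
 have n0: "\<And>m n. m \<ge> n0 j \<Longrightarrow> n \<ge> m \<Longrightarrow> nrm M (\<lambda>x. S n x - S m x) \<le> (1/2) ^ j" for j
  using someI_ex[OF tail[of "(1/2) ^ j"]] unfolding n0_def by simp
 \<comment> \<open>Strictly increasing and at least \<open>n0 j\<close>, so consecutive partial sums
   along r differ by at most (1/2)^j in norm.\<close>
 define r where "r j = (\<Sum>i\<le>j. n0 i) + j" for j
 have r: "strict_mono r" by (rule strict_monoI_Suc) (simp add: r_def)
 have rn: "r j \<ge> n0 j" for j unfolding r_def by (simp add: trans_le_add1 member_le_sum)
 have "AE x in M. convergent (\<lambda>j. S (r j) x)"
  by (rule L2_AE_convergent_subseq[OF SL]) (intro n0 rn strict_mono_leD[OF r] le_SucI order_refl)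
 define w where "w x = lim (\<lambda>j. S (r j) x)" for x
 have lim: "AE x in M. (\<lambda>j. S (r j) x) \<longlonglongrightarrow> w x"
  using \<open>AE x in M. convergent (\<lambda>j. S (r j) x)\<close> unfolding w_def by eventually_elim (rule convergent_LIMSEQ_iff[THEN iffD1])
 have wm: "w \<in> borel_measurable M"
  unfolding w_def[abs_def] by (rule borel_measurable_lim_metric) (use SL in \<open>simp add: L2_iff\<close>)
 have close: "w \<in> L2 M \<and> nrm M (\<lambda>x. w x - S n x) \<le> (1/2) ^ j" if n: "n \<ge> n0 j" for n j
 proof -
  have b: "nrm M (\<lambda>x. S (r i) x - S n x) \<le> (1/2) ^ j" if "i \<ge> n" for i
   by (rule n0[OF n]) (use that seq_suble[OF r, of i] in simp)
  show ?thesis using L2_Fatou[OF SL lim wm SL b] by blast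
 qed
 have wL: "w \<in> L2 M" using close[of 0] by blast
 have conv: "(\<lambda>n. nrm M (\<lambda>x. w x - S n x)) \<longlonglongrightarrow> 0"
 proof (rule LIMSEQ_I)
  fix \<epsilon> :: real assume "\<epsilon> > 0"
  then obtain j where j: "(1/2) ^ j < \<epsilon>" using real_arch_pow_inv[of \<epsilon> "1/2"] by auto
  show "\<exists>no. \<forall>n\<ge>no. norm (nrm M (\<lambda>x. w x - S n x) - 0) < \<epsilon>"
   by (rule exI[of _ "n0 j"]) (use close j in \<open>auto intro: le_less_trans\<close>)
 qed
 have ipS: "ip M (S n) (e k) = b k" if "n > k" for n k
 proof -
  have "ip M (S n) (e k) = (\<Sum>i<n. b i * (if i = k then 1 else 0))"
   unfolding S_def[abs_def] by (subst ip_sum_left[OF L2_scale[OF e] e]) (simp add: ip_scale_left on)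
  also have "\<dots> = b k" using that by (simp add: if_distrib[of "\<lambda>x. _ * x"] cong: if_cong)
  finally show ?thesis .
 qed
 have ipw: "ip M w (e k) = b k" for k
 proof -
  have n1: "nrm M (e k) = 1"
  proof -
   have "complex_of_real ((nrm M (e k))^2) = 1" using on[of k k] by (simp add: ip_self)
   hence "(nrm M (e k))^2 = 1" by (simp only: of_real_eq_1_iff)
   thus ?thesis using nrm_nonneg[of M "e k"] by (simp add: power2_eq_1_iff)
  qed
  have "(\<lambda>n. ip M w (e k) - ip M (S n) (e k)) \<longlonglongrightarrow> 0"
  proof (rule Lim_null_comparison[OF _ conv])
   show "\<forall>\<^sub>F n in sequentially. norm (ip M w (e k) - ip M (S n) (e k)) \<le> nrm M (\<lambda>x. w x - S n x)"
    using L2_CS[OF L2_diff[OF wL SL] e[of k]] n1 by (simp add: ip_diff_left[OF wL SL e])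
  qed
  moreover have "(\<lambda>n. ip M w (e k) - ip M (S n) (e k)) \<longlonglongrightarrow> ip M w (e k) - b k"
   by (rule tendsto_eventually) (use ipS in \<open>auto simp: eventually_sequentially intro!: exI[of _ "Suc k"]\<close>)
  ultimately show ?thesis using LIMSEQ_unique by fastforce
 qed
 have nS: "(nrm M (S n))^2 = (\<Sum>k<n. (cmod (b k))^2)" for n
  using orthonormal_tail[OF e on, of 0 n b] by (simp add: S_def[abs_def] atLeast0LessThan)
 have "(\<lambda>n. nrm M (S n)) \<longlonglongrightarrow> nrm M w"
 proof (rule Lim_transform[of "\<lambda>_. nrm M w"])
  show "(\<lambda>n. nrm M (S n) - nrm M w) \<longlonglongrightarrow> 0"
  proof (rule Lim_null_comparison[OF _ conv])
   have "\<bar>nrm M (S n) - nrm M w\<bar> \<le> nrm M (\<lambda>x. w x - S n x)" for n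
    using nrm_triangle[OF L2_diff[OF wL SL[of n]] SL[of n]] nrm_triangle[OF L2_diff[OF SL[of n] wL] wL] nrm_diff_comm[of M w "S n"] by simp
   thus "\<forall>\<^sub>F n in sequentially. norm (nrm M (S n) - nrm M w) \<le> nrm M (\<lambda>x. w x - S n x)" by simp
  qed
 qed simp
 hence "(\<lambda>n. (nrm M (S n))^2) \<longlonglongrightarrow> (nrm M w)^2" by (rule tendsto_power)
 hence "(nrm M w)^2 = (\<Sum>k. (cmod (b k))^2)" unfolding nS
  by (intro LIMSEQ_unique[OF _ summable_LIMSEQ[OF b]])
 thus ?thesis using that[OF wL ipw _ r] lim unfolding S_def by blast
qed

lemma orthonormal_Bessel:
 assumes e: "\<And>k. e k \<in> L2 M" and on: "\<And>j k. ip M (e j) (e k) = (if j = k then 1 else 0)" and w: "w \<in> L2 M"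
 shows "summable (\<lambda>k. (cmod (ip M w (e k)))^2)"
proof (rule summableI_nonneg_bounded[where x = "(nrm M w)^2"])
 fix n
 define b where "b k = ip M w (e k)" for k
 define S where "S x = (\<Sum>k<n. b k * e k x)" for x
 have SL: "S \<in> L2 M" unfolding S_def[abs_def] by (intro L2_sum L2_scale e)
 have nS: "(nrm M S)^2 = (\<Sum>k<n. (cmod (b k))^2)"
  using orthonormal_tail[OF e on, of 0 n b] by (simp add: S_def[abs_def] atLeast0LessThan)
 have "ip M w S = (\<Sum>k<n. cnj (b k) * b k)"
  unfolding S_def[abs_def] by (subst ip_sum_right[OF L2_scale[OF e] w]) (simp add: ip_scale_right b_def)
 also have "\<dots> = of_real (\<Sum>k<n. (cmod (b k))^2)" by (simp add: complex_norm_square mult.commute flip: of_real_power)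
 finally have "Re (ip M w S) = (nrm M S)^2" by (simp add: nS)
 moreover have "Re (ip M w S) \<le> nrm M w * nrm M S" using L2_CS[OF w SL] complex_Re_le_cmod order_trans by blast
 ultimately have "nrm M S * nrm M S \<le> nrm M w * nrm M S" by (simp add: power2_eq_square)
 hence "nrm M S \<le> nrm M w" using nrm_nonneg[of M S] nrm_nonneg[of M w] by (metis less_eq_real_def mult_right_le_imp_le)
 thus "(\<Sum>k<n. (cmod (ip M w (e k)))^2) \<le> (nrm M w)^2"
  using power_mono[of _ _ 2, OF _ nrm_nonneg[of M S]] by (simp add: nS[symmetric, unfolded b_def])
qed simp

section \<open>Completeness of the orthonormal system on the Plancherel side\<close>

context plancherel_setting
begin

text \<open>As h is bounded, G = F sqrt(h) is square integrable and hence the image of some f0. For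
  a truncation f of f0 to |z|^2 \<le> s, the transform times sqrt(h) is a series in the
  \<open>ek\<close> with absolutely summable coefficients, so its product with F is 0. By the
  isometry f is orthogonal to f0, and this product is the squared norm of f.\<close>

lemma ek_complete:
 assumes F: "F \<in> L2 \<mu>" and orth: "\<And>k. ip \<mu> F (ek k) = 0"
 shows "AE l in \<mu>. F l = 0"
proof -
 define G where "G l = F l * of_real (sqrt (hh l))" for l
 have mF: "F \<in> borel_measurable \<mu>" using F by (simp add: L2_iff)
 have mG: "G \<in> borel_measurable \<mu>" unfolding G_def[abs_def] using mF measurable_hh by measurable
 have hb: "hh l \<le> weight_integral N \<nu>" for l by (rule hh_le)
 have GL: "G \<in> L2 \<mu>"
  unfolding L2_iff
 proof
  show "integrable \<mu> (\<lambda>l. (cmod (G l))^2)"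
  proof (rule Bochner_Integration.integrable_bound[where f = "\<lambda>l. weight_integral N \<nu> * (cmod (F l))^2"])
   show "AE l in \<mu>. norm ((cmod (G l))^2) \<le> norm (weight_integral N \<nu> * (cmod (F l))^2)"
   proof (rule AE_I2)
    fix l
    have "(cmod (G l))^2 = hh l * (cmod (F l))^2"
     unfolding G_def using hh_pos[of l] by (simp add: norm_mult power_mult_distrib)
    thus "norm ((cmod (G l))^2) \<le> norm (weight_integral N \<nu> * (cmod (F l))^2)"
     using hb[of l] hh_pos[of l] by (auto simp: abs_mult intro!: mult_right_mono)
   qed
  qed (use L2_integrable[OF F] mG in auto)
 qed (rule mG)
 obtain f0 where f0: "f0 \<in> ips_carrier radial_L2" "ips_eq (L2_space \<mu>) (U1 f0) G"
  using U1(1) GL unfolding unitary_iso_def by blast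
 have f0L: "f0 \<in> L2 iota" and f0r: "radial_fun f0" using f0(1) by (auto simp: radial_L2_carrier)
 have UG: "AE l in \<mu>. U1 f0 l = G l" using f0(2) ips_eq_L2[OF U1_L2[OF f0(1)] GL] by simp
 have main: "AE z in iota. (norm z)^2 \<le> s \<longrightarrow> f0 z = 0" if s: "0 < s" "s < 1" for s
 proof -
  define f where "f z = (if (norm z)^2 \<le> s then f0 z else 0)" for z
  have mf: "f \<in> borel_measurable iota"
  proof -
   have [measurable]: "f0 \<in> borel_measurable borel" using f0L unfolding L2_iff measurable_cong_sets[OF sets_iota refl] by simp
   show ?thesis unfolding f_def[abs_def] by measurable
  qed
  have supp: "\<And>z. (norm z)^2 > s \<Longrightarrow> f z = 0" by (simp add: f_def)
  have fL: "f \<in> L2 iota"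
   unfolding L2_iff
  proof
   show "integrable iota (\<lambda>z. (cmod (f z))^2)"
   proof (rule Bochner_Integration.integrable_bound[OF L2_integrable[OF f0L]])
    show "(\<lambda>z. (cmod (f z))^2) \<in> borel_measurable iota" using mf by measurable
   qed (auto simp: f_def)
  qed (rule mf)
  have fI: "integrable iota f"
  proof -
   have nn: "\<nu> > real CARD('n)" using nu NC by simp
   have W: "integrable iota (\<lambda>z::complex^'n. (1 - (norm z)^2) powr \<nu>)" using integrable_iota_weight[OF nn, of 0] by simp
   \<comment> \<open>On |z|^2 \<le> s the weight (1 - |z|^2)^\<nu> is at least (1 - s)^\<nu>, so
     \<open>K\<close> times this integrable weight dominates 1 there. This makes the truncation
     integrable as well as square integrable.\<close>
   define K where "K = 1 / (1 - s) powr \<nu>"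
   have "integrable iota (\<lambda>z. (cmod (f0 z))^2 + K * (1 - (norm z)^2) powr \<nu>)"
    by (intro Bochner_Integration.integrable_add integrable_mult_right W L2_integrable f0L)
   thus ?thesis
   proof (rule Bochner_Integration.integrable_bound[OF _ mf])
    have "cmod (f z) \<le> (cmod (f0 z))^2 + K * (1 - (norm z)^2) powr \<nu>" for z
    proof (cases "(norm z)^2 \<le> s")
     case True
     have "(1 - s) powr \<nu> \<le> (1 - (norm z)^2) powr \<nu>" using True s nupos by (intro powr_mono2) auto
     hence "1 \<le> K * (1 - (norm z)^2) powr \<nu>" using s by (simp add: K_def)
     moreover have "cmod (f0 z) \<le> (cmod (f0 z))^2 + 1"
      using sum_squares_bound[of "cmod (f0 z)" 1] norm_ge_zero[of "f0 z"] by (simp del: norm_ge_zero)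
     ultimately show ?thesis using True by (simp add: f_def)
    qed (simp add: f_def K_def)
    moreover have "(cmod (f0 z))^2 + K * (1 - (norm z)^2) powr \<nu> \<ge> 0" for z by (simp add: K_def)
    ultimately show "AE z in iota. norm (f z) \<le> norm ((cmod (f0 z))^2 + K * (1 - (norm z)^2) powr \<nu>)"
     by (intro AE_I2) (simp del: norm_ge_zero)
   qed
  qed
  have frad: "radial_fun f"
   unfolding radial_fun_def
  proof
   fix g :: "'n gmat" assume g: "g \<in> stab0"
   have "AE z in iota. f0 (act g z) = f0 z" using f0r g by (simp add: radial_fun_def)
   thus "AE z in iota. f (act g z) = f z"
    using AE_iota_ball by eventually_elim (simp add: f_def stab0_norm[OF g])
  qed
  have fD: "f \<in> radial_L1_L2" using fL fI frad by (simp add: radial_L1_L2_def radial_L2_carrier)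
  define a where "a k = of_real (pochhammer \<nu> k / fact k / sqrt (dk k)) * (LINT z|iota. f z * wfun \<nu> k z)" for k
  define I where "I = (LINT z|iota. cmod (f z))"
  have I0: "I \<ge> 0" by (simp add: I_def integral_nonneg)
  have pp: "pochhammer \<nu> k > 0" for k by (rule pochhammer_pos[OF nupos])
  have dk1: "dk k \<ge> 1" for k by (rule hdim_ge_1[OF Npos])
  have aS: "summable (\<lambda>k. cmod (a k))"
  proof (rule summable_comparison_test'[where g = "\<lambda>k. (pochhammer \<nu> k / fact k * s ^ k) * I"])
   show "summable (\<lambda>k. pochhammer \<nu> k / fact k * s ^ k * I)"
    by (intro summable_mult2 sums_summable[OF pochhammer_binomial_sums]) (use s in simp)
   show "norm (cmod (a k)) \<le> pochhammer \<nu> k / fact k * s ^ k * I" for k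
   proof -
    have "cmod (a k) = (pochhammer \<nu> k / fact k / sqrt (dk k)) * cmod (LINT z|iota. f z * wfun \<nu> k z)"
     unfolding a_def norm_mult norm_of_real using pp[of k] dk1[of k] by simp
    also have "\<dots> \<le> (pochhammer \<nu> k / fact k / 1) * (s ^ k * I)"
     unfolding I_def using pp[of k] dk1[of k] ft_expansion(2)[OF fI s supp, of k]
     by (intro mult_mono divide_left_mono) auto
    finally show ?thesis by (simp add: mult.assoc)
   qed
  qed
  have exp: "(\<lambda>k. a k * (ek k l * cnj (F l))) sums (ft f l * cnj (G l))" for l
  proof -
   have "(\<lambda>k. (of_real (pochhammer \<nu> k / fact k * sk k l) * (LINT z|iota. f z * wfun \<nu> k z)) * cnj (G l)) sums (ft f l * cnj (G l))"
    by (intro sums_mult2 ft_expansion(1)[OF fI s supp])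
   moreover have "(of_real (pochhammer \<nu> k / fact k * sk k l) * (LINT z|iota. f z * wfun \<nu> k z)) * cnj (G l) = a k * (ek k l * cnj (F l))" for k
    using dk1[of k] by (simp add: a_def ek_def G_def)
   ultimately show ?thesis by simp
  qed
  have int0: "(LINT l|\<mu>. ek k l * cnj (F l)) = 0" for k
   using orth[of k] cnj_ip[of \<mu> F "ek k"] by (simp add: ip_def)
  have S: "(\<lambda>k. LINT l|\<mu>. a k * (ek k l * cnj (F l))) sums (LINT l|\<mu>. (\<Sum>k. a k * (ek k l * cnj (F l))))"
  proof (rule sums_integral)
   show "integrable \<mu> (\<lambda>l. a k * (ek k l * cnj (F l)))" for k by (intro integrable_mult_right L2_mult_integrable ek_L2 F)
   have b: "(LINT l|\<mu>. norm (a k * (ek k l * cnj (F l)))) \<le> cmod (a k) * nrm \<mu> F" for k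
   proof -
    have "(LINT l|\<mu>. norm (a k * (ek k l * cnj (F l)))) = cmod (a k) * (LINT l|\<mu>. cmod (ek k l) * cmod (F l))"
     by (simp add: norm_mult)
    also have "\<dots> \<le> cmod (a k) * (1 * nrm \<mu> F)" using L2_norm_CS[OF ek_L2 F, of k] unfolding nrm_ek by (intro mult_left_mono) auto
    finally show ?thesis by simp
   qed
   show "summable (\<lambda>k. LINT l|\<mu>. norm (a k * (ek k l * cnj (F l))))"
    by (rule summable_comparison_test'[OF summable_mult2[OF aS, of "nrm \<mu> F"]]) (use b in \<open>simp add: integral_nonneg\<close>)
   have "(\<integral>\<^sup>+l. (\<Sum>k. ennreal (norm (a k * (ek k l * cnj (F l))))) \<partial>\<mu>) = (\<Sum>k. \<integral>\<^sup>+l. ennreal (norm (a k * (ek k l * cnj (F l)))) \<partial>\<mu>)"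
    by (rule nn_integral_suminf) (use measurable_ek mF in measurable)
   also have "\<dots> \<le> (\<Sum>k. ennreal (cmod (a k) * nrm \<mu> F))"
   proof (intro suminf_le)
    fix k
    have "(\<integral>\<^sup>+l. ennreal (norm (a k * (ek k l * cnj (F l)))) \<partial>\<mu>) = ennreal (LINT l|\<mu>. norm (a k * (ek k l * cnj (F l))))"
     by (intro nn_integral_eq_integral integrable_norm integrable_mult_right L2_mult_integrable ek_L2 F) auto
    thus "(\<integral>\<^sup>+l. ennreal (norm (a k * (ek k l * cnj (F l)))) \<partial>\<mu>) \<le> ennreal (cmod (a k) * nrm \<mu> F)" using b[of k] by (simp add: ennreal_leI)
   qed auto
   also have "\<dots> = ennreal (\<Sum>k. cmod (a k) * nrm \<mu> F)" by (intro suminf_ennreal2 summable_mult2 aS) auto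
   also have "\<dots> < \<infinity>" by simp
   finally have "(\<integral>\<^sup>+l. (\<Sum>k. ennreal (norm (a k * (ek k l * cnj (F l))))) \<partial>\<mu>) \<noteq> \<infinity>" by simp
   hence "AE l in \<mu>. (\<Sum>k. ennreal (norm (a k * (ek k l * cnj (F l))))) \<noteq> \<infinity>"
    by (intro nn_integral_PInf_AE) (use measurable_ek mF in measurable)
   thus "AE l in \<mu>. summable (\<lambda>k. norm (a k * (ek k l * cnj (F l))))"
    by eventually_elim (intro summable_suminf_not_top, auto)
  qed
  have z: "(LINT l|\<mu>. a k * (ek k l * cnj (F l))) = 0" for k by (simp add: int0)
  have e: "(\<Sum>k. a k * (ek k l * cnj (F l))) = ft f l * cnj (G l)" for l using exp by (simp add: sums_iff)
  have "ip \<mu> (ft f) G = 0" using sums_unique2[OF S[unfolded z e] sums_zero] by (simp add: ip_def)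
  moreover have "ip \<mu> (ft f) G = ip \<mu> (U1 f) (U1 f0)"
  proof (rule ip_cong_AE)
   show "AE l in \<mu>. ft f l = U1 f l" using U1_AE[OF fD] by eventually_elim simp
   show "AE l in \<mu>. G l = U1 f0 l" using UG by eventually_elim simp
  qed (auto intro: ft_L2 fD GL U1_L2 f0 radial_L1_L2_D)
  ultimately have "ip iota f f0 = 0" using U1_ip[OF radial_L1_L2_D(1)[OF fD] f0(1)] by simp
  moreover have "ip iota f f0 = ip iota f f"
   unfolding ip_def by (rule Bochner_Integration.integral_cong) (auto simp: f_def)
  ultimately have "nrm iota f = 0" by (simp add: ip_self)
  hence "AE z in iota. f z = 0" using nrm_eq_0_iff[OF fL] by simp
  thus ?thesis by eventually_elim (auto simp: f_def)
 qed
 have "AE z in iota. \<forall>n::nat. (norm z)^2 \<le> real (n + 1) / real (n + 2) \<longrightarrow> f0 z = 0"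
  unfolding AE_all_countable by (intro allI main) auto
 hence "AE z in iota. f0 z = 0"
  using AE_iota_ball
 proof eventually_elim
  case (elim z)
  have "(norm z)^2 < 1" using elim(2) by (simp add: abs_square_less_1)
  moreover have "(\<lambda>n::nat. real (n + 1) / real (n + 2)) \<longlonglongrightarrow> 1" by real_asymp
  ultimately have "eventually (\<lambda>n::nat. (norm z)^2 < real (n + 1) / real (n + 2)) sequentially" by (intro order_tendstoD(1))
  then obtain n :: nat where "(norm z)^2 < real (n + 1) / real (n + 2)" using eventually_happens' sequentially_bot by blast
  thus ?case using elim(1) less_imp_le by blast
 qed
 hence "nrm iota f0 = 0" using nrm_eq_0_iff[OF f0L] by simp
 hence "ip \<mu> (U1 f0) (U1 f0) = 0" using U1_ip[OF f0(1) f0(1)] by (simp add: ip_self)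
 hence "nrm \<mu> (U1 f0) = 0" by (simp add: ip_self)
 hence "AE l in \<mu>. U1 f0 l = 0" using nrm_eq_0_iff[OF U1_L2[OF f0(1)]] by simp
 thus ?thesis using UG
 proof eventually_elim
  case (elim l)
  thus ?case using hh_pos[of l] by (simp add: G_def)
 qed
qed

text \<open>Riesz-Fischer provides a function with the same coefficients and the right norm, and
  completeness identifies it with w.\<close>

lemma ek_Parseval:
 assumes w: "w \<in> L2 \<mu>" shows "(nrm \<mu> w)^2 = (\<Sum>k. (cmod (ip \<mu> w (ek k)))^2)"
proof -
 obtain u r where u: "u \<in> L2 \<mu>" "\<And>k. ip \<mu> u (ek k) = ip \<mu> w (ek k)" "(nrm \<mu> u)^2 = (\<Sum>k. (cmod (ip \<mu> w (ek k)))^2)"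
   and "strict_mono (r :: nat \<Rightarrow> nat)" "AE x in \<mu>. (\<lambda>j. \<Sum>k<r j. ip \<mu> w (ek k) * ek k x) \<longlonglongrightarrow> u x"
  by (rule Riesz_Fischer[OF ek_L2 ek_orthonormal orthonormal_Bessel[OF ek_L2 ek_orthonormal w]]; rule that)
 have "AE l in \<mu>. u l - w l = 0"
  by (rule ek_complete) (auto intro: L2_diff u w simp: ip_diff_left[OF u(1) w ek_L2] u)
 hence "nrm \<mu> u = nrm \<mu> w" unfolding nrm_def
  by (intro arg_cong[where f = sqrt] integral_cong_AE) (use u w in \<open>auto simp: L2_iff\<close>)
 thus ?thesis using u by simp
qed

end

section \<open>Holomorphic functions and the Bergman space\<close>

definition cdiff :: "(complex^'n::finite \<Rightarrow> complex) \<Rightarrow> complex^'n \<Rightarrow> bool" where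
 "cdiff f z \<longleftrightarrow> (\<exists>L. (f has_derivative L) (at z) \<and> (\<forall>c v. L (c *s v) = c * L v))"

lemma holomorphic_Cn_iff: "holomorphic_Cn f S \<longleftrightarrow> (\<forall>z\<in>S. cdiff f z)"
 by (simp add: holomorphic_Cn_def cdiff_def)

lemma cdiff_const: "cdiff (\<lambda>z. c) z"
 unfolding cdiff_def by (intro exI[of _ "\<lambda>h. 0"]) auto

lemma cdiff_add: assumes "cdiff f z" "cdiff g z" shows "cdiff (\<lambda>z. f z + g z) z"
proof -
 obtain L K where "(f has_derivative L) (at z)" "\<And>c v. L (c *s v) = c * L v" "(g has_derivative K) (at z)" "\<And>c v. K (c *s v) = c * K v"
  using assms unfolding cdiff_def by blast
 thus ?thesis unfolding cdiff_def by (intro exI[of _ "\<lambda>h. L h + K h"]) (auto intro!: derivative_eq_intros simp: distrib_left)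
qed

lemma cdiff_mult: assumes "cdiff f z" "cdiff g z" shows "cdiff (\<lambda>z. f z * g z) z"
proof -
 obtain L K where "(f has_derivative L) (at z)" "\<And>c v. L (c *s v) = c * L v" "(g has_derivative K) (at z)" "\<And>c v. K (c *s v) = c * K v"
  using assms unfolding cdiff_def by blast
 thus ?thesis unfolding cdiff_def by (intro exI[of _ "\<lambda>h. f z * K h + L h * g z"]) (auto intro!: derivative_eq_intros simp: algebra_simps)
qed

lemma cdiff_compose_field:
 assumes "cdiff g z" "(f has_field_derivative d) (at (g z))" shows "cdiff (\<lambda>z. f (g z)) z"
proof -
 obtain L where L: "(g has_derivative L) (at z)" "\<And>c v. L (c *s v) = c * L v" using assms unfolding cdiff_def by blast
 have "((\<lambda>z. f (g z)) has_derivative (\<lambda>h. d * L h)) (at z)"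
  using has_derivative_compose[OF L(1)] assms(2) unfolding has_field_derivative_def by blast
 thus ?thesis unfolding cdiff_def using L(2) by (intro exI[of _ "\<lambda>h. d * L h"]) (simp add: mult.left_commute)
qed

lemma cdiff_divide: assumes "cdiff f z" "cdiff g z" "g z \<noteq> 0" shows "cdiff (\<lambda>z. f z / g z) z"
proof -
 have "cdiff (\<lambda>z. inverse (g z)) z"
  by (rule cdiff_compose_field[OF assms(2)]) (rule DERIV_inverse[OF assms(3)])
 from cdiff_mult[OF assms(1) this] show ?thesis by (simp add: divide_inverse)
qed

lemma cdiff_nth: "cdiff (\<lambda>z. z $ j) z"
 unfolding cdiff_def
 by (intro exI[of _ "\<lambda>h. h $ j"]) (auto intro!: bounded_linear_imp_has_derivative bounded_linear_vec_nth)

lemma cdiff_sum: "(\<And>i. i \<in> I \<Longrightarrow> cdiff (f i) z) \<Longrightarrow> cdiff (\<lambda>z. \<Sum>i\<in>I. f i z) z"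
 by (induction I rule: infinite_finite_induct) (auto intro: cdiff_add cdiff_const)

lemma cdiff_hprod: "cdiff (\<lambda>z. hprod z w) z"
 unfolding hprod_def by (intro cdiff_sum cdiff_mult cdiff_nth cdiff_const)

lemma cdiff_transform:
 assumes "cdiff f z" "open S" "z \<in> S" "\<And>u. u \<in> S \<Longrightarrow> f u = g u" shows "cdiff g z"
 using assms unfolding cdiff_def by (metis has_derivative_transform_within_open)

lemma cdiff_compose_vec:
 fixes g :: "complex^'n::finite \<Rightarrow> complex^'n"
 assumes f: "cdiff f (g z)" and g: "\<And>i. cdiff (\<lambda>z. g z $ i) z"
 shows "cdiff (\<lambda>z. f (g z)) z"
proof -
 obtain L where L: "(f has_derivative L) (at (g z))" "\<And>c v. L (c *s v) = c * L v" using f unfolding cdiff_def by blast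
 have "\<forall>i. \<exists>D. ((\<lambda>z. g z $ i) has_derivative D) (at z) \<and> (\<forall>c v. D (c *s v) = c * D v)" using g unfolding cdiff_def by blast
 then obtain D where D: "\<And>i. ((\<lambda>z. g z $ i) has_derivative D i) (at z)" "\<And>i c v. D i (c *s v) = c * D i v" by metis
 have "(g has_derivative (\<lambda>h. \<chi> i. D i h)) (at z)"
  unfolding has_derivative_componentwise_within[of g]
 proof
  fix b :: "complex^'n" assume "b \<in> Basis"
  then obtain i c where b: "b = axis i c" by (auto simp: Basis_vec_def)
  show "((\<lambda>x. g x \<bullet> b) has_derivative (\<lambda>x. (\<chi> i. D i x) \<bullet> b)) (at z)"
   unfolding b inner_axis using has_derivative_inner_left[OF D(1)[of i], of c] by simp
 qed
 from has_derivative_compose[OF this L(1)]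
 have "((\<lambda>z. f (g z)) has_derivative (\<lambda>h. L (\<chi> i. D i h))) (at z)" .
 moreover have "L (\<chi> i. D i (c *s v)) = c * L (\<chi> i. D i v)" for c v
 proof -
  have "(\<chi> i. D i (c *s v)) = c *s (\<chi> i. D i v)" by (simp add: vec_eq_iff D(2))
  thus ?thesis by (simp add: L(2))
 qed
 ultimately show ?thesis unfolding cdiff_def by blast
qed

lemma cdiff_act: assumes "den x z \<noteq> 0" shows "cdiff (\<lambda>z. act x z $ i) z"
proof -
 have d: "(\<Sum>j\<in>UNIV. x $ None $ Some j * z $ j) + x $ None $ None \<noteq> 0"
  using assms by (simp add: den_def matrix_vector_mult_def sum_option)
 show ?thesis unfolding act_def vec_lambda_beta
  by (intro cdiff_divide cdiff_add cdiff_sum cdiff_mult cdiff_nth cdiff_const d)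
qed

lemma cdiff_line:
 assumes "cdiff g (a + \<zeta> *s b)" shows "\<exists>d. ((\<lambda>\<zeta>. g (a + \<zeta> *s b)) has_field_derivative d) (at \<zeta>)"
proof -
 obtain L where L: "(g has_derivative L) (at (a + \<zeta> *s b))" "\<And>c v. L (c *s v) = c * L v" using assms unfolding cdiff_def by blast
 have bl: "bounded_linear (\<lambda>h::complex. h *s b)"
 proof (rule bounded_linear_intro[where K = "norm b"])
  fix x y :: complex and r :: real
  show "(x + y) *s b = x *s b + y *s b" by (simp add: vector_sadd_rdistrib)
  show "(r *\<^sub>R x) *s b = r *\<^sub>R (x *s b)" by (simp add: vec_eq_iff)
  show "norm (x *s b) \<le> norm x * norm b"
  proof -
   have "norm (x *s b) = norm x * norm b" unfolding norm_vec_def by (simp add: norm_mult L2_set_left_distrib L2_set_right_distrib)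
   thus ?thesis by simp
  qed
 qed
 have "((\<lambda>\<zeta>. a + \<zeta> *s b) has_derivative (\<lambda>h. h *s b)) (at \<zeta>)"
  by (auto intro!: derivative_eq_intros bounded_linear_imp_has_derivative bl)
 from has_derivative_compose[OF this L(1)]
 have "((\<lambda>\<zeta>. g (a + \<zeta> *s b)) has_derivative (\<lambda>h. L b * h)) (at \<zeta>)" by (simp add: L(2) mult.commute)
 thus ?thesis unfolding has_field_derivative_def by blast
qed

lemma norm_smult_vec: "norm (c *s v :: complex^'n::finite) = cmod c * norm v"
 unfolding norm_vec_def by (simp add: norm_mult L2_set_left_distrib L2_set_right_distrib)

lemma scaleR_vec_complex: "r *\<^sub>R (v :: complex^'n) = complex_of_real r *s v"
 by (simp add: vec_eq_iff) (simp add: scaleR_conv_of_real)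

text \<open>Differentiation under the integral sign, by a second-order Taylor bound for \<psi> that
  is uniform on a closed disc of radius below 1. It is the source of holomorphy for limits in the
  Bergman space and for homogeneous components.\<close>

lemma cdiff_kernel_integral:
 fixes M :: "(complex^'n::finite) measure"
 assumes g: "integrable M g" and ball: "AE u in M. norm u < 1" and sets: "sets M = sets borel"
  and psi: "\<psi> holomorphic_on ball 0 1" and mpsi: "\<psi> \<in> borel_measurable borel" and z: "norm z < 1"
 shows "cdiff (\<lambda>z. LINT u|M. g u * \<psi> (hprod z u)) z"
proof -
 \<comment> \<open>\<rho> lies strictly between |z| and 1, which leaves room for increments of z
   while all products with points of the ball stay in the closed disc of radius \<rho>.\<close>
 define r \<rho> where "r = norm z" and "\<rho> = (1 + norm z) / 2"
 have r: "0 \<le> r" "r < \<rho>" "\<rho> < 1" using z by (auto simp: r_def \<rho>_def)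
 have sub: "cball 0 \<rho> \<subseteq> ball (0::complex) 1" using r by auto
 have bdd: "\<exists>C\<ge>0. \<forall>x\<in>cball 0 \<rho>. cmod (q x) \<le> C" if "q holomorphic_on ball 0 1" for q
 proof -
  have "compact (q ` cball 0 \<rho>)"
   using that sub by (intro compact_continuous_image holomorphic_on_imp_continuous_on) (auto elim: holomorphic_on_subset)
  then obtain C where C: "\<forall>y\<in>q ` cball 0 \<rho>. cmod y \<le> C" using compact_imp_bounded bounded_iff by blast
  hence "\<forall>x\<in>cball 0 \<rho>. cmod (q x) \<le> max C 0" by (auto simp: le_max_iff_disj)
  thus ?thesis by (intro exI[of _ "max C 0"]) auto
 qed
 define p1 p2 where "p1 = deriv \<psi>" and "p2 = deriv p1"
 have h1: "p1 holomorphic_on ball 0 1" unfolding p1_def by (intro holomorphic_deriv psi) auto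
 have h2: "p2 holomorphic_on ball 0 1" unfolding p2_def by (intro holomorphic_deriv h1) auto
 obtain C0 where C0: "C0 \<ge> 0" "\<And>x. x \<in> cball 0 \<rho> \<Longrightarrow> cmod (\<psi> x) \<le> C0" using bdd[OF psi] by blast
 obtain C1 where C1: "C1 \<ge> 0" "\<And>x. x \<in> cball 0 \<rho> \<Longrightarrow> cmod (p1 x) \<le> C1" using bdd[OF h1] by blast
 obtain C2 where C2: "C2 \<ge> 0" "\<And>x. x \<in> cball 0 \<rho> \<Longrightarrow> cmod (p2 x) \<le> C2" using bdd[OF h2] by blast
 have taylor: "cmod (\<psi> y - \<psi> x - p1 x * (y - x)) \<le> C2 * (cmod (y - x))^2" if "x \<in> cball 0 \<rho>" "y \<in> cball 0 \<rho>" for x y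
 proof -
  define f where "f i = (if i = 0 then \<psi> else if i = 1 then p1 else p2)" for i :: nat
  have "cmod (f 0 y - (\<Sum>i\<le>1. f i x * (y - x) ^ i / fact i)) \<le> C2 * cmod (y - x) ^ Suc 1 / fact 1"
  proof (rule complex_Taylor[of "cball 0 \<rho>"])
   show "(f i has_field_derivative f (Suc i) u) (at u within cball 0 \<rho>)" if "u \<in> cball 0 \<rho>" "i \<le> 1" for i u
   proof -
    have u: "u \<in> ball 0 1" using that sub by blast
    have "(\<psi> has_field_derivative p1 u) (at u)" unfolding p1_def by (rule holomorphic_derivI[OF psi open_ball u])
    moreover have "(p1 has_field_derivative p2 u) (at u)" unfolding p2_def by (rule holomorphic_derivI[OF h1 open_ball u])
    moreover have "i = 0 \<or> i = 1" using that by auto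
    ultimately show ?thesis unfolding f_def by (auto intro: has_field_derivative_at_within)
   qed
  qed (use that C2 in \<open>auto simp: f_def\<close>)
  thus ?thesis by (simp add: f_def power2_eq_square algebra_simps)
 qed
 \<comment> \<open>The derivative of \<psi>, cut off outside the disc so that it is Borel on the
   whole plane.\<close>
 define q where "q x = indicator (ball 0 1) x *\<^sub>R p1 x" for x
 have mq: "q \<in> borel_measurable borel" unfolding q_def[abs_def]
  by (rule borel_measurable_continuous_on_indicator) (auto intro: holomorphic_on_imp_continuous_on h1)
 have qp: "q x = p1 x" if "x \<in> cball 0 \<rho>" for x using that sub by (auto simp: q_def)
 have mg: "g \<in> borel_measurable M" using g by (rule borel_measurable_integrable)
 have mh: "(\<lambda>u. hprod a u) \<in> borel_measurable M" for a
  unfolding measurable_cong_sets[OF sets refl] hprod_def by (intro borel_measurable_continuous_onI continuous_intros)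
 have in_ball: "hprod a u \<in> cball 0 \<rho>" if "norm a \<le> \<rho>" "norm u < 1" for a u
 proof -
  have "cmod (hprod a u) \<le> norm a * norm u" by (rule norm_hprod_le)
  also have "\<dots> \<le> \<rho> * 1" using that r by (intro mult_mono) auto
  finally show ?thesis by simp
 qed
 have hle: "cmod (hprod h u) \<le> norm h" if "norm u < 1" for h u
 proof -
  have "cmod (hprod h u) \<le> norm h * norm u" by (rule norm_hprod_le)
  also have "\<dots> \<le> norm h * 1" using that by (intro mult_left_mono) auto
  finally show ?thesis by simp
 qed
 have gI: "integrable M (\<lambda>u. K * cmod (g u))" for K using g by simp
 have I0: "integrable M (\<lambda>u. g u * \<psi> (hprod a u))" if "norm a \<le> \<rho>" for a
 proof (rule Bochner_Integration.integrable_bound[OF gI[of C0]])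
  show "(\<lambda>u. g u * \<psi> (hprod a u)) \<in> borel_measurable M" using mg mh mpsi by measurable
  show "AE u in M. norm (g u * \<psi> (hprod a u)) \<le> norm (C0 * cmod (g u))"
   using ball
  proof eventually_elim
   case (elim u)
   thus ?case using mult_right_mono[OF C0(2)[OF in_ball[OF that elim]], of "cmod (g u)"] C0(1) by (simp add: norm_mult abs_mult mult.commute)
  qed
 qed
 have zr: "norm z \<le> \<rho>" using r by (simp add: r_def)
 have B1: "AE u in M. norm (g u * (q (hprod z u) * hprod h u)) \<le> (C1 * norm h) * cmod (g u)" for h
  using ball
 proof eventually_elim
  case (elim u)
  have "cmod (q (hprod z u) * hprod h u) \<le> C1 * norm h"
   unfolding norm_mult qp[OF in_ball[OF zr elim]] using C1 hle[OF elim] in_ball[OF zr elim] by (intro mult_mono) auto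
  thus ?case using mult_right_mono[of _ _ "cmod (g u)"] by (fastforce simp: norm_mult mult.commute)
 qed
 have I1: "integrable M (\<lambda>u. g u * (q (hprod z u) * hprod h u))" for h
 proof (rule Bochner_Integration.integrable_bound[OF gI[of "C1 * norm h"]])
  show "(\<lambda>u. g u * (q (hprod z u) * hprod h u)) \<in> borel_measurable M" using mg mh mq by measurable
  show "AE u in M. norm (g u * (q (hprod z u) * hprod h u)) \<le> norm (C1 * norm h * cmod (g u))"
   using B1[of h] by eventually_elim (use C1 in \<open>simp add: abs_mult\<close>)
 qed
 define f where "f z = (LINT u|M. g u * \<psi> (hprod z u))" for z
 define L where "L h = (LINT u|M. g u * (q (hprod z u) * hprod h u))" for h
 define G where "G = (LINT u|M. cmod (g u))"
 have Lc: "L (c *s v) = c * L v" for c v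
  unfolding L_def by (simp add: hprod_scale_left mult.left_commute)
 have Lbl: "bounded_linear L"
 proof (rule bounded_linear_intro[where K = "C1 * G"])
  show "L (x + y) = L x + L y" for x y
   unfolding L_def using I1 by (simp add: hprod_add_left distrib_left)
  show "L (t *\<^sub>R x) = t *\<^sub>R L x" for t x
   by (simp add: scaleR_vec_complex Lc) (simp add: scaleR_conv_of_real)
  show "norm (L x) \<le> norm x * (C1 * G)" for x
  proof -
   have "norm (L x) \<le> (LINT u|M. norm (g u * (q (hprod z u) * hprod x u)))" unfolding L_def by (rule integral_norm_bound)
   also have "\<dots> \<le> (LINT u|M. (C1 * norm x) * cmod (g u))"
    by (rule integral_mono_AE) (use I1 gI B1 in auto)
   finally show ?thesis by (simp add: G_def mult_ac)
  qed
 qed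
 have "(f has_derivative L) (at z)"
 proof (rule has_derivativeI_sandwich[of "\<rho> - r"])
  show "0 < \<rho> - r" using r by simp
  show "((\<lambda>y. C2 * G * norm (y - z)) \<longlongrightarrow> 0) (at z)"
   by (auto intro!: tendsto_eq_intros)
  fix y assume y: "y \<noteq> z" "dist y z < \<rho> - r"
  have yr: "norm y \<le> \<rho>" using y norm_triangle_ineq2[of y z] by (simp add: r_def dist_norm)
  have "(f y - f z) - L (y - z) = (LINT u|M. g u * (\<psi> (hprod y u) - \<psi> (hprod z u) - q (hprod z u) * hprod (y - z) u))"
   unfolding f_def L_def using I0[OF yr] I0[OF zr] I1[of "y - z"] by (simp add: right_diff_distrib)
  also have "norm \<dots> \<le> (LINT u|M. (C2 * (norm (y - z))^2) * cmod (g u))"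
  proof (rule order_trans[OF integral_norm_bound integral_mono_AE])
   have "integrable M (\<lambda>u. g u * \<psi> (hprod y u) - g u * \<psi> (hprod z u) - g u * (q (hprod z u) * hprod (y - z) u))"
    by (intro Bochner_Integration.integrable_diff I0 I1 yr zr)
   thus "integrable M (\<lambda>u. norm (g u * (\<psi> (hprod y u) - \<psi> (hprod z u) - q (hprod z u) * hprod (y - z) u)))"
    by (intro integrable_norm) (simp add: right_diff_distrib)
   show "AE u in M. norm (g u * (\<psi> (hprod y u) - \<psi> (hprod z u) - q (hprod z u) * hprod (y - z) u)) \<le> C2 * (norm (y - z))^2 * cmod (g u)"
    using ball
   proof eventually_elim
    case (elim u)
    have "cmod (\<psi> (hprod y u) - \<psi> (hprod z u) - q (hprod z u) * hprod (y - z) u) \<le> C2 * (cmod (hprod (y - z) u))^2"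
     unfolding hprod_diff_left qp[OF in_ball[OF zr elim]] by (intro taylor in_ball yr zr elim)
    also have "\<dots> \<le> C2 * (norm (y - z))^2" using C2(1) hle[OF elim, of "y - z"] by (intro mult_left_mono power_mono) auto
    finally show ?case using mult_left_mono[of _ _ "cmod (g u)"] by (fastforce simp: norm_mult mult.commute)
   qed
  qed (rule gI)
  finally show "norm (f y - f z - L (y - z)) / norm (y - z) \<le> C2 * G * norm (y - z)"
   using y by (simp add: G_def divide_le_eq power2_eq_square mult_ac)
 qed (rule Lbl)
 thus ?thesis unfolding cdiff_def f_def using Lc by blast
qed

text \<open>The reproducing kernel as a function of the Hermitian product. The cut-off makes it
  Borel on the plane and lets only bases with positive real part enter the power.\<close>

definition kpsi :: "real \<Rightarrow> complex \<Rightarrow> complex" where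
 "kpsi \<nu> x = (if x \<in> ball 0 1 then (1 - x) powr (of_real (- \<nu>)) else 0)"

lemma kpsi_holomorphic: "kpsi \<nu> holomorphic_on ball 0 1"
proof -
 have "(\<lambda>x. (1 - x) powr (of_real (- \<nu>))) holomorphic_on ball (0::complex) 1"
 proof (intro holomorphic_intros)
  fix x :: complex assume "x \<in> ball 0 1"
  hence "Re x < 1" using complex_Re_le_cmod[of x] by simp
  thus "1 - x \<notin> \<real>\<^sub>\<le>\<^sub>0" by (auto simp: complex_nonpos_Reals_iff)
 qed
 thus ?thesis by (rule holomorphic_transform) (simp add: kpsi_def)
qed

lemma kpsi_measurable: "kpsi \<nu> \<in> borel_measurable borel"
proof -
 have "(\<lambda>x. indicator (ball 0 1) x *\<^sub>R kpsi \<nu> x) \<in> borel_measurable borel"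
  by (rule borel_measurable_continuous_on_indicator) (auto intro: holomorphic_on_imp_continuous_on kpsi_holomorphic)
 moreover have "(\<lambda>x. indicator (ball 0 1) x *\<^sub>R kpsi \<nu> x) = kpsi \<nu>" by (auto simp: kpsi_def indicator_def fun_eq_iff)
 ultimately show ?thesis by simp
qed

lemma kpsi_sums: "cmod x < 1 \<Longrightarrow> (\<lambda>k. of_real (pochhammer \<nu> k / fact k) * x ^ k) sums kpsi \<nu> x"
 using pochhammer_binomial_sums_complex[of x "of_real \<nu>"] by (simp add: kpsi_def pochhammer_of_real)

lemma kpsi_cnj: "cnj (kpsi \<nu> x) = kpsi \<nu> (cnj x)"
proof (cases "cmod x < 1")
 case True
 have "(\<lambda>k. cnj (of_real (pochhammer \<nu> k / fact k) * x ^ k)) sums cnj (kpsi \<nu> x)"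
  by (subst sums_cnj) (rule kpsi_sums[OF True])
 moreover have "(\<lambda>k. cnj (of_real (pochhammer \<nu> k / fact k) * x ^ k)) = (\<lambda>k. of_real (pochhammer \<nu> k / fact k) * (cnj x) ^ k)" by simp
 ultimately have "(\<lambda>k. of_real (pochhammer \<nu> k / fact k) * (cnj x) ^ k) sums cnj (kpsi \<nu> x)" by simp
 moreover have "(\<lambda>k. of_real (pochhammer \<nu> k / fact k) * (cnj x) ^ k) sums kpsi \<nu> (cnj x)"
  using True by (intro kpsi_sums) simp
 ultimately show ?thesis by (rule sums_unique2)
qed (simp add: kpsi_def)

lemma circle_mean:
 assumes "f holomorphic_on ball 0 R" "R > 1"
 shows "set_integrable lborel {0..1} (\<lambda>t. f (cis (2 * pi * t)))"
  and "(LINT t:{0..1}|lborel. f (cis (2 * pi * t))) = f 0"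
proof -
 have cont: "continuous_on {0..1} (\<lambda>t. f (cis (2 * pi * t)))"
 proof (rule continuous_on_compose2[of "ball 0 R" f])
  show "continuous_on (ball 0 R) f" using assms holomorphic_on_imp_continuous_on by blast
  show "continuous_on {0..1} (\<lambda>t. cis (2 * pi * t))" unfolding cis_conv_exp by (intro continuous_intros)
 qed (use assms in auto)
 show I: "set_integrable lborel {0..1} (\<lambda>t. f (cis (2 * pi * t)))"
  by (rule borel_integrable_atLeastAtMost'[OF cont])
 have "((\<lambda>u. f u / (u - 0)) has_contour_integral (2 * of_real pi * \<i> * f 0)) (circlepath 0 1)"
 proof (rule Cauchy_integral_circlepath)
  show "continuous_on (cball 0 1) f" using assms by (intro holomorphic_on_imp_continuous_on) (auto elim: holomorphic_on_subset)
  show "f holomorphic_on ball 0 1" using assms by (auto elim: holomorphic_on_subset)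
 qed auto
 hence h1: "((\<lambda>t. f (circlepath 0 1 t) / circlepath 0 1 t * vector_derivative (circlepath 0 1) (at t within {0..1})) has_integral (2 * of_real pi * \<i> * f 0)) {0..1}"
  unfolding has_contour_integral_def by simp
 have h2: "f (circlepath 0 1 t) / circlepath 0 1 t * vector_derivative (circlepath 0 1) (at t within {0..1}) = 2 * of_real pi * \<i> * f (cis (2 * pi * t))" if "t \<in> {0..1}" for t
 proof -
  have v: "vector_derivative (circlepath 0 1) (at t within {0..1}) = 2 * of_real pi * \<i> * exp (2 * of_real pi * \<i> * of_real t)"
   using vector_derivative_circlepath01[of t 0 1] that by simp
  have c: "circlepath 0 1 t = exp (2 * of_real pi * \<i> * of_real t)" by (simp add: circlepath)
  have e: "cis (2 * pi * t) = exp (2 * of_real pi * \<i> * of_real t)" by (simp add: cis_conv_exp mult_ac)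
  show ?thesis unfolding v c e by simp
 qed
 have "((\<lambda>t. 2 * of_real pi * \<i> * f (cis (2 * pi * t))) has_integral (2 * of_real pi * \<i> * f 0)) {0..1}"
  by (rule has_integral_eq[OF h2 h1])
 hence "((\<lambda>t. (1 / (2 * of_real pi * \<i>)) * (2 * of_real pi * \<i> * f (cis (2 * pi * t)))) has_integral (1 / (2 * of_real pi * \<i>)) * (2 * of_real pi * \<i> * f 0)) {0..1}"
  by (rule has_integral_mult_right)
 hence "((\<lambda>t. f (cis (2 * pi * t))) has_integral f 0) {0..1}" by simp
 thus "(LINT t:{0..1}|lborel. f (cis (2 * pi * t))) = f 0"
  using set_borel_integral_eq_integral(2)[OF I] by (simp add: integral_unique)
qed

section \<open>The Bergman measure and the Bergman space\<close>

lemma sets_bergman [simp, measurable_cong]: "sets (bergman_measure \<nu> :: (complex^'n) measure) = sets borel"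
 by (simp add: bergman_measure_def)
lemma space_bergman [simp]: "space (bergman_measure \<nu> :: (complex^'n) measure) = UNIV"
 by (simp add: bergman_measure_def)

lemma bergman_const_pos: "\<nu> > real CARD('n) \<Longrightarrow> bergman_const TYPE('n::finite) \<nu> > 0"
 unfolding bergman_const_def by (intro divide_pos_pos mult_pos_pos Gamma_real_pos) auto

lemma bergman_const_weight:
 assumes "\<nu> > real CARD('n)" shows "bergman_const TYPE('n::finite) \<nu> * weight_integral CARD('n) \<nu> = 1"
proof -
 let ?N = "CARD('n)"
 have "?N = Suc (?N - 1)" by simp
 hence "real ?N * Gamma (real ?N) = fact ?N"
  using Gamma_fact[of "?N - 1", where 'a = real] by (metis fact_Suc of_nat_Suc add.commute of_nat_fact)
 moreover have "Gamma \<nu> > 0" "Gamma (\<nu> - real ?N) > 0" using assms by (auto intro!: Gamma_real_pos)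
 ultimately show ?thesis unfolding bergman_const_def weight_integral_def Beta_def by simp
qed

text \<open>Relative to the invariant measure \<open>iota\<close>, unitarity of the representation
  becomes a transformation rule for the weight (1 - |z|^2)^\<nu> alone, namely
  \<open>wt_act\<close>.\<close>

lemma bergman_density:
 assumes "\<nu> > real CARD('n)"
 shows "(bergman_measure \<nu> :: (complex^'n::finite) measure) = density iota (\<lambda>z. ennreal (bergman_const TYPE('n) \<nu> * (1 - (norm z)^2) powr \<nu>))"
proof -
 let ?c = "bergman_const TYPE('n) \<nu>"
 have c: "?c > 0" by (rule bergman_const_pos[OF assms])
 have "density iota (\<lambda>z::complex^'n. ennreal (?c * (1 - (norm z)^2) powr \<nu>)) = density ball_measure (\<lambda>z. ennreal ((1 - (norm z)^2) powr (- (real CARD('n) + 1))) * ennreal (?c * (1 - (norm z)^2) powr \<nu>))"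
  unfolding iota_def by (rule density_density_eq) measurable
 also have "\<dots> = bergman_measure \<nu>"
  unfolding bergman_measure_def
 proof (rule density_cong)
  show "AE z in (ball_measure :: (complex^'n) measure). ennreal ((1 - (norm z)^2) powr (- (real CARD('n) + 1))) * ennreal (?c * (1 - (norm z)^2) powr \<nu>) = ennreal (?c * (1 - (norm z)^2) powr (\<nu> - real CARD('n) - 1))"
  proof (rule AE_I2)
   fix z :: "complex^'n"
   have e: "- (real CARD('n) + 1) + \<nu> = \<nu> - real CARD('n) - 1" by simp
   show "ennreal ((1 - (norm z)^2) powr (- (real CARD('n) + 1))) * ennreal (?c * (1 - (norm z)^2) powr \<nu>) = ennreal (?c * (1 - (norm z)^2) powr (\<nu> - real CARD('n) - 1))"
    unfolding e[symmetric] powr_add using c by (simp add: ennreal_mult[symmetric] mult_ac)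
  qed
 qed measurable
 finally show ?thesis by simp
qed

locale bergman_setting =
 fixes N :: nat and \<nu> :: real and haar :: "('n::finite) gmat measure"
 assumes NC: "N = CARD('n)" and nu: "\<nu> > real N" and haar: "normalized_haar haar"
begin

abbreviation "M \<equiv> (bergman_measure \<nu> :: (complex^'n) measure)"
abbreviation "BH \<equiv> (bergman_space \<nu> :: (complex^'n \<Rightarrow> complex) ips)"
abbreviation "HC \<equiv> ips_carrier BH"
abbreviation "hb \<equiv> h_hat N \<nu>"
abbreviation "sb k l \<equiv> sqc N \<nu> l k"
abbreviation "ck k \<equiv> pochhammer \<nu> k / fact k"
abbreviation "W \<equiv> weight_integral N \<nu>"
abbreviation "cnu \<equiv> 1 / W"
definition wt :: "complex^'n \<Rightarrow> real" where "wt z = (1 - (norm z)^2) powr \<nu>"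

lemma Npos: "N \<ge> 1" by (simp add: NC Suc_leI)
lemma nupos: "\<nu> > 0" using nu by simp
lemma nuC: "\<nu> > real CARD('n)" using nu NC by simp

lemma W0: "W > 0" by (rule weight_integral_pos[OF nu Npos])

lemma measurable_wt [measurable]: "wt \<in> borel_measurable borel" unfolding wt_def[abs_def] by measurable
lemma wt_nonneg: "wt z \<ge> 0" by (simp add: wt_def)

lemma M_density: "M = density iota (\<lambda>z. ennreal (cnu * wt z))"
proof -
 have "bergman_const TYPE('n) \<nu> = cnu" using bergman_const_weight[OF nuC] W0 by (simp add: NC field_simps)
 thus ?thesis using bergman_density[OF nuC] by (simp add: wt_def[abs_def])
qed

lemma AE_M_ball: "AE z in M. norm z < 1"
 unfolding M_density using AE_iota_ball by (subst AE_density) auto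

lemma integral_M:
 fixes g :: "complex^'n \<Rightarrow> 'b::{banach, second_countable_topology}"
 assumes "g \<in> borel_measurable borel"
 shows "integral\<^sup>L M g = (LINT z|iota. (cnu * wt z) *\<^sub>R g z)" "integrable M g \<longleftrightarrow> integrable iota (\<lambda>z. (cnu * wt z) *\<^sub>R g z)"
proof -
 have g: "g \<in> borel_measurable iota" and m: "(\<lambda>z. cnu * wt z) \<in> borel_measurable iota"
  unfolding measurable_cong_sets[OF sets_iota refl] using assms by measurable
 have nn: "AE z in iota. 0 \<le> cnu * wt z" using W0 wt_nonneg by simp
 show "integral\<^sup>L M g = (LINT z|iota. (cnu * wt z) *\<^sub>R g z)" unfolding M_density by (rule integral_density[OF g m nn])
 show "integrable M g \<longleftrightarrow> integrable iota (\<lambda>z. (cnu * wt z) *\<^sub>R g z)" unfolding M_density by (rule integrable_density[OF g m nn])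
qed

text \<open>On the diagonal the degree k part of the kernel is (\<nu>)_k / k! |z|^(2k), so its
  integral should be the trace of the projection onto degree k, the dimension d_k. It is verified by
  induction from the recursion of the Beta function.\<close>

lemma integral_M_power:
 "integrable M (\<lambda>z. ((norm z)^2) ^ k)"
 "ck k * (LINT z|M. ((norm z)^2) ^ k) = hdim N k"
proof -
 have m: "(\<lambda>z::complex^'n. ((norm z)^2) ^ k) \<in> borel_measurable borel" by measurable
 have e: "(cnu * wt z) *\<^sub>R ((norm z)^2) ^ k = cnu * (((norm z)^2) ^ k * (1 - (norm z)^2) powr \<nu>)" for z :: "complex^'n" by (simp add: wt_def)
 show "integrable M (\<lambda>z. ((norm z)^2) ^ k)"
  unfolding integral_M(2)[OF m] e by (intro integrable_mult_right integrable_iota_weight nuC)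
 have e1: "(LINT z|M. ((norm z)^2) ^ k) = cnu * (real N * Beta (real N + real k) (\<nu> - real N))"
  unfolding integral_M(1)[OF m] e integral_mult_right_zero integral_iota_weight[OF nuC] by (simp add: NC)
 have e2: "pochhammer \<nu> k * (real N * Beta (real N + real k) (\<nu> - real N)) = pochhammer (real N) k * W"
 proof (induction k)
  case 0 show ?case by (simp add: weight_integral_def)
 next
  case (Suc k)
  have "(real N + real k + (\<nu> - real N)) * Beta (real N + real k + 1) (\<nu> - real N) = (real N + real k) * Beta (real N + real k) (\<nu> - real N)"
   by (rule Beta_plus1_left) (use Npos in \<open>auto dest: nonpos_Ints_nonpos\<close>)
  hence "(\<nu> + real k) * Beta (real N + real (Suc k)) (\<nu> - real N) = (real N + real k) * Beta (real N + real k) (\<nu> - real N)"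
   by (simp add: algebra_simps)
  moreover have "pochhammer \<nu> (Suc k) * (real N * Beta (real N + real (Suc k)) (\<nu> - real N)) = pochhammer \<nu> k * real N * ((\<nu> + real k) * Beta (real N + real (Suc k)) (\<nu> - real N))"
   by (simp add: pochhammer_Suc)
  ultimately have "pochhammer \<nu> (Suc k) * (real N * Beta (real N + real (Suc k)) (\<nu> - real N)) = (real N + real k) * (pochhammer \<nu> k * (real N * Beta (real N + real k) (\<nu> - real N)))"
   by (simp add: mult_ac)
  thus ?case unfolding Suc by (simp add: pochhammer_Suc)
 qed
 have e3: "ck k * (cnu * X) = cnu / fact k * (pochhammer \<nu> k * X)" for X by simp
 show "ck k * (LINT z|M. ((norm z)^2) ^ k) = hdim N k"
  unfolding e1 e3 e2 hdim_def using W0 by simp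
qed

lemma finite_M: "finite_measure M"
proof (rule finite_measureI)
 have "(LINT z|M. (1::real)) = 1" using integral_M_power(2)[of 0] by (simp add: hdim_def)
 moreover have "integrable M (\<lambda>z. 1::real)" using integral_M_power(1)[of 0] by simp
 ultimately have "(\<integral>\<^sup>+z. ennreal 1 \<partial>M) = ennreal 1" by (subst nn_integral_eq_integral) auto
 thus "emeasure M (space M) \<noteq> \<infinity>" by simp
qed

lemma L2_bounded:
 assumes "f \<in> borel_measurable M" "AE z in M. cmod (f z) \<le> B" shows "f \<in> L2 M"
proof -
 have "integrable M (\<lambda>z. (cmod (f z))^2)"
 proof (rule finite_measure.integrable_const_bound[OF finite_M])
  show "AE z in M. norm ((cmod (f z))^2) \<le> B^2" using assms(2) by eventually_elim (simp add: power_mono)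
 qed (use assms in measurable)
 thus ?thesis using assms by (simp add: L2_iff)
qed

lemma L2_integrable1: assumes "f \<in> L2 M" shows "integrable M f"
proof -
 have "(\<lambda>z. 1) \<in> L2 M" by (rule L2_bounded[where B = 1]) auto
 from L2_mult_integrable[OF assms this] show ?thesis by simp
qed

lemma HC_iff: "f \<in> HC \<longleftrightarrow> f \<in> L2 M \<and> (\<forall>z. norm z < 1 \<longrightarrow> cdiff f z) \<and> (\<forall>z. norm z \<ge> 1 \<longrightarrow> f z = 0)"
 by (auto simp: bergman_space_def holomorphic_Cn_iff)

lemma HC_L2: "f \<in> HC \<Longrightarrow> f \<in> L2 M" by (simp add: HC_iff)
lemma HC_out: "f \<in> HC \<Longrightarrow> \<not> norm z < 1 \<Longrightarrow> f z = 0" by (simp add: HC_iff)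
lemma HC_measurable: "f \<in> HC \<Longrightarrow> f \<in> borel_measurable borel"
 using HC_L2 by (simp add: L2_iff cong: measurable_cong_sets)
lemma ips_inner_H: "ips_inner BH f g = ip M f g" by (simp add: bergman_space_def ips_inner_L2)
lemma ips_norm_H: "ips_norm BH f = nrm M f" by (simp add: ips_norm_def ips_inner_H ip_self)
lemma ips_add_H: "ips_add BH f g = (\<lambda>z::complex^'n. f z + g z)" by (simp add: bergman_space_def L2_space_def)
lemma ips_scale_H: "ips_scale BH c f = (\<lambda>z::complex^'n. c * f z)" by (simp add: bergman_space_def L2_space_def)

lemma HC_add: "f \<in> HC \<Longrightarrow> g \<in> HC \<Longrightarrow> (\<lambda>z. f z + g z) \<in> HC"
 unfolding HC_iff by (auto intro: L2_add cdiff_add)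
lemma HC_scale: "f \<in> HC \<Longrightarrow> (\<lambda>z. c * f z) \<in> HC"
 unfolding HC_iff by (auto intro: L2_scale cdiff_mult cdiff_const)
lemma HC_diff: "f \<in> HC \<Longrightarrow> g \<in> HC \<Longrightarrow> (\<lambda>z. f z - g z) \<in> HC"
 using HC_add[of f "\<lambda>z. -1 * g z"] HC_scale[of g "-1"] by simp
lemma HC_zero: "(\<lambda>z. 0) \<in> HC" unfolding HC_iff by (auto intro: L2_zero cdiff_const)
lemma HC_sum: "(\<And>i. i \<in> I \<Longrightarrow> f i \<in> HC) \<Longrightarrow> (\<lambda>x. \<Sum>i\<in>I. f i x) \<in> HC"
 by (induction I rule: infinite_finite_induct) (auto intro: HC_add HC_zero)

lemma open_norm_less: "open {z::complex^'n. norm z < 1}"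
 by (rule open_Collect_less) (intro continuous_intros)+

lemma HC_bounded:
 assumes "\<And>z. norm z < 1 \<Longrightarrow> cdiff F z" "\<And>z. norm z < 1 \<Longrightarrow> cmod (F z) \<le> B"
  "(\<lambda>z. if norm z < 1 then F z else 0) \<in> borel_measurable borel"
 shows "(\<lambda>z. if norm z < 1 then F z else 0) \<in> HC"
 unfolding HC_iff
proof (intro conjI allI impI)
 show "(\<lambda>z. if norm z < 1 then F z else 0) \<in> L2 M"
  by (rule L2_bounded[where B = "max B 0"]) (use assms in \<open>auto simp: le_max_iff_disj\<close>)
 fix z :: "complex^'n" assume "norm z < 1"
 thus "cdiff (\<lambda>z. if norm z < 1 then F z else 0) z"
  by (intro cdiff_transform[OF assms(1) open_norm_less]) auto
qed auto

lemma measurable_if_ball: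
 fixes F :: "complex^'n \<Rightarrow> complex"
 assumes "\<And>z. norm z < 1 \<Longrightarrow> cdiff F z" shows "(\<lambda>z. if norm z < 1 then F z else 0) \<in> borel_measurable borel"
proof -
 have "continuous_on {z. norm z < 1} F"
  unfolding continuous_on_eq_continuous_at[OF open_norm_less]
  using assms has_derivative_continuous unfolding cdiff_def by blast
 hence "(\<lambda>z. indicator {z. norm z < 1} z *\<^sub>R F z) \<in> borel_measurable borel"
  by (intro borel_measurable_continuous_on_indicator borel_open open_norm_less)
 moreover have "(\<lambda>z. indicator {z. norm z < 1} z *\<^sub>R F z) = (\<lambda>z. if norm z < 1 then F z else 0)" by (auto simp: fun_eq_iff)
 ultimately show ?thesis by simp
qed

text \<open>The degree k term in the binomial expansion of the reproducing kernel (1 - <z,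
  w>)^(-\<nu>); \<open>Kw\<close> is the kernel itself.\<close>

definition Kmono :: "nat \<Rightarrow> complex^'n \<Rightarrow> complex^'n \<Rightarrow> complex" where
 "Kmono k w z = (if norm z < 1 then of_real (ck k) * hprod z w ^ k else 0)"

definition Kw :: "complex^'n \<Rightarrow> complex^'n \<Rightarrow> complex" where
 "Kw w z = (if norm z < 1 then kpsi \<nu> (hprod z w) else 0)"

lemma poch_pos: "pochhammer \<nu> k > 0" by (rule pochhammer_pos[OF nupos])

lemma cdiff_power: "cdiff f z \<Longrightarrow> cdiff (\<lambda>z. f z ^ k) z"
 by (induction k) (auto intro: cdiff_const cdiff_mult)

lemma Kmono_HC: "Kmono k w \<in> HC"
proof -
 have d: "cdiff (\<lambda>z. of_real (ck k) * hprod z w ^ k) z" for z :: "complex^'n"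
  by (intro cdiff_mult cdiff_const cdiff_power cdiff_hprod)
 have b: "cmod (of_real (ck k) * hprod z w ^ k) \<le> ck k * norm w ^ k" if "norm z < 1" for z
 proof -
  have "cmod (hprod z w) \<le> norm z * norm w" by (rule norm_hprod_le)
  also have "\<dots> \<le> 1 * norm w" using that by (intro mult_right_mono) auto
  finally have "cmod (hprod z w) ^ k \<le> norm w ^ k" by (intro power_mono) auto
  thus ?thesis unfolding norm_mult norm_power norm_of_real using poch_pos[of k] by (simp add: divide_right_mono)
 qed
 show ?thesis unfolding Kmono_def[abs_def] by (rule HC_bounded[OF d b measurable_if_ball[OF d]])
qed

lemma hprod_ball: "norm z < 1 \<Longrightarrow> norm w \<le> 1 \<Longrightarrow> hprod z w \<in> ball 0 1"
proof -
 assume "norm z < 1" "norm w \<le> 1"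
 have "cmod (hprod z w) \<le> norm z * norm w" by (rule norm_hprod_le)
 also have "\<dots> \<le> norm z * 1" using \<open>norm w \<le> 1\<close> by (intro mult_left_mono) auto
 finally show ?thesis using \<open>norm z < 1\<close> by simp
qed

lemma cdiff_kpsi: "norm z < 1 \<Longrightarrow> norm w \<le> 1 \<Longrightarrow> cdiff (\<lambda>z. kpsi \<nu> (hprod z w)) z"
 by (rule cdiff_compose_field[OF cdiff_hprod]) (rule holomorphic_derivI[OF kpsi_holomorphic open_ball hprod_ball])

lemma kpsi_bounded: "r < 1 \<Longrightarrow> \<exists>B. \<forall>x. cmod x \<le> r \<longrightarrow> cmod (kpsi \<nu> x) \<le> B"
proof -
 assume r: "r < 1"
 have "compact (kpsi \<nu> ` cball 0 r)"
  by (intro compact_continuous_image holomorphic_on_imp_continuous_on holomorphic_on_subset[OF kpsi_holomorphic] compact_cball)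
    (use r in auto)
 then obtain B where "\<forall>y\<in>kpsi \<nu> ` cball 0 r. cmod y \<le> B" using compact_imp_bounded bounded_iff by blast
 thus ?thesis by (intro exI[of _ B]) auto
qed

lemma Kw_HC: assumes w: "norm w < 1" shows "Kw w \<in> HC"
proof -
 obtain B where B: "\<And>x. cmod x \<le> norm w \<Longrightarrow> cmod (kpsi \<nu> x) \<le> B" using kpsi_bounded[OF w] by blast
 have d: "cdiff (\<lambda>z. kpsi \<nu> (hprod z w)) z" if "norm z < 1" for z using cdiff_kpsi[OF that] w by simp
 have b: "cmod (kpsi \<nu> (hprod z w)) \<le> B" if "norm z < 1" for z
 proof (rule B)
  have "cmod (hprod z w) \<le> norm z * norm w" by (rule norm_hprod_le)
  also have "\<dots> \<le> 1 * norm w" using that by (intro mult_right_mono) auto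
  finally show "cmod (hprod z w) \<le> norm w" by simp
 qed
 show ?thesis unfolding Kw_def[abs_def] by (rule HC_bounded[OF d b measurable_if_ball[OF d]])
qed

lemma coherent_eq: "coherent \<nu> w z = of_real ((1 - (norm w)^2) powr (\<nu> / 2)) * Kw w z" if "norm w < 1"
 using hprod_ball[of z w] that by (simp add: coherent_def Kw_def kpsi_def)

definition one :: "complex^'n \<Rightarrow> complex" where "one = indicator (ball 0 1)"

lemma one_eq: "one z = (if norm z < 1 then 1 else 0)" by (simp add: one_def indicator_def)

lemma one_Kmono: "one = Kmono 0 0" by (auto simp: fun_eq_iff one_eq Kmono_def)

lemma one_HC: "one \<in> HC" unfolding one_Kmono by (rule Kmono_HC)

lemma ip_one_one: "ip M one one = 1"
proof -
 have "ip M one one = (LINT z|M. complex_of_real 1)"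
  unfolding ip_def
 proof (rule integral_cong_AE)
  show "AE z in M. one z * cnj (one z) = complex_of_real 1" using AE_M_ball by eventually_elim (simp add: one_eq)
  show "(\<lambda>z. one z * cnj (one z)) \<in> borel_measurable M" using L2_measurable[OF HC_L2[OF one_HC]] by measurable
 qed simp
 also have "\<dots> = of_real (LINT z|M. 1)" by (rule integral_complex_of_real)
 also have "(LINT z|M. (1::real)) = 1" using integral_M_power(2)[of 0] by (simp add: hdim_def)
 finally show ?thesis by simp
qed

text \<open>With z' the preimage of z, the form identity at the pairs (z', z'), (0, 0) and (z', 0)
  eliminates the automorphy factors and leaves the kernel at w = x 0.\<close>

lemma wt_act:
 assumes x: "x \<in> SU_n1" and z: "norm z < 1"
 shows "wt (act (matrix_inv x) z) = (cmod (coherent \<nu> (act x 0) z))^2 * wt z"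
proof -
 define z' w where "z' = act (matrix_inv x) z" and "w = act x 0"
 have fp: "form_preserving x" "form_preserving (matrix_inv x)" using x SU_form SU_inverse by auto
 have z': "norm z' < 1" unfolding z'_def by (rule norm_act_less[OF fp(2) z])
 have az: "act x z' = z" unfolding z'_def by (rule act_inverse(1)[OF x z])
 have w: "norm w < 1" unfolding w_def by (rule norm_act_less[OF fp(1)]) simp
 have i1: "(cmod (den x z'))^2 * (1 - (norm z)^2) = 1 - (norm z')^2" using act_norm_identity[OF fp(1) z'] by (simp add: az)
 have i2: "(cmod (den x 0))^2 * (1 - (norm w)^2) = 1" using act_norm_identity[OF fp(1), of 0] by (simp add: w_def)
 have i3: "den x z' * cnj (den x 0) * (1 - hprod z w) = 1" using act_identity[OF fp(1) z', of 0] by (simp add: az w_def)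
 have pos: "1 - (norm w)^2 > 0" "1 - (norm z)^2 > 0" using w z by (auto simp: abs_square_less_1)
 have nz: "1 - hprod z w \<noteq> 0" using i3 by auto
 have "(cmod (den x z'))^2 * (cmod (den x 0))^2 * (cmod (1 - hprod z w))^2 = 1"
  using arg_cong[OF i3, of "\<lambda>a. (cmod a)^2"] by (simp add: norm_mult power_mult_distrib)
 hence "(cmod (den x z'))^2 * ((cmod (den x 0))^2 * (1 - (norm w)^2)) * (cmod (1 - hprod z w))^2 = 1 - (norm w)^2" by (simp add: mult_ac)
 hence "(cmod (den x z'))^2 * (cmod (1 - hprod z w))^2 = 1 - (norm w)^2" unfolding i2 by simp
 hence "(cmod (den x z'))^2 = (1 - (norm w)^2) * (cmod (1 - hprod z w)) powr (- 2)"
  using nz by (simp add: powr_minus divide_simps powr_numeral)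
 hence t: "1 - (norm z')^2 = (1 - (norm w)^2) * (cmod (1 - hprod z w)) powr (- 2) * (1 - (norm z)^2)" using i1 by simp
 have "wt z' = (1 - (norm w)^2) powr \<nu> * (cmod (1 - hprod z w)) powr (- 2 * \<nu>) * wt z"
  unfolding wt_def t using pos by (simp add: powr_mult powr_powr)
 moreover have "(cmod (coherent \<nu> w z))^2 = (1 - (norm w)^2) powr \<nu> * (cmod (1 - hprod z w)) powr (- 2 * \<nu>)"
 proof -
  have "cmod ((1 - hprod z w) powr of_real (- \<nu>)) = (cmod (1 - hprod z w)) powr (- \<nu>)"
   using norm_powr_real_powr'[of "of_real (- \<nu>)" "1 - hprod z w"] by simp
  moreover have "(b powr s)^2 = b powr (2 * s)" for b s :: real
   by (simp add: power2_eq_square powr_add[symmetric])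
  ultimately show ?thesis using z by (simp add: coherent_def norm_mult power_mult_distrib)
 qed
 ultimately show ?thesis unfolding z'_def w_def by simp
qed

lemma integral_iota_act:
 fixes F :: "complex^'n \<Rightarrow> 'b::{banach, second_countable_topology}"
 assumes "y \<in> SU_n1" "F \<in> borel_measurable borel"
 shows "(LINT z|iota. F (act y z)) = (LINT z|iota. F z)" "integrable iota (\<lambda>z. F (act y z)) \<longleftrightarrow> integrable iota F"
proof -
 have m: "act y \<in> iota \<rightarrow>\<^sub>M borel" by measurable
 show "(LINT z|iota. F (act y z)) = (LINT z|iota. F z)"
  using integral_distr[OF m assms(2)] iota_invariant[OF haar assms(1)] by simp
 show "integrable iota (\<lambda>z. F (act y z)) \<longleftrightarrow> integrable iota F"
  using integrable_distr_eq[OF m assms(2)] iota_invariant[OF haar assms(1)] by simp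
qed

abbreviation "rep x f \<equiv> bergman_rep \<nu> x f"

lemma rep_ball: "bergman_rep \<nu> x f z = (if norm z < 1 then coherent \<nu> (act x 0) z * f (act (matrix_inv x) z) else 0)"
 by (simp add: bergman_rep_def coherent_def)

text \<open>Change of variables in the invariant measure: by \<open>wt_act\<close>, the squared
  modulus of the coherent state is exactly the quotient of the weights. Square integrability of the
  transported function comes from the same identity with f in both slots.\<close>

lemma rep_HC_ip:
 assumes x: "x \<in> SU_n1" and f: "f \<in> HC" and g: "g \<in> HC"
 shows "rep x f \<in> HC" "ip M (rep x f) (rep x g) = ip M f g"
proof -
 define y w where "y = matrix_inv x" and "w = act x 0"
 have y: "y \<in> SU_n1" unfolding y_def by (rule SU_inverse(1)[OF x])
 have fp: "form_preserving x" "form_preserving y" using x y SU_form by auto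
 have w: "norm w < 1" unfolding w_def by (rule norm_act_less[OF fp(1)]) simp
 define c where "c = complex_of_real ((1 - (norm w)^2) powr (\<nu> / 2))"
 have d: "cdiff (\<lambda>z. (c * kpsi \<nu> (hprod z w)) * h (act y z)) z" if "norm z < 1" "h \<in> HC" for z h
 proof -
  have "cdiff h (act y z)" using that(2) norm_act_less[OF fp(2) that(1)] by (simp add: HC_iff)
  hence "cdiff (\<lambda>z. h (act y z)) z" by (rule cdiff_compose_vec) (rule cdiff_act[OF den_nonzero[OF fp(2) that(1)]])
  thus ?thesis using cdiff_kpsi[OF that(1), of w] w by (intro cdiff_mult cdiff_const) auto
 qed
 have r: "rep x h = (\<lambda>z. if norm z < 1 then (c * kpsi \<nu> (hprod z w)) * h (act y z) else 0)" for h
  unfolding fun_eq_iff rep_ball w_def[symmetric] y_def[symmetric] using w by (simp add: coherent_eq Kw_def c_def)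
 have m: "rep x h \<in> borel_measurable borel" if "h \<in> HC" for h unfolding r by (rule measurable_if_ball[OF d[OF _ that]])
 have key: "AE z in iota. (cnu * wt z) *\<^sub>R (rep x f z * cnj (rep x g z)) = (\<lambda>u. (cnu * wt u) *\<^sub>R (f u * cnj (g u))) (act y z)" for f g
  using AE_iota_ball
 proof eventually_elim
  case (elim z)
  have "rep x f z * cnj (rep x g z) = of_real ((cmod (coherent \<nu> (act x 0) z))^2) * (f (act y z) * cnj (g (act y z)))"
   using elim by (simp add: rep_ball y_def complex_norm_square mult_ac flip: of_real_power)
  thus ?case unfolding y_def using wt_act[OF x elim] by (simp add: scaleR_conv_of_real mult_ac)
 qed
 have mh: "(\<lambda>u. (cnu * wt u) *\<^sub>R (f u * cnj (g u))) \<in> borel_measurable borel" if "f \<in> HC" "g \<in> HC" for f g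
  using HC_measurable[OF that(1)] HC_measurable[OF that(2)] by measurable
 have mr: "(\<lambda>z. rep x f z * cnj (rep x g z)) \<in> borel_measurable borel" if "f \<in> HC" "g \<in> HC" for f g
  using m[OF that(1)] m[OF that(2)] by measurable
 have Iff: "integrable M (\<lambda>z. rep x f z * cnj (rep x f z))"
 proof -
  have "integrable M (\<lambda>z. f z * cnj (f z))" by (intro L2_mult_integrable HC_L2 f)
  hence "integrable iota (\<lambda>u. (cnu * wt u) *\<^sub>R (f u * cnj (f u)))"
   by (subst (asm) integral_M(2)) (use HC_measurable[OF f] in measurable)
  hence "integrable iota (\<lambda>z. (\<lambda>u. (cnu * wt u) *\<^sub>R (f u * cnj (f u))) (act y z))"
   by (subst integral_iota_act(2)[OF y mh[OF f f]])
  moreover have "integrable iota (\<lambda>z. (cnu * wt z) *\<^sub>R (rep x f z * cnj (rep x f z))) \<longleftrightarrow> integrable iota (\<lambda>z. (\<lambda>u. (cnu * wt u) *\<^sub>R (f u * cnj (f u))) (act y z))"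
   by (rule integrable_cong_AE) (use key[of f f] mr[OF f f] measurable_compose[OF measurable_act mh[OF f f]] in auto)
  ultimately have "integrable iota (\<lambda>z. (cnu * wt z) *\<^sub>R (rep x f z * cnj (rep x f z)))" by simp
  thus ?thesis by (subst integral_M(2)[OF mr[OF f f]])
 qed
 have "integrable M (\<lambda>z. (cmod (rep x f z))^2)"
 proof -
  have "integrable M (\<lambda>z. Re (rep x f z * cnj (rep x f z)))" by (rule integrable_Re[OF Iff])
  moreover have "Re (a * cnj a) = (cmod a)^2" for a by (metis Re_complex_of_real complex_norm_square)
  ultimately show ?thesis by (simp only:)
 qed
 moreover have "cdiff (rep x f) z" if "norm z < 1" for z
  unfolding r by (rule cdiff_transform[OF d[OF that f] open_norm_less]) (use that in auto)
 moreover have "rep x f \<in> borel_measurable M" using m[OF f] by simp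
 ultimately show "rep x f \<in> HC" unfolding HC_iff L2_iff by (auto simp: rep_ball)
 have "ip M (rep x f) (rep x g) = (LINT z|iota. (cnu * wt z) *\<^sub>R (rep x f z * cnj (rep x g z)))"
  unfolding ip_def by (rule integral_M(1)[OF mr[OF f g]])
 also have "\<dots> = (LINT z|iota. (\<lambda>u. (cnu * wt u) *\<^sub>R (f u * cnj (g u))) (act y z))"
  by (rule integral_cong_AE) (use key[of f g] mr[OF f g] measurable_compose[OF measurable_act mh[OF f g]] in auto)
 also have "\<dots> = (LINT u|iota. (cnu * wt u) *\<^sub>R (f u * cnj (g u)))"
  by (rule integral_iota_act(1)[OF y mh[OF f g]])
 also have "\<dots> = ip M f g"
  unfolding ip_def by (rule integral_M(1)[symmetric]) (use HC_measurable[OF f] HC_measurable[OF g] in measurable)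
 finally show "ip M (rep x f) (rep x g) = ip M f g" .
qed

end

text \<open>Numbers with positive real part have logarithms with imaginary part below pi/2 in
  modulus, so the logarithm of the product is the sum without a branch correction.\<close>

lemma powr_times_real_inverse:
 assumes "Re a > 0" "Re b > 0" "a * b = of_real r" "r > 0"
 shows "a powr s * b powr s = of_real r powr s"
proof -
 have nz: "a \<noteq> 0" "b \<noteq> 0" using assms by auto
 have "\<bar>Im (Ln a)\<bar> < pi / 2" "\<bar>Im (Ln b)\<bar> < pi / 2" using assms(1,2) Re_Ln_pos_lt[OF nz(1)] Re_Ln_pos_lt[OF nz(2)] by simp_all
 hence "Ln (a * b) = Ln a + Ln b" using nz by (intro Ln_times_simple) auto
 thus ?thesis using nz assms(3,4) by (simp add: powr_def exp_add[symmetric] distrib_left[symmetric])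
qed

context bergman_setting
begin

lemma den_inverse:
 fixes x :: "'n gmat"
 assumes x: "x \<in> SU_n1" shows "den (matrix_inv x) 0 = cnj (den x 0)"
proof -
 have j: "jform Z (lift 0) = Z $ None" "jform (lift 0) Z = cnj (Z $ None)" for Z :: "complex^('n option)"
  by (simp_all add: jform_def)
 have "jform (x *v (matrix_inv x *v lift 0)) (x *v lift 0) = jform (matrix_inv x *v lift 0) (lift 0)"
  by (rule form_preserving_jform[OF SU_form[OF x]])
 thus ?thesis unfolding matrix_vector_mul_assoc SU_inverse(3)[OF x] matrix_vector_mul_lid j den_def by simp
qed

text \<open>The representation is projective, but no phase occurs for x and its inverse: the factors
  1 - <z, w> and 1 - <z', w'> have positive real part and the positive product r = 1/|den x 0|^2, so
  their principal powers multiply to a real power of r, which cancels against the two normalizing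
  factors.\<close>

lemma rep_inverse:
 assumes x: "x \<in> SU_n1" and f: "f \<in> HC"
 shows "rep x (rep (matrix_inv x) f) = f"
proof
 fix z
 show "rep x (rep (matrix_inv x) f) z = f z"
 proof (cases "norm z < 1")
  case True
  define y z' w w' where "y = matrix_inv x" and "z' = act y z" and "w = act x 0" and "w' = act y 0"
  have y: "y \<in> SU_n1" unfolding y_def by (rule SU_inverse(1)[OF x])
  have fp: "form_preserving x" "form_preserving y" using x y SU_form by auto
  have z': "norm z' < 1" unfolding z'_def by (rule norm_act_less[OF fp(2) True])
  have ww: "norm w < 1" "norm w' < 1" unfolding w_def w'_def using norm_act_less[OF fp(1), of 0] norm_act_less[OF fp(2), of 0] by auto
  have az: "act x z' = z" unfolding z'_def y_def by (rule act_inverse(1)[OF x True])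
  have inv: "matrix_inv y = x"
  proof -
   have "matrix_inv y = (x ** y) ** matrix_inv y" by (simp add: SU_inverse(3)[OF x] y_def)
   also have "\<dots> = x" unfolding matrix_mul_assoc[symmetric] SU_inverse(3)[OF y] by simp
   finally show ?thesis .
  qed
  define d where "d = den x 0"
  have i1: "den x z' * cnj d * (1 - hprod z w) = 1" using act_identity[OF fp(1) z', of 0] by (simp add: az w_def d_def)
  have i2: "den y z * d * (1 - hprod z' w') = 1" using act_identity[OF fp(2) True, of 0] den_inverse[OF x] by (simp add: z'_def w'_def d_def y_def)
  have i3: "den x z' * den y z = 1"
  proof -
   have "lift z = x *v (y *v lift z)" by (simp add: matrix_vector_mul_assoc SU_inverse(3)[OF x] y_def)
   also have "\<dots> = den y z *s (x *v lift z')" unfolding mult_lift[OF fp(2) True] z'_def[symmetric] by (rule vector_scalar_commute)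
   finally have "lift z $ None = (den y z *s (x *v lift z')) $ None" by simp
   thus ?thesis by (simp add: den_def mult.commute)
  qed
  have d0: "d \<noteq> 0" using i2 by auto
  define r where "r = 1 / (cmod d)^2"
  have r0: "r > 0" using d0 by (simp add: r_def)
  have "(den x z' * den y z) * ((cnj d * d) * ((1 - hprod z w) * (1 - hprod z' w'))) = 1"
   using i1 i2 by (metis (no_types, lifting) mult.assoc mult.commute mult.left_commute mult.right_neutral)
  hence "(cnj d * d) * ((1 - hprod z w) * (1 - hprod z' w')) = 1" unfolding i3 by simp
  moreover have "cnj d * d = of_real ((cmod d)^2)" unfolding complex_norm_square by (simp add: mult.commute)
  ultimately have prod: "(1 - hprod z w) * (1 - hprod z' w') = of_real r"
   using d0 by (simp add: r_def divide_simps mult.commute)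
  have re: "Re (1 - hprod z w) > 0" if "norm z < 1" "norm w < 1" for z w :: "complex^'n"
  proof -
   have "hprod z w \<in> ball 0 1" using hprod_ball[of z w] that by simp
   hence "Re (hprod z w) < 1" using complex_Re_le_cmod[of "hprod z w"] by simp
   thus ?thesis by simp
  qed
  have P: "(1 - hprod z w) powr (of_real (- \<nu>)) * (1 - hprod z' w') powr (of_real (- \<nu>)) = of_real (r powr (- \<nu>))"
   using powr_times_real_inverse[OF re[OF True ww(1)] re[OF z' ww(2)] prod r0, of "of_real (- \<nu>)"] powr_of_real[of r "- \<nu>"] r0 by simp
  have n1: "1 - (norm w)^2 = r" using act_norm_identity[OF fp(1), of 0] d0 by (simp add: w_def r_def d_def field_simps)
  have n2: "1 - (norm w')^2 = r" using act_norm_identity[OF fp(2), of 0] d0 den_inverse[OF x] by (simp add: w'_def r_def d_def y_def field_simps)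
  have rr: "r powr (\<nu> / 2) * r powr (\<nu> / 2) * r powr (- \<nu>) = 1" using r0 by (simp flip: powr_add)
  have "rep x (rep y f) z = coherent \<nu> w z * (coherent \<nu> w' z' * f z)"
   using True z' by (simp add: rep_ball y_def[symmetric] w_def[symmetric] z'_def[symmetric] inv az w'_def[symmetric])
  also have "coherent \<nu> w z * (coherent \<nu> w' z' * f z) = (of_real (r powr (\<nu> / 2) * r powr (\<nu> / 2)) * ((1 - hprod z w) powr (of_real (- \<nu>)) * (1 - hprod z' w') powr (of_real (- \<nu>)))) * f z"
   using True z' by (simp add: coherent_def n1 n2)
  also have "\<dots> = of_real (r powr (\<nu> / 2) * r powr (\<nu> / 2) * r powr (- \<nu>)) * f z" unfolding P by simp
  finally show ?thesis unfolding rr y_def by simp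
 qed (simp add: rep_ball HC_out[OF f])
qed

lemma stab0_rep: "k \<in> stab0 \<Longrightarrow> norm z < 1 \<Longrightarrow> rep k f z = f (act (matrix_inv k) z)"
 by (simp add: rep_ball stab0_def coherent_def)

lemma integral_M_stab0:
 fixes F :: "complex^'n \<Rightarrow> complex"
 assumes k: "k \<in> stab0" and F: "F \<in> borel_measurable borel"
 shows "(LINT z|M. F (act k z)) = (LINT z|M. F z)" "integrable M (\<lambda>z. F (act k z)) \<longleftrightarrow> integrable M F"
proof -
 have ks: "k \<in> SU_n1" by (rule stab0_SU[OF k])
 have mk: "(\<lambda>z. F (act k z)) \<in> borel_measurable borel" by (rule measurable_compose[OF measurable_act F])
 have mG: "(\<lambda>u. (cnu * wt u) *\<^sub>R F u) \<in> borel_measurable borel" using F by measurable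
 have key: "AE z in iota. (cnu * wt z) *\<^sub>R F (act k z) = (\<lambda>u. (cnu * wt u) *\<^sub>R F u) (act k z)"
  using AE_iota_ball by eventually_elim (simp add: wt_def stab0_norm[OF k])
 have m1: "(\<lambda>z. (cnu * wt z) *\<^sub>R F (act k z)) \<in> borel_measurable iota" "(\<lambda>z. (\<lambda>u. (cnu * wt u) *\<^sub>R F u) (act k z)) \<in> borel_measurable iota"
  unfolding measurable_cong_sets[OF sets_iota refl] using mk measurable_compose[OF measurable_act mG] by measurable
 have "(LINT z|M. F (act k z)) = (LINT z|iota. (\<lambda>u. (cnu * wt u) *\<^sub>R F u) (act k z))"
  unfolding integral_M(1)[OF mk] by (rule integral_cong_AE[OF m1 key])
 thus "(LINT z|M. F (act k z)) = (LINT z|M. F z)"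
  unfolding integral_iota_act(1)[OF ks mG] integral_M(1)[OF F] .
 have "integrable iota (\<lambda>z. (cnu * wt z) *\<^sub>R F (act k z)) \<longleftrightarrow> integrable iota (\<lambda>z. (\<lambda>u. (cnu * wt u) *\<^sub>R F u) (act k z))"
  by (rule integrable_cong_AE[OF m1 key])
 thus "integrable M (\<lambda>z. F (act k z)) \<longleftrightarrow> integrable M F"
  unfolding integral_M(2)[OF mk] integral_M(2)[OF F] integral_iota_act(2)[OF ks mG] .
qed

lemma integral_M_rotate:
 fixes F :: "complex^'n \<Rightarrow> complex"
 assumes c: "cmod c = 1" and F: "F \<in> borel_measurable borel"
 shows "(LINT z|M. F (c *s z)) = (LINT z|M. F z)" "integrable M (\<lambda>z. F (c *s z)) \<longleftrightarrow> integrable M F"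
proof -
 obtain k :: "'n gmat" where k: "k \<in> stab0" "\<And>z. act k z = c *s z" by (rule stab0_scalar[OF c]; rule that)
 show "(LINT z|M. F (c *s z)) = (LINT z|M. F z)" "integrable M (\<lambda>z. F (c *s z)) \<longleftrightarrow> integrable M F"
  using integral_M_stab0[OF k(1) F] by (simp_all add: k(2))
qed

section \<open>Mean value property, reproducing kernel and completeness\<close>

lemma slice_holomorphic:
 assumes f: "f \<in> HC" and S: "\<And>\<zeta>. \<zeta> \<in> S \<Longrightarrow> norm (a + \<zeta> *s b) < 1" and "open S"
 shows "(\<lambda>\<zeta>. f (a + \<zeta> *s b)) holomorphic_on S"
 unfolding holomorphic_on_open[OF \<open>open S\<close>]
proof
 fix \<zeta> assume "\<zeta> \<in> S"
 hence "cdiff f (a + \<zeta> *s b)" using f S by (simp add: HC_iff)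
 thus "\<exists>f'. ((\<lambda>\<zeta>. f (a + \<zeta> *s b)) has_field_derivative f') (at \<zeta>)" by (rule cdiff_line)
qed

lemma mean_value_circle:
 assumes g: "g \<in> HC" and z: "norm z < 1"
 shows "set_integrable lborel {0..1} (\<lambda>t. g (cis (2 * pi * t) *s z))" "(LINT t:{0..1}|lborel. g (cis (2 * pi * t) *s z)) = g 0"
proof -
 define R where "R = (if z = 0 then 2 else 1 / norm z)"
 have R: "R > 1" using z by (simp add: R_def)
 have "norm (\<zeta> *s z) < 1" if "\<zeta> \<in> ball 0 R" for \<zeta>
  using that by (cases "z = 0") (simp_all add: norm_smult_vec R_def field_simps)
 hence "(\<lambda>\<zeta>. g (0 + \<zeta> *s z)) holomorphic_on ball 0 R" by (intro slice_holomorphic g) auto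
 hence "(\<lambda>\<zeta>. g (\<zeta> *s z)) holomorphic_on ball 0 R" by simp
 from circle_mean[OF this R] show "set_integrable lborel {0..1} (\<lambda>t. g (cis (2 * pi * t) *s z))" "(LINT t:{0..1}|lborel. g (cis (2 * pi * t) *s z)) = g 0"
  by simp_all
qed

text \<open>The measure is invariant under scalar rotations. Averaging over them and exchanging the
  integrals leaves the mean of g over circles around 0, which is g(0).\<close>

lemma integral_HC: assumes g: "g \<in> HC" shows "(LINT z|M. g z) = g 0"
proof -
 define T where "T = restrict_space lborel {0..1::real}"
 have spT: "space T = {0..1}" by (simp add: T_def space_restrict_space)
 interpret T: finite_measure T by (rule finite_measureI) (simp add: T_def space_restrict_space emeasure_restrict_space)
 interpret M: finite_measure M by (rule finite_M)
 interpret pair_sigma_finite T M ..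
 have intT: "(LINT t|T. h t) = (LINT t:{0..1}|lborel. h t)" for h :: "real \<Rightarrow> complex"
  unfolding T_def set_lebesgue_integral_def by (rule integral_restrict_space) simp
 have gI: "integrable M g" by (rule L2_integrable1[OF HC_L2[OF g]])
 have mg: "g \<in> borel_measurable borel" by (rule HC_measurable[OF g])
 have rot: "(\<lambda>(t, z). cis (2 * pi * t) *s z) \<in> borel_measurable (T \<Otimes>\<^sub>M M)"
 proof (rule borel_measurable_vec)
  fix i
  have "(\<lambda>z::complex^'n. z $ i) \<in> borel_measurable borel" by (intro borel_measurable_continuous_onI continuous_intros)
  hence 1: "(\<lambda>p. snd p $ i) \<in> borel_measurable (T \<Otimes>\<^sub>M M)" by (intro measurable_compose[OF measurable_snd]) simp
  have "(\<lambda>t. cis (2 * pi * t)) \<in> borel_measurable borel" unfolding cis_conv_exp by (intro borel_measurable_continuous_onI continuous_intros)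
  hence "(\<lambda>t. cis (2 * pi * t)) \<in> borel_measurable T" unfolding T_def by (intro measurable_restrict_space1) simp
  hence 2: "(\<lambda>p. cis (2 * pi * fst p)) \<in> borel_measurable (T \<Otimes>\<^sub>M M)" by (intro measurable_compose[OF measurable_fst])
  show "(\<lambda>x. (case x of (t, z) \<Rightarrow> cis (2 * pi * t) *s z) $ i) \<in> borel_measurable (T \<Otimes>\<^sub>M M)"
   using borel_measurable_times[OF 2 1] by (simp add: case_prod_beta)
 qed
 have F: "(\<lambda>(t, z). g (cis (2 * pi * t) *s z)) \<in> borel_measurable (T \<Otimes>\<^sub>M M)"
  using measurable_compose[OF rot mg] by (simp add: case_prod_beta)
 have mn: "(\<lambda>z. complex_of_real (cmod (g z))) \<in> borel_measurable borel" using mg by measurable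
 have nI: "(LINT z|M. cmod (g (cis (2 * pi * t) *s z))) = (LINT z|M. cmod (g z))" for t
 proof -
  have "complex_of_real (LINT z|M. cmod (g (cis (2 * pi * t) *s z))) = (LINT z|M. complex_of_real (cmod (g z)))"
   using integral_M_rotate(1)[OF _ mn, of "cis (2 * pi * t)"] by (simp add: integral_complex_of_real)
  thus ?thesis unfolding integral_complex_of_real by (simp only: of_real_eq_iff)
 qed
 have FI: "integrable (T \<Otimes>\<^sub>M M) (\<lambda>(t, z). g (cis (2 * pi * t) *s z))"
 proof (rule Fubini_integrable[OF F])
  show "integrable T (\<lambda>t. LINT z|M. norm (case (t, z) of (t, z) \<Rightarrow> g (cis (2 * pi * t) *s z)))" by (simp add: nI)
  show "AE t in T. integrable M (\<lambda>z. case (t, z) of (t, z) \<Rightarrow> g (cis (2 * pi * t) *s z))"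
   using integral_M_rotate(2)[OF _ mg] gI by simp
 qed
 have "(LINT z|M. LINT t|T. g (cis (2 * pi * t) *s z)) = (LINT t|T. LINT z|M. g (cis (2 * pi * t) *s z))"
  using Fubini_integral[OF FI] by simp
 also have "\<dots> = (LINT t|T. (LINT z|M. g z))"
  using integral_M_rotate(1)[OF _ mg] by simp
 also have "\<dots> = (LINT z|M. g z)" unfolding intT by (simp add: set_lebesgue_integral_def)
 finally have "(LINT z|M. g z) = (LINT z|M. LINT t|T. g (cis (2 * pi * t) *s z))" by simp
 also have "\<dots> = (LINT z|M. g 0)"
 proof (rule integral_cong_AE)
  show "AE z in M. (LINT t|T. g (cis (2 * pi * t) *s z)) = g 0"
   using AE_M_ball by eventually_elim (simp add: intT mean_value_circle(2)[OF g])
  have "integrable M (\<lambda>z. LINT t|T. g (cis (2 * pi * t) *s z))"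
   using integrable_snd[OF FI] by simp
  thus "(\<lambda>z. LINT t|T. g (cis (2 * pi * t) *s z)) \<in> borel_measurable M" by (rule borel_measurable_integrable)
 qed simp
 also have "\<dots> = g 0"
 proof -
  have "measure M (space M) = 1" using integral_M_power(2)[of 0] by (simp add: hdim_def)
  thus ?thesis by simp
 qed
 finally show ?thesis .
qed

lemma ip_one: assumes g: "g \<in> HC" shows "ip M g one = g 0"
proof -
 have "ip M g one = (LINT z|M. g z)" unfolding ip_def
 proof (rule integral_cong_AE)
  show "AE z in M. g z * cnj (one z) = g z" using AE_M_ball by eventually_elim (simp add: one_eq)
 qed (use HC_L2[OF g] HC_L2[OF one_HC] in \<open>auto simp: L2_iff\<close>)
 thus ?thesis by (simp add: integral_HC[OF g])
qed

lemma rep_one: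
 assumes x: "x \<in> SU_n1" shows "rep x one = coherent \<nu> (act x 0)"
proof
 fix z
 show "rep x one z = coherent \<nu> (act x 0) z"
  using norm_act_less[OF SU_form[OF SU_inverse(1)[OF x]], of z] by (simp add: rep_ball one_eq coherent_def)
qed

lemma adjoint_unique:
 assumes "u \<in> HC" "v \<in> HC" "\<And>f. f \<in> HC \<Longrightarrow> ip M f u = ip M f v" "\<And>f. f \<in> HC \<Longrightarrow> nrm M f = 0 \<Longrightarrow> f = (\<lambda>z. 0)"
 shows "u = v"
proof -
 have d: "(\<lambda>z. u z - v z) \<in> HC" by (intro HC_diff assms)
 have "ip M (\<lambda>z. u z - v z) (\<lambda>z. u z - v z) = 0"
  using assms(3)[OF d] by (simp add: ip_diff_right HC_L2 assms d)
 hence "nrm M (\<lambda>z. u z - v z) = 0" by (simp add: ip_self)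
 from assms(4)[OF d this] show ?thesis by (simp add: fun_eq_iff)
qed

lemma norm_act_inv0:
 fixes x :: "'n gmat"
 assumes x: "x \<in> SU_n1" shows "norm (act (matrix_inv x) 0) = norm (act x 0)"
proof -
 have "(cmod (den x 0))^2 * (1 - (norm (act x 0))^2) = (cmod (den x 0))^2 * (1 - (norm (act (matrix_inv x) 0))^2)"
  using act_norm_identity[OF SU_form[OF x], of 0] act_norm_identity[OF SU_form[OF SU_inverse(1)[OF x]], of 0] den_inverse[OF x] by simp
 moreover have "den x 0 \<noteq> 0" using den_nonzero[OF SU_form[OF x], of 0] by simp
 ultimately have "(norm (act x 0))^2 = (norm (act (matrix_inv x) 0))^2" by simp
 thus ?thesis by (simp add: power2_eq_iff_nonneg)
qed

lemma rep_adjoint: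
 assumes x: "x \<in> SU_n1" and f: "f \<in> HC" and g: "g \<in> HC"
 shows "ip M (rep x f) g = ip M f (rep (matrix_inv x) g)"
proof -
 note y = SU_inverse(1)[OF x]
 have "ip M (rep x f) g = ip M (rep x f) (rep x (rep (matrix_inv x) g))" by (simp add: rep_inverse[OF x g])
 also have "\<dots> = ip M f (rep (matrix_inv x) g)" by (rule rep_HC_ip(2)[OF x f rep_HC_ip(1)[OF y g g]])
 finally show ?thesis .
qed

text \<open>The coherent state is the image of the constant 1 under x, so unitarity moves the
  product to the constant function, where the mean value property evaluates it at 0.\<close>

lemma ip_coherent:
 assumes x: "x \<in> SU_n1" and f: "f \<in> HC"
 shows "ip M f (coherent \<nu> (act x 0)) = of_real ((1 - (norm (act x 0))^2) powr (\<nu> / 2)) * f (act x 0)"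
proof -
 note y = SU_inverse(1)[OF x]
 have inv: "matrix_inv (matrix_inv x) = x"
 proof -
  have "matrix_inv (matrix_inv x) = (x ** matrix_inv x) ** matrix_inv (matrix_inv x)" by (simp add: SU_inverse(3)[OF x])
  also have "\<dots> = x" unfolding matrix_mul_assoc[symmetric] SU_inverse(3)[OF y] by simp
  finally show ?thesis .
 qed
 have "ip M f (rep x one) = cnj (ip M (rep x one) f)" by (simp add: cnj_ip)
 also have "\<dots> = ip M (rep (matrix_inv x) f) one" unfolding rep_adjoint[OF x one_HC f] by (simp add: cnj_ip)
 also have "\<dots> = rep (matrix_inv x) f 0" by (rule ip_one[OF rep_HC_ip(1)[OF y f f]])
 also have "\<dots> = of_real ((1 - (norm (act x 0))^2) powr (\<nu> / 2)) * f (act x 0)"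
  by (simp add: rep_ball inv coherent_def norm_act_inv0[OF x])
 finally show ?thesis unfolding rep_one[OF x] .
qed

text \<open>By transitivity every point of the ball is some x 0, and the kernel there is a positive
  multiple of the coherent state.\<close>

theorem reproducing:
 assumes w: "norm w < 1" and f: "f \<in> HC" shows "ip M f (Kw w) = f w"
proof -
 obtain x :: "'n gmat" where x: "x \<in> SU_n1" "act x 0 = w" by (rule SU_transitive[OF w]; rule that)
 let ?c = "(1 - (norm w)^2) powr (\<nu> / 2)"
 have c: "?c > 0" using w by (simp add: abs_square_less_1 less_imp_neq)
 have "coherent \<nu> w = (\<lambda>z. of_real ?c * Kw w z)" using coherent_eq[OF w] by (simp add: fun_eq_iff)
 hence "of_real ?c * ip M f (Kw w) = of_real ?c * f w"
  using ip_coherent[OF x(1) f] by (simp add: x(2) ip_scale_right)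
 thus ?thesis using c by simp
qed

lemma HC_norm_zero: assumes f: "f \<in> HC" and "nrm M f = 0" shows "f = (\<lambda>z. 0)"
proof
 fix z show "f z = 0"
 proof (cases "norm z < 1")
  case True
  have "cmod (f z) \<le> nrm M f * nrm M (Kw z)"
   using L2_CS[OF HC_L2[OF f] HC_L2[OF Kw_HC[OF True]]] by (simp add: reproducing[OF True f])
  thus ?thesis using assms by simp
 qed (simp add: HC_out[OF f])
qed

lemma HC_eqI:
 assumes "u \<in> HC" "v \<in> HC" "\<And>f. f \<in> HC \<Longrightarrow> ip M f u = ip M f v" shows "u = v"
 by (rule adjoint_unique[OF assms HC_norm_zero])

lemma ips_eq_H: assumes "u \<in> HC" "v \<in> HC" shows "ips_eq BH u v \<longleftrightarrow> u = v"
proof -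
 have "ips_eq BH u v \<longleftrightarrow> nrm M (\<lambda>z. u z - v z) = 0"
  by (simp add: ips_eq_def ips_norm_H ips_add_H ips_scale_H)
 also have "\<dots> \<longleftrightarrow> u = v"
 proof
  assume "nrm M (\<lambda>z. u z - v z) = 0"
  hence "(\<lambda>z. u z - v z) = (\<lambda>z. 0)" by (rule HC_norm_zero[OF HC_diff[OF assms]])
  hence "u z - v z = 0" for z by (rule fun_cong)
  thus "u = v" by (intro ext) simp
 qed (simp add: nrm_def)
 finally show ?thesis .
qed

text \<open>Point evaluations are bounded through the reproducing kernel, so a Cauchy sequence
  converges at every point. The limit again satisfies the reproducing formula, and as an integral
  against the kernel it is holomorphic.\<close>

lemma HC_complete:
 fixes s :: "nat \<Rightarrow> complex^'n \<Rightarrow> complex"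
 assumes s: "\<And>n. s n \<in> HC" and cauchy: "\<And>e. e > 0 \<Longrightarrow> \<exists>n0. \<forall>m\<ge>n0. \<forall>n\<ge>m. nrm M (\<lambda>z. s n z - s m z) \<le> e"
 obtains u where "u \<in> HC" "(\<lambda>n. nrm M (\<lambda>z. u z - s n z)) \<longlonglongrightarrow> 0"
proof -
 have conv: "convergent (\<lambda>n. s n z)" for z
 proof (cases "norm z < 1")
  case True
  show ?thesis
  proof (rule Cauchy_convergent, rule metric_CauchyI)
   fix e :: real assume e: "e > 0"
   define K where "K = nrm M (Kw z) + 1"
   have K: "K > 0" using nrm_nonneg[of M "Kw z"] by (simp add: K_def add_nonneg_pos)
   obtain n0 where n0: "\<And>m n. m \<ge> n0 \<Longrightarrow> n \<ge> m \<Longrightarrow> nrm M (\<lambda>z. s n z - s m z) \<le> e / (2 * K)"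
    using cauchy[of "e / (2 * K)"] e K by auto
   have le: "dist (s n z) (s m z) < e" if "m \<ge> n0" "n \<ge> m" for m n
   proof -
    have d: "(\<lambda>z. s n z - s m z) \<in> HC" by (intro HC_diff s)
    have "cmod (s n z - s m z) \<le> nrm M (\<lambda>z. s n z - s m z) * nrm M (Kw z)"
     using L2_CS[OF HC_L2[OF d] HC_L2[OF Kw_HC[OF True]]] by (simp add: reproducing[OF True d])
    also have "\<dots> \<le> e / (2 * K) * K" using n0[OF that] e K by (intro mult_mono) (auto simp: K_def)
    also have "\<dots> < e" using e K by simp
    finally show ?thesis by (simp add: dist_norm)
   qed
   show "\<exists>M. \<forall>m\<ge>M. \<forall>n\<ge>M. dist (s m z) (s n z) < e"
   proof (intro exI[of _ n0] allI impI)
    fix m n assume "n0 \<le> m" "n0 \<le> n"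
    thus "dist (s m z) (s n z) < e" using le[of m n] le[of n m] by (cases "m \<le> n") (auto simp: dist_commute)
   qed
  qed
 next
  case False
  hence "s n z = 0" for n using HC_out[OF s] by blast
  thus ?thesis by (simp add: convergent_const)
 qed
 define u where "u z = lim (\<lambda>n. s n z)" for z
 have lim: "(\<lambda>n. s n z) \<longlonglongrightarrow> u z" for z unfolding u_def by (rule convergent_LIMSEQ_iff[THEN iffD1, OF conv])
 have mu: "u \<in> borel_measurable M" unfolding u_def[abs_def]
  by (rule borel_measurable_lim_metric) (use HC_L2[OF s] in \<open>simp add: L2_iff\<close>)
 have F: "u \<in> L2 M \<and> (\<forall>n\<ge>n0. nrm M (\<lambda>z. u z - s n z) \<le> e)" if "\<forall>m\<ge>n0. \<forall>n\<ge>m. nrm M (\<lambda>z. s n z - s m z) \<le> e" for n0 e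
 proof -
  have "u \<in> L2 M \<and> nrm M (\<lambda>z. u z - s n z) \<le> e" if n: "n \<ge> n0" for n
   using L2_Fatou[OF HC_L2[OF s] AE_I2[OF lim] mu HC_L2[OF s], of n n e] \<open>\<forall>m\<ge>n0. _\<close> n by blast
  thus ?thesis by blast
 qed
 have uL: "u \<in> L2 M" using F cauchy[of 1] by (metis zero_less_one)
 have lim0: "(\<lambda>n. nrm M (\<lambda>z. u z - s n z)) \<longlonglongrightarrow> 0"
 proof (rule LIMSEQ_I)
  fix e :: real assume "e > 0"
  then obtain n0 where "\<forall>m\<ge>n0. \<forall>n\<ge>m. nrm M (\<lambda>z. s n z - s m z) \<le> e / 2" using cauchy[of "e / 2"] by auto
  hence "\<forall>n\<ge>n0. nrm M (\<lambda>z. u z - s n z) \<le> e / 2" using F by blast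
  thus "\<exists>no. \<forall>n\<ge>no. norm (nrm M (\<lambda>z. u z - s n z) - 0) < e" using \<open>e > 0\<close> by (intro exI[of _ n0]) fastforce
 qed
 have rp: "ip M u (Kw z) = u z" if z: "norm z < 1" for z
 proof -
  note K = HC_L2[OF Kw_HC[OF z]]
  have "(\<lambda>n. ip M u (Kw z) - s n z) \<longlonglongrightarrow> 0"
  proof (rule Lim_null_comparison)
   show "\<forall>\<^sub>F n in sequentially. norm (ip M u (Kw z) - s n z) \<le> nrm M (\<lambda>z. u z - s n z) * nrm M (Kw z)"
    using L2_CS[OF L2_diff[OF uL HC_L2[OF s]] K] by (simp add: ip_diff_left[OF uL HC_L2[OF s] K] reproducing[OF z s])
   show "(\<lambda>n. nrm M (\<lambda>z. u z - s n z) * nrm M (Kw z)) \<longlonglongrightarrow> 0" using tendsto_mult_left_zero[OF lim0] .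
  qed
  moreover have "(\<lambda>n. ip M u (Kw z) - s n z) \<longlonglongrightarrow> ip M u (Kw z) - u z" by (intro tendsto_intros lim)
  ultimately show ?thesis using LIMSEQ_unique by fastforce
 qed
 have "cdiff u z" if z: "norm z < 1" for z
 proof -
  have "cdiff (\<lambda>z. LINT w|M. u w * kpsi \<nu> (hprod z w)) z"
   by (rule cdiff_kernel_integral[OF L2_integrable1[OF uL] AE_M_ball _ kpsi_holomorphic kpsi_measurable z]) simp
  thus ?thesis
  proof (rule cdiff_transform[OF _ open_norm_less])
   fix v :: "complex^'n" assume "v \<in> {z. norm z < 1}"
   hence v: "norm v < 1" by simp
   have "u v = (LINT w|M. u w * cnj (Kw v w))" using rp[OF v] by (simp add: ip_def)
   also have "\<dots> = (LINT w|M. u w * kpsi \<nu> (hprod v w))"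
   proof (rule integral_cong_AE)
    show "AE w in M. u w * cnj (Kw v w) = u w * kpsi \<nu> (hprod v w)"
     using AE_M_ball by eventually_elim (simp add: Kw_def kpsi_cnj cnj_hprod)
    have h: "(\<lambda>w. hprod v w) \<in> borel_measurable borel" unfolding hprod_def by (intro borel_measurable_continuous_onI continuous_intros)
    have "(\<lambda>w. kpsi \<nu> (hprod v w)) \<in> borel_measurable M" using measurable_compose[OF h kpsi_measurable] by simp
    thus "(\<lambda>w. u w * kpsi \<nu> (hprod v w)) \<in> borel_measurable M" using mu by measurable
    show "(\<lambda>w. u w * cnj (Kw v w)) \<in> borel_measurable M" using mu L2_measurable[OF HC_L2[OF Kw_HC[OF v]]] by measurable
   qed
   finally show "(LINT w|M. u w * kpsi \<nu> (hprod v w)) = u v" by simp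
  qed (use z in simp)
 qed
 moreover have "u z = 0" if "norm z \<ge> 1" for z
  using LIMSEQ_unique[OF lim[of z]] HC_out[OF s] that by (simp add: not_less)
 ultimately have "u \<in> HC" using uL by (simp add: HC_iff)
 thus ?thesis using that lim0 by blast
qed

section \<open>Orthonormal bases of the Bergman space\<close>

lemma ip_zero: "ip M (\<lambda>z. 0) f = 0" "ip M f (\<lambda>z. 0) = 0" by (simp_all add: ip_def)

lemma nrm_zero: "nrm M (\<lambda>z. 0) = 0" by (simp add: nrm_def)

lemma H_CS: "f \<in> HC \<Longrightarrow> g \<in> HC \<Longrightarrow> cmod (ip M f g) \<le> nrm M f * nrm M g"
 by (intro L2_CS HC_L2)

text \<open>Common core of the basis expansion, the representation of functionals and the diagonal
  operators, which differ only in the orthogonal sequence that is summed.\<close>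

lemma orthogonal_series:
 fixes g :: "nat \<Rightarrow> complex^'n \<Rightarrow> complex"
 assumes g: "\<And>i. g i \<in> HC" and orth: "\<And>i j. i \<noteq> j \<Longrightarrow> ip M (g i) (g j) = 0"
  and summ: "summable (\<lambda>i. (nrm M (g i))^2)"
 obtains u where "u \<in> HC" "(\<lambda>n. nrm M (\<lambda>z. u z - (\<Sum>i<n. g i z))) \<longlonglongrightarrow> 0"
  "\<And>y. y \<in> HC \<Longrightarrow> (\<lambda>i. ip M (g i) y) sums ip M u y" "(\<lambda>i. (nrm M (g i))^2) sums (nrm M u)^2"
proof -
 define s where "s n z = (\<Sum>i<n. g i z)" for n z
 have sH: "s n \<in> HC" for n unfolding s_def[abs_def] by (intro HC_sum g)
 have sd: "(nrm M (\<lambda>z. s n z - s m z))^2 = (\<Sum>i=m..<n. (nrm M (g i))^2)" if "m \<le> n" for m n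
 proof -
  have e: "(\<lambda>z. s n z - s m z) = (\<lambda>z. \<Sum>i<n - m. g (m + i) z)"
  proof
   fix z
   have "s n z = s m z + (\<Sum>i=m..<n. g i z)"
    unfolding s_def lessThan_atLeast0 using sum.atLeastLessThan_concat[of 0 m n "\<lambda>i. g i z"] that by simp
   also have "(\<Sum>i=m..<n. g i z) = (\<Sum>i<n - m. g (m + i) z)"
    using sum.shift_bounds_nat_ivl[of "\<lambda>i. g i z" 0 m "n - m"] that by (simp add: lessThan_atLeast0 add.commute)
   finally show "s n z - s m z = (\<Sum>i<n - m. g (m + i) z)" by simp
  qed
  have "(nrm M (\<lambda>z. s n z - s m z))^2 = (\<Sum>i<n - m. (nrm M (g (m + i)))^2)"
   unfolding e by (rule nrm_sum_sq) (auto intro: HC_L2 g orth)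
  also have "\<dots> = (\<Sum>i=m..<n. (nrm M (g i))^2)"
   using sum.shift_bounds_nat_ivl[of "\<lambda>i. (nrm M (g i))^2" 0 m "n - m"] that by (simp add: lessThan_atLeast0 add.commute)
  finally show ?thesis .
 qed
 obtain u where u: "u \<in> HC" "(\<lambda>n. nrm M (\<lambda>z. u z - s n z)) \<longlonglongrightarrow> 0"
 proof (rule HC_complete[OF sH])
  fix e :: real assume e: "e > 0"
  from summ[unfolded summable_Cauchy] e obtain n0 where n0: "\<And>m n. m \<ge> n0 \<Longrightarrow> norm (\<Sum>i=m..<n. (nrm M (g i))^2) < e^2"
   by (meson zero_less_power)
  show "\<exists>n0. \<forall>m\<ge>n0. \<forall>n\<ge>m. nrm M (\<lambda>z. s n z - s m z) \<le> e"
  proof (intro exI[of _ n0] allI impI)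
   fix m n assume "n0 \<le> m" "m \<le> n"
   have "(nrm M (\<lambda>z. s n z - s m z))^2 \<le> e^2" using n0[OF \<open>n0 \<le> m\<close>, of n] sd[OF \<open>m \<le> n\<close>] by simp
   thus "nrm M (\<lambda>z. s n z - s m z) \<le> e" using e by (simp add: power2_le_iff_abs_le)
  qed
 next
  fix u assume "u \<in> HC" "(\<lambda>n. nrm M (\<lambda>z. u z - s n z)) \<longlonglongrightarrow> 0"
  thus thesis by (rule that)
 qed
 have ser: "(\<lambda>i. ip M (g i) y) sums ip M u y" if y: "y \<in> HC" for y
  unfolding sums_def
 proof (rule Lim_null_comparison[THEN LIM_zero_cancel])
  show "(\<lambda>n. nrm M (\<lambda>z. u z - s n z) * nrm M y) \<longlonglongrightarrow> 0" using tendsto_mult_left_zero[OF u(2)] .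
  show "\<forall>\<^sub>F n in sequentially. norm ((\<Sum>i<n. ip M (g i) y) - ip M u y) \<le> nrm M (\<lambda>z. u z - s n z) * nrm M y"
  proof (intro always_eventually allI)
   fix n
   have "ip M (\<lambda>z. u z - s n z) y = ip M u y - (\<Sum>i<n. ip M (g i) y)"
    using ip_diff_left[OF HC_L2[OF u(1)] HC_L2[OF sH] HC_L2[OF y], of n]
     ip_sum_left[of "{..<n}" g M y] HC_L2[OF g] HC_L2[OF y] by (simp add: s_def[abs_def])
   thus "norm ((\<Sum>i<n. ip M (g i) y) - ip M u y) \<le> nrm M (\<lambda>z. u z - s n z) * nrm M y"
    using H_CS[OF HC_diff[OF u(1) sH] y, of n] by (simp add: norm_minus_commute)
  qed
 qed
 have ui: "ip M u (g i) = of_real ((nrm M (g i))^2)" for i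
 proof -
  have "(\<lambda>j. ip M (g j) (g i)) = (\<lambda>j. if j = i then ip M (g j) (g j) else 0)" using orth by auto
  thus ?thesis using sums_unique2[OF ser[OF g] , of i] sums_single[of i "\<lambda>j. ip M (g j) (g j)"] by (simp add: ip_self)
 qed
 have "ip M (g i) u = of_real ((nrm M (g i))^2)" for i using arg_cong[OF ui[of i], of cnj] by (simp add: cnj_ip)
 hence "(\<lambda>i. complex_of_real ((nrm M (g i))^2)) sums of_real ((nrm M u)^2)" using ser[OF u(1)] by (simp add: ip_self)
 hence "(\<lambda>i. (nrm M (g i))^2) sums (nrm M u)^2" unfolding sums_of_real_iff .
 thus thesis using that[OF u(1) u(2)[unfolded s_def] ser] by blast
qed

lemma Bessel_finite:
 assumes I: "finite I" and x: "x \<in> HC" and g: "\<And>i. i \<in> I \<Longrightarrow> g i \<in> HC"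
  and orth: "\<And>i j. i \<in> I \<Longrightarrow> j \<in> I \<Longrightarrow> i \<noteq> j \<Longrightarrow> ip M (g i) (g j) = 0"
  and one: "\<And>i. i \<in> I \<Longrightarrow> ip M (g i) (g i) = 1 \<or> g i = (\<lambda>z. 0)"
 shows "(\<Sum>i\<in>I. (cmod (ip M x (g i)))^2) \<le> (nrm M x)^2"
proof -
 define y where "y z = (\<Sum>i\<in>I. ip M x (g i) * g i z)" for z
 define S where "S = (\<Sum>i\<in>I. (cmod (ip M x (g i)))^2)"
 have yH: "y \<in> HC" unfolding y_def[abs_def] by (intro HC_sum HC_scale g)
 have yi: "ip M y (g i) = ip M x (g i)" if i: "i \<in> I" for i
 proof -
  have "ip M y (g i) = (\<Sum>j\<in>I. ip M x (g j) * ip M (g j) (g i))"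
   unfolding y_def[abs_def] by (subst ip_sum_left) (auto intro: L2_scale HC_L2 g i simp: ip_scale_left)
  also have "\<dots> = (\<Sum>j\<in>I. if j = i then ip M x (g i) * ip M (g i) (g i) else 0)"
   by (intro sum.cong) (auto simp: orth i)
  also have "\<dots> = ip M x (g i)" using one[OF i] i I by (auto simp: ip_zero)
  finally show ?thesis .
 qed
 have r: "ip M v y = of_real S" if "v \<in> HC" "\<And>i. i \<in> I \<Longrightarrow> ip M v (g i) = ip M x (g i)" for v
 proof -
  have "ip M v y = (\<Sum>i\<in>I. cnj (ip M x (g i)) * ip M v (g i))"
   unfolding y_def[abs_def] by (subst ip_sum_right) (auto intro: L2_scale HC_L2 g that simp: ip_scale_right)
  also have "\<dots> = of_real S" unfolding S_def of_real_sum
   by (intro sum.cong refl) (simp add: that(2) complex_norm_square[symmetric] mult.commute)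
  finally show ?thesis .
 qed
 have S0: "S \<ge> 0" unfolding S_def by (intro sum_nonneg) auto
 have "of_real ((nrm M y)^2) = complex_of_real S" using r[OF yH yi] by (simp add: ip_self)
 hence yn: "(nrm M y)^2 = S" by (simp only: of_real_eq_iff)
 have "S \<le> nrm M x * nrm M y" using H_CS[OF x yH] r[OF x] S0 by simp
 hence "S^2 \<le> (nrm M x)^2 * S" using power_mono[OF _ S0, of "nrm M x * nrm M y" 2] by (simp add: power_mult_distrib yn)
 hence "S \<le> (nrm M x)^2" using S0 by (cases "S = 0") (auto simp: power2_eq_square)
 thus ?thesis by (simp add: S_def)
qed

lemma exists_onb: "\<exists>E. is_onb BH E"
proof -
 define P where "P = {E. E \<subseteq> HC \<and> (\<forall>e\<in>E. \<forall>e'\<in>E. ip M e e' = (if e = e' then 1 else 0))}"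
 have "\<exists>E\<in>P. \<forall>X\<in>P. E \<subseteq> X \<longrightarrow> X = E"
 proof (rule subset_Zorn')
  fix C assume C: "subset.chain P C"
  show "\<Union>C \<in> P"
   unfolding P_def
  proof (intro CollectI conjI ballI)
   show "\<Union>C \<subseteq> HC" using C by (auto simp: subset.chain_def P_def)
   fix e e' assume "e \<in> \<Union>C" "e' \<in> \<Union>C"
   then obtain X Y where XY: "X \<in> C" "e \<in> X" "Y \<in> C" "e' \<in> Y" by blast
   have "X \<subseteq> Y \<or> Y \<subseteq> X" using C XY(1,3) unfolding subset.chain_def by fast
   then obtain X where X: "X \<in> C" "e \<in> X" "e' \<in> X" using XY by blast
   have "X \<in> P" using X(1) C by (auto simp: subset.chain_def)
   thus "ip M e e' = (if e = e' then 1 else 0)" using X by (simp add: P_def)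
  qed
 qed
 then obtain E where E: "E \<in> P" and max: "\<And>X. X \<in> P \<Longrightarrow> E \<subseteq> X \<Longrightarrow> X = E" by blast
 have "nrm M x = 0" if x: "x \<in> HC" and xe: "\<forall>e\<in>E. ip M x e = 0" for x
 proof (rule ccontr)
  assume nz: "nrm M x \<noteq> 0"
  define v where "v z = of_real (1 / nrm M x) * x z" for z
  have v: "v \<in> HC" unfolding v_def[abs_def] by (intro HC_scale x)
  have ve: "ip M v e = 0" "ip M e v = 0" if "e \<in> E" for e
  proof -
   show *: "ip M v e = 0" unfolding v_def[abs_def] ip_scale_left using xe that by simp
   show "ip M e v = 0" using arg_cong[OF *, of cnj] by (simp add: cnj_ip)
  qed
  have vv: "ip M v v = 1"
   unfolding v_def[abs_def] ip_scale_left ip_scale_right ip_self using nz by (simp add: power2_eq_square)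
  have "insert v E \<in> P" unfolding P_def using E v ve vv by (auto simp: P_def)
  hence "v \<in> E" using max[of "insert v E"] by auto
  thus False using ve vv by fastforce
 qed
 moreover have "E \<subseteq> HC" "\<forall>e\<in>E. \<forall>e'\<in>E. ip M e e' = (if e = e' then 1 else 0)" using E unfolding P_def by blast+
 ultimately have "is_onb BH E" unfolding is_onb_def ips_inner_H ips_norm_H by blast
 thus ?thesis ..
qed

definition E :: "(complex^'n \<Rightarrow> complex) set" where "E = some_onb BH"

lemma E_onb: "is_onb BH E"
 unfolding E_def some_onb_def by (rule someI_ex[OF exists_onb])

lemma E_HC: "e \<in> E \<Longrightarrow> e \<in> HC"
 and E_ip: "e \<in> E \<Longrightarrow> e' \<in> E \<Longrightarrow> ip M e e' = (if e = e' then 1 else 0)"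
 and E_total: "x \<in> HC \<Longrightarrow> (\<And>e. e \<in> E \<Longrightarrow> ip M x e = 0) \<Longrightarrow> x = (\<lambda>z. 0)"
 using E_onb HC_norm_zero[of x] by (auto simp: is_onb_def ips_inner_H ips_norm_H)

lemma HC_continuous: "e \<in> HC \<Longrightarrow> continuous_on {z. norm z < 1} e"
 unfolding continuous_on_eq_continuous_at[OF open_norm_less]
 using has_derivative_continuous unfolding HC_iff cdiff_def by blast

text \<open>At a fixed point z, Bessel's inequality for the kernel \<open>Kw z\<close> leaves only
  countably many e with e(z) \<noteq> 0, and by continuity each e is nonzero somewhere on a
  countable dense set. Sums over the chosen basis thereby become series.\<close>

lemma E_countable: "countable E"
proof -
 obtain D :: "(complex^'n) set" where D: "countable D" "\<And>X. open X \<Longrightarrow> X \<noteq> {} \<Longrightarrow> \<exists>d\<in>D. d \<in> X"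
  by (rule countable_dense_setE; rule that)
 have c: "countable {e\<in>E. e z \<noteq> 0}" if z: "norm z < 1" for z
 proof -
  have "(\<lambda>e. (cmod (ip M (Kw z) e))^2) summable_on E"
  proof (rule nonneg_bdd_above_summable_on)
   show "bdd_above (sum (\<lambda>e. (cmod (ip M (Kw z) e))^2) ` {F. F \<subseteq> E \<and> finite F})"
   proof (rule bdd_aboveI2)
    fix F assume "F \<in> {F. F \<subseteq> E \<and> finite F}"
    thus "(\<Sum>e\<in>F. (cmod (ip M (Kw z) e))^2) \<le> (nrm M (Kw z))^2"
     by (intro Bessel_finite Kw_HC z) (auto intro!: E_HC simp: E_ip subset_iff)
   qed
  qed simp
  hence "countable {e\<in>E. (cmod (ip M (Kw z) e))^2 \<noteq> 0}" by (rule summable_countable_real)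
  moreover have "ip M (Kw z) e = cnj (e z)" if "e \<in> E" for e
   using arg_cong[OF reproducing[OF z E_HC[OF that]], of cnj] by (simp add: cnj_ip)
  ultimately show ?thesis by (auto elim!: countable_subset[rotated])
 qed
 have "E \<subseteq> (\<Union>z\<in>{z\<in>D. norm z < 1}. {e\<in>E. e z \<noteq> 0})"
 proof
  fix e assume e: "e \<in> E"
  have "e \<noteq> (\<lambda>z. 0)" using E_ip[OF e e] by (auto simp: ip_zero)
  then obtain z where z: "e z \<noteq> 0" by (auto simp: fun_eq_iff)
  have "open ({z. norm z < 1} \<inter> e -` (- {0}))"
   by (rule continuous_open_preimage[OF HC_continuous[OF E_HC[OF e]] open_norm_less]) auto
  moreover have "norm z < 1" using z HC_out[OF E_HC[OF e]] by blast
  ultimately obtain d where "d \<in> D" "d \<in> {z. norm z < 1} \<inter> e -` (- {0})" using D(2) z by blast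
  thus "e \<in> (\<Union>z\<in>{z\<in>D. norm z < 1}. {e\<in>E. e z \<noteq> 0})" using e by auto
 qed
 moreover have "countable (\<Union>z\<in>{z\<in>D. norm z < 1}. {e\<in>E. e z \<noteq> 0})"
  using D(1) c by (intro countable_UN) (auto intro: countable_subset[of _ D])
 ultimately show ?thesis by (rule countable_subset)
qed

text \<open>The basis as a sequence; if it were finite, the sequence would be padded with zeros.\<close>

definition en :: "nat \<Rightarrow> complex^'n \<Rightarrow> complex" where
 "en n = (if n \<in> to_nat_on E ` E then inv_into E (to_nat_on E) n else (\<lambda>z. 0))"

lemma inj_to_nat: "inj_on (to_nat_on E) E" by (rule inj_on_to_nat_on[OF E_countable])

lemma en_cases: "en n \<in> E \<or> en n = (\<lambda>z. 0)"
 unfolding en_def by (auto intro: inv_into_into)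

lemma en_HC: "en n \<in> HC" using en_cases[of n] E_HC HC_zero by auto

lemma en_to_nat: "e \<in> E \<Longrightarrow> en (to_nat_on E e) = e" by (simp add: en_def inj_to_nat)

lemma en_orth: assumes "i \<noteq> j" shows "ip M (en i) (en j) = 0"
proof (cases "i \<in> to_nat_on E ` E \<and> j \<in> to_nat_on E ` E")
 case True
 then obtain e e' where e: "e \<in> E" "e' \<in> E" "i = to_nat_on E e" "j = to_nat_on E e'" by blast
 hence "e \<noteq> e'" using assms by auto
 thus ?thesis using e by (simp add: en_to_nat E_ip)
qed (auto simp: en_def ip_zero)

lemma en_one: "ip M (en i) (en i) = 1 \<or> en i = (\<lambda>z. 0)"
 using en_cases[of i] E_ip by auto

lemma nrm_en: "en i = (\<lambda>z. 0) \<or> nrm M (en i) = 1"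
proof -
 have "(nrm M (en i))^2 = 1" if "ip M (en i) (en i) = 1"
  using that unfolding ip_self by (metis of_real_1 of_real_eq_iff)
 thus ?thesis using en_one[of i] nrm_nonneg[of M "en i"] by (auto simp: power2_eq_1_iff)
qed

lemma has_sum_onb:
 assumes "F (\<lambda>z. 0) = 0" shows "(F has_sum s) E \<longleftrightarrow> ((\<lambda>n. F (en n)) has_sum s) UNIV"
proof -
 have "((\<lambda>n. F (en n)) has_sum s) UNIV \<longleftrightarrow> ((\<lambda>n. F (en n)) has_sum s) (to_nat_on E ` E)"
  by (rule has_sum_cong_neutral) (auto simp: en_def assms)
 also have "\<dots> \<longleftrightarrow> (((\<lambda>n. F (en n)) \<circ> to_nat_on E) has_sum s) E" by (rule has_sum_reindex[OF inj_to_nat])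
 also have "\<dots> \<longleftrightarrow> (F has_sum s) E" by (rule has_sum_cong) (simp add: en_to_nat)
 finally show ?thesis by simp
qed

lemma onb_summable: assumes x: "x \<in> HC" shows "summable (\<lambda>i. (cmod (ip M x (en i)))^2)"
proof (rule bounded_imp_summable)
 fix n show "(\<Sum>i\<le>n. (cmod (ip M x (en i)))^2) \<le> (nrm M x)^2"
  by (rule Bessel_finite[OF _ x en_HC en_orth en_one]) auto
qed simp

lemma onb_expansion:
 assumes x: "x \<in> HC"
 shows "(\<lambda>n. nrm M (\<lambda>z. x z - (\<Sum>i<n. ip M x (en i) * en i z))) \<longlonglongrightarrow> 0"
  "\<And>y. y \<in> HC \<Longrightarrow> (\<lambda>i. ip M x (en i) * ip M (en i) y) sums ip M x y"
  "(\<lambda>i. (cmod (ip M x (en i)))^2) sums (nrm M x)^2"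
proof -
 have n: "(nrm M (\<lambda>z. ip M x (en i) * en i z))^2 = (cmod (ip M x (en i)))^2" for i
  using nrm_en[of i] by (auto simp: nrm_scale ip_zero nrm_zero)
 obtain u where u: "u \<in> HC" "(\<lambda>n. nrm M (\<lambda>z. u z - (\<Sum>i<n. ip M x (en i) * en i z))) \<longlonglongrightarrow> 0"
  "\<And>y. y \<in> HC \<Longrightarrow> (\<lambda>i. ip M (\<lambda>z. ip M x (en i) * en i z) y) sums ip M u y"
  "(\<lambda>i. (nrm M (\<lambda>z. ip M x (en i) * en i z))^2) sums (nrm M u)^2"
  by (rule orthogonal_series[of "\<lambda>i z. ip M x (en i) * en i z"]; (rule that)?)
    (auto intro: HC_scale en_HC simp: n onb_summable x ip_scale_left ip_scale_right en_orth)
 have "(\<lambda>z. u z - x z) = (\<lambda>z. 0)"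
 proof (rule E_total[OF HC_diff[OF u(1) x]])
  fix e assume e: "e \<in> E"
  define i where "i = to_nat_on E e"
  have ei: "en i = e" by (simp add: i_def en_to_nat e)
  have "ip M (\<lambda>z. ip M x (en j) * en j z) e = (if j = i then ip M x (en j) else 0)" for j
   unfolding ip_scale_left using en_orth[of j i] E_ip[OF e e] by (cases "j = i") (simp_all add: ei)
  hence "ip M u e = ip M x (en i)"
   using sums_unique2[OF u(3)[OF E_HC[OF e]]] sums_single[of i "\<lambda>j. ip M x (en j)"] by simp
  thus "ip M (\<lambda>z. u z - x z) e = 0" using ip_diff_left[of u M x e] u(1) x E_HC[OF e] HC_L2 by (simp add: ei)
 qed
 hence "u = x" by (simp add: fun_eq_iff)
 thus "(\<lambda>n. nrm M (\<lambda>z. x z - (\<Sum>i<n. ip M x (en i) * en i z))) \<longlonglongrightarrow> 0"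
  "\<And>y. y \<in> HC \<Longrightarrow> (\<lambda>i. ip M x (en i) * ip M (en i) y) sums ip M x y"
  "(\<lambda>i. (cmod (ip M x (en i)))^2) sums (nrm M x)^2"
  using u(2-4) by (simp_all add: n ip_scale_left)
qed

text \<open>The representer has the conjugates of the values on the basis as coefficients. Testing
  the functional on finite parts gives S \<le> C sqrt(S) for the partial sums S of the squared
  norms, hence S \<le> C^2 and convergence.\<close>

lemma Riesz_representation:
 assumes add: "\<And>f g. f \<in> HC \<Longrightarrow> g \<in> HC \<Longrightarrow> l (\<lambda>z. f z + g z) = l f + l g"
  and scale: "\<And>c f. f \<in> HC \<Longrightarrow> l (\<lambda>z. c * f z) = c * l f"
  and bound: "\<And>f. f \<in> HC \<Longrightarrow> cmod (l f) \<le> C * nrm M f"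
 obtains u where "u \<in> HC" "\<And>f. f \<in> HC \<Longrightarrow> l f = ip M f u"
proof -
 have l0: "l (\<lambda>z. 0) = 0" using scale[OF HC_zero, of 0] by simp
 have lsum: "l (\<lambda>z. \<Sum>i<n. g i z) = (\<Sum>i<n. l (g i))" if "\<And>i. g i \<in> HC" for g :: "nat \<Rightarrow> _" and n
  by (induction n) (simp_all add: l0 add HC_sum that)
 define b where "b i = l (en i)" for i
 have b0: "b i = 0" if "en i = (\<lambda>z. 0)" for i using that l0 by (simp add: b_def)
 define g where "g i z = cnj (b i) * en i z" for i z
 have g: "g i \<in> HC" for i unfolding g_def[abs_def] by (intro HC_scale en_HC)
 have orth: "ip M (g i) (g j) = 0" if "i \<noteq> j" for i j
  unfolding g_def[abs_def] ip_scale_left ip_scale_right en_orth[OF that] by simp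
 have gn: "(nrm M (g i))^2 = (cmod (b i))^2" for i
  unfolding g_def[abs_def] nrm_scale using nrm_en[of i] b0[of i] by auto
 have summ: "summable (\<lambda>i. (nrm M (g i))^2)"
 proof (rule bounded_imp_summable)
  fix n
  define S where "S = (\<Sum>i\<le>n. (nrm M (g i))^2)"
  define y where "y z = (\<Sum>i<Suc n. g i z)" for z
  have y: "y \<in> HC" unfolding y_def[abs_def] by (intro HC_sum g)
  have S0: "S \<ge> 0" unfolding S_def by (intro sum_nonneg) auto
  have yn: "(nrm M y)^2 = S" unfolding y_def[abs_def] S_def lessThan_Suc_atMost[symmetric]
   by (rule nrm_sum_sq) (auto intro: HC_L2 g orth)
  have lg: "l (g i) = of_real ((nrm M (g i))^2)" for i
   unfolding gn unfolding g_def[abs_def] scale[OF en_HC] b_def[symmetric]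
   by (metis complex_norm_square mult.commute)
  have "l y = (\<Sum>i<Suc n. l (g i))" unfolding y_def[abs_def] by (rule lsum[OF g])
  hence "l y = of_real S" unfolding S_def lessThan_Suc_atMost of_real_sum lg .
  hence "S \<le> C * nrm M y" using bound[OF y] S0 by simp
  hence "S^2 \<le> C^2 * S" using power_mono[OF _ S0, of "C * nrm M y" 2] by (simp add: power_mult_distrib yn)
  thus "(\<Sum>i\<le>n. (nrm M (g i))^2) \<le> C^2" unfolding S_def[symmetric] using S0
   by (cases "S = 0") (auto simp: power2_eq_square)
 qed simp
 obtain u where u: "u \<in> HC" "(\<lambda>n. nrm M (\<lambda>z. u z - (\<Sum>i<n. g i z))) \<longlonglongrightarrow> 0"
  "\<And>y. y \<in> HC \<Longrightarrow> (\<lambda>i. ip M (g i) y) sums ip M u y" "(\<lambda>i. (nrm M (g i))^2) sums (nrm M u)^2"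
  by (rule orthogonal_series[OF g orth summ]; (assumption | rule that))
 have uj: "ip M (en j) u = b j" for j
 proof -
  have "(\<lambda>i. ip M (g i) (en j)) = (\<lambda>i. if i = j then cnj (b i) else 0)"
  proof
   fix i
   show "ip M (g i) (en j) = (if i = j then cnj (b i) else 0)"
    unfolding g_def[abs_def] ip_scale_left using en_orth[of i j] en_one[of j] b0[of j] by (auto simp: ip_zero)
  qed
  hence "ip M u (en j) = cnj (b j)" using sums_unique2[OF u(3)[OF en_HC]] sums_single[of j "\<lambda>i. cnj (b i)"] by simp
  thus ?thesis using cnj_ip[of M u "en j"] by simp
 qed
 have "l f = ip M f u" if f: "f \<in> HC" for f
 proof -
  have h: "(\<lambda>z. ip M f (en i) * en i z) \<in> HC" for i by (intro HC_scale en_HC)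
  have sH: "(\<lambda>z. \<Sum>i<n. ip M f (en i) * en i z) \<in> HC" for n by (intro HC_sum h)
  have "(\<lambda>i. ip M f (en i) * b i) sums l f"
   unfolding sums_def
  proof (rule Lim_null_comparison[THEN LIM_zero_cancel])
   show "(\<lambda>n. C * nrm M (\<lambda>z. f z - (\<Sum>i<n. ip M f (en i) * en i z))) \<longlonglongrightarrow> 0"
    using tendsto_mult_right_zero[OF onb_expansion(1)[OF f], of C] by (simp add: mult.commute)
   show "\<forall>\<^sub>F n in sequentially. norm ((\<Sum>i<n. ip M f (en i) * b i) - l f) \<le> C * nrm M (\<lambda>z. f z - (\<Sum>i<n. ip M f (en i) * en i z))"
   proof (intro always_eventually allI)
    fix n
    let ?s = "\<lambda>z. \<Sum>i<n. ip M f (en i) * en i z"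
    have "l ?s = (\<Sum>i<n. ip M f (en i) * b i)" unfolding lsum[OF h] scale[OF en_HC] b_def ..
    moreover have "l f = l (\<lambda>z. f z - ?s z) + l ?s" using add[OF HC_diff[OF f sH] sH, of n n] by simp
    ultimately show "norm ((\<Sum>i<n. ip M f (en i) * b i) - l f) \<le> C * nrm M (\<lambda>z. f z - ?s z)"
     using bound[OF HC_diff[OF f sH], of n] by (simp add: norm_minus_commute)
   qed
  qed
  thus ?thesis using sums_unique2[OF onb_expansion(2)[OF f u(1)]] by (simp add: uj)
 qed
 thus thesis by (rule that[OF u(1)])
qed

end

section \<open>Radial operators\<close>

lemma hprod_pythagoras:
 assumes "hprod a b = 0" shows "(norm (a + b))^2 = (norm a)^2 + (norm b)^2"
proof -
 have "hprod b a = 0" using arg_cong[OF assms, of cnj] by (simp add: cnj_hprod)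
 hence "complex_of_real ((norm (a + b))^2) = of_real ((norm a)^2 + (norm b)^2)"
  unfolding of_real_add hprod_self[symmetric] using assms by (simp add: hprod_add_left hprod_add_right)
 thus ?thesis by (simp only: of_real_eq_iff)
qed

text \<open>A reflection along v = w - w'. With X = <w, v> one has X + cnj X = |v|^2 because |w| =
  |w'|; the factor c = -cnj X / X has modulus 1 and makes (c - 1) X = -|v|^2, so w moves by exactly
  -v.\<close>

lemma stab0_transitive:
 fixes w w' :: "complex^'n::finite"
 assumes "norm w = norm w'"
 obtains g :: "'n gmat" where "g \<in> stab0" "act g w = w'"
proof (cases "w = w'")
 case True
 obtain g :: "'n gmat" where "g \<in> stab0" "\<And>z. act g z = 1 *s z" by (rule stab0_scalar[of 1]) (simp, rule that)
 thus thesis using True that by simp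
next
 case False
 define v where "v = w - w'"
 define X where "X = hprod w v"
 define d where "d = norm v"
 have d0: "d > 0" using False by (simp add: d_def v_def)
 have n: "hprod w w = hprod w' w'" unfolding hprod_self assms ..
 have "complex_of_real (d^2) = X + cnj X"
  unfolding X_def d_def hprod_self[symmetric] v_def hprod_diff_left hprod_diff_right n by (simp add: cnj_hprod)
 hence dX: "of_real d * of_real d = X + cnj X" by (simp add: power2_eq_square)
 have X0: "X \<noteq> 0" using dX d0 by auto
 define c where "c = - cnj X / X"
 have c: "cmod c = 1" using X0 by (simp add: c_def norm_divide)
 have u: "norm (complex_of_real (1 / d) *s v) = 1" using d0 unfolding norm_smult_vec by (simp add: d_def norm_divide)
 obtain g :: "'n gmat" where g: "g \<in> stab0" "\<And>z. act g z = z + ((c - 1) * hprod z (of_real (1 / d) *s v)) *s (of_real (1 / d) *s v)"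
  by (rule stab0_reflection[OF c u]; rule that)
 have "(c - 1) * X = - (of_real d * of_real d)" unfolding c_def dX using X0 by (simp add: field_simps)
 hence e: "(c - 1) * (1 / of_real d * X) * (1 / of_real d) = -1" using d0 by (simp add: field_simps)
 have "act g w = w + ((c - 1) * (1 / of_real d * X) * (1 / of_real d)) *s v"
  unfolding g(2) hprod_scale_right X_def[symmetric] vector_smult_assoc by simp
 also have "\<dots> = w'" unfolding e by (simp add: v_def vec_eq_iff)
 finally show thesis using g(1) that by blast
qed

lemma circle_identity:
 assumes "g holomorphic_on ball 0 R" "R > 1" "\<And>c. cmod c = 1 \<Longrightarrow> g c = 0" "cmod z < R"
 shows "g z = 0"
proof (rule analytic_continuation[of g "ball 0 R" "sphere 0 1" 1 z])
 have "sphere (0::complex) 1 \<noteq> {x}" for x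
 proof
  assume h: "sphere (0::complex) 1 = {x}"
  have "1 \<in> {x}" "-1 \<in> {x}" unfolding h[symmetric] by simp_all
  thus False by auto
 qed
 thus "(1::complex) islimpt sphere 0 1"
  by (intro connected_imp_perfect) (auto simp: connected_sphere)
qed (use assms in auto)

context bergman_setting
begin

section \<open>Homogeneous components and diagonal operators\<close>

lemma ck_pos: "ck k > 0" using poch_pos by simp

lemma nrm_le_bound:
 assumes "f \<in> L2 M" "\<And>z. norm z < 1 \<Longrightarrow> cmod (f z) \<le> B" shows "nrm M f \<le> B"
proof -
 have B: "B \<ge> 0" using assms(2)[of 0] norm_ge_zero[of "f 0"] by (simp del: norm_ge_zero)
 interpret finite_measure M by (rule finite_M)
 have "(LINT z|M. (cmod (f z))^2) \<le> (LINT z|M. B^2)"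
 proof (rule integral_mono_AE)
  show "AE z in M. (cmod (f z))^2 \<le> B^2" using AE_M_ball by eventually_elim (auto intro!: power_mono assms(2))
 qed (use assms(1) in \<open>simp_all add: L2_iff\<close>)
 also have "(LINT z|M. B^2) = B^2" using integral_M_power(2)[of 0] by (simp add: hdim_def)
 finally have "(nrm M f)^2 \<le> B^2" by (simp add: nrm_sq)
 thus ?thesis using B by (simp add: power2_le_iff_abs_le)
qed

lemma nrm_Kmono_le: assumes z: "norm z \<le> 1" shows "nrm M (Kmono k z) \<le> ck k"
proof (rule nrm_le_bound[OF HC_L2[OF Kmono_HC]])
 fix u :: "complex^'n" assume u: "norm u < 1"
 have "cmod (hprod u z) \<le> norm u * norm z" by (rule norm_hprod_le)
 also have "\<dots> \<le> 1" using u z by (intro mult_le_one) auto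
 finally have "cmod (hprod u z) ^ k \<le> 1" by (intro power_le_one) auto
 hence "ck k * cmod (hprod u z) ^ k \<le> ck k" using ck_pos[of k] by (intro mult_left_le) auto
 moreover have "cmod (Kmono k z u) = ck k * cmod (hprod u z) ^ k"
  using u ck_pos[of k] unfolding Kmono_def by (simp only: if_True norm_mult norm_power norm_of_real)
 ultimately show "cmod (Kmono k z u) \<le> ck k" by simp
qed

text \<open>The binomial series of the kernel at z converges uniformly in the other variable, with
  tails at most \<open>T n\<close>, hence in norm. Pairing with f and the reproducing formula give
  the expansion of f(z).\<close>

lemma Kmono_sums:
 assumes f: "f \<in> HC" and z: "norm z < 1" shows "(\<lambda>k. ip M f (Kmono k z)) sums f z"
proof -
 define r where "r = norm z"
 have r: "0 \<le> r" "r < 1" using z by (auto simp: r_def)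
 have S: "summable (\<lambda>k. ck k * r ^ k)"
 proof -
  have "(\<lambda>k. complex_of_real (ck k * r ^ k)) sums kpsi \<nu> (of_real r)" using kpsi_sums[of "of_real r" \<nu>] r by simp
  from summable_Re[OF sums_summable[OF this]] show ?thesis by (simp only: Re_complex_of_real)
 qed
 define T where "T n = (\<Sum>k. ck (k + n) * r ^ (k + n))" for n
 have T0: "T \<longlonglongrightarrow> 0" unfolding T_def by (rule suminf_exist_split2[OF S])
 have b: "nrm M (\<lambda>u. Kw z u - (\<Sum>k<n. Kmono k z u)) \<le> T n" for n
 proof (rule nrm_le_bound)
  show "(\<lambda>u. Kw z u - (\<Sum>k<n. Kmono k z u)) \<in> L2 M" by (intro HC_L2 HC_diff HC_sum Kmono_HC Kw_HC z)
  fix u :: "complex^'n" assume u: "norm u < 1"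
  define x where "x = hprod u z"
  have "cmod x \<le> norm u * norm z" unfolding x_def by (rule norm_hprod_le)
  also have "\<dots> \<le> 1 * r" using u by (intro mult_mono) (auto simp: r_def)
  finally have x: "cmod x \<le> r" by simp
  have sx: "(\<lambda>k. of_real (ck k) * x ^ k) sums Kw z u" using kpsi_sums[of x \<nu>] x r u by (simp add: Kw_def x_def)
  have "(\<lambda>k. of_real (ck (k + n)) * x ^ (k + n)) sums (Kw z u - (\<Sum>k<n. of_real (ck k) * x ^ k))"
   using sums_split_initial_segment[OF sx] .
  moreover have "(\<Sum>k<n. of_real (ck k) * x ^ k) = (\<Sum>k<n. Kmono k z u)" using u by (simp add: Kmono_def x_def)
  ultimately have s2: "(\<lambda>k. of_real (ck (k + n)) * x ^ (k + n)) sums (Kw z u - (\<Sum>k<n. Kmono k z u))" by simp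
  have le: "cmod (of_real (ck (k + n)) * x ^ (k + n)) \<le> ck (k + n) * r ^ (k + n)" for k
   unfolding norm_mult norm_power norm_of_real using ck_pos[of "k + n"] by (simp only: abs_of_pos) (intro mult_left_mono power_mono x, auto)
  have sS: "summable (\<lambda>k. ck (k + n) * r ^ (k + n))" by (rule summable_ignore_initial_segment[OF S])
  show "cmod (Kw z u - (\<Sum>k<n. Kmono k z u)) \<le> T n"
   unfolding T_def sums_unique[OF s2] by (rule norm_suminf_le[OF le sS])
 qed
 show ?thesis unfolding sums_def
 proof (rule Lim_null_comparison[THEN LIM_zero_cancel])
  show "(\<lambda>n. nrm M f * T n) \<longlonglongrightarrow> 0" using tendsto_mult_right_zero[OF T0] .
  show "\<forall>\<^sub>F n in sequentially. norm ((\<Sum>k<n. ip M f (Kmono k z)) - f z) \<le> nrm M f * T n"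
  proof (intro always_eventually allI)
   fix n
   have K: "(\<lambda>u. Kw z u - (\<Sum>k<n. Kmono k z u)) \<in> HC" by (intro HC_diff HC_sum Kmono_HC Kw_HC z)
   have "ip M f (\<lambda>u. Kw z u - (\<Sum>k<n. Kmono k z u)) = f z - (\<Sum>k<n. ip M f (Kmono k z))"
    by (subst ip_diff_right) (auto intro!: HC_L2 f HC_sum Kmono_HC Kw_HC z simp: ip_sum_right HC_L2 f Kmono_HC reproducing z)
   hence "norm ((\<Sum>k<n. ip M f (Kmono k z)) - f z) \<le> nrm M f * nrm M (\<lambda>u. Kw z u - (\<Sum>k<n. Kmono k z u))"
    using H_CS[OF f K] by (simp add: norm_minus_commute)
   also have "\<dots> \<le> nrm M f * T n" using b by (intro mult_left_mono) auto
   finally show "norm ((\<Sum>k<n. ip M f (Kmono k z)) - f z) \<le> nrm M f * T n" .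
  qed
 qed
qed

lemma Kmono_swap: "norm w < 1 \<Longrightarrow> norm z < 1 \<Longrightarrow> cnj (Kmono k w z) = Kmono k z w"
 by (simp add: Kmono_def cnj_hprod)

lemma Kmono_scale: "Kmono k (c *s w) = (\<lambda>z. cnj c ^ k * Kmono k w z)"
 by (auto simp: Kmono_def hprod_scale_right power_mult_distrib)

text \<open>Different degrees are orthogonal by rotation invariance. Then the expansion of
  \<open>Kmono k w\<close> by \<open>Kmono_sums\<close> has a single nonzero term, which settles
  equal degrees.\<close>

lemma ip_Kmono:
 assumes z: "norm z < 1" shows "ip M (Kmono j w) (Kmono k z) = (if j = k then Kmono k w z else 0)"
proof -
 have ne: "ip M (Kmono j w) (Kmono k z) = 0" if "j \<noteq> k" for j k
 proof -
  \<comment> \<open>For this angle the phases picked up in degrees j and k have quotient -1, so the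
    inner product equals its own negative.\<close>
  define t where "t = pi / (real j - real k)"
  define c where "c = cis t"
  have c: "cmod c = 1" by (simp add: c_def)
  have "c ^ j = cis (real j * t)" unfolding c_def by (rule Complex.DeMoivre)
  moreover have "cnj (c ^ k) = cis (- (real k * t))" unfolding c_def Complex.DeMoivre by (rule cis_cnj)
  ultimately have "c ^ j * cnj (c ^ k) = cis (real j * t - real k * t)" by (simp only: cis_mult) simp
  also have "real j * t - real k * t = (real j - real k) * t" by (simp add: left_diff_distrib)
  also have "\<dots> = pi" using that by (simp add: t_def)
  finally have cc: "c ^ j * cnj (c ^ k) = -1" by simp
  have r: "Kmono j w (c *s u) = c ^ j * Kmono j w u" for j u and w :: "complex^'n"
   by (simp add: Kmono_def norm_smult_vec c hprod_scale_left power_mult_distrib)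
  have m: "(\<lambda>u. Kmono j w u * cnj (Kmono k z u)) \<in> borel_measurable borel"
   using HC_measurable[OF Kmono_HC] by measurable
  have "ip M (Kmono j w) (Kmono k z) = (LINT u|M. c ^ j * cnj (c ^ k) * (Kmono j w u * cnj (Kmono k z u)))"
   unfolding ip_def integral_M_rotate(1)[OF c m, symmetric] r by (simp add: mult_ac)
  also have "\<dots> = - ip M (Kmono j w) (Kmono k z)" unfolding cc ip_def by simp
  finally show ?thesis by simp
 qed
 have "(\<lambda>i. ip M (Kmono k w) (Kmono i z)) = (\<lambda>i. if i = k then ip M (Kmono k w) (Kmono k z) else 0)"
  using ne by auto
 hence "ip M (Kmono k w) (Kmono k z) = Kmono k w z"
  using sums_unique2[OF Kmono_sums[OF Kmono_HC z]] sums_single[of k "\<lambda>i. ip M (Kmono k w) (Kmono k z)"] by fastforce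
 thus ?thesis using ne by auto
qed

lemma nrm_Kmono: "norm z < 1 \<Longrightarrow> (nrm M (Kmono k z))^2 = ck k * ((norm z)^2) ^ k"
proof -
 assume z: "norm z < 1"
 have "complex_of_real ((nrm M (Kmono k z))^2) = of_real (ck k * ((norm z)^2) ^ k)"
  unfolding ip_self[symmetric] ip_Kmono[OF z] using z by (simp add: Kmono_def hprod_self)
 thus ?thesis by (simp only: of_real_eq_iff)
qed

text \<open>The orthogonal projection onto the homogeneous polynomials of degree k, written through
  its kernel \<open>Kmono\<close> rather than through coefficients of monomials.\<close>

definition Pk :: "nat \<Rightarrow> (complex^'n \<Rightarrow> complex) \<Rightarrow> complex^'n \<Rightarrow> complex" where
 "Pk k f z = (if norm z < 1 then ip M f (Kmono k z) else 0)"

lemma Pk_bound: assumes f: "f \<in> HC" and z: "norm z < 1" shows "cmod (ip M f (Kmono k z)) \<le> nrm M f * ck k"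
proof -
 have "cmod (ip M f (Kmono k z)) \<le> nrm M f * nrm M (Kmono k z)" by (rule H_CS[OF f Kmono_HC])
 also have "\<dots> \<le> nrm M f * ck k" using nrm_Kmono_le[of z k] z by (intro mult_left_mono) auto
 finally show ?thesis .
qed

lemma Pk_HC: assumes f: "f \<in> HC" shows "Pk k f \<in> HC"
proof -
 have d: "cdiff (\<lambda>z. ip M f (Kmono k z)) z" if z: "norm z < 1" for z
 proof -
  have "cdiff (\<lambda>z. LINT u|M. f u * (\<lambda>x. of_real (ck k) * x ^ k) (hprod z u)) z"
   by (rule cdiff_kernel_integral[OF L2_integrable1[OF HC_L2[OF f]] AE_M_ball sets_bergman _ _ z])
     (auto intro!: holomorphic_intros)
  moreover have "(LINT u|M. f u * (\<lambda>x. of_real (ck k) * x ^ k) (hprod z u)) = ip M f (Kmono k z)" for z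
   unfolding ip_def
  proof (rule integral_cong_AE)
   show "AE u in M. f u * (of_real (ck k) * hprod z u ^ k) = f u * cnj (Kmono k z u)"
    using AE_M_ball by eventually_elim (simp add: Kmono_def cnj_hprod)
   have "(\<lambda>u. hprod z u) \<in> borel_measurable borel"
    unfolding hprod_def by (intro borel_measurable_continuous_onI continuous_intros)
   thus "(\<lambda>u. f u * (of_real (ck k) * hprod z u ^ k)) \<in> borel_measurable M"
    using HC_measurable[OF f] by measurable
   show "(\<lambda>u. f u * cnj (Kmono k z u)) \<in> borel_measurable M"
    using HC_measurable[OF f] HC_measurable[OF Kmono_HC[of k z]] by measurable
  qed
  ultimately show ?thesis by simp
 qed
 show ?thesis unfolding Pk_def[abs_def] by (rule HC_bounded[OF d Pk_bound[OF f] measurable_if_ball[OF d]])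
qed

lemma nrm_Pk_le: assumes f: "f \<in> HC" shows "nrm M (Pk k f) \<le> nrm M f * ck k"
proof (rule nrm_le_bound[OF HC_L2[OF Pk_HC[OF f]]])
 fix z :: "complex^'n" assume "norm z < 1"
 thus "cmod (Pk k f z) \<le> nrm M f * ck k" using Pk_bound[OF f, of z k] by (simp add: Pk_def)
qed

lemma Pk_Kmono: "norm z < 1 \<Longrightarrow> Pk j (Kmono k z) = (if j = k then Kmono k z else (\<lambda>z. 0))"
 by (auto simp: Pk_def fun_eq_iff ip_Kmono Kmono_def)

lemma Pk_Kw: "norm w < 1 \<Longrightarrow> Pk k (Kw w) = Kmono k w"
proof
 fix z assume w: "norm w < 1"
 show "Pk k (Kw w) z = Kmono k w z"
  using arg_cong[OF reproducing[OF w Kmono_HC[of k z]], of cnj] w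
  by (auto simp: Pk_def cnj_ip Kmono_swap) (simp add: Kmono_def)
qed

text \<open>The functional sending f to <P_k f, g> has a representer t. Testing it on the kernels
  \<open>Kw w\<close>, which \<open>Pk k\<close> maps to \<open>Kmono k w\<close>, shows that t and
  P_k g agree at every point w.\<close>

lemma ip_Pk:
 assumes f: "f \<in> HC" and g: "g \<in> HC" shows "ip M (Pk k f) g = ip M f (Pk k g)"
proof -
 obtain t where t: "t \<in> HC" "\<And>f. f \<in> HC \<Longrightarrow> ip M (Pk k f) g = ip M f t"
 proof (rule Riesz_representation[of "\<lambda>f. ip M (Pk k f) g" "ck k * nrm M g"])
  fix f h assume f: "f \<in> HC" and h: "h \<in> HC"
  have "Pk k (\<lambda>z. f z + h z) = (\<lambda>z. Pk k f z + Pk k h z)"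
   using f h by (auto simp: Pk_def ip_add_left HC_L2 Kmono_HC)
  thus "ip M (Pk k (\<lambda>z. f z + h z)) g = ip M (Pk k f) g + ip M (Pk k h) g"
   using f h g by (simp add: ip_add_left HC_L2 Pk_HC)
 next
  fix c f assume f: "f \<in> HC"
  have "Pk k (\<lambda>z. c * f z) = (\<lambda>z. c * Pk k f z)" by (auto simp: Pk_def ip_scale_left)
  thus "ip M (Pk k (\<lambda>z. c * f z)) g = c * ip M (Pk k f) g" by (simp add: ip_scale_left)
 next
  fix f assume f: "f \<in> HC"
  have "cmod (ip M (Pk k f) g) \<le> nrm M (Pk k f) * nrm M g" by (rule H_CS[OF Pk_HC[OF f] g])
  also have "\<dots> \<le> nrm M f * ck k * nrm M g" by (intro mult_right_mono nrm_Pk_le f) simp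
  finally show "cmod (ip M (Pk k f) g) \<le> ck k * nrm M g * nrm M f" by (simp add: mult_ac)
 next
  fix u assume "u \<in> HC" "\<And>f. f \<in> HC \<Longrightarrow> ip M (Pk k f) g = ip M f u"
  thus thesis by (rule that)
 qed
 have "t = Pk k g"
 proof
  fix w show "t w = Pk k g w"
  proof (cases "norm w < 1")
   case True
   have "ip M (Kmono k w) g = ip M (Kw w) t" using t(2)[OF Kw_HC[OF True]] by (simp add: Pk_Kw True)
   hence "ip M g (Kmono k w) = ip M t (Kw w)" by (metis cnj_ip)
   thus ?thesis using True reproducing[OF True t(1)] by (simp add: Pk_def)
  qed (simp add: Pk_def HC_out[OF t(1)])
 qed
 thus ?thesis using t(2)[OF f] by simp
qed

lemma Pk_Pk: assumes f: "f \<in> HC" shows "Pk j (Pk k f) = (if j = k then Pk k f else (\<lambda>z. 0))"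
proof
 fix z
 show "Pk j (Pk k f) z = (if j = k then Pk k f else (\<lambda>z. 0)) z"
  by (auto simp: Pk_def[of j "Pk k f"] ip_Pk f Kmono_HC Pk_Kmono ip_zero) (auto simp: Pk_def)
qed

lemma ip_Pk_Pk:
 assumes "f \<in> HC" "g \<in> HC" shows "ip M (Pk j f) (Pk k g) = (if j = k then ip M (Pk k f) g else 0)"
 using assms by (auto simp: ip_Pk Pk_HC Pk_Pk ip_zero)

lemma ip_Pk_Kmono: "f \<in> HC \<Longrightarrow> norm z < 1 \<Longrightarrow> ip M f (Kmono k z) = Pk k f z" by (simp add: Pk_def)

lemma summable_Pk: assumes f: "f \<in> HC" shows "summable (\<lambda>k. (nrm M (Pk k f))^2)"
proof (rule bounded_imp_summable)
 fix n
 define y where "y z = (\<Sum>k<Suc n. Pk k f z)" for z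
 define S where "S = (\<Sum>k\<le>n. (nrm M (Pk k f))^2)"
 have y: "y \<in> HC" unfolding y_def[abs_def] by (intro HC_sum Pk_HC f)
 have S0: "S \<ge> 0" unfolding S_def by (intro sum_nonneg) auto
 have yn: "(nrm M y)^2 = S" unfolding y_def[abs_def] S_def lessThan_Suc_atMost[symmetric]
  by (rule nrm_sum_sq) (auto intro: HC_L2 Pk_HC f simp: ip_Pk_Pk f)
 have "ip M (Pk k f) f = of_real ((nrm M (Pk k f))^2)" for k using ip_Pk_Pk[OF f f, of k k] by (simp add: ip_self)
 moreover have "ip M y f = (\<Sum>k<Suc n. ip M (Pk k f) f)"
  unfolding y_def[abs_def] by (rule ip_sum_left) (auto intro: HC_L2 Pk_HC f)
 ultimately have "ip M y f = of_real S" unfolding S_def lessThan_Suc_atMost by simp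
 hence "S \<le> nrm M y * nrm M f" using H_CS[OF y f] S0 by simp
 hence "S^2 \<le> S * (nrm M f)^2" using power_mono[OF _ S0, of "nrm M y * nrm M f" 2] by (simp add: power_mult_distrib yn)
 thus "(\<Sum>k\<le>n. (nrm M (Pk k f))^2) \<le> (nrm M f)^2" unfolding S_def[symmetric] using S0
  by (cases "S = 0") (auto simp: power2_eq_square)
qed simp

text \<open>The operator acting on homogeneous polynomials of degree \<open>k\<close> as multiplication by \<open>a k\<close>.\<close>

definition diag :: "(nat \<Rightarrow> complex) \<Rightarrow> (complex^'n \<Rightarrow> complex) \<Rightarrow> complex^'n \<Rightarrow> complex" where
 "diag a f z = (\<Sum>k. a k * Pk k f z)"

definition bdd :: "(nat \<Rightarrow> complex) \<Rightarrow> bool" where "bdd a \<longleftrightarrow> (\<exists>C. \<forall>k. cmod (a k) \<le> C)"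

lemma bdd_obtain: assumes "bdd a" obtains C where "C \<ge> 0" "\<And>k. cmod (a k) \<le> C"
 using assms norm_ge_zero order_trans unfolding bdd_def by metis

lemma bdd_cnj: "bdd a \<Longrightarrow> bdd (\<lambda>k. cnj (a k))" by (simp add: bdd_def)

lemma bdd_mult: assumes "bdd a" "bdd b" shows "bdd (\<lambda>k. a k * b k)"
proof -
 obtain A where A: "A \<ge> 0" "\<And>k. cmod (a k) \<le> A" by (rule bdd_obtain[OF assms(1)]; rule that)
 obtain B where B: "B \<ge> 0" "\<And>k. cmod (b k) \<le> B" by (rule bdd_obtain[OF assms(2)]; rule that)
 show ?thesis unfolding bdd_def by (intro exI[of _ "A * B"] allI) (auto simp: norm_mult intro!: mult_mono A B)
qed

lemma diag_props:
 assumes a: "bdd a" and f: "f \<in> HC"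
 shows "diag a f \<in> HC" "\<And>y. y \<in> HC \<Longrightarrow> (\<lambda>k. a k * ip M (Pk k f) y) sums ip M (diag a f) y"
  "(\<lambda>k. (cmod (a k))^2 * (nrm M (Pk k f))^2) sums (nrm M (diag a f))^2"
proof -
 obtain C where C: "C \<ge> 0" "\<And>k. cmod (a k) \<le> C" by (rule bdd_obtain[OF a]; rule that)
 have n: "(nrm M (\<lambda>z. a k * Pk k f z))^2 = (cmod (a k))^2 * (nrm M (Pk k f))^2" for k
  by (simp add: nrm_scale power_mult_distrib)
 have summ: "summable (\<lambda>k. (cmod (a k))^2 * (nrm M (Pk k f))^2)"
  by (rule summable_comparison_test'[OF summable_mult[OF summable_Pk[OF f], of "C^2"], of 0])
    (auto intro!: mult_right_mono power_mono C)
 obtain u where u: "u \<in> HC" "(\<lambda>n. nrm M (\<lambda>z. u z - (\<Sum>k<n. a k * Pk k f z))) \<longlonglongrightarrow> 0"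
  "\<And>y. y \<in> HC \<Longrightarrow> (\<lambda>k. ip M (\<lambda>z. a k * Pk k f z) y) sums ip M u y"
  "(\<lambda>k. (nrm M (\<lambda>z. a k * Pk k f z))^2) sums (nrm M u)^2"
  by (rule orthogonal_series[of "\<lambda>k z. a k * Pk k f z"]; (rule that)?)
    (auto intro: HC_scale Pk_HC f simp: n summ ip_scale_left ip_scale_right ip_Pk_Pk f)
 have "u = diag a f"
 proof
  fix z show "u z = diag a f z"
  proof (cases "norm z < 1")
   case True
   have "(\<lambda>k. a k * Pk k f z) sums u z"
    using u(3)[OF Kw_HC[OF True]] unfolding reproducing[OF True u(1)] ip_scale_left reproducing[OF True Pk_HC[OF f]] .
   thus ?thesis by (simp add: diag_def sums_iff)
  qed (simp add: HC_out[OF u(1)] diag_def Pk_def)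
 qed
 thus "diag a f \<in> HC" "\<And>y. y \<in> HC \<Longrightarrow> (\<lambda>k. a k * ip M (Pk k f) y) sums ip M (diag a f) y"
  "(\<lambda>k. (cmod (a k))^2 * (nrm M (Pk k f))^2) sums (nrm M (diag a f))^2"
  using u by (simp_all add: n ip_scale_left)
qed

lemmas diag_HC = diag_props(1)

lemma diag_one: assumes f: "f \<in> HC" shows "diag (\<lambda>k. 1) f = f"
proof
 fix z show "diag (\<lambda>k. 1) f z = f z"
  using Kmono_sums[OF f, of z] HC_out[OF f, of z] by (cases "norm z < 1") (auto simp: diag_def Pk_def sums_iff)
qed

lemma nrm_diag_le:
 assumes f: "f \<in> HC" and C: "\<And>k. cmod (a k) \<le> C" shows "nrm M (diag a f) \<le> C * nrm M f"
proof -
 have C0: "C \<ge> 0" using C[of 0] norm_ge_zero order_trans by blast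
 have a: "bdd a" "bdd (\<lambda>k. 1)" using C by (auto simp: bdd_def)
 have "(nrm M (diag a f))^2 \<le> C^2 * (nrm M f)^2"
 proof (rule sums_le[OF _ diag_props(3)[OF a(1) f]])
  show "(\<lambda>k. C^2 * (nrm M (Pk k f))^2) sums (C^2 * (nrm M f)^2)"
   using sums_mult[OF diag_props(3)[OF a(2) f], of "C^2"] by (simp add: diag_one f)
 qed (auto intro!: mult_right_mono power_mono C)
 hence "(nrm M (diag a f))^2 \<le> (C * nrm M f)^2" by (simp add: power_mult_distrib)
 thus ?thesis using C0 by (simp add: power2_le_iff_abs_le)
qed

lemma Pk_diag: assumes a: "bdd a" and f: "f \<in> HC" shows "Pk k (diag a f) = (\<lambda>z. a k * Pk k f z)"
proof
 fix z
 show "Pk k (diag a f) z = a k * Pk k f z"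
 proof (cases "norm z < 1")
  case True
  have "a j * ip M (Pk j f) (Kmono k z) = (if j = k then a k * Pk k f z else 0)" for j
   using Pk_Pk[OF f, of k j] True by (auto simp: ip_Pk_Kmono Pk_HC f)
  hence "ip M (diag a f) (Kmono k z) = a k * Pk k f z"
   using sums_unique2[OF diag_props(2)[OF a f Kmono_HC[of k z]]] sums_single[of k "\<lambda>j. a k * Pk k f z"] by simp
  thus ?thesis using True by (simp add: Pk_def)
 qed (simp add: Pk_def)
qed

text \<open>By \<open>Kmono_sums\<close> a function in the Bergman space is determined by its
  products with all \<open>Kmono k z\<close>. Most identities for diagonal operators are proved by
  this criterion.\<close>

lemma diag_unique:
 assumes u: "u \<in> HC" and h: "\<And>k z. norm z < 1 \<Longrightarrow> ip M u (Kmono k z) = a k * ip M f (Kmono k z)"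
 shows "u = diag a f"
proof
 fix z show "u z = diag a f z"
  using Kmono_sums[OF u, of z] HC_out[OF u, of z] by (cases "norm z < 1") (auto simp: diag_def Pk_def sums_iff h)
qed

lemma diag_diag: assumes "bdd a" "bdd b" "f \<in> HC" shows "diag a (diag b f) = diag (\<lambda>k. a k * b k) f"
 by (simp add: fun_eq_iff diag_def[of a] diag_def[of "\<lambda>k. a k * b k"] Pk_diag assms mult.assoc)

lemma diag_add: assumes "bdd a" "bdd b" "f \<in> HC" shows "diag (\<lambda>k. a k + b k) f = (\<lambda>z. diag a f z + diag b f z)"
proof
 fix z
 have s: "summable (\<lambda>k. a k * Pk k f z)" if "bdd a" for a
 proof (cases "norm z < 1")
  case True
  show ?thesis using diag_props(2)[OF that assms(3) Kw_HC[OF True]] unfolding reproducing[OF True Pk_HC[OF assms(3)]]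
   by (rule sums_summable)
 qed (simp add: Pk_def)
 show "diag (\<lambda>k. a k + b k) f z = diag a f z + diag b f z"
  unfolding diag_def by (simp add: suminf_add[OF s[OF assms(1)] s[OF assms(2)]] ring_distribs)
qed

lemma diag_scale: assumes "bdd a" "f \<in> HC" shows "diag (\<lambda>k. c * a k) f = (\<lambda>z. c * diag a f z)"
proof (rule sym, rule diag_unique)
 show "(\<lambda>z. c * diag a f z) \<in> HC" by (intro HC_scale diag_HC assms)
 fix k and z :: "complex^'n" assume z: "norm z < 1"
 show "ip M (\<lambda>z. c * diag a f z) (Kmono k z) = c * a k * ip M f (Kmono k z)"
  using Pk_diag[OF assms, of k] z by (simp add: ip_scale_left ip_Pk_Kmono diag_HC assms)
qed

lemma ip_diag: assumes a: "bdd a" and f: "f \<in> HC" and g: "g \<in> HC" shows "ip M (diag a f) g = ip M f (diag (\<lambda>k. cnj (a k)) g)"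
proof -
 have "(\<lambda>k. cnj (cnj (a k) * ip M (Pk k g) f)) sums cnj (ip M (diag (\<lambda>k. cnj (a k)) g) f)"
  unfolding sums_cnj by (rule diag_props(2)[OF bdd_cnj[OF a] g f])
 hence "(\<lambda>k. a k * ip M (Pk k f) g) sums ip M f (diag (\<lambda>k. cnj (a k)) g)" by (simp add: cnj_ip ip_Pk f g)
 thus ?thesis using sums_unique2[OF diag_props(2)[OF a f g]] by simp
qed

lemma ip_diag_diag:
 assumes a: "bdd a" and b: "bdd b" and f: "f \<in> HC"
 shows "ip M (diag a f) (diag b f) = ip M (diag (\<lambda>k. a k * cnj (b k)) f) f"
 using ip_diag[OF bdd_cnj[OF b] diag_HC[OF a f] f] diag_diag[OF bdd_cnj[OF b] a f]
 by (simp add: mult.commute)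

lemma rep_Kmono:
 assumes g: "g \<in> stab0" and w: "norm w < 1" shows "rep g (Kmono k w) = Kmono k (act g w)"
proof
 fix z
 have "hprod (act (matrix_inv g) z) w = hprod z (act g w)" if z: "norm z < 1"
  using stab0_hprod[OF stab0_inverse[OF g] z, of "act g w"] stab0_norm[OF g w] act_inverse(2)[OF stab0_SU[OF g] w] w by simp
 moreover have "rep g (Kmono k w) z = Kmono k w (act (matrix_inv g) z)" if "norm z < 1" by (rule stab0_rep[OF g that])
 ultimately show "rep g (Kmono k w) z = Kmono k (act g w) z"
  using stab0_norm[OF stab0_inverse[OF g], of z] by (cases "norm z < 1") (simp_all add: Kmono_def, simp add: rep_ball)
qed

lemma diag_rep: assumes a: "bdd a" and f: "f \<in> HC" and g: "g \<in> stab0" shows "diag a (rep g f) = rep g (diag a f)"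
proof (rule sym, rule diag_unique)
 note SU = stab0_SU[OF g]
 show "rep g (diag a f) \<in> HC" by (rule rep_HC_ip(1)[OF SU diag_HC[OF a f] f])
 fix k and z :: "complex^'n" assume z: "norm z < 1"
 define z' where "z' = act (matrix_inv g) z"
 have z': "norm z' < 1" "act g z' = z"
  using stab0_norm[OF stab0_inverse[OF g] z] act_inverse(1)[OF SU z] z by (auto simp: z'_def)
 have e: "ip M (rep g h) (Kmono k z) = Pk k h z'" if "h \<in> HC" for h
  using rep_HC_ip(2)[OF SU that Kmono_HC[of k z']] z' by (simp add: rep_Kmono[OF g z'(1)] Pk_def)
 show "ip M (rep g (diag a f)) (Kmono k z) = a k * ip M (rep g f) (Kmono k z)"
  using e[OF diag_HC[OF a f]] e[OF f] by (simp add: Pk_diag a f)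
qed

text \<open>On the line of w0, scalar rotations and holomorphy give u(p w0) = p^k u(w0). For y
  orthogonal to w0, reflections fixing w0 rotate y, so u(p w0 + \<zeta> y) is constant on the unit
  circle and, by holomorphy, equal to its value at \<zeta> = 0. Hence u depends only on <x, w0> and
  is homogeneous of degree k in it.\<close>

lemma invariant_homogeneous:
 assumes u: "u \<in> HC" and w0: "norm w0 = 1 / 2"
  and inv: "\<And>g c y. g \<in> stab0 \<Longrightarrow> act g w0 = c *s w0 \<Longrightarrow> cmod c = 1 \<Longrightarrow> norm y < 1 \<Longrightarrow> u (act g y) = c ^ k * u y"
 obtains \<beta> where "u = (\<lambda>z. \<beta> * Kmono k w0 z)"
proof -
 have ww: "hprod w0 w0 = 1 / 4" unfolding hprod_self w0 by (simp add: power2_eq_square)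
 have slice0: "u (p *s w0) = p ^ k * u w0" if p: "cmod p < 2" for p
 proof -
  have "u (p *s w0) - p ^ k * u w0 = 0"
  proof (rule circle_identity[where R = 2 and g = "\<lambda>p. u (p *s w0) - p ^ k * u w0"])
   have "(\<lambda>p. u (0 + p *s w0)) holomorphic_on ball 0 2"
    by (rule slice_holomorphic[OF u]) (auto simp: norm_smult_vec w0)
   thus "(\<lambda>p. u (p *s w0) - p ^ k * u w0) holomorphic_on ball 0 2" by (auto intro!: holomorphic_intros)
   fix c :: complex assume c: "cmod c = 1"
   obtain g :: "'n gmat" where g: "g \<in> stab0" "\<And>z. act g z = c *s z" by (rule stab0_scalar[OF c]; rule that)
   show "u (c *s w0) - c ^ k * u w0 = 0" using inv[OF g(1) g(2) c, of w0] w0 by (simp add: g(2))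
  qed (use p in auto)
  thus ?thesis by simp
 qed
 have "u x = (4 ^ k * u w0 / of_real (ck k)) * Kmono k w0 x" for x
 proof (cases "norm x < 1")
  case True
  \<comment> \<open>The 4 is 1/|w0|^2, so p w0 is the orthogonal projection of x onto the line of
    w0.\<close>
  define p where "p = 4 * hprod x w0"
  define y where "y = x - p *s w0"
  have yw: "hprod y w0 = 0" by (simp add: y_def hprod_diff_left hprod_scale_left ww p_def)
  have perp: "(norm (p *s w0 + \<zeta> *s y))^2 = (cmod p / 2)^2 + (cmod \<zeta>)^2 * (norm y)^2" for \<zeta>
  proof -
   have "hprod w0 y = 0" using arg_cong[OF yw, of cnj] by (simp add: cnj_hprod)
   hence "hprod (p *s w0) (\<zeta> *s y) = 0" by (simp add: hprod_scale_left hprod_scale_right)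
   thus ?thesis by (simp add: hprod_pythagoras norm_smult_vec w0 power_mult_distrib)
  qed
  have lt: "(cmod p / 2)^2 + (norm y)^2 < 1"
  proof -
   have "x = p *s w0 + 1 *s y" by (simp add: y_def)
   hence "(norm x)^2 = (cmod p / 2)^2 + (norm y)^2" using perp[of 1] by simp
   moreover have "(norm x)^2 < 1" using True by (simp add: abs_square_less_1)
   ultimately show ?thesis by linarith
  qed
  have "(cmod p / 2)^2 < 1" using lt zero_le_power2[of "norm y"] by linarith
  hence p2: "cmod p < 2" by (simp add: abs_square_less_1)
  have "u x = u (p *s w0)"
  proof (cases "y = 0")
   case False
   \<comment> \<open>The radius within which p w0 + \<zeta> y stays in the ball. It exceeds 1
     because \<zeta> = 1 gives x, which lies inside.\<close>
   define R where "R = sqrt ((1 - (cmod p / 2)^2) / (norm y)^2)"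
   have ny: "(norm y)^2 > 0" using False by simp
   have R: "R > 1" unfolding R_def using lt ny by simp
   have in1: "norm (p *s w0 + \<zeta> *s y) < 1" if "cmod \<zeta> < R" for \<zeta>
   proof -
    have "(cmod \<zeta>)^2 < R^2" using that by (intro power_strict_mono) auto
    also have "R^2 = (1 - (cmod p / 2)^2) / (norm y)^2" unfolding R_def by (intro real_sqrt_pow2 divide_nonneg_pos) (use lt ny in linarith)+
    finally have "(norm (p *s w0 + \<zeta> *s y))^2 < 1" unfolding perp using ny by (simp add: field_simps)
    thus ?thesis by (simp add: abs_square_less_1)
   qed
   have "u (p *s w0 + 0 *s y) - u x = 0"
   proof (rule circle_identity[where R = R and g = "\<lambda>\<zeta>. u (p *s w0 + \<zeta> *s y) - u x"])
    have "(\<lambda>\<zeta>. u (p *s w0 + \<zeta> *s y)) holomorphic_on ball 0 R"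
     by (rule slice_holomorphic[OF u]) (auto intro: in1)
    thus "(\<lambda>\<zeta>. u (p *s w0 + \<zeta> *s y) - u x) holomorphic_on ball 0 R" by (auto intro!: holomorphic_intros)
    fix c :: complex assume c: "cmod c = 1"
    define v where "v = complex_of_real (1 / norm y) *s y"
    have v: "norm v = 1" unfolding v_def norm_smult_vec using False by (simp add: norm_divide)
    obtain g :: "'n gmat" where g: "g \<in> stab0" "\<And>z. act g z = z + ((c - 1) * hprod z v) *s v"
     by (rule stab0_reflection[OF c v]; rule that)
    have "hprod w0 v = 0" using arg_cong[OF yw, of cnj] by (simp add: v_def cnj_hprod hprod_scale_right)
    hence gw: "act g w0 = 1 *s w0" unfolding g(2) by simp
    have "hprod x v = hprod y v" using \<open>hprod w0 v = 0\<close> by (simp add: y_def hprod_diff_left hprod_scale_left)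
    also have "\<dots> = of_real (norm y)" unfolding v_def hprod_scale_right hprod_self using False by (simp add: power2_eq_square)
    finally have "((c - 1) * hprod x v) *s v = (c - 1) *s y" unfolding v_def vector_smult_assoc using False by simp
    hence "act g x = p *s w0 + c *s y" unfolding g(2) by (simp add: y_def vec_eq_iff algebra_simps)
    thus "u (p *s w0 + c *s y) - u x = 0" using inv[OF g(1) gw _ True] by simp
   qed (use R in auto)
   thus ?thesis by simp
  qed (simp add: y_def)
  also have "\<dots> = p ^ k * u w0" by (rule slice0[OF p2])
  finally show ?thesis using True ck_pos[of k] poch_pos[of k] by (simp add: Kmono_def p_def power_mult_distrib)
 qed (simp add: HC_out[OF u] Kmono_def)
 thus thesis using that by blast
qed

text \<open>Schur's lemma for the decomposition of the Bergman space into homogeneous polynomials.\<close>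

lemma radial_form:
 assumes add1: "\<And>f g y. f \<in> HC \<Longrightarrow> g \<in> HC \<Longrightarrow> y \<in> HC \<Longrightarrow> S (\<lambda>z. f z + g z) y = S f y + S g y"
  and scale1: "\<And>c f y. f \<in> HC \<Longrightarrow> y \<in> HC \<Longrightarrow> S (\<lambda>z. c * f z) y = c * S f y"
  and add2: "\<And>f g y. f \<in> HC \<Longrightarrow> g \<in> HC \<Longrightarrow> y \<in> HC \<Longrightarrow> S y (\<lambda>z. f z + g z) = S y f + S y g"
  and scale2: "\<And>c f y. f \<in> HC \<Longrightarrow> y \<in> HC \<Longrightarrow> S y (\<lambda>z. c * f z) = cnj c * S y f"
  and bound: "\<And>f y. f \<in> HC \<Longrightarrow> y \<in> HC \<Longrightarrow> cmod (S f y) \<le> C * nrm M f * nrm M y"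
  and inv: "\<And>g f y. g \<in> stab0 \<Longrightarrow> f \<in> HC \<Longrightarrow> y \<in> HC \<Longrightarrow> S (rep g f) (rep g y) = S f y"
 obtains a where "bdd a" "\<And>f y. f \<in> HC \<Longrightarrow> y \<in> HC \<Longrightarrow> S f y = ip M (diag a f) y"
  "\<And>k f z. f \<in> HC \<Longrightarrow> norm z < 1 \<Longrightarrow> S f (Kmono k z) = a k * Pk k f z"
proof -
 obtain w0 :: "complex^'n" where w0: "norm w0 = 1 / 2" using vector_choose_size[of "1/2"] by auto
 have w1: "norm w0 < 1" using w0 by simp
 have "\<exists>\<alpha>. \<forall>f\<in>HC. \<forall>z. norm z < 1 \<longrightarrow> S f (Kmono k z) = \<alpha> * Pk k f z" for k
 proof -
  obtain u where u: "u \<in> HC" "\<And>f. f \<in> HC \<Longrightarrow> S f (Kmono k w0) = ip M f u"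
  proof (rule Riesz_representation[of "\<lambda>f. S f (Kmono k w0)" "C * nrm M (Kmono k w0)"])
   fix f assume "f \<in> HC"
   thus "cmod (S f (Kmono k w0)) \<le> C * nrm M (Kmono k w0) * nrm M f" using bound[OF _ Kmono_HC] by (simp add: mult_ac)
  next
   fix u assume "u \<in> HC" "\<And>f. f \<in> HC \<Longrightarrow> S f (Kmono k w0) = ip M f u"
   thus thesis by (rule that)
  qed (auto intro: add1 scale1 Kmono_HC)
  have tr: "S f (Kmono k (act g w0)) = ip M f (rep g u)" if g: "g \<in> stab0" and f: "f \<in> HC" for g f
  proof -
   note SU = stab0_SU[OF g]
   define f' where "f' = rep (matrix_inv g) f"
   have f': "f' \<in> HC" unfolding f'_def by (rule rep_HC_ip(1)[OF SU_inverse(1)[OF SU] f f])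
   have e: "rep g f' = f" unfolding f'_def by (rule rep_inverse[OF SU f])
   show ?thesis using inv[OF g f' Kmono_HC[of k w0]] u(2)[OF f'] rep_HC_ip(2)[OF SU f' u(1)]
    by (simp add: e rep_Kmono[OF g w1])
  qed
  \<comment> \<open>An element that moves w0 only by a scalar c multiplies \<open>Kmono k w0\<close>
    by a power of the conjugate of c; invariance of the form passes this character on to the
    representer u.\<close>
  have hom: "u (act g y) = c ^ k * u y" if g: "g \<in> stab0" and gw: "act g w0 = c *s w0" and c: "cmod c = 1" and y: "norm y < 1" for g c y
  proof -
   note SU = stab0_SU[OF g]
   have "rep g u = (\<lambda>z. cnj c ^ k * u z)"
   proof (rule HC_eqI)
    show "rep g u \<in> HC" by (rule rep_HC_ip(1)[OF SU u(1) u(1)])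
    show "(\<lambda>z. cnj c ^ k * u z) \<in> HC" by (rule HC_scale[OF u(1)])
    fix f assume f: "f \<in> HC"
    show "ip M f (rep g u) = ip M f (\<lambda>z. cnj c ^ k * u z)"
     unfolding tr[OF g f, symmetric] gw Kmono_scale scale2[OF Kmono_HC f] u(2)[OF f] ip_scale_right by simp
   qed
   hence "cnj c ^ k * u (act g y) = u y"
    using stab0_rep[OF g, of "act g y" u] stab0_norm[OF g y] act_inverse(2)[OF SU y] y by simp
   hence "c ^ k * (cnj c ^ k * u (act g y)) = c ^ k * u y" by simp
   moreover have "c ^ k * cnj c ^ k = 1" unfolding power_mult_distrib[symmetric] using c by (simp add: complex_norm_square[symmetric])
   ultimately show ?thesis by (simp add: mult.assoc[symmetric])
  qed
  obtain \<beta> where b: "u = (\<lambda>z. \<beta> * Kmono k w0 z)" by (rule invariant_homogeneous[OF u(1) w0 hom]; (assumption | rule that))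
  have "S f (Kmono k z) = cnj \<beta> * Pk k f z" if f: "f \<in> HC" and z: "norm z < 1" for f z
  proof -
   \<comment> \<open>Every z is a multiple of a point on the sphere through w0, where transitivity
     and the homogeneity of \<open>Kmono\<close> apply. For z = 0 the multiple is 0 and w0 itself
     serves as the point.\<close>
   define t where "t = 2 * norm z"
   define z' where "z' = (if z = 0 then w0 else complex_of_real (1 / t) *s z)"
   have z': "norm z' = norm w0" unfolding z'_def by (cases "z = 0") (simp_all add: norm_smult_vec norm_divide t_def w0)
   have zz: "z = complex_of_real t *s z'" unfolding z'_def vector_smult_assoc by (auto simp: t_def)
   obtain g :: "'n gmat" where g: "g \<in> stab0" "act g w0 = z'" by (rule stab0_transitive[OF z'[symmetric]]; rule that)
   have "rep g u = (\<lambda>x. \<beta> * Kmono k z' x)"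
    unfolding g(2)[symmetric] rep_Kmono[OF g(1) w1, symmetric] b by (auto simp: bergman_rep_def)
   hence "S f (Kmono k z') = cnj \<beta> * ip M f (Kmono k z')" using tr[OF g(1) f] by (simp add: g(2) ip_scale_right)
   hence "S f (Kmono k z) = cnj \<beta> * ip M f (Kmono k z)"
    unfolding zz Kmono_scale scale2[OF Kmono_HC f] ip_scale_right by simp
   thus ?thesis using z by (simp add: Pk_def)
  qed
  thus ?thesis by blast
 qed
 then obtain a where a: "\<And>k f z. f \<in> HC \<Longrightarrow> norm z < 1 \<Longrightarrow> S f (Kmono k z) = a k * Pk k f z" by metis
 have "cmod (a k) \<le> C" for k
 proof -
  have n0: "(nrm M (Kmono k w0))^2 > 0" unfolding nrm_Kmono[OF w1] w0 by (intro mult_pos_pos ck_pos) simp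
  have "S (Kmono k w0) (Kmono k w0) = a k * of_real ((nrm M (Kmono k w0))^2)"
   using a[OF Kmono_HC[of k w0] w1, of k] w1 unfolding ip_self[symmetric] by (simp add: Pk_def)
  hence "cmod (a k) * (nrm M (Kmono k w0))^2 \<le> C * (nrm M (Kmono k w0))^2"
   using bound[OF Kmono_HC[of k w0] Kmono_HC[of k w0]] by (simp add: norm_mult power2_eq_square mult.assoc)
  thus ?thesis using n0 by simp
 qed
 hence ab: "bdd a" by (auto simp: bdd_def)
 have "S f y = ip M (diag a f) y" if f: "f \<in> HC" and y: "y \<in> HC" for f y
 proof -
  obtain t where t: "t \<in> HC" "\<And>y. y \<in> HC \<Longrightarrow> cnj (S f y) = ip M y t"
  proof (rule Riesz_representation[of "\<lambda>y. cnj (S f y)" "C * nrm M f"])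
   fix y assume "y \<in> HC"
   thus "cmod (cnj (S f y)) \<le> C * nrm M f * nrm M y" using bound[OF f] by simp
  next
   fix t assume "t \<in> HC" "\<And>y. y \<in> HC \<Longrightarrow> cnj (S f y) = ip M y t"
   thus thesis by (rule that)
  qed (auto simp: add2 scale2 f)
  have St: "S f y = ip M t y" if "y \<in> HC" for y using arg_cong[OF t(2)[OF that], of cnj] by (simp add: cnj_ip)
  have "t = diag a f"
   by (rule diag_unique[OF t(1)]) (use a[OF f] St[OF Kmono_HC] in \<open>simp add: Pk_def\<close>)
  thus ?thesis using St[OF y] by simp
 qed
 thus thesis using that[OF ab _ a] by blast
qed

end

section \<open>Hilbert--Schmidt and trace class radial operators\<close>

text \<open>Written with the same four coefficients as \<open>nrm_polarization\<close>, so that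
  convergence statements for squared norms transfer termwise to inner products, in
  \<open>trace_inner\<close> and in \<open>ek_Parseval_sums\<close>.\<close>

lemma polarization_complex:
 "p * cnj q = (1 / 4) * of_real ((cmod (p + 1 * q))^2) + (- (1 / 4)) * of_real ((cmod (p + (-1) * q))^2) +
   (\<i> / 4) * of_real ((cmod (p + \<i> * q))^2) + (- (\<i> / 4)) * of_real ((cmod (p + (- \<i>) * q))^2)"
 unfolding complex_norm_square by (simp add: field_simps)

lemma sums_suminf_ennreal:
 assumes "\<And>i. f i \<ge> 0" shows "f sums s \<longleftrightarrow> s \<ge> 0 \<and> (\<Sum>i. ennreal (f i)) = ennreal s"
proof
 assume s: "f sums s"
 have "s \<ge> 0" by (rule sums_le[OF _ sums_zero s]) (use assms in auto)
 thus "s \<ge> 0 \<and> (\<Sum>i. ennreal (f i)) = ennreal s" using suminf_ennreal_eq[OF assms s] by simp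
next
 assume "s \<ge> 0 \<and> (\<Sum>i. ennreal (f i)) = ennreal s"
 hence s: "s \<ge> 0" "(\<Sum>i. ennreal (f i)) = ennreal s" by auto
 have "(\<lambda>i. ennreal (f i)) sums ennreal s" unfolding s(2)[symmetric] by (rule summable_sums) simp
 thus "f sums s" using s(1) assms by simp
qed

lemma nrm_polarization:
 assumes f: "f \<in> L2 M" and g: "g \<in> L2 M"
 shows "ip M f g = (1 / 4) * of_real ((nrm M (\<lambda>z. f z + 1 * g z))^2) + (- (1 / 4)) * of_real ((nrm M (\<lambda>z. f z + (-1) * g z))^2) +
   (\<i> / 4) * of_real ((nrm M (\<lambda>z. f z + \<i> * g z))^2) + (- (\<i> / 4)) * of_real ((nrm M (\<lambda>z. f z + (- \<i>) * g z))^2)"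
proof -
 have n: "complex_of_real ((nrm M (\<lambda>z. f z + c * g z))^2) = ip M f f + cnj c * ip M f g + c * cnj (ip M f g) + c * cnj c * ip M g g" for c
 proof -
  have cg: "(\<lambda>z. c * g z) \<in> L2 M" by (rule L2_scale[OF g])
  have "ip M (\<lambda>z. f z + c * g z) (\<lambda>z. f z + c * g z) = (ip M f f + ip M f (\<lambda>z. c * g z)) + (ip M (\<lambda>z. c * g z) f + ip M (\<lambda>z. c * g z) (\<lambda>z. c * g z))"
   by (simp only: ip_add_left[OF f cg L2_add[OF f cg]] ip_add_right[OF f cg f] ip_add_right[OF f cg cg])
  thus ?thesis unfolding ip_self[symmetric] ip_scale_left ip_scale_right cnj_ip by (simp add: algebra_simps)
 qed
 show ?thesis unfolding n by (simp add: field_simps)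
qed

context bergman_setting
begin

abbreviation "dd \<equiv> hdim N"

lemma dd_pos: "dd k > 0" by (rule hdim_pos[OF Npos])

lemma nrm_nn_integral: assumes "f \<in> HC" shows "ennreal ((nrm M f)^2) = (\<integral>\<^sup>+z. ennreal ((cmod (f z))^2) \<partial>M)"
 unfolding nrm_sq using HC_L2[OF assms] by (subst nn_integral_eq_integral) (auto simp: L2_iff)

text \<open>The sum over the basis moves inside the integral over the ball, where Parseval turns it
  into the squared norm of the adjoint applied to the kernel at z. Expanded by degree this has the
  terms |a_k|^2 (\<nu>)_k / k! |z|^(2k), which integrate to |a_k|^2 d_k. In the extended reals all
  exchanges hold whether or not the sums are finite.\<close>

lemma HS_norm_ennreal:
 assumes a: "bdd a"
 shows "(\<Sum>i. ennreal ((nrm M (diag a (en i)))^2)) = (\<Sum>k. ennreal ((cmod (a k))^2 * dd k))"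
proof -
 have mf: "diag a (en i) \<in> borel_measurable M" for i using HC_measurable[OF diag_HC[OF a en_HC]] by simp
 have "(\<Sum>i. ennreal ((nrm M (diag a (en i)))^2)) = (\<Sum>i. \<integral>\<^sup>+z. ennreal ((cmod (diag a (en i) z))^2) \<partial>M)"
  by (simp only: nrm_nn_integral[OF diag_HC[OF a en_HC]])
 also have "\<dots> = (\<integral>\<^sup>+z. (\<Sum>i. ennreal ((cmod (diag a (en i) z))^2)) \<partial>M)"
  by (rule nn_integral_suminf[symmetric]) (use mf in measurable)
 also have "\<dots> = (\<integral>\<^sup>+z. (\<Sum>k. ennreal ((cmod (a k))^2 * (ck k * ((norm z)^2) ^ k))) \<partial>M)"
 proof (rule nn_integral_cong_AE)
  show "AE z in M. (\<Sum>i. ennreal ((cmod (diag a (en i) z))^2)) = (\<Sum>k. ennreal ((cmod (a k))^2 * (ck k * ((norm z)^2) ^ k)))"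
   using AE_M_ball
  proof eventually_elim
   case (elim z)
   define v where "v = diag (\<lambda>k. cnj (a k)) (Kw z)"
   have v: "v \<in> HC" unfolding v_def by (intro diag_HC bdd_cnj a Kw_HC elim)
   have "cmod (diag a (en i) z) = cmod (ip M v (en i))" for i
   proof -
    have "diag a (en i) z = ip M (diag a (en i)) (Kw z)" by (rule reproducing[OF elim diag_HC[OF a en_HC], symmetric])
    also have "\<dots> = ip M (en i) v" unfolding v_def by (rule ip_diag[OF a en_HC Kw_HC[OF elim]])
    also have "\<dots> = cnj (ip M v (en i))" by (simp add: cnj_ip)
    finally show ?thesis by simp
   qed
   hence 1: "(\<lambda>i. (cmod (diag a (en i) z))^2) sums (nrm M v)^2" using onb_expansion(3)[OF v] by simp
   have 2: "(\<lambda>k. (cmod (a k))^2 * (ck k * ((norm z)^2) ^ k)) sums (nrm M v)^2"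
    using diag_props(3)[OF bdd_cnj[OF a] Kw_HC[OF elim]]
    by (simp only: v_def[symmetric] complex_mod_cnj Pk_Kw[OF elim] nrm_Kmono[OF elim])
   have nn: "(cmod (a k))^2 * (ck k * ((norm z)^2) ^ k) \<ge> 0" for k
    using ck_pos[of k] by (intro mult_nonneg_nonneg zero_le_power zero_le_power2) auto
   show ?case unfolding suminf_ennreal_eq[OF nn 2] by (rule suminf_ennreal_eq[OF _ 1]) simp
  qed
 qed
 also have "\<dots> = (\<Sum>k. \<integral>\<^sup>+z. ennreal ((cmod (a k))^2 * (ck k * ((norm z)^2) ^ k)) \<partial>M)"
  by (rule nn_integral_suminf) measurable
 also have "\<dots> = (\<Sum>k. ennreal ((cmod (a k))^2 * dd k))"
 proof (rule suminf_cong)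
  fix k
  have "(\<integral>\<^sup>+z. ennreal ((cmod (a k))^2 * (ck k * ((norm z)^2) ^ k)) \<partial>M) = ennreal (LINT z|M. (cmod (a k))^2 * (ck k * ((norm z)^2) ^ k))"
  proof (rule nn_integral_eq_integral)
   show "integrable M (\<lambda>z. (cmod (a k))^2 * (ck k * ((norm z)^2) ^ k))" by (intro integrable_mult_right integral_M_power(1))
   show "AE z in M. 0 \<le> (cmod (a k))^2 * (ck k * ((norm z)^2) ^ k)"
    by (intro AE_I2 mult_nonneg_nonneg zero_le_power zero_le_power2 less_imp_le[OF ck_pos])
  qed
  also have "(LINT z|M. (cmod (a k))^2 * (ck k * ((norm z)^2) ^ k)) = (cmod (a k))^2 * dd k"
   unfolding integral_mult_right_zero integral_M_power(2) ..
  finally show "(\<integral>\<^sup>+z. ennreal ((cmod (a k))^2 * (ck k * ((norm z)^2) ^ k)) \<partial>M) = ennreal ((cmod (a k))^2 * dd k)" .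
 qed
 finally show ?thesis .
qed

lemma diag_zero: "diag a (\<lambda>z. 0) = (\<lambda>z. 0)"
proof -
 have "Pk k (\<lambda>z. 0) = (\<lambda>z. 0)" for k by (auto simp: Pk_def ip_zero)
 thus ?thesis by (simp add: diag_def[abs_def])
qed

lemma HS_sums:
 assumes a: "bdd a"
 shows "((\<lambda>e. (nrm M (diag a e))^2) has_sum s) E \<longleftrightarrow> (\<lambda>k. (cmod (a k))^2 * dd k) sums s"
proof -
 have "((\<lambda>e. (nrm M (diag a e))^2) has_sum s) E \<longleftrightarrow> ((\<lambda>i. (nrm M (diag a (en i)))^2) has_sum s) UNIV"
  by (rule has_sum_onb) (simp add: diag_zero nrm_zero)
 also have "\<dots> \<longleftrightarrow> (\<lambda>i. (nrm M (diag a (en i)))^2) sums s"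
  by (rule iffI, erule has_sum_imp_sums) (auto intro!: norm_summable_imp_has_sum dest: sums_summable)
 also have "\<dots> \<longleftrightarrow> (\<lambda>k. (cmod (a k))^2 * dd k) sums s"
  by (subst (1 2) sums_suminf_ennreal) (use HS_norm_ennreal[OF a] dd_pos in \<open>auto intro!: mult_nonneg_nonneg simp: less_imp_le\<close>)
 finally show ?thesis .
qed

definition sqsum :: "(nat \<Rightarrow> complex) \<Rightarrow> bool" where "sqsum a \<longleftrightarrow> summable (\<lambda>k. (cmod (a k))^2 * dd k)"

lemma sqsum_bdd: assumes "sqsum a" shows "bdd a"
proof -
 let ?s = "\<Sum>k. (cmod (a k))^2 * dd k"
 have "cmod (a k) \<le> sqrt ?s" for k
 proof -
  have "(cmod (a k))^2 * 1 \<le> (cmod (a k))^2 * dd k" using hdim_ge_1[OF Npos] by (intro mult_left_mono) auto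
  also have "\<dots> = (\<Sum>j\<in>{k}. (cmod (a j))^2 * dd j)" by simp
  also have "\<dots> \<le> ?s"
   by (rule sum_le_suminf) (use assms dd_pos in \<open>auto simp: sqsum_def less_imp_le\<close>)
  finally show ?thesis by (simp add: real_le_rsqrt)
 qed
 thus ?thesis by (auto simp: bdd_def)
qed

lemma sqsum_add: assumes "sqsum a" "sqsum b" shows "sqsum (\<lambda>k. a k + b k)"
 unfolding sqsum_def
proof (rule summable_comparison_test')
 show "summable (\<lambda>k. 2 * ((cmod (a k))^2 * dd k) + 2 * ((cmod (b k))^2 * dd k))"
  using assms unfolding sqsum_def by (intro summable_add summable_mult)
 fix k :: nat assume "k \<ge> 0"
 have "(cmod (a k + b k))^2 \<le> (cmod (a k) + cmod (b k))^2" by (intro power_mono norm_triangle_ineq) auto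
 also have "\<dots> \<le> 2 * (cmod (a k))^2 + 2 * (cmod (b k))^2"
  using zero_le_power2[of "cmod (a k) - cmod (b k)"] unfolding power2_diff power2_sum by linarith
 finally have "(cmod (a k + b k))^2 * dd k \<le> (2 * (cmod (a k))^2 + 2 * (cmod (b k))^2) * dd k"
  using dd_pos[of k] by (intro mult_right_mono) auto
 thus "norm ((cmod (a k + b k))^2 * dd k) \<le> 2 * ((cmod (a k))^2 * dd k) + 2 * ((cmod (b k))^2 * dd k)"
  using dd_pos[of k] by (simp add: algebra_simps)
qed

lemma sqsum_scale: "sqsum a \<Longrightarrow> sqsum (\<lambda>k. c * a k)"
 unfolding sqsum_def by (simp add: norm_mult power_mult_distrib mult.assoc summable_mult)

lemma trace_inner:
 assumes a: "sqsum a" and b: "sqsum b"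
 obtains s where "((\<lambda>e. ip M (diag a e) (diag b e)) has_sum s) E" "(\<lambda>k. a k * cnj (b k) * of_real (dd k)) sums s"
proof -
 note ba = sqsum_bdd[OF a] and bb = sqsum_bdd[OF b]
 define ab where "ab c k = a k + c * b k" for c k
 have ss: "sqsum (ab c)" for c unfolding ab_def[abs_def] by (intro sqsum_add sqsum_scale a b)
 define S where "S c = (\<Sum>k. (cmod (ab c k))^2 * dd k)" for c
 have 1: "(\<lambda>k. complex_of_real ((cmod (ab c k))^2 * dd k)) sums of_real (S c)" for c
  using ss[of c] unfolding S_def sqsum_def by (intro sums_of_real summable_sums)
 have "(\<lambda>k. (cmod (ab c k))^2 * dd k) sums S c" for c using ss[of c] unfolding S_def sqsum_def by (rule summable_sums)
 hence "((\<lambda>e. (nrm M (diag (ab c) e))^2) has_sum S c) E" for c using HS_sums[OF sqsum_bdd[OF ss]] by blast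
 hence 2: "((\<lambda>e. complex_of_real ((nrm M (diag (ab c) e))^2)) has_sum of_real (S c)) E" for c by (rule has_sum_of_real)
 have d: "diag (ab c) e = (\<lambda>z. diag a e z + c * diag b e z)" if "e \<in> E" for c e
  unfolding ab_def[abs_def] using diag_add[OF ba sqsum_bdd[OF sqsum_scale[OF b, of c]] E_HC[OF that]] diag_scale[OF bb E_HC[OF that], of c] by simp
 define s where "s = (1 / 4) * of_real (S 1) + (- (1 / 4)) * of_real (S (-1)) + (\<i> / 4) * of_real (S \<i>) + (- (\<i> / 4)) * of_real (S (- \<i>))"
 have "((\<lambda>e. (1 / 4) * complex_of_real ((nrm M (diag (ab 1) e))^2) + (- (1 / 4)) * of_real ((nrm M (diag (ab (-1)) e))^2)
   + (\<i> / 4) * of_real ((nrm M (diag (ab \<i>) e))^2) + (- (\<i> / 4)) * of_real ((nrm M (diag (ab (- \<i>)) e))^2)) has_sum s) E"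
  unfolding s_def by (intro has_sum_add has_sum_cmult_right 2)
 also have "?this \<longleftrightarrow> ((\<lambda>e. ip M (diag a e) (diag b e)) has_sum s) E"
  by (rule has_sum_cong) (simp only: d nrm_polarization[OF HC_L2[OF diag_HC[OF ba E_HC]] HC_L2[OF diag_HC[OF bb E_HC]]])
 finally have t: "((\<lambda>e. ip M (diag a e) (diag b e)) has_sum s) E" .
 have "(\<lambda>k. (1 / 4) * complex_of_real ((cmod (ab 1 k))^2 * dd k) + (- (1 / 4)) * of_real ((cmod (ab (-1) k))^2 * dd k)
   + (\<i> / 4) * of_real ((cmod (ab \<i> k))^2 * dd k) + (- (\<i> / 4)) * of_real ((cmod (ab (- \<i>) k))^2 * dd k)) sums s"
  unfolding s_def by (intro sums_add sums_mult 1)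
 moreover have "(1 / 4) * complex_of_real ((cmod (ab 1 k))^2 * dd k) + (- (1 / 4)) * of_real ((cmod (ab (-1) k))^2 * dd k)
   + (\<i> / 4) * of_real ((cmod (ab \<i> k))^2 * dd k) + (- (\<i> / 4)) * of_real ((cmod (ab (- \<i>) k))^2 * dd k) = a k * cnj (b k) * of_real (dd k)" for k
  unfolding polarization_complex[of "a k" "b k"] ab_def of_real_mult distrib_right by (simp only: mult.assoc)
 ultimately have "(\<lambda>k. a k * cnj (b k) * of_real (dd k)) sums s" by simp
 thus thesis using t that by blast
qed

definition abssum :: "(nat \<Rightarrow> complex) \<Rightarrow> bool" where "abssum a \<longleftrightarrow> bdd a \<and> summable (\<lambda>k. cmod (a k) * dd k)"

lemma abssum_sqsum: assumes "abssum a" shows "sqsum a"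
proof -
 obtain C where C: "C \<ge> 0" "\<And>k. cmod (a k) \<le> C" by (rule bdd_obtain[of a]; (rule that)?) (use assms in \<open>simp_all add: abssum_def\<close>)
 show ?thesis unfolding sqsum_def
 proof (rule summable_comparison_test'[OF summable_mult[of _ C]])
  show "summable (\<lambda>k. cmod (a k) * dd k)" using assms by (simp add: abssum_def)
  fix k assume "k \<ge> (0::nat)"
  have "cmod (a k) * (cmod (a k) * dd k) \<le> C * (cmod (a k) * dd k)"
   using dd_pos[of k] by (intro mult_right_mono C) (auto intro!: mult_nonneg_nonneg)
  thus "norm ((cmod (a k))^2 * dd k) \<le> C * (cmod (a k) * dd k)"
   using dd_pos[of k] by (simp add: power2_eq_square mult.assoc)
 qed
qed

text \<open>Write c = x cnj(y) with |x|^2 = |y|^2 = |c|, both square summable against d_k. Then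
  <diag c e, e> = <diag x e, diag y e>, and \<open>trace_inner\<close> applies.\<close>

lemma trace_diag:
 assumes c: "abssum c"
 shows "((\<lambda>e. ip M (diag c e) e) has_sum (\<Sum>k. c k * of_real (dd k))) E" "summable (\<lambda>k. c k * of_real (dd k))"
proof -
 define x where "x k = complex_of_real (sqrt (cmod (c k)))" for k
 define y where "y k = x k * cnj (sgn (c k))" for k
 have nx: "(cmod (x k))^2 = cmod (c k)" for k by (simp add: x_def)
 have ny: "(cmod (y k))^2 = cmod (c k)" for k by (simp add: y_def norm_mult power_mult_distrib nx norm_sgn)
 have xy: "x k * cnj (y k) = c k" for k
 proof -
  have "x k * cnj (y k) = of_real (cmod (c k)) * sgn (c k)"
   unfolding y_def x_def by (simp add: mult.assoc[symmetric] of_real_mult[symmetric] del: of_real_mult)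
  thus ?thesis by (cases "c k = 0") (simp_all add: sgn_div_norm scaleR_conv_of_real)
 qed
 have s: "sqsum x" "sqsum y" using c by (simp_all add: sqsum_def nx ny abssum_def)
 obtain S where S: "((\<lambda>e. ip M (diag x e) (diag y e)) has_sum S) E" "(\<lambda>k. x k * cnj (y k) * of_real (dd k)) sums S"
  by (rule trace_inner[OF s]; rule that)
 have "((\<lambda>e. ip M (diag x e) (diag y e)) has_sum S) E \<longleftrightarrow> ((\<lambda>e. ip M (diag c e) e) has_sum S) E"
  by (rule has_sum_cong) (simp add: ip_diag_diag sqsum_bdd s E_HC xy)
 thus "((\<lambda>e. ip M (diag c e) e) has_sum (\<Sum>k. c k * of_real (dd k))) E" "summable (\<lambda>k. c k * of_real (dd k))"
  using S by (auto simp: xy sums_iff)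
qed

section \<open>Radial operators as diagonal operators, and the trace class condition\<close>

lemma adjoint_rep:
 assumes x: "x \<in> SU_n1" and f: "f \<in> HC" shows "adjoint_op BH (rep x) f = rep (matrix_inv x) f"
 unfolding adjoint_op_def
proof (rule some_equality)
 have r: "rep (matrix_inv x) f \<in> HC" by (rule rep_HC_ip(1)[OF SU_inverse(1)[OF x] f f])
 thus "rep (matrix_inv x) f \<in> HC \<and> (\<forall>h\<in>HC. ips_inner BH (rep x h) f = ips_inner BH h (rep (matrix_inv x) f))"
  using rep_adjoint[OF x _ f] by (simp add: ips_inner_H)
 fix u assume "u \<in> HC \<and> (\<forall>h\<in>HC. ips_inner BH (rep x h) f = ips_inner BH h u)"
 thus "u = rep (matrix_inv x) f"
  by (intro HC_eqI r) (auto simp: ips_inner_H rep_adjoint[OF x _ f, symmetric])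
qed

lemma translate_op_eq: "x \<in> SU_n1 \<Longrightarrow> f \<in> HC \<Longrightarrow> translate_op \<nu> x A f = rep x (A (rep (matrix_inv x) f))"
 by (simp add: translate_op_def adjoint_rep)

lemma rep_inverse_left: assumes x: "x \<in> SU_n1" and f: "f \<in> HC" shows "rep (matrix_inv x) (rep x f) = f"
proof (rule HC_eqI)
 show "rep (matrix_inv x) (rep x f) \<in> HC"
  by (rule rep_HC_ip(1)[OF SU_inverse(1)[OF x] rep_HC_ip(1)[OF x f f] f])
 fix h assume h: "h \<in> HC"
 show "ip M h (rep (matrix_inv x) (rep x f)) = ip M h f"
  using rep_adjoint[OF x h rep_HC_ip(1)[OF x f f]] rep_HC_ip(2)[OF x h f] by simp
qed (rule f)

lemma linear_op_H:
 assumes "linear_op BH BH A"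
 shows "f \<in> HC \<Longrightarrow> A f \<in> HC" "f \<in> HC \<Longrightarrow> g \<in> HC \<Longrightarrow> A (\<lambda>z. f z + g z) = (\<lambda>z. A f z + A g z)"
  "f \<in> HC \<Longrightarrow> A (\<lambda>z. c * f z) = (\<lambda>z. c * A f z)"
proof -
 show 1: "f \<in> HC \<Longrightarrow> A f \<in> HC" for f using assms by (simp add: linear_op_def)
 show "f \<in> HC \<Longrightarrow> g \<in> HC \<Longrightarrow> A (\<lambda>z. f z + g z) = (\<lambda>z. A f z + A g z)"
  using assms ips_eq_H[OF 1[OF HC_add[of f g]] HC_add[OF 1[of f] 1[of g]]] by (simp add: linear_op_def ips_add_H)
 show "f \<in> HC \<Longrightarrow> A (\<lambda>z. c * f z) = (\<lambda>z. c * A f z)"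
  using assms ips_eq_H[OF 1[OF HC_scale[of f c]] HC_scale[OF 1[of f], of c]] by (simp add: linear_op_def ips_scale_H)
qed

lemma bounded_op_diag: assumes a: "bdd a" shows "bounded_op BH (diag a)"
proof -
 obtain C where C: "C \<ge> 0" "\<And>k. cmod (a k) \<le> C" by (rule bdd_obtain[OF a]; rule that)
 have add: "diag a (\<lambda>z. f z + g z) = (\<lambda>z. diag a f z + diag a g z)" if f: "f \<in> HC" and g: "g \<in> HC" for f g
  by (rule sym, rule diag_unique, intro HC_add diag_HC a f g)
   (use Pk_diag[OF a] f g in \<open>simp add: ip_add_left HC_L2 diag_HC a Kmono_HC ip_Pk_Kmono ring_distribs\<close>)
 have scale: "diag a (\<lambda>z. c * f z) = (\<lambda>z. c * diag a f z)" if f: "f \<in> HC" for f c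
  by (rule sym, rule diag_unique, intro HC_scale diag_HC a f)
   (use Pk_diag[OF a] f in \<open>simp add: ip_scale_left HC_L2 diag_HC a Kmono_HC ip_Pk_Kmono\<close>)
 have refl: "ips_eq BH f f" if "f \<in> HC" for f using ips_eq_H[OF that that] by simp
 have "nrm M (diag a f) \<le> C * nrm M f" if "f \<in> HC" for f by (rule nrm_diag_le[OF that C(2)])
 thus ?thesis
  unfolding bounded_op_def linear_op_def ips_add_H ips_scale_H ips_norm_H
  by (auto simp: add scale intro!: diag_HC a refl HC_add HC_scale)
qed

lemma radial_op_diag: assumes a: "bdd a" shows "radial_op \<nu> (diag a)"
 unfolding radial_op_def
proof (intro ballI)
 fix g :: "'n gmat" and f assume g: "g \<in> stab0" and f: "f \<in> HC"
 show "translate_op \<nu> g (diag a) f = diag a f"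
  unfolding translate_op_eq[OF stab0_SU[OF g] f] diag_rep[OF a f stab0_inverse[OF g]]
  by (rule rep_inverse[OF stab0_SU[OF g] diag_HC[OF a f]])
qed

text \<open>Radiality says that A commutes with \<open>rep g\<close> for g in the stabilizer of 0,
  so \<open>radial_form\<close> applies to the form <A f, y>.\<close>

lemma radial_bounded_diag:
 assumes A: "bounded_op BH A" and r: "radial_op \<nu> A"
 obtains a where "bdd a" "\<And>f. f \<in> HC \<Longrightarrow> A f = diag a f"
proof -
 have lin: "linear_op BH BH A" using A by (simp add: bounded_op_def)
 note L = linear_op_H[OF lin]
 obtain C where C: "\<And>f. f \<in> HC \<Longrightarrow> nrm M (A f) \<le> C * nrm M f" using A unfolding bounded_op_def ips_norm_H by blast
 obtain a where a: "bdd a" "\<And>f y. f \<in> HC \<Longrightarrow> y \<in> HC \<Longrightarrow> ip M (A f) y = ip M (diag a f) y"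
  "\<And>k f z. f \<in> HC \<Longrightarrow> norm z < 1 \<Longrightarrow> ip M (A f) (Kmono k z) = a k * Pk k f z"
 proof (rule radial_form[of "\<lambda>f y. ip M (A f) y" C])
  fix f y assume f: "f \<in> HC" and y: "y \<in> HC"
  have "cmod (ip M (A f) y) \<le> nrm M (A f) * nrm M y" by (rule H_CS[OF L(1)[OF f] y])
  also have "\<dots> \<le> C * nrm M f * nrm M y" by (intro mult_right_mono C f) simp
  finally show "cmod (ip M (A f) y) \<le> C * nrm M f * nrm M y" .
 next
  fix g :: "'n gmat" and f y assume g: "g \<in> stab0" and f: "f \<in> HC" and y: "y \<in> HC"
  note SU = stab0_SU[OF g]
  have rf: "rep g f \<in> HC" by (rule rep_HC_ip(1)[OF SU f f])
  have "A (rep g f) = translate_op \<nu> g A (rep g f)" using r g rf by (simp add: radial_op_def)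
  also have "\<dots> = rep g (A f)" by (simp add: translate_op_eq[OF SU rf] rep_inverse_left[OF SU f])
  finally show "ip M (A (rep g f)) (rep g y) = ip M (A f) y" using rep_HC_ip(2)[OF SU L(1)[OF f] y] by simp
 next
  fix a :: "nat \<Rightarrow> complex" assume "bdd a" "\<And>f y. f \<in> HC \<Longrightarrow> y \<in> HC \<Longrightarrow> ip M (A f) y = ip M (diag a f) y"
   "\<And>k f z. f \<in> HC \<Longrightarrow> norm z < 1 \<Longrightarrow> ip M (A f) (Kmono k z) = a k * Pk k f z"
  thus thesis by (rule that)
 qed (auto simp: L ip_add_left ip_add_right ip_scale_left ip_scale_right HC_L2)
 have "A f = diag a f" if f: "f \<in> HC" for f
  by (rule diag_unique[OF L(1)[OF f]]) (simp add: a(3)[OF f] Pk_def)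
 thus thesis by (rule that[OF a(1)])
qed

lemma diag_inject:
 assumes "\<And>f. f \<in> HC \<Longrightarrow> diag a f = diag b f" shows "a = b"
proof
 fix k
 obtain w0 :: "complex^'n" where w0: "norm w0 = 1 / 2" using vector_choose_size[of "1/2"] by auto
 have w1: "norm w0 < 1" using w0 by simp
 have e: "diag a (Kmono k w0) w0 = a k * Kmono k w0 w0" for a
  using suminf_finite[of "{k}" "\<lambda>j. a j * Pk j (Kmono k w0) w0"] by (simp add: diag_def Pk_Kmono[OF w1])
 have "w0 \<noteq> 0" using w0 by auto
 hence "Kmono k w0 w0 \<noteq> 0" using w1 poch_pos[of k] by (simp add: Kmono_def hprod_self)
 thus "a k = b k" using e[of a] e[of b] assms[OF Kmono_HC[of k w0]] by simp
qed

text \<open>The imaginary part of <R(x + c y), x + c y> vanishes; the choices c = 1 and c = i show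
  that the form of R is Hermitian.\<close>

lemma nonneg_symmetric:
 assumes R: "bounded_op BH R" and pos: "\<And>x. x \<in> HC \<Longrightarrow> ip M (R x) x \<in> nonneg_Reals" and x: "x \<in> HC" and y: "y \<in> HC"
 shows "ip M (R x) y = ip M x (R y)"
proof -
 have "linear_op BH BH R" using R by (simp add: bounded_op_def)
 note L = linear_op_H[OF this]
 have im: "Im (ip M (R x) x) = 0" if "x \<in> HC" for x using pos[OF that] by (simp add: complex_nonneg_Reals_iff)
 have s: "Im (cnj c * ip M (R x) y + c * ip M (R y) x) = 0" for c
 proof -
  have cy: "(\<lambda>z. c * y z) \<in> HC" by (rule HC_scale[OF y])
  note h = HC_L2[OF x] HC_L2[OF cy] HC_L2[OF HC_add[OF x cy]] HC_L2[OF L(1)[OF x]] HC_L2[OF L(1)[OF cy]]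
  have "ip M (R (\<lambda>z. x z + c * y z)) (\<lambda>z. x z + c * y z) =
    ip M (R x) x + cnj c * ip M (R x) y + (c * ip M (R y) x + c * (cnj c * ip M (R y) y))"
   unfolding L(2)[OF x cy] ip_add_left[OF h(4,5,3)] ip_add_right[OF h(1,2,4)] ip_add_right[OF h(1,2,5)]
   unfolding L(3)[OF y] ip_scale_left ip_scale_right by (simp add: algebra_simps)
  moreover have "Im (c * (cnj c * ip M (R y) y)) = 0"
   unfolding mult.assoc[symmetric] complex_norm_square[symmetric] using im[OF y] by simp
  ultimately show ?thesis using im[OF HC_add[OF x cy]] im[OF x] by simp
 qed
 have "ip M (R x) y = cnj (ip M (R y) x)" using s[of 1] s[of \<i>] by (simp add: complex_eq_iff)
 thus ?thesis by (simp add: cnj_ip)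
qed

text \<open>The absolute value R is given only by positivity and <R x, R y> = <A x, A y>, so its
  eigenvalues have to be found. On f = \<open>Kmono k w\<close> the square of R acts as |a_k|^2,
  hence g = R f - |a_k| f satisfies R g = -|a_k| g and positivity forces g = 0. So R is diagonal
  with entries |a_k|, and its trace is the squared Hilbert-Schmidt norm of the diagonal operator
  with entries sqrt(|a_k|).\<close>

lemma trace_class_diag:
 assumes T: "trace_class BH A" and A: "bdd a" "\<And>f. f \<in> HC \<Longrightarrow> A f = diag a f"
 shows "abssum a"
proof -
 obtain R where R: "bounded_op BH R" "\<And>x. x \<in> HC \<Longrightarrow> ip M (R x) x \<in> nonneg_Reals"
  "\<And>x y. x \<in> HC \<Longrightarrow> y \<in> HC \<Longrightarrow> ip M (R x) (R y) = ip M (A x) (A y)" "(\<lambda>e. ip M (R e) e) summable_on E"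
  using T unfolding trace_class_def ips_inner_H E_def by blast
 have lin: "linear_op BH BH R" using R(1) by (simp add: bounded_op_def)
 note L = linear_op_H[OF lin]
 have R_sym: "ip M (R x) y = ip M x (R y)" if "x \<in> HC" "y \<in> HC" for x y
  by (rule nonneg_symmetric[OF R(1) _ that]) (rule R(2))
 define \<rho> where "\<rho> k = complex_of_real (cmod (a k))" for k
 define \<sigma> where "\<sigma> k = complex_of_real (sqrt (cmod (a k)))" for k
 have RK: "R (Kmono k w) = (\<lambda>z. \<rho> k * Kmono k w z)" if w: "norm w < 1" for k w
 proof -
  let ?f = "Kmono k w"
  have f: "?f \<in> HC" by (rule Kmono_HC)
  define g where "g z = R ?f z - \<rho> k * ?f z" for z
  have g: "g \<in> HC" unfolding g_def[abs_def] by (intro HC_diff HC_scale L f)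
  have Af: "A ?f = (\<lambda>z. a k * ?f z)"
   unfolding A(2)[OF f]
  proof (rule sym, rule diag_unique)
   show "(\<lambda>z. a k * ?f z) \<in> HC" by (rule HC_scale[OF f])
   fix j and z :: "complex^'n" assume "norm z < 1"
   thus "ip M (\<lambda>z. a k * ?f z) (Kmono j z) = a j * ip M ?f (Kmono j z)" by (simp add: ip_scale_left ip_Kmono)
  qed
  have "R (R ?f) = (\<lambda>z. \<rho> k * \<rho> k * ?f z)"
  proof (rule HC_eqI[OF L(1)[OF L(1)[OF f]] HC_scale[OF f]])
   fix h assume h: "h \<in> HC"
   have "ip M h (R (R ?f)) = ip M (A h) (A ?f)" using R_sym[OF h L(1)[OF f]] R(3)[OF h f] by simp
   also have "\<dots> = cnj (a k) * ip M (diag a h) (Kmono k w)" by (simp add: Af ip_scale_right A(2) h)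
   also have "ip M (diag a h) (Kmono k w) = a k * ip M h (Kmono k w)"
    using Pk_diag[OF A(1) h, of k] w by (simp add: ip_Pk_Kmono diag_HC A h)
   also have "cnj (a k) * (a k * ip M h (Kmono k w)) = ip M h (\<lambda>z. \<rho> k * \<rho> k * ?f z)"
    unfolding ip_scale_right by (simp add: \<rho>_def complex_norm_square[symmetric] power2_eq_square[symmetric] mult.assoc[symmetric] mult.commute[of "cnj (a k)"])
   finally show "ip M h (R (R ?f)) = ip M h (\<lambda>z. \<rho> k * \<rho> k * ?f z)" .
  qed
  moreover have "R g = (\<lambda>z. R (R ?f) z + (- \<rho> k) * R ?f z)"
  proof -
   have "g = (\<lambda>z. R ?f z + (- \<rho> k) * ?f z)" by (simp add: g_def fun_eq_iff)
   thus ?thesis using L(2)[OF L(1)[OF f] HC_scale[OF f, of "- \<rho> k"]] L(3)[OF f, of "- \<rho> k"] by simp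
  qed
  ultimately have Rg: "R g = (\<lambda>z. - \<rho> k * g z)" by (simp add: g_def[abs_def] algebra_simps)
  have "ip M (R g) g = - of_real (cmod (a k) * (nrm M g)^2)" unfolding Rg ip_scale_left ip_self by (simp add: \<rho>_def)
  hence z: "cmod (a k) * (nrm M g)^2 \<le> 0" using R(2)[OF g] by (simp add: complex_nonneg_Reals_iff)
  \<comment> \<open>For a_k = 0 the positivity argument gives nothing; then g = R f, whose norm is
    that of A f = 0.\<close>
  have "nrm M g = 0"
  proof (cases "a k = 0")
   case True
   have "ip M (R ?f) (R ?f) = 0" using R(3)[OF f f] True by (simp add: Af ip_zero)
   hence "nrm M (R ?f) = 0" by (simp add: ip_self)
   moreover have "g = R ?f" by (simp add: g_def[abs_def] \<rho>_def True)
   ultimately show ?thesis by simp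
  next
   case False
   hence "(nrm M g)^2 \<le> 0" using z by (simp add: mult_le_0_iff)
   thus ?thesis by simp
  qed
  thus ?thesis using HC_norm_zero[OF g] by (simp add: g_def fun_eq_iff)
 qed
 obtain C where C: "C \<ge> 0" "\<And>k. cmod (a k) \<le> C" by (rule bdd_obtain[OF A(1)]; rule that)
 have "bdd \<rho>" unfolding bdd_def \<rho>_def by (intro exI[of _ C]) (simp add: C)
 moreover have "bdd \<sigma>" unfolding bdd_def \<sigma>_def by (intro exI[of _ "sqrt C"]) (simp add: C)
 ultimately have br: "bdd \<rho>" "bdd \<sigma>" .
 have Rd: "R f = diag \<rho> f" if f: "f \<in> HC" for f
 proof (rule diag_unique[OF L(1)[OF f]])
  fix k and z :: "complex^'n" assume z: "norm z < 1"
  show "ip M (R f) (Kmono k z) = \<rho> k * ip M f (Kmono k z)"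
   unfolding R_sym[OF f Kmono_HC] RK[OF z] ip_scale_right by (simp add: \<rho>_def)
 qed
 have "ip M (R e) e = of_real ((nrm M (diag \<sigma> e))^2)" if "e \<in> E" for e
  unfolding ip_self[symmetric] ip_diag_diag[OF br(2) br(2) E_HC[OF that]] Rd[OF E_HC[OF that]]
  by (simp add: \<sigma>_def \<rho>_def[abs_def] of_real_mult[symmetric] del: of_real_mult)
 hence "(\<lambda>e. complex_of_real ((nrm M (diag \<sigma> e))^2)) summable_on E" using R(4) by (simp cong: summable_on_cong)
 hence "(\<lambda>e. Re (complex_of_real ((nrm M (diag \<sigma> e))^2))) summable_on E" by (rule summable_on_Re)
 hence "(\<lambda>e. (nrm M (diag \<sigma> e))^2) summable_on E" by (simp only: Re_complex_of_real)
 then obtain s where "((\<lambda>e. (nrm M (diag \<sigma> e))^2) has_sum s) E" by (auto simp: summable_on_def)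
 hence "summable (\<lambda>k. (cmod (\<sigma> k))^2 * dd k)" using HS_sums[OF br(2)] sums_summable by blast
 thus ?thesis using A(1) by (simp add: abssum_def \<sigma>_def)
qed

section \<open>The Fourier transform of operators\<close>

lemma ip_weight_bounded:
 assumes p: "p \<in> borel_measurable borel" "\<And>z. norm z < 1 \<Longrightarrow> cmod (p z) \<le> C" and f: "f \<in> HC" and y: "y \<in> HC"
 shows "integrable M (\<lambda>z. p z * f z * cnj (y z))" "cmod (LINT z|M. p z * f z * cnj (y z)) \<le> C * nrm M f * nrm M y"
proof -
 have C: "C \<ge> 0" using p(2)[of 0] norm_ge_zero[of "p 0"] by (simp del: norm_ge_zero)
 have m: "(\<lambda>z. p z * f z * cnj (y z)) \<in> borel_measurable M"
  using p(1) HC_measurable[OF f] HC_measurable[OF y] by measurable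
 have i: "integrable M (\<lambda>z. C * (cmod (f z) * cmod (y z)))"
  using L2_norm_mult_integrable[OF HC_L2[OF f] HC_L2[OF y]] by simp
 have b: "AE z in M. norm (p z * f z * cnj (y z)) \<le> C * (cmod (f z) * cmod (y z))"
  using AE_M_ball
 proof eventually_elim
  case (elim z)
  have "cmod (p z) * (cmod (f z) * cmod (y z)) \<le> C * (cmod (f z) * cmod (y z))" by (intro mult_right_mono p elim) simp
  thus ?case by (simp add: norm_mult mult.assoc)
 qed
 show int: "integrable M (\<lambda>z. p z * f z * cnj (y z))"
  by (rule Bochner_Integration.integrable_bound[OF i m]) (use b in eventually_elim, simp)
 have "cmod (LINT z|M. p z * f z * cnj (y z)) \<le> (LINT z|M. norm (p z * f z * cnj (y z)))" by (rule integral_norm_bound)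
 also have "\<dots> \<le> (LINT z|M. C * (cmod (f z) * cmod (y z)))" by (rule integral_mono_AE[OF integrable_norm[OF int] i b])
 also have "\<dots> \<le> C * (nrm M f * nrm M y)"
  using mult_left_mono[OF L2_norm_CS[OF HC_L2[OF f] HC_L2[OF y]] C] by simp
 finally show "cmod (LINT z|M. p z * f z * cnj (y z)) \<le> C * nrm M f * nrm M y" by (simp add: mult.assoc)
qed

lemma h_hat_positive: "hb l > 0" using h_hat_pos[OF nuC, of l] by (simp add: NC)

abbreviation "sf l z \<equiv> spherical_fun (complex_of_real l) (z :: complex^'n)"

lemma sf_act: "k \<in> stab0 \<Longrightarrow> norm z < 1 \<Longrightarrow> sf l (act k z) = sf l z"
 by (simp add: spherical_fun_def stab0_norm)

text \<open>The form of the Toeplitz operator whose symbol is the spherical function. The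
  convolution of the spherical function with P_0 is \<open>W\<close> times this operator, because
  the Bergman measure has the density (1 - |z|^2)^\<nu> / W against \<open>iota\<close>. As a form
  it can be passed directly to \<open>radial_form\<close>.\<close>

definition TS :: "real \<Rightarrow> (complex^'n \<Rightarrow> complex) \<Rightarrow> (complex^'n \<Rightarrow> complex) \<Rightarrow> complex" where
 "TS l f y = (LINT z|M. sf l z * f z * cnj (y z))"

lemma TS_diag:
 obtains t where "bdd t" "\<And>f y. f \<in> HC \<Longrightarrow> y \<in> HC \<Longrightarrow> TS l f y = ip M (diag t f) y"
  "\<And>k f z. f \<in> HC \<Longrightarrow> norm z < 1 \<Longrightarrow> TS l f (Kmono k z) = t k * Pk k f z"
proof -
 obtain C where C: "C \<ge> 0" "\<And>z::complex^'n. norm z < 1 \<Longrightarrow> cmod (sf l z) \<le> C"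
  by (rule spherical_fun_bounded; rule that)
 have m: "(\<lambda>z. sf l z) \<in> borel_measurable borel" by measurable
 note B = ip_weight_bounded[OF m C(2)]
 show thesis
 proof (rule radial_form[of "TS l" C])
  fix f g y assume h: "f \<in> HC" "g \<in> HC" "y \<in> HC"
  have "TS l (\<lambda>z. f z + g z) y = (LINT z|M. sf l z * f z * cnj (y z) + sf l z * g z * cnj (y z))"
   unfolding TS_def by (intro Bochner_Integration.integral_cong) (simp_all add: algebra_simps)
  thus "TS l (\<lambda>z. f z + g z) y = TS l f y + TS l g y"
   using Bochner_Integration.integral_add[OF B(1)[OF _ h(1) h(3)] B(1)[OF _ h(2) h(3)]] by (simp add: TS_def)
  have "TS l y (\<lambda>z. f z + g z) = (LINT z|M. sf l z * y z * cnj (f z) + sf l z * y z * cnj (g z))"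
   unfolding TS_def by (intro Bochner_Integration.integral_cong) (simp_all add: algebra_simps)
  thus "TS l y (\<lambda>z. f z + g z) = TS l y f + TS l y g"
   using Bochner_Integration.integral_add[OF B(1)[OF _ h(3) h(1)] B(1)[OF _ h(3) h(2)]] by (simp add: TS_def)
 next
  fix c f y
  show "TS l (\<lambda>z. c * f z) y = c * TS l f y" "TS l y (\<lambda>z. c * f z) = cnj c * TS l y f"
   unfolding TS_def integral_mult_right_zero[symmetric] by (simp_all add: mult_ac)
 next
  fix f y assume "f \<in> HC" "y \<in> HC"
  thus "cmod (TS l f y) \<le> C * nrm M f * nrm M y" unfolding TS_def by (intro B(2))
 next
  fix g :: "'n gmat" and f y assume g: "g \<in> stab0" and f: "f \<in> HC" and y: "y \<in> HC"
  note g' = stab0_inverse[OF g] and SU = stab0_SU[OF g]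
  let ?F = "\<lambda>z. sf l z * f z * cnj (y z)"
  have mF: "?F \<in> borel_measurable borel" using HC_measurable[OF f] HC_measurable[OF y] by measurable
  have "TS l (rep g f) (rep g y) = (LINT z|M. ?F (act (matrix_inv g) z))"
   unfolding TS_def
  proof (rule integral_cong_AE)
   show "AE z in M. sf l z * rep g f z * cnj (rep g y z) = ?F (act (matrix_inv g) z)"
    using AE_M_ball by eventually_elim (simp add: stab0_rep[OF g] sf_act[OF g'])
   show "(\<lambda>z. sf l z * rep g f z * cnj (rep g y z)) \<in> borel_measurable M"
    using HC_measurable[OF rep_HC_ip(1)[OF SU f f]] HC_measurable[OF rep_HC_ip(1)[OF SU y y]] by measurable
   show "(\<lambda>z. ?F (act (matrix_inv g) z)) \<in> borel_measurable M"
    using measurable_compose[OF measurable_act mF, of "matrix_inv g"] by simp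
  qed
  also have "\<dots> = TS l f y" unfolding TS_def by (rule integral_M_stab0(1)[OF g' mF])
  finally show "TS l (rep g f) (rep g y) = TS l f y" .
 next
  fix a :: "nat \<Rightarrow> complex" assume "bdd a" "\<And>f y. f \<in> HC \<Longrightarrow> y \<in> HC \<Longrightarrow> TS l f y = ip M (diag a f) y"
   "\<And>k f z. f \<in> HC \<Longrightarrow> norm z < 1 \<Longrightarrow> TS l f (Kmono k z) = a k * Pk k f z"
  thus thesis by (rule that)
 qed
qed

text \<open>The eigenvalues are found by integrating \<open>TS l (Kmono k w) (Kmono k w)\<close> over \<open>w\<close>.\<close>

lemma TS_eigenvalue:
 assumes t: "\<And>k f z. f \<in> HC \<Longrightarrow> norm z < 1 \<Longrightarrow> TS l f (Kmono k z) = t k * Pk k f z"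
 shows "of_real (W) * t k = of_real (sb k l * hb l)"
proof -
 obtain C where C: "C \<ge> 0" "\<And>z::complex^'n. norm z < 1 \<Longrightarrow> cmod (sf l z) \<le> C"
  by (rule spherical_fun_bounded; rule that)
 interpret M: finite_measure M by (rule finite_M)
 interpret P: pair_sigma_finite M M ..
 interpret PF: finite_measure "M \<Otimes>\<^sub>M M" by (rule finite_measure_pair_measure) (rule finite_M)+
 define B :: "(complex^'n) set" where "B = {z. norm z < 1}"
 have B: "B \<in> sets borel" unfolding B_def by (rule borel_open[OF open_norm_less])
 \<comment> \<open>The squared modulus of \<open>Kmono k w z\<close> times the spherical function in
   z, cut off to the ball in both variables. It is bounded, hence integrable over the finite product
   measure.\<close>
 define G where "G w z = (indicator B w * indicator B z) *\<^sub>R (sf l z * of_real ((ck k * cmod (hprod z w) ^ k)^2))" for w z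
 have Gb: "norm (G w z) \<le> C * (ck k)^2" for w z
 proof (cases "w \<in> B \<and> z \<in> B")
  case True
  hence wz: "norm w < 1" "norm z < 1" by (auto simp: B_def)
  have "cmod (hprod z w) \<le> 1 * 1" using wz by (intro order_trans[OF norm_hprod_le] mult_mono) auto
  hence h: "cmod (hprod z w) ^ k \<le> 1" by (intro power_le_one) auto
  have "ck k * cmod (hprod z w) ^ k \<le> ck k * 1" by (rule mult_left_mono[OF h less_imp_le[OF ck_pos]])
  moreover have "0 \<le> ck k * cmod (hprod z w) ^ k" by (intro mult_nonneg_nonneg less_imp_le[OF ck_pos] zero_le_power norm_ge_zero)
  ultimately have "(ck k * cmod (hprod z w) ^ k)^2 \<le> (ck k)^2" by (intro power_mono) simp_all
  hence "cmod (sf l z) * (ck k * cmod (hprod z w) ^ k)^2 \<le> C * (ck k)^2" by (intro mult_mono C wz) auto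
  thus ?thesis using True unfolding G_def by (simp only: indicator_simps mult_1 scaleR_one norm_mult norm_of_real abs_power2)
 next
  case False
  have "0 \<le> C * (ck k)^2" using C(1) by simp
  thus ?thesis using False unfolding G_def by (auto simp: indicator_def)
 qed
 have nth: "(\<lambda>z::complex^'n. z $ j) \<in> borel_measurable borel" for j
  by (intro borel_measurable_continuous_onI continuous_intros)
 have mG: "case_prod G \<in> borel_measurable (M \<Otimes>\<^sub>M M)"
 proof -
  have s: "sets (M \<Otimes>\<^sub>M M) = sets (borel \<Otimes>\<^sub>M borel :: ((complex^'n) \<times> (complex^'n)) measure)"
   by (intro sets_pair_measure_cong) simp_all
  have h: "(\<lambda>p. hprod (snd p) (fst p :: complex^'n)) \<in> borel_measurable (borel \<Otimes>\<^sub>M borel)"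
   unfolding hprod_def using measurable_compose[OF measurable_fst nth] measurable_compose[OF measurable_snd nth] by measurable
  have "case_prod G = (\<lambda>p. (indicator B (fst p) * indicator B (snd p)) *\<^sub>R (sf l (snd p) * of_real ((ck k * cmod (hprod (snd p) (fst p)) ^ k)^2)))"
   by (auto simp: fun_eq_iff G_def)
  moreover have "\<dots> \<in> borel_measurable (borel \<Otimes>\<^sub>M borel)"
   using h B measurable_compose[OF measurable_snd measurable_spherical_fun[of "of_real l"]] by measurable
  ultimately show ?thesis unfolding measurable_cong_sets[OF s refl] by simp
 qed
 have iG: "integrable (M \<Otimes>\<^sub>M M) (case_prod G)"
  by (rule PF.integrable_const_bound[where B = "C * (ck k)^2"]) (auto simp: Gb mG)
 \<comment> \<open>Integrating over z first gives t_k (\<nu>)_k / k! |w|^(2k), over w first the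
   spherical function times (\<nu>)_k / k! |z|^(2k). The outer integrals are then t_k d_k on one
   side and a multiple of the spherical transform of \<open>wfun \<nu> k\<close> on the
   other.\<close>
 have F: "(LINT z|M. LINT w|M. G w z) = (LINT w|M. LINT z|M. G w z)" by (rule P.Fubini_integral[OF iG])
 have mGw: "G w \<in> borel_measurable M" "(\<lambda>w. G w z) \<in> borel_measurable M" for w z
  using measurable_Pair2[OF mG, of w] measurable_Pair1[OF mG, of z] by simp_all
 have KG: "cmod (Kmono k w z) = ck k * cmod (hprod z w) ^ k" if "norm z < 1" for w z
  using that ck_pos[of k] unfolding Kmono_def by (simp only: if_True norm_mult norm_power norm_of_real)
 have in1: "(LINT z|M. G w z) = t k * of_real (ck k * ((norm w)^2) ^ k)" if w: "norm w < 1" for w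
 proof -
  have "(LINT z|M. G w z) = TS l (Kmono k w) (Kmono k w)"
   unfolding TS_def
  proof (rule integral_cong_AE[OF mGw(1)])
   show "AE z in M. G w z = sf l z * Kmono k w z * cnj (Kmono k w z)"
    using AE_M_ball
   proof eventually_elim
    case (elim z)
    have "Kmono k w z * cnj (Kmono k w z) = of_real ((ck k * cmod (hprod z w) ^ k)^2)"
     unfolding complex_norm_square[symmetric] KG[OF elim] ..
    thus ?case using w elim by (simp add: G_def B_def mult.assoc del: of_real_power of_real_mult)
   qed
   show "(\<lambda>z. sf l z * Kmono k w z * cnj (Kmono k w z)) \<in> borel_measurable M"
    using HC_measurable[OF Kmono_HC] by measurable
  qed
  also have "\<dots> = t k * of_real ((nrm M (Kmono k w))^2)"
   unfolding t[OF Kmono_HC w] ip_self[symmetric] using w by (simp add: Pk_def)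
  finally show ?thesis unfolding nrm_Kmono[OF w] .
 qed
 have in2: "(LINT w|M. G w z) = sf l z * of_real (ck k * ((norm z)^2) ^ k)" if z: "norm z < 1" for z
 proof -
  have "(LINT w|M. G w z) = (LINT w|M. sf l z * of_real ((cmod (Kmono k z w))^2))"
  proof (rule integral_cong_AE[OF mGw(2)])
   show "AE w in M. G w z = sf l z * of_real ((cmod (Kmono k z w))^2)"
    using AE_M_ball
   proof eventually_elim
    case (elim w)
    have "cmod (hprod z w) = cmod (hprod w z)" using complex_mod_cnj[of "hprod z w"] by (simp add: cnj_hprod)
    thus ?case unfolding KG[OF elim] using z elim by (simp add: G_def B_def)
   qed
   show "(\<lambda>w. sf l z * of_real ((cmod (Kmono k z w))^2)) \<in> borel_measurable M"
    using HC_measurable[OF Kmono_HC] by measurable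
  qed
  also have "\<dots> = sf l z * of_real ((nrm M (Kmono k z))^2)"
   unfolding integral_mult_right_zero integral_complex_of_real nrm_sq ..
  finally show ?thesis unfolding nrm_Kmono[OF z] .
 qed
 have mp: "(\<lambda>z::complex^'n. (norm z)\<^sup>2 ^ k) \<in> borel_measurable borel" by measurable
 have "(LINT w|M. LINT z|M. G w z) = (LINT w|M. t k * of_real (ck k * ((norm w)^2) ^ k))"
 proof (rule integral_cong_AE)
  show "AE w in M. (LINT z|M. G w z) = t k * of_real (ck k * ((norm w)^2) ^ k)" using AE_M_ball by eventually_elim (rule in1)
  show "(\<lambda>w. LINT z|M. G w z) \<in> borel_measurable M" using M.borel_measurable_lebesgue_integral[OF mG] by simp
 qed (use mp in measurable)
 also have "\<dots> = t k * of_real (dd k)"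
  unfolding integral_mult_right_zero integral_complex_of_real integral_M_power(2) ..
 finally have r: "(LINT w|M. LINT z|M. G w z) = t k * of_real (dd k)" .
 have "(LINT z|M. LINT w|M. G w z) = (LINT z|M. sf l z * of_real (ck k * ((norm z)^2) ^ k))"
 proof (rule integral_cong_AE)
  show "AE z in M. (LINT w|M. G w z) = sf l z * of_real (ck k * ((norm z)^2) ^ k)" using AE_M_ball by eventually_elim (rule in2)
  have "(\<lambda>(z, w). G w z) \<in> borel_measurable (M \<Otimes>\<^sub>M M)" using measurable_pair_swap[OF mG] by (simp add: case_prod_beta')
  thus "(\<lambda>z. LINT w|M. G w z) \<in> borel_measurable M" by (rule M.borel_measurable_lebesgue_integral)
 qed (use mp in measurable)
 also have "\<dots> = (LINT z|iota. (cnu * wt z) *\<^sub>R (sf l z * of_real (ck k * ((norm z)^2) ^ k)))"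
  by (rule integral_M(1)) (use mp in measurable)
 also have "\<dots> = (LINT z|iota. of_real (cnu * ck k) * (wfun \<nu> k z * sf l z))"
  by (intro Bochner_Integration.integral_cong refl) (simp add: wfun_def wt_def scaleR_conv_of_real mult_ac)
 also have "\<dots> = of_real (cnu * ck k) * spherical_transform (wfun \<nu> k :: complex^'n \<Rightarrow> complex) (of_real l)"
  unfolding integral_mult_right_zero spherical_transform_def ..
 also have "\<dots> = of_real (cnu * ck k * (pochhammer (real N) k / pochhammer \<nu> k * (sb k l * hb l)))"
  unfolding spherical_transform_wfun_eq[OF nuC] NC by (simp only: of_real_mult)
 also have "cnu * ck k * (pochhammer (real N) k / pochhammer \<nu> k * (sb k l * hb l)) = cnu * (dd k * (sb k l * hb l))"
  using poch_pos[of k] by (simp add: hdim_def)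
 finally have "t k * of_real (dd k) = of_real (cnu * (dd k * (sb k l * hb l)))" using F r by simp
 hence "of_real (W) * t k * of_real (dd k) = of_real (W * (cnu * (dd k * (sb k l * hb l))))"
  unfolding of_real_mult[of "W" "_ * _"] by (simp only: mult.assoc)
 also have "W * (cnu * (dd k * (sb k l * hb l))) = (sb k l * hb l) * dd k" using W0 by simp
 finally show ?thesis using dd_pos[of k] by (simp only: of_real_mult mult_right_cancel) simp
qed

lemma TS_iota:
 assumes f: "f \<in> HC" and y: "y \<in> HC"
 shows "has_bochner_integral iota (\<lambda>z. sf l z * (of_real (wt z) * f z * cnj (y z))) (of_real (W) * TS l f y)"
proof -
 obtain C where C: "C \<ge> 0" "\<And>z::complex^'n. norm z < 1 \<Longrightarrow> cmod (sf l z) \<le> C"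
  by (rule spherical_fun_bounded; rule that)
 have m: "(\<lambda>z. sf l z) \<in> borel_measurable borel" by measurable
 let ?g = "\<lambda>z. sf l z * f z * cnj (y z)"
 have mg: "?g \<in> borel_measurable borel" using m HC_measurable[OF f] HC_measurable[OF y] by measurable
 have "has_bochner_integral iota (\<lambda>z. (cnu * wt z) *\<^sub>R ?g z) (TS l f y)"
  using ip_weight_bounded(1)[OF m C(2) f y] unfolding has_bochner_integral_iff integral_M[OF mg] TS_def by simp
 hence "has_bochner_integral iota (\<lambda>z. of_real (W) * ((cnu * wt z) *\<^sub>R ?g z)) (of_real (W) * TS l f y)"
  by (rule has_bochner_integral_mult_right)
 moreover have "of_real (W) * ((cnu * wt z) *\<^sub>R ?g z) = sf l z * (of_real (wt z) * f z * cnj (y z))" for z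
  using W0 by (simp add: scaleR_conv_of_real)
 ultimately show ?thesis by simp
qed

text \<open>The translate of P_0 by x is the rank one operator of the coherent state at x 0. Both
  inner products with it are evaluated by \<open>ip_coherent\<close>, each contributing the square
  root of the weight.\<close>

lemma translate_const_proj:
 assumes x: "x \<in> SU_n1" and f: "f \<in> HC" and y: "y \<in> HC"
 shows "ip M (translate_op \<nu> x (const_proj \<nu>) f) y = of_real (wt (act x 0)) * f (act x 0) * cnj (y (act x 0))"
proof -
 let ?w = "act x 0" and ?s = "complex_of_real ((1 - (norm (act x 0))^2) powr (\<nu> / 2))"
 have cp: "const_proj \<nu> g = (\<lambda>z. ip M g one * one z)" for g
  unfolding const_proj_def Let_def ips_inner_H ips_scale_H one_def[symmetric] ip_one_one by simp
 have r: "rep x (\<lambda>z. c * one z) = (\<lambda>z. c * coherent \<nu> ?w z)" for c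
  using rep_one[OF x] by (auto simp: fun_eq_iff bergman_rep_def)
 have "ip M one (rep (matrix_inv x) f) = ip M (coherent \<nu> ?w) f" using rep_adjoint[OF x one_HC f] by (simp add: rep_one[OF x])
 hence c: "ip M (rep (matrix_inv x) f) one = ip M f (coherent \<nu> ?w)" by (metis cnj_ip)
 have "translate_op \<nu> x (const_proj \<nu>) f = (\<lambda>z. (?s * f ?w) * coherent \<nu> ?w z)"
  unfolding translate_op_eq[OF x f] cp c r ip_coherent[OF x f] ..
 hence "ip M (translate_op \<nu> x (const_proj \<nu>) f) y = (?s * f ?w) * cnj (ip M y (coherent \<nu> ?w))" by (simp add: ip_scale_left cnj_ip)
 also have "\<dots> = (?s * ?s) * f ?w * cnj (y ?w)" unfolding ip_coherent[OF x y] by simp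
 also have "?s * ?s = of_real (wt ?w)" unfolding wt_def of_real_mult[symmetric] powr_add[symmetric] by simp
 finally show ?thesis .
qed

text \<open>Matrix coefficients of the translates of P_0 depend on x only through x 0, so the Haar
  integral becomes one over \<open>iota\<close>, that is, \<open>W\<close> times \<open>TS\<close>.
  That form has the eigenvalues s_k h / W, and the normalization by sqrt(h) leaves s_k
  sqrt(h).\<close>

lemma T_op_diag:
 assumes f: "f \<in> HC" shows "T_op haar \<nu> (of_real l) f = diag (\<lambda>k. of_real (sb k l * sqrt (hb l))) f"
proof -
 let ?W = "complex_of_real (W)"
 obtain t where t: "bdd t" "\<And>f y. f \<in> HC \<Longrightarrow> y \<in> HC \<Longrightarrow> TS l f y = ip M (diag t f) y"
  "\<And>k f z. f \<in> HC \<Longrightarrow> norm z < 1 \<Longrightarrow> TS l f (Kmono k z) = t k * Pk k f z"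
  by (rule TS_diag; rule that)
 have Wt: "?W * t k = of_real (sb k l * hb l)" for k by (rule TS_eigenvalue[OF t(3)])
 define u where "u = (\<lambda>z. ?W * diag t f z)"
 have u: "u \<in> HC" unfolding u_def by (intro HC_scale diag_HC t f)
 have hb: "has_bochner_integral haar (\<lambda>x. ips_inner BH (op_scale BH (sf l (act x 0)) (translate_op \<nu> x (const_proj \<nu>)) f) y) (ip M u y)"
  if y: "y \<in> HC" for y
 proof -
  let ?F = "\<lambda>z. sf l z * (of_real (wt z) * f z * cnj (y z))"
  have mF: "?F \<in> borel_measurable borel" using HC_measurable[OF f] HC_measurable[OF y] by measurable
  have ma: "(\<lambda>x. act x 0 :: complex^'n) \<in> haar \<rightarrow>\<^sub>M borel" by (rule measurable_act_group[OF sets_haar[OF haar]])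
  have "has_bochner_integral (distr haar borel (\<lambda>x. act x 0)) ?F (?W * TS l f y)"
   unfolding haar_pushforward[OF haar] by (rule TS_iota[OF f y])
  hence "has_bochner_integral haar (\<lambda>x. ?F (act x 0)) (?W * TS l f y)"
   unfolding has_bochner_integral_iff integrable_distr_eq[OF ma mF] integral_distr[OF ma mF] .
  moreover have "?W * TS l f y = ip M u y" unfolding u_def ip_scale_left t(2)[OF f y] ..
  moreover have "has_bochner_integral haar (\<lambda>x. ?F (act x 0)) (ip M u y) = has_bochner_integral haar
    (\<lambda>x. ips_inner BH (op_scale BH (sf l (act x 0)) (translate_op \<nu> x (const_proj \<nu>)) f) y) (ip M u y)"
   by (rule has_bochner_integral_cong)
    (auto simp: ips_inner_H op_scale_def ips_scale_H ip_scale_left translate_const_proj f y space_haar[OF haar])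
  ultimately show ?thesis by simp
 qed
 \<comment> \<open>The weak integral is chosen among all representers of the integrated form. In the
   Bergman space there is exactly one, namely u.\<close>
 have "conv_fun_op haar \<nu> (spherical_fun (of_real l)) (const_proj \<nu>) f = u"
  unfolding conv_fun_op_def weak_integral_op_def
 proof (rule some_equality)
  show "u \<in> HC \<and> (\<forall>y\<in>HC. has_bochner_integral haar (\<lambda>x. ips_inner BH
   (op_scale BH (spherical_fun (of_real l) (act x 0)) (translate_op \<nu> x (const_proj \<nu>)) f) y) (ips_inner BH u y))"
   using u hb by (simp add: ips_inner_H)
  fix v assume v: "v \<in> HC \<and> (\<forall>y\<in>HC. has_bochner_integral haar (\<lambda>x. ips_inner BH
   (op_scale BH (spherical_fun (of_real l) (act x 0)) (translate_op \<nu> x (const_proj \<nu>)) f) y) (ips_inner BH v y))"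
  show "v = u"
  proof (rule HC_eqI)
   fix y assume y: "y \<in> HC"
   have "ip M v y = ip M u y" using v y has_bochner_integral_eq[OF _ hb[OF y]] by (simp add: ips_inner_H)
   thus "ip M y v = ip M y u" by (metis cnj_ip)
  qed (use v u in auto)
 qed
 moreover have "csqrt (spherical_transform (h_fun \<nu> :: complex^'n \<Rightarrow> complex) (of_real l)) = of_real (sqrt (hb l))"
  unfolding spherical_transform_h_fun[OF nuC] NC[symmetric] by (rule of_real_sqrt[OF less_imp_le[OF h_hat_positive], symmetric])
 ultimately have T: "T_op haar \<nu> (of_real l) f = (\<lambda>z. 1 / of_real (sqrt (hb l)) * u z)"
  by (simp add: T_op_def op_scale_def ips_scale_H)
 have hp: "hb l > 0" by (rule h_hat_positive)
 have e: "1 / of_real (sqrt (hb l)) * ?W * t k = of_real (sb k l * sqrt (hb l))" for k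
 proof -
  have "1 / sqrt (hb l) * (sb k l * hb l) = sb k l * sqrt (hb l)"
   using hp by (simp add: field_simps)
  hence "complex_of_real (1 / sqrt (hb l) * (sb k l * hb l)) = of_real (sb k l * sqrt (hb l))" by (simp only:)
  thus ?thesis unfolding of_real_mult[of "1 / _"] mult.assoc Wt by (simp del: of_real_mult)
 qed
 have "(\<lambda>z. 1 / of_real (sqrt (hb l)) * u z) = diag (\<lambda>k. 1 / of_real (sqrt (hb l)) * ?W * t k) f"
  unfolding diag_scale[OF t(1) f] u_def by (simp add: mult.assoc)
 thus ?thesis unfolding T e by simp
qed

text \<open>\<open>A\<close> composed with \<open>T_op\<close> is diagonal with entries a_k s_k
  sqrt(h). For fixed l the s_k are bounded in k, so these entries are again absolutely summable
  against d_k and \<open>trace_diag\<close> gives the trace.\<close>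

lemma op_transform_diag:
 assumes a: "abssum a" and A: "\<And>f. f \<in> HC \<Longrightarrow> A f = diag a f"
 shows "(\<lambda>k. a k * of_real (sb k l * sqrt (hb l) * dd k)) sums op_transform haar \<nu> A (of_real l)"
proof -
 obtain C where C: "C \<ge> 0" "\<And>k. \<bar>sb k l\<bar> \<le> C"
  by (rule sq_bounded[of "real N" \<nu> "lap N l"]; (rule that)?) (use Npos nupos lap_pos[OF Npos] in auto)
 define t where "t k = complex_of_real (sb k l * sqrt (hb l))" for k
 define C' where "C' = C * sqrt (hb l)"
 have C': "cmod (t k) \<le> C'" for k
  unfolding t_def C'_def norm_of_real abs_mult using C(2)[of k] h_hat_positive[of l] by (simp add: mult_right_mono)
 have t: "bdd t" using C' by (auto simp: bdd_def)
 have ab: "bdd a" and as: "summable (\<lambda>k. cmod (a k) * dd k)" using a by (simp_all add: abssum_def)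
 have c: "abssum (\<lambda>k. a k * t k)"
  unfolding abssum_def
 proof
  show "bdd (\<lambda>k. a k * t k)" by (rule bdd_mult[OF ab t])
  show "summable (\<lambda>k. cmod (a k * t k) * dd k)"
  proof (rule summable_comparison_test'[OF summable_mult[OF as, of C']])
   fix k :: nat assume "0 \<le> k"
   have "cmod (t k) * (cmod (a k) * dd k) \<le> C' * (cmod (a k) * dd k)"
    using dd_pos[of k] by (intro mult_right_mono C' mult_nonneg_nonneg) auto
   thus "norm (cmod (a k * t k) * dd k) \<le> C' * (cmod (a k) * dd k)"
    using dd_pos[of k] by (simp add: norm_mult mult_ac)
  qed
 qed
 have "ips_inner BH ((A \<circ> T_op haar \<nu> (of_real l)) e) e = ip M (diag (\<lambda>k. a k * t k) e) e" if "e \<in> E" for e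
 proof -
  note e = E_HC[OF that]
  have "T_op haar \<nu> (of_real l) e = diag t e" unfolding T_op_diag[OF e] t_def ..
  thus ?thesis using A[OF diag_HC[OF t e]] by (simp add: ips_inner_H diag_diag[OF ab t e])
 qed
 hence "op_transform haar \<nu> A (of_real l) = (\<Sum>\<^sub>\<infinity>e\<in>E. ip M (diag (\<lambda>k. a k * t k) e) e)"
  unfolding op_transform_def op_trace_def E_def[symmetric] by (intro infsum_cong)
 also have "\<dots> = (\<Sum>k. a k * t k * of_real (dd k))" by (rule infsumI[OF trace_diag(1)[OF c]])
 finally have "(\<lambda>k. a k * t k * of_real (dd k)) sums op_transform haar \<nu> A (of_real l)"
  using summable_sums[OF trace_diag(2)[OF c]] by simp
 thus ?thesis by (simp add: t_def mult.assoc)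
qed

end

locale fourier_setting = plancherel_setting N \<nu> \<mu> "TYPE('n)" + bergman_setting N \<nu> haar
 for N :: nat and \<nu> :: real and \<mu> :: "real measure" and haar :: "('n::finite) gmat measure"
begin

text \<open>Unique by \<open>diag_inject\<close>. Only the action on the Bergman space counts, as
  operators are arbitrary functions outside the carrier.\<close>

definition eig :: "'n bop \<Rightarrow> nat \<Rightarrow> complex" where
 "eig A = (SOME a. bdd a \<and> (\<forall>f\<in>HC. A f = diag a f))"

abbreviation "RH \<equiv> ips_carrier (radial_HS \<nu> :: 'n bop ips)"

lemma eigI: assumes "bdd a" "\<And>f. f \<in> HC \<Longrightarrow> A f = diag a f" shows "eig A = a"
 unfolding eig_def
proof (rule some_equality)
 fix b assume "bdd b \<and> (\<forall>f\<in>HC. A f = diag b f)"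
 thus "b = a" using assms(2) by (intro diag_inject) simp
qed (use assms in simp)

lemma eig_diag:
 assumes "bounded_op BH A" "radial_op \<nu> A"
 shows "bdd (eig A)" "f \<in> HC \<Longrightarrow> A f = diag (eig A) f"
proof -
 obtain a where a: "bdd a" "\<And>f. f \<in> HC \<Longrightarrow> A f = diag a f" by (rule radial_bounded_diag[OF assms]; rule that)
 thus "bdd (eig A)" "f \<in> HC \<Longrightarrow> A f = diag (eig A) f" using eigI[OF a] by simp_all
qed

lemma RH_iff: "A \<in> RH \<longleftrightarrow> bounded_op BH A \<and> radial_op \<nu> A \<and> (\<lambda>e. (nrm M (A e))^2) summable_on E"
 by (auto simp: radial_HS_def HS_space_def hilbert_schmidt_def ips_norm_H E_def)

lemma HS_summable:
 assumes a: "bdd a" and A: "\<And>f. f \<in> HC \<Longrightarrow> A f = diag a f"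
 shows "(\<lambda>e. (nrm M (A e))^2) summable_on E \<longleftrightarrow> sqsum a"
proof -
 have "(\<lambda>e. (nrm M (A e))^2) summable_on E \<longleftrightarrow> (\<lambda>e. (nrm M (diag a e))^2) summable_on E"
  by (rule summable_on_cong) (simp add: A E_HC)
 thus ?thesis by (simp add: summable_on_def HS_sums[OF a] sqsum_def summable_def)
qed

lemma RH_D: assumes "A \<in> RH" shows "sqsum (eig A)" "f \<in> HC \<Longrightarrow> A f = diag (eig A) f"
 using eig_diag[of A] HS_summable[of "eig A" A] assms by (auto simp: RH_iff)

lemma diag_RH: assumes "sqsum a" shows "diag a \<in> RH"
 using HS_summable[OF sqsum_bdd[OF assms], of "diag a"] assms
 by (simp add: RH_iff bounded_op_diag radial_op_diag sqsum_bdd)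

lemma T1_D:
 assumes A: "A \<in> radial_T1 \<nu>" shows "A \<in> RH" "abssum (eig A)"
proof -
 have t: "trace_class BH A" and r: "radial_op \<nu> A" using A by (auto simp: radial_T1_def)
 hence b: "bounded_op BH A" by (simp add: trace_class_def)
 note e = eig_diag[OF b r]
 show s: "abssum (eig A)" by (rule trace_class_diag[OF t e])
 show "A \<in> RH" using HS_summable[of "eig A" A] e abssum_sqsum[OF s] b r by (simp add: RH_iff)
qed

text \<open>The coefficient of A with respect to the projection onto degree k divided by its
  Hilbert-Schmidt norm sqrt(d_k).\<close>

definition cf :: "'n bop \<Rightarrow> nat \<Rightarrow> complex" where "cf A k = eig A k * of_real (sqrt (dd k))"

lemma cf_sq: "(cmod (cf A k))^2 = (cmod (eig A k))^2 * dd k"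
 using dd_pos[of k] by (simp add: cf_def norm_mult power_mult_distrib)

lemma cf_summable: "A \<in> RH \<Longrightarrow> summable (\<lambda>k. (cmod (cf A k))^2)"
 unfolding cf_sq using RH_D(1) by (simp add: sqsum_def)

text \<open>The isometry that carries the normalized projection of degree k to \<open>ek k\<close>.
  The choice is determined up to null sets by completeness.\<close>

definition U2 :: "'n bop \<Rightarrow> real \<Rightarrow> complex" where
 "U2 A = (SOME w. w \<in> L2 \<mu> \<and> (\<forall>k. ip \<mu> w (ek k) = cf A k))"

lemma U2: assumes A: "A \<in> RH" shows "U2 A \<in> L2 \<mu>" "ip \<mu> (U2 A) (ek k) = cf A k"
proof -
 obtain w and r :: "nat \<Rightarrow> nat" where "w \<in> L2 \<mu>" "\<And>k. ip \<mu> w (ek k) = cf A k" "(nrm \<mu> w)^2 = (\<Sum>k. (cmod (cf A k))^2)"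
  "strict_mono r" "AE x in \<mu>. (\<lambda>j. \<Sum>k<r j. cf A k * ek k x) \<longlonglongrightarrow> w x"
  by (rule Riesz_Fischer[OF ek_L2 ek_orthonormal cf_summable[OF A]]; rule that)
 hence "\<exists>w. w \<in> L2 \<mu> \<and> (\<forall>k. ip \<mu> w (ek k) = cf A k)" by blast
 from someI_ex[OF this] show "U2 A \<in> L2 \<mu>" "ip \<mu> (U2 A) (ek k) = cf A k" by (auto simp: U2_def)
qed

lemma ek_eqI:
 assumes "u \<in> L2 \<mu>" "v \<in> L2 \<mu>" "\<And>k. ip \<mu> u (ek k) = ip \<mu> v (ek k)" shows "ips_eq (L2_space \<mu>) u v"
proof -
 have "AE l in \<mu>. u l - v l = 0"
  by (rule ek_complete) (use assms in \<open>auto intro: L2_diff simp: ip_diff_left ek_L2\<close>)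
 thus ?thesis unfolding ips_eq_L2[OF assms(1,2)] by eventually_elim simp
qed

lemma ek_Parseval_sums:
 assumes u: "u \<in> L2 \<mu>" and v: "v \<in> L2 \<mu>"
 shows "(\<lambda>k. ip \<mu> u (ek k) * cnj (ip \<mu> v (ek k))) sums ip \<mu> u v"
proof -
 have s: "(\<lambda>k. complex_of_real ((cmod (ip \<mu> u (ek k) + c * ip \<mu> v (ek k)))^2)) sums of_real ((nrm \<mu> (\<lambda>z. u z + c * v z))^2)" for c
 proof -
  have w: "(\<lambda>z. u z + c * v z) \<in> L2 \<mu>" by (intro L2_add L2_scale u v)
  have "(\<lambda>k. (cmod (ip \<mu> (\<lambda>z. u z + c * v z) (ek k)))^2) sums (nrm \<mu> (\<lambda>z. u z + c * v z))^2"
   unfolding ek_Parseval[OF w] by (rule summable_sums[OF orthonormal_Bessel[OF ek_L2 ek_orthonormal w]])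
  thus ?thesis unfolding ip_add_left[OF u L2_scale[OF v] ek_L2] ip_scale_left by (rule sums_of_real)
 qed
 show ?thesis unfolding nrm_polarization[OF u v] polarization_complex
  by (intro sums_add sums_mult s)
qed

lemma U2_ip:
 assumes A: "A \<in> RH" and B: "B \<in> RH" shows "ip \<mu> (U2 A) (U2 B) = ips_inner (radial_HS \<nu>) A B"
proof -
 obtain s where s: "((\<lambda>e. ip M (diag (eig A) e) (diag (eig B) e)) has_sum s) E" "(\<lambda>k. eig A k * cnj (eig B k) * of_real (dd k)) sums s"
  by (rule trace_inner[OF RH_D(1)[OF A] RH_D(1)[OF B]]; rule that)
 have "ips_inner (radial_HS \<nu>) A B = (\<Sum>\<^sub>\<infinity>e\<in>E. ip M (diag (eig A) e) (diag (eig B) e))"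
 proof -
  have "ips_inner (radial_HS \<nu>) A B = (\<Sum>\<^sub>\<infinity>e\<in>E. ip M (A e) (B e))"
   by (simp only: radial_HS_def HS_space_def E_def ips_inner_H ips.simps)
  also have "\<dots> = (\<Sum>\<^sub>\<infinity>e\<in>E. ip M (diag (eig A) e) (diag (eig B) e))"
   by (rule infsum_cong) (simp only: RH_D(2)[OF A E_HC, symmetric] RH_D(2)[OF B E_HC, symmetric])
  finally show ?thesis .
 qed
 also have "\<dots> = s" by (rule infsumI[OF s(1)])
 also have "eig A k * cnj (eig B k) * of_real (dd k) = cf A k * cnj (cf B k)" for k
 proof -
  have "complex_of_real (dd k) = of_real (sqrt (dd k)) * of_real (sqrt (dd k))"
   unfolding of_real_mult[symmetric] using dd_pos[of k] by simp
  thus ?thesis by (simp add: cf_def mult_ac)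
 qed
 hence "s = ip \<mu> (U2 A) (U2 B)"
  using sums_unique2[OF s(2)] ek_Parseval_sums[OF U2(1)[OF A] U2(1)[OF B]] by (simp add: U2(2) A B)
 finally show ?thesis by simp
qed

lemma RH_ops:
 "ips_add (radial_HS \<nu>) A B f = (\<lambda>z. A f z + B f z)" "ips_scale (radial_HS \<nu>) c A f = (\<lambda>z. c * A f z)"
 for A B :: "'n bop"
 by (simp_all add: radial_HS_def HS_space_def ips_add_H op_scale_def ips_scale_H)

lemma RH_add:
 assumes A: "A \<in> RH" and B: "B \<in> RH"
 shows "sqsum (\<lambda>k. eig A k + eig B k)" "\<forall>f\<in>HC. ips_add (radial_HS \<nu>) A B f = diag (\<lambda>k. eig A k + eig B k) f"
proof -
 note a = RH_D(1)[OF A] and b = RH_D(1)[OF B]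
 show "sqsum (\<lambda>k. eig A k + eig B k)" by (rule sqsum_add[OF a b])
 show "\<forall>f\<in>HC. ips_add (radial_HS \<nu>) A B f = diag (\<lambda>k. eig A k + eig B k) f"
 proof
  fix f assume f: "f \<in> HC"
  show "ips_add (radial_HS \<nu>) A B f = diag (\<lambda>k. eig A k + eig B k) f"
   unfolding RH_ops diag_add[OF sqsum_bdd[OF a] sqsum_bdd[OF b] f] using RH_D(2)[OF A f] RH_D(2)[OF B f] by (simp only:)
 qed
qed

lemma RH_scale:
 assumes A: "A \<in> RH"
 shows "sqsum (\<lambda>k. c * eig A k)" "\<forall>f\<in>HC. ips_scale (radial_HS \<nu>) c A f = diag (\<lambda>k. c * eig A k) f"
proof -
 note a = RH_D(1)[OF A]
 show "sqsum (\<lambda>k. c * eig A k)" by (rule sqsum_scale[OF a])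
 show "\<forall>f\<in>HC. ips_scale (radial_HS \<nu>) c A f = diag (\<lambda>k. c * eig A k) f"
 proof
  fix f assume f: "f \<in> HC"
  show "ips_scale (radial_HS \<nu>) c A f = diag (\<lambda>k. c * eig A k) f"
   unfolding RH_ops diag_scale[OF sqsum_bdd[OF a] f] using RH_D(2)[OF A f] by (simp only:)
 qed
qed

text \<open>\<open>U2\<close> depends on an operator only through \<open>eig\<close>, so an operator
  known just by its action on the Bergman space may be replaced by the corresponding
  \<open>diag\<close>. Sums and multiples of operators are treated in this way.\<close>

lemma U2_eigI:
 assumes "sqsum a" "\<forall>f\<in>HC. A f = diag a f"
 shows "U2 A \<in> L2 \<mu>" "ip \<mu> (U2 A) (ek k) = a k * of_real (sqrt (dd k))"
proof -
 have e: "eig A = a" "eig (diag a) = a" using assms by (auto intro!: eigI sqsum_bdd)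
 have "U2 A = U2 (diag a)" unfolding U2_def cf_def e ..
 thus "U2 A \<in> L2 \<mu>" "ip \<mu> (U2 A) (ek k) = a k * of_real (sqrt (dd k))"
  using U2[OF diag_RH[OF assms(1)]] by (simp_all add: cf_def e)
qed

lemma U2_linear:
 assumes A: "A \<in> RH" and B: "B \<in> RH"
 shows "U2 (ips_add (radial_HS \<nu>) A B) \<in> L2 \<mu>" "ips_eq (L2_space \<mu>) (U2 (ips_add (radial_HS \<nu>) A B)) (\<lambda>l. U2 A l + U2 B l)"
  "U2 (ips_scale (radial_HS \<nu>) c A) \<in> L2 \<mu>" "ips_eq (L2_space \<mu>) (U2 (ips_scale (radial_HS \<nu>) c A)) (\<lambda>l. c * U2 A l)"
proof -
 note a = U2_eigI[OF RH_add[OF A B]]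
 note s = U2_eigI[OF RH_scale[OF A, of c]]
 show "U2 (ips_add (radial_HS \<nu>) A B) \<in> L2 \<mu>" "U2 (ips_scale (radial_HS \<nu>) c A) \<in> L2 \<mu>" by (rule a(1), rule s(1))
 show "ips_eq (L2_space \<mu>) (U2 (ips_add (radial_HS \<nu>) A B)) (\<lambda>l. U2 A l + U2 B l)"
  by (rule ek_eqI[OF a(1) L2_add[OF U2(1)[OF A] U2(1)[OF B]]])
   (simp add: a(2) ip_add_left U2 A B ek_L2 cf_def ring_distribs)
 show "ips_eq (L2_space \<mu>) (U2 (ips_scale (radial_HS \<nu>) c A)) (\<lambda>l. c * U2 A l)"
  by (rule ek_eqI[OF s(1) L2_scale[OF U2(1)[OF A]]])
   (simp add: s(2) ip_scale_left U2 A ek_L2 cf_def)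
qed

lemma U2_surj:
 assumes w: "w \<in> L2 \<mu>" obtains A where "A \<in> RH" "ips_eq (L2_space \<mu>) (U2 A) w"
proof -
 define a where "a k = ip \<mu> w (ek k) / of_real (sqrt (dd k))" for k
 have sd: "sqrt (dd k) > 0" for k using dd_pos by simp
 have ad: "a k * of_real (sqrt (dd k)) = ip \<mu> w (ek k)" for k using sd[of k] by (simp add: a_def)
 have "(cmod (a k))^2 * dd k = (cmod (ip \<mu> w (ek k)))^2" for k
  unfolding ad[symmetric] norm_mult power_mult_distrib norm_of_real using dd_pos[of k] by simp
 hence "sqsum a" using orthonormal_Bessel[OF ek_L2 ek_orthonormal w] by (simp add: sqsum_def)
 note u = U2_eigI[OF this, of "diag a"] and d = diag_RH[OF this]
 have "ips_eq (L2_space \<mu>) (U2 (diag a)) w" by (rule ek_eqI[OF _ w]) (simp_all add: u ad)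
 thus thesis using d that by blast
qed

text \<open>For trace class A the series of \<open>cf A k\<close> times \<open>ek k\<close>
  converges to the transform at every l, which also gives measurability. Riesz-Fischer yields a
  subsequence of the same partial sums converging almost everywhere to the L2 function with these
  coefficients, so the two agree almost everywhere.\<close>

lemma U2_op_transform:
 assumes A: "A \<in> radial_T1 \<nu>"
 shows "(\<lambda>l. op_transform haar \<nu> A (of_real l)) \<in> L2 \<mu>" "ips_eq (L2_space \<mu>) (U2 A) (\<lambda>l. op_transform haar \<nu> A (of_real l))"
proof -
 let ?T = "\<lambda>l. op_transform haar \<nu> A (of_real l)"
 note AR = T1_D(1)[OF A] and aa = T1_D(2)[OF A]
 have sm: "(\<lambda>k. cf A k * ek k l) sums ?T l" for l
 proof -
  have "(\<lambda>k. eig A k * of_real (sk k l * sqrt (hh l) * dd k)) sums ?T l"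
   by (rule op_transform_diag[OF aa RH_D(2)[OF AR]])
  moreover have "eig A k * of_real (sk k l * sqrt (hh l) * dd k) = cf A k * ek k l" for k
  proof -
   have "dd k = sqrt (dd k) * sqrt (dd k)" using dd_pos[of k] by simp
   hence "sk k l * sqrt (hh l) * dd k = sqrt (dd k) * (sqrt (dd k) * sk k l * sqrt (hh l))" by (metis mult.assoc mult.commute)
   thus ?thesis by (simp only: cf_def ek_def of_real_mult mult.assoc)
  qed
  ultimately show ?thesis by simp
 qed
 obtain w and r :: "nat \<Rightarrow> nat" where w: "w \<in> L2 \<mu>" "\<And>k. ip \<mu> w (ek k) = cf A k" "(nrm \<mu> w)^2 = (\<Sum>k. (cmod (cf A k))^2)"
  "strict_mono r" "AE x in \<mu>. (\<lambda>j. \<Sum>k<r j. cf A k * ek k x) \<longlonglongrightarrow> w x"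
  by (rule Riesz_Fischer[OF ek_L2 ek_orthonormal cf_summable[OF AR]]; rule that)
 have "AE l in \<mu>. w l = ?T l"
  using w(5)
 proof eventually_elim
  case (elim l)
  have "(\<lambda>j. \<Sum>k<r j. cf A k * ek k l) \<longlonglongrightarrow> ?T l"
   using LIMSEQ_subseq_LIMSEQ[OF sm[of l, unfolded sums_def] w(4)] by (simp add: o_def)
  thus ?case using elim LIMSEQ_unique by blast
 qed
 note wT = this
 have "?T = (\<lambda>l. \<Sum>k. cf A k * ek k l)" using sm by (simp add: sums_iff)
 hence mT: "?T \<in> borel_measurable \<mu>" using measurable_ek by simp
 have "integrable \<mu> (\<lambda>l. (cmod (?T l))^2)"
 proof (rule integrable_cong_AE_imp)
  show "integrable \<mu> (\<lambda>l. (cmod (w l))^2)" using w(1) by (simp add: L2_iff)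
  show "AE l in \<mu>. (cmod (w l))^2 = (cmod (?T l))^2" using wT by eventually_elim simp
 qed (use mT in measurable)
 thus T: "?T \<in> L2 \<mu>" using mT by (simp add: L2_iff)
 have "AE l in \<mu>. U2 A l = w l" using ek_eqI[OF U2(1)[OF AR] w(1)] U2(2)[OF AR] w(2) ips_eq_L2[OF U2(1)[OF AR] w(1)] by simp
 thus "ips_eq (L2_space \<mu>) (U2 A) ?T"
  unfolding ips_eq_L2[OF U2(1)[OF AR] T] using wT by eventually_elim simp
qed

text \<open>The function |e_0|^2 is integrable and positive everywhere, so its superlevel sets have
  finite measure and exhaust the half line. This makes Fubini available for the product with the
  two-point space.\<close>

lemma sigma_finite_mu: "sigma_finite_measure \<mu>"
proof
 define g where "g l = (cmod (ek 0 l))^2" for l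
 have g: "integrable \<mu> g" using ek_L2[of 0] by (simp add: L2_iff g_def[abs_def])
 have pos: "g l > 0" for l using hh_pos[of l] by (simp add: g_def ek_def hdim_def)
 define S where "S n = {l \<in> space \<mu>. g l \<ge> 1 / real (Suc n)}" for n
 show "\<exists>A. countable A \<and> A \<subseteq> sets \<mu> \<and> \<Union>A = space \<mu> \<and> (\<forall>a\<in>A. emeasure \<mu> a \<noteq> \<infinity>)"
 proof (intro exI[of _ "range S"] conjI ballI)
  have "g \<in> borel_measurable \<mu>" using g by (rule borel_measurable_integrable)
  thus "range S \<subseteq> sets \<mu>" unfolding S_def by auto
  show "\<Union> (range S) = space \<mu>"
  proof
   show "space \<mu> \<subseteq> \<Union> (range S)"
   proof
    fix l assume l: "l \<in> space \<mu>"
    obtain n where "inverse (real (Suc n)) < g l" using reals_Archimedean[OF pos] by blast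
    hence "l \<in> S n" using l by (simp add: S_def inverse_eq_divide)
    thus "l \<in> \<Union> (range S)" by blast
   qed
  qed (auto simp: S_def)
  fix a assume "a \<in> range S"
  then obtain n where a: "a = S n" by blast
  have "emeasure \<mu> (S n) \<le> ennreal (1 / (1 / real (Suc n)) * (LINT l|\<mu>. g l))"
   unfolding S_def by (rule integral_Markov_inequality[OF g]) (use pos in \<open>auto simp: less_imp_le\<close>)
  from le_less_trans[OF this ennreal_less_top] show "emeasure \<mu> a \<noteq> \<infinity>" unfolding a by simp
 qed simp
qed

declare One_nat_def [simp del]

section \<open>Two copies of the Plancherel space and the direct sum of the transforms\<close>

abbreviation "J \<equiv> count_space {0, 1 :: nat}"
abbreviation "PM \<equiv> \<mu> \<Otimes>\<^sub>M J"

definition pair_fun :: "(real \<Rightarrow> complex) \<Rightarrow> (real \<Rightarrow> complex) \<Rightarrow> real \<times> nat \<Rightarrow> complex" where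
 "pair_fun u v = (\<lambda>(l, j). if j = 0 then u l else v l)"

lemma pair_sigma: "pair_sigma_finite \<mu> J"
proof -
 interpret sigma_finite_measure \<mu> by (rule sigma_finite_mu)
 interpret J: finite_measure J by (rule finite_measure_count_space) simp
 show ?thesis ..
qed

lemma PM_integrable:
 fixes F :: "real \<times> nat \<Rightarrow> 'b::{banach, second_countable_topology}"
 assumes m: "F \<in> borel_measurable PM" and i: "integrable \<mu> (\<lambda>l. F (l, 0))" "integrable \<mu> (\<lambda>l. F (l, 1))"
 shows "integrable PM F" "integral\<^sup>L PM F = (LINT l|\<mu>. F (l, 0)) + (LINT l|\<mu>. F (l, 1))"
proof -
 interpret pair_sigma_finite \<mu> J by (rule pair_sigma)
 have s: "(LINT j|J. G j) = G 0 + G 1" for G :: "nat \<Rightarrow> 'c::{banach, second_countable_topology}"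
  by (subst lebesgue_integral_count_space_finite) auto
 show int: "integrable PM F"
 proof (rule Fubini_integrable[OF m])
  show "integrable \<mu> (\<lambda>x. LINT y|J. norm (F (x, y)))" unfolding s using i by simp
  show "AE x in \<mu>. integrable J (\<lambda>y. F (x, y))" by (simp add: integrable_count_space)
 qed
 show "integral\<^sup>L PM F = (LINT l|\<mu>. F (l, 0)) + (LINT l|\<mu>. F (l, 1))"
  unfolding integral_fst'[OF int, symmetric] s by (rule Bochner_Integration.integral_add[OF i])
qed

lemma pair_fun_L2:
 assumes u: "u \<in> L2 \<mu>" and v: "v \<in> L2 \<mu>" shows "pair_fun u v \<in> L2 PM"
proof -
 have [measurable]: "u \<in> borel_measurable \<mu>" "v \<in> borel_measurable \<mu>" using u v by (auto simp: L2_iff)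
 have "(\<lambda>p. if snd p = (0::nat) then u (fst p) else v (fst p)) \<in> borel_measurable PM" by measurable
 hence m: "pair_fun u v \<in> borel_measurable PM" by (simp add: pair_fun_def case_prod_beta')
 have "integrable PM (\<lambda>p. (cmod (pair_fun u v p))^2)"
  by (rule PM_integrable(1)) (use m u v in \<open>auto simp: L2_iff pair_fun_def\<close>)
 thus ?thesis using m by (simp add: L2_iff)
qed

lemma pair_fun_ip:
 assumes u: "u \<in> L2 \<mu>" "v \<in> L2 \<mu>" and u': "u' \<in> L2 \<mu>" "v' \<in> L2 \<mu>"
 shows "ip PM (pair_fun u v) (pair_fun u' v') = ip \<mu> u u' + ip \<mu> v v'"
 unfolding ip_def
 by (subst PM_integrable(2)) (use pair_fun_L2[OF u] pair_fun_L2[OF u'] L2_mult_integrable[OF u(1) u'(1)] L2_mult_integrable[OF u(2) u'(2)] in \<open>auto simp: pair_fun_def dest!: L2_measurable\<close>)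

text \<open>The exceptional set in the product is controlled through norms: the squared norm of the
  difference is the sum of those of the two components.\<close>

lemma pair_fun_eq:
 assumes u: "u \<in> L2 \<mu>" "v \<in> L2 \<mu>" and u': "u' \<in> L2 \<mu>" "v' \<in> L2 \<mu>"
  and e: "ips_eq (L2_space \<mu>) u u'" "ips_eq (L2_space \<mu>) v v'"
 shows "ips_eq (L2_space PM) (pair_fun u v) (pair_fun u' v')"
proof -
 have d: "(\<lambda>l. u l - u' l) \<in> L2 \<mu>" "(\<lambda>l. v l - v' l) \<in> L2 \<mu>" by (intro L2_diff u u')+
 have "(\<lambda>p. pair_fun u v p - pair_fun u' v' p) = pair_fun (\<lambda>l. u l - u' l) (\<lambda>l. v l - v' l)"
  by (auto simp: pair_fun_def)
 note pd = this
 have n: "nrm \<mu> (\<lambda>l. u l - u' l) = 0" "nrm \<mu> (\<lambda>l. v l - v' l) = 0"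
  using e unfolding ips_eq_L2[OF u(1) u'(1)] ips_eq_L2[OF u(2) u'(2)] nrm_eq_0_iff[OF d(1)] nrm_eq_0_iff[OF d(2)] by auto
 have "ip PM (\<lambda>p. pair_fun u v p - pair_fun u' v' p) (\<lambda>p. pair_fun u v p - pair_fun u' v' p) = 0"
  unfolding pd pair_fun_ip[OF d d] unfolding ip_self n by simp
 hence "nrm PM (\<lambda>p. pair_fun u v p - pair_fun u' v' p) = 0" unfolding ip_self of_real_eq_0_iff power_eq_0_iff by blast
 hence "AE p in PM. pair_fun u v p - pair_fun u' v' p = 0"
  using nrm_eq_0_iff[OF L2_diff[OF pair_fun_L2[OF u] pair_fun_L2[OF u']]] by simp
 thus ?thesis unfolding ips_eq_L2[OF pair_fun_L2[OF u] pair_fun_L2[OF u']] by eventually_elim simp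
qed

lemma pair_fun_surj:
 assumes w: "w \<in> L2 PM"
 shows "(\<lambda>l. w (l, 0)) \<in> L2 \<mu>" "(\<lambda>l. w (l, 1)) \<in> L2 \<mu>" "ips_eq (L2_space PM) (pair_fun (\<lambda>l. w (l, 0)) (\<lambda>l. w (l, 1))) w"
proof -
 interpret pair_sigma_finite \<mu> J by (rule pair_sigma)
 have m: "(\<lambda>l. w (l, j)) \<in> borel_measurable \<mu>" if "j \<in> {0, 1}" for j
  using measurable_compose[OF measurable_Pair2'[of j J \<mu>], of w] w that by (auto simp: L2_iff)
 have int: "integrable PM (\<lambda>p. (cmod (w p))^2)" using w by (simp add: L2_iff)
 have s: "(LINT j|J. G j) = G 0 + G 1" for G :: "nat \<Rightarrow> real"
  by (subst lebesgue_integral_count_space_finite) auto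
 have i: "integrable \<mu> (\<lambda>l. (cmod (w (l, 0)))^2 + (cmod (w (l, 1)))^2)" using integrable_fst'[OF int] unfolding s .
 show L: "(\<lambda>l. w (l, 0)) \<in> L2 \<mu>" "(\<lambda>l. w (l, 1)) \<in> L2 \<mu>"
  using m[of 0] m[of 1] by (auto simp: L2_iff intro!: Bochner_Integration.integrable_bound[OF i])
 have "AE p in PM. pair_fun (\<lambda>l. w (l, 0)) (\<lambda>l. w (l, 1)) p = w p"
  by (rule AE_I2) (auto simp: space_pair_measure pair_fun_def)
 thus "ips_eq (L2_space PM) (pair_fun (\<lambda>l. w (l, 0)) (\<lambda>l. w (l, 1))) w" unfolding ips_eq_L2[OF pair_fun_L2[OF L] w] .
qed

text \<open>The extension is the direct sum of \<open>U1\<close> and \<open>U2\<close>, glued by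
  \<open>pair_fun\<close>. Linearity and agreement with the transforms hold up to null sets, since
  both summands are choices of representatives.\<close>

lemma fourier_unitary:
 "extends_to_unitary_iso (ips_sum (radial_L2 :: (complex^'n \<Rightarrow> complex) ips) (radial_HS \<nu>)) (L2_space PM)
   (radial_L1_L2 \<times> radial_T1 \<nu>) (fourier_pair haar \<nu>)"
proof -
 let ?V = "ips_sum (radial_L2 :: (complex^'n \<Rightarrow> complex) ips) (radial_HS \<nu> :: 'n bop ips)"
 let ?R = "radial_L2 :: (complex^'n \<Rightarrow> complex) ips"
 define U where "U = (\<lambda>(f, A). pair_fun (U1 f) (U2 A))"
 have car: "ips_carrier ?V = ips_carrier ?R \<times> RH" by (simp add: ips_sum_def)
 have lin1: "linear_op ?R (L2_space \<mu>) U1" using U1(1) by (simp add: unitary_iso_def)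
 have add1: "U1 (ips_add ?R f g) \<in> L2 \<mu>" "ips_eq (L2_space \<mu>) (U1 (ips_add ?R f g)) (\<lambda>l. U1 f l + U1 g l)"
  if f: "f \<in> ips_carrier ?R" and g: "g \<in> ips_carrier ?R" for f g
 proof -
  have "ips_add ?R f g = (\<lambda>z. f z + g z)" by (simp add: radial_L2_def L2_space_def)
  moreover have "radial_fun (\<lambda>z. f z + g z)"
   unfolding radial_fun_def
  proof
   fix k :: "'n gmat" assume "k \<in> stab0"
   hence "AE z in iota. f (act k z) = f z" "AE z in iota. g (act k z) = g z"
    using f g by (auto simp: radial_L2_carrier radial_fun_def)
   thus "AE z in iota. f (act k z) + g (act k z) = f z + g z" by eventually_elim simp
  qed
  ultimately show "U1 (ips_add ?R f g) \<in> L2 \<mu>" using f g by (intro U1_L2) (auto simp: radial_L2_carrier intro: L2_add)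
  show "ips_eq (L2_space \<mu>) (U1 (ips_add ?R f g)) (\<lambda>l. U1 f l + U1 g l)"
   using lin1 f g by (simp add: linear_op_def) (simp add: L2_space_def)
 qed
 have scale1: "U1 (ips_scale ?R c f) \<in> L2 \<mu>" "ips_eq (L2_space \<mu>) (U1 (ips_scale ?R c f)) (\<lambda>l. c * U1 f l)"
  if f: "f \<in> ips_carrier ?R" for f c
 proof -
  have "ips_scale ?R c f = (\<lambda>z. c * f z)" by (simp add: radial_L2_def L2_space_def)
  moreover have "radial_fun (\<lambda>z. c * f z)"
   unfolding radial_fun_def
  proof
   fix k :: "'n gmat" assume "k \<in> stab0"
   hence "AE z in iota. f (act k z) = f z" using f by (auto simp: radial_L2_carrier radial_fun_def)
   thus "AE z in iota. c * f (act k z) = c * f z" by eventually_elim simp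
  qed
  ultimately show "U1 (ips_scale ?R c f) \<in> L2 \<mu>" using f by (intro U1_L2) (auto simp: radial_L2_carrier intro: L2_scale)
  show "ips_eq (L2_space \<mu>) (U1 (ips_scale ?R c f)) (\<lambda>l. c * U1 f l)"
   using lin1 f by (simp add: linear_op_def) (simp add: L2_space_def)
 qed
 have pf_add: "ips_add (L2_space PM) (pair_fun u v) (pair_fun u' v') = pair_fun (\<lambda>l. u l + u' l) (\<lambda>l. v l + v' l)" for u v u' v'
  by (auto simp: L2_space_def pair_fun_def)
 have pf_scale: "ips_scale (L2_space PM) c (pair_fun u v) = pair_fun (\<lambda>l. c * u l) (\<lambda>l. c * v l)" for c u v
  by (auto simp: L2_space_def pair_fun_def)
 have "unitary_iso ?V (L2_space PM) U"
  unfolding unitary_iso_def linear_op_def car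
 proof (intro conjI ballI allI)
  fix x assume "x \<in> ips_carrier ?R \<times> RH"
  then obtain f A where x: "x = (f, A)" "f \<in> ips_carrier ?R" "A \<in> RH" by blast
  note LX = U1_L2[OF x(2)] U2(1)[OF x(3)]
  show "U x \<in> L2 PM" unfolding x U_def using pair_fun_L2[OF LX] by simp
  show "ips_eq (L2_space PM) (U (ips_scale ?V c x)) (ips_scale (L2_space PM) c (U x))" for c
   unfolding x U_def
   using pair_fun_eq[OF scale1(1)[OF x(2)] U2_linear(3)[OF x(3) x(3)] L2_scale[OF LX(1)] L2_scale[OF LX(2)] scale1(2)[OF x(2)] U2_linear(4)[OF x(3) x(3)], of c c]
   by (simp add: pf_scale) (simp add: ips_sum_def)
  fix y assume "y \<in> ips_carrier ?R \<times> RH"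
  then obtain g B where y: "y = (g, B)" "g \<in> ips_carrier ?R" "B \<in> RH" by blast
  note LY = U1_L2[OF y(2)] U2(1)[OF y(3)]
  show "ips_eq (L2_space PM) (U (ips_add ?V x y)) (ips_add (L2_space PM) (U x) (U y))"
   unfolding x y U_def
   using pair_fun_eq[OF add1(1)[OF x(2) y(2)] U2_linear(1)[OF x(3) y(3)] L2_add[OF LX(1) LY(1)] L2_add[OF LX(2) LY(2)] add1(2)[OF x(2) y(2)] U2_linear(2)[OF x(3) y(3)]]
   by (simp add: pf_add) (simp add: ips_sum_def)
  have "ips_inner ?R f g = ip iota f g" by (simp add: radial_L2_def ips_inner_L2)
  thus "ips_inner (L2_space PM) (U x) (U y) = ips_inner ?V x y"
   unfolding x y U_def using U1_ip[OF x(2) y(2)] U2_ip[OF x(3) y(3)]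
   by (simp add: ips_inner_L2 pair_fun_ip LX LY) (simp add: ips_sum_def)
 next
  fix w assume w: "w \<in> L2 PM"
  note p = pair_fun_surj[OF w]
  obtain f where f: "f \<in> ips_carrier ?R" "ips_eq (L2_space \<mu>) (U1 f) (\<lambda>l. w (l, 0))" using U1(1) p(1) by (auto simp: unitary_iso_def)
  obtain A where A: "A \<in> RH" "ips_eq (L2_space \<mu>) (U2 A) (\<lambda>l. w (l, 1))" by (rule U2_surj[OF p(2)]; rule that)
  have eq: "ips_eq (L2_space PM) (U (f, A)) (pair_fun (\<lambda>l. w (l, 0)) (\<lambda>l. w (l, 1)))"
   unfolding U_def using pair_fun_eq[OF U1_L2[OF f(1)] U2(1)[OF A(1)] p(1,2) f(2) A(2)] by simp
  note UL = pair_fun_L2[OF U1_L2[OF f(1)] U2(1)[OF A(1)]]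
  have "AE q in PM. pair_fun (U1 f) (U2 A) q = pair_fun (\<lambda>l. w (l, 0)) (\<lambda>l. w (l, 1)) q"
   using eq unfolding U_def split ips_eq_L2[OF UL pair_fun_L2[OF p(1,2)]] .
  moreover have "AE q in PM. pair_fun (\<lambda>l. w (l, 0)) (\<lambda>l. w (l, 1)) q = w q"
   using p(3) unfolding ips_eq_L2[OF pair_fun_L2[OF p(1,2)] w] .
  ultimately have "AE q in PM. pair_fun (U1 f) (U2 A) q = w q" by eventually_elim simp
  hence "ips_eq (L2_space PM) (U (f, A)) w" unfolding U_def split ips_eq_L2[OF UL w] .
  thus "\<exists>x\<in>ips_carrier ?R \<times> RH. ips_eq (L2_space PM) (U x) w" using f A by blast
 qed
 moreover have "fourier_pair haar \<nu> (f, A) \<in> L2 PM \<and> ips_eq (L2_space PM) (U (f, A)) (fourier_pair haar \<nu> (f, A))"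
  if f: "f \<in> radial_L1_L2" and A: "A \<in> radial_T1 \<nu>" for f :: "complex^'n \<Rightarrow> complex" and A
 proof -
  note f' = radial_L1_L2_D(1)[OF f]
  have e: "fourier_pair haar \<nu> (f, A) = pair_fun (ft f) (\<lambda>l. op_transform haar \<nu> A (of_real l))"
   by (auto simp: fourier_pair_def pair_fun_def)
  show ?thesis
   unfolding e U_def
   using pair_fun_L2[OF ft_L2[OF f] U2_op_transform(1)[OF A]]
    pair_fun_eq[OF U1_L2[OF f'] U2(1)[OF T1_D(1)[OF A]] ft_L2[OF f] U2_op_transform(1)[OF A] U1(2)[OF f] U2_op_transform(2)[OF A]]
   by simp
 qed
 moreover have "radial_L1_L2 \<times> radial_T1 \<nu> \<subseteq> ips_carrier ?R \<times> RH" using radial_L1_L2_D(1) T1_D(1) by blast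
 ultimately show ?thesis
  unfolding extends_to_unitary_iso_def car by (intro conjI exI[of _ U]) auto
qed

end

theorem theorem6p9:
  fixes \<nu> :: real
    and haar :: "('n::finite) gmat measure"
    and \<mu> :: "real measure"
  assumes "real CARD('n) < \<nu>"
    and "normalized_haar haar"
    and "plancherel_measure TYPE('n) \<mu>"
  shows "extends_to_unitary_iso
           (ips_sum radial_L2 (radial_HS \<nu>))
           (L2_space (\<mu> \<Otimes>\<^sub>M count_space {0, 1 :: nat}))
           (radial_L1_L2 \<times> radial_T1 \<nu>)
           (fourier_pair haar \<nu>)"
proof -
  interpret fourier_setting "CARD('n)" \<nu> \<mu> haar
    using assms by unfold_locales auto
  show ?thesis by (rule fourier_unitary)
qed

end
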